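(* Let $m\ge1$ and $n_1,\dots,n_m\ge1$ be integers, fix $t>0$ and $x\in\mathbb{R}^d$, and let $I_n(f_n(\cdot,t,x))$ be the multiple Wiener–Itô integral of the symmetric chaos kernel $f_n(\cdot,t,x)$. Then $$\mathbb{E}\big[I_{n_1}(f_{n_1}(\cdot,t,x))\cdots I_{n_m}(f_{n_m}(\cdot,t,x))\big]=\sum_{\mathcal{D}\in\mathbb{D}(n_1,\dots,n_m)}F_{\mathcal{D}}(f_{n_1},\dots,f_{n_m})$$ $$=\sum_{\mathcal{D}\in\mathbb{D}(n_1,\dots,n_m)}\int\ \prod_{j=1}^m\Big[I_0(t_{(j,1)},x_{(j,1)})\,\mathbf{1}_{\{0<t_{(j,1)}<\cdots<t_{(j,n_j)}<t\}}\prod_{r=1}^{n_j}G_{t_{(j,r+1)}-t_{(j,r)}}\big(x_{(j,r+1)},x_{(j,r)}\big)\Big]$$ $$\qquad\times\prod_{[(\overline k,\overline r),(\underline k,\underline r)]\in\mathscr{E}(\mathcal{D})}\gamma\big(t_{(\overline k,\overline r)}-t_{(\underline k,\underline r)}\big)\Lambda\big(x_{(\overline k,\overline r)}-x_{(\underline k,\underline r)}\big)\ dt_{\mathcal{D}}\,dx_{\mathcal{D}},$$ where $t_{(j,n_j+1)}=t$ and $x_{(j,n_j+1)}=x$ for all $1\le j\le m$, and $dt_{\mathcal{D}}dx_{\mathcal{D}}$ denotes integration over all variables $(t_{(k,r)},x_{(k,r)})\in\mathbb{R}_+\times\mathbb{R}^d$, $1\le k\le m$, $1\le r\le n_k$.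
   Context: Noise. $\gamma:\mathbb{R}\to\mathbb{R}_+$, $\Lambda:\mathbb{R}^d\to\mathbb{R}_+$ are non-negative and non-negative definite. Either there are $\gamma_0\in(0,1)$, $c,C>0$ with $c|t|^{-\gamma_0}\le\gamma(t)\le C|t|^{-\gamma_0}$ on $\mathbb{R}_+$, or $\gamma=\delta$ ($\gamma_0=1$); and one of the following holds: $c|x|^{-\lambda}\le\Lambda(x)\le C|x|^{-\lambda}$ on $\mathbb{R}^d$ for some $\lambda\in(0,d)$; $c\prod_j|x_j|^{-\lambda_j}\le\Lambda(x)\le C\prod_j|x_j|^{-\lambda_j}$ on $\mathbb{R}^d$ for some $\lambda_j\in(0,1)$; or $d=1$, $\gamma=\delta$, $\Lambda=\delta$. $\mathcal{H}$ is the Hilbert space completion of $C_c^\infty(\mathbb{R}_+\times\mathbb{R}^d)$ under $\langle\phi,\psi\rangle_{\mathcal{H}}=\int\phi(t,x)\psi(s,y)\gamma(t-s)\Lambda(x-y)\,dt\,dx\,ds\,dy$, and $W$ is a centered Gaussian family indexed by $\mathcal{H}$ with covariance $\langle\cdot,\cdot\rangle_{\mathcal{H}}$. $I_n$ is the $n$-fold multiple Wiener–Itô integral with respect to $W$ on symmetric elements of $\mathcal{H}^{\otimes n}$, normalized so that $\mathbb{E}|I_n(f)|^2=n!\|f\|^2_{\mathcal{H}^{\otimes n}}$. Kernels. $G_t(x,y)$ is the Green's function of the operator in the equation $\mathscr{L}u=u\dot W$ and $I_0(t,x)$ is the deterministic term determined by the initial data. The chaos kernel $f_n(\cdot,t,x)$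 (assumed to lie in $\mathcal{H}^{\otimes n}$ so that $I_n(f_n)$ makes sense) is $$f_n(t_1,x_1,\dots,t_n,x_n,t,x)=\frac1{n!}\sum_{\sigma\in S_n}G_{t-t_{\sigma(n)}}(x,x_{\sigma(n)})\,G_{t_{\sigma(n)}-t_{\sigma(n-1)}}(x_{\sigma(n)},x_{\sigma(n-1)})\cdots G_{t_{\sigma(2)}-t_{\sigma(1)}}(x_{\sigma(2)},x_{\sigma(1)})\,I_0(t_{\sigma(1)},x_{\sigma(1)})\,\mathbf{1}_{\{0<t_{\sigma(1)}<\cdots<t_{\sigma(n)}<t\}},$$ where $S_n$ is the set of permutations of $\{1,\dots,n\}$. Diagrams. Consider vertices $(k,r)$, $1\le k\le m$, $1\le r\le n_k$, with $k$ the row. An edge $[(\overline k,\overline r),(\underline k,\underline r)]$ joins two vertices with $\overline k<\underline k$ (so vertices in the same row are never joined). An admissible diagram $\mathcal{D}$ is a set of edges $\mathscr{E}(\mathcal{D})$ such that every vertex belongs to exactly one edge; $\mathbb{D}(n_1,\dots,n_m)$ is the set of all admissible diagrams (empty if none exists, in which case the sums are $0$). For functions $g_k$ of $n_k$ vector variables $(t_{(k,1)},x_{(k,1)}),\dots,(t_{(k,n_k)},x_{(k,n_k)})$, $$F_{\mathcal{D}}(g_1,\dots,g_m)=\int\prod_{k=1}^m g_k\big((t_{(k,1)},x_{(k,1)}),\dots,(t_{(k,n_k)},x_{(k,n_k)})\big)\prod_{[(\overline k,\overline r),(\underline k,\underline r)]\in\mathscr{E}(\mathcal{D})}\gamma(t_{(\overline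 k,\overline r)}-t_{(\underline k,\underline r)})\Lambda(x_{(\overline k,\overline r)}-x_{(\underline k,\underline r)})\,dt\,dx,$$ the integral being over all variables in $\mathbb{R}_+\times\mathbb{R}^d$. *)

theory Defs
  imports "HOL-Probability.Probability" "HOL-Combinatorics.Permutations"
begin

section \<open>Test functions\<close>

text \<open>A function is smooth when all its iterated directional derivatives exist and are
  differentiable (hence continuous).\<close>

definition directional_deriv :: "'a::euclidean_space \<Rightarrow> ('a \<Rightarrow> real) \<Rightarrow> 'a \<Rightarrow> real" where
  "directional_deriv v f = (\<lambda>x. frechet_derivative f (at x) v)"

definition smooth :: "('a::euclidean_space \<Rightarrow> real) \<Rightarrow> bool" where
  "smooth f \<longleftrightarrow> (\<forall>vs x. foldr directional_deriv vs f differentiable (at x))"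

definition test_functions :: "('a::euclidean_space \<Rightarrow> real) set" where
  "test_functions = {\<phi>. smooth \<phi> \<and> compact (closure {x. \<phi> x \<noteq> 0})}"

section \<open>The noise\<close>

text \<open>A correlation is either a genuine function \<open>k\<close>, entering integrals through the
  factor \<open>k (x - y)\<close>, or the Dirac delta.\<close>

datatype 'a correlation = Kernel "'a \<Rightarrow> real" | Delta

text \<open>Positive definiteness is tested against test functions, because the kernels of
  interest blow up at the origin.\<close>

definition covariance_function :: "('a::euclidean_space \<Rightarrow> real) \<Rightarrow> bool" where
  "covariance_function k \<longleftrightarrow>
     k \<in> borel_measurable borel \<and> (\<forall>x. 0 \<le> k x) \<and> (\<forall>x. k (- x) = k x) \<and>
     (\<forall>\<phi>\<in>test_functions. 0 \<le> (\<integral>(x, y). \<phi> x * \<phi> y * k (x - y) \<partial>(lborel \<Otimes>\<^sub>M lborel)))"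

definition admissible_noise :: "real correlation \<Rightarrow> (real ^ 'd) correlation \<Rightarrow> bool" where
  "admissible_noise \<gamma> \<Lambda> \<longleftrightarrow>
     (case \<gamma> of
        Kernel g \<Rightarrow> covariance_function g \<and>
          (\<exists>\<gamma>0 c C. 0 < \<gamma>0 \<and> \<gamma>0 < 1 \<and> 0 < c \<and> 0 < C \<and>
             (\<forall>t>0. c * \<bar>t\<bar> powr (- \<gamma>0) \<le> g t \<and> g t \<le> C * \<bar>t\<bar> powr (- \<gamma>0)))
      | Delta \<Rightarrow> True) \<and>
     (case \<Lambda> of
        Kernel k \<Rightarrow> covariance_function k \<and>
          ((\<exists>l c C. 0 < l \<and> l < real CARD('d) \<and> 0 < c \<and> 0 < C \<and>
              (\<forall>x. x \<noteq> 0 \<longrightarrow> c * norm x powr (- l) \<le> k x \<and> k x \<le> C * norm x powr (- l))) \<or>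
           (\<exists>(l :: 'd \<Rightarrow> real) c C. (\<forall>j. 0 < l j \<and> l j < 1) \<and> 0 < c \<and> 0 < C \<and>
              (\<forall>x. (\<forall>j. x $ j \<noteq> 0) \<longrightarrow>
                 c * (\<Prod>j\<in>UNIV. \<bar>x $ j\<bar> powr (- l j)) \<le> k x \<and>
                 k x \<le> C * (\<Prod>j\<in>UNIV. \<bar>x $ j\<bar> powr (- l j)))))
      | Delta \<Rightarrow> CARD('d) = 1 \<and> \<gamma> = Delta)"

text \<open>\<open>correlation_measure \<kappa> B V E\<close> is the measure
  \[ \prod_{(a,b) \in E} \kappa(z_a - z_b) \prod_{v \in V} B(dz_v) \]
  on configurations \<open>z\<close> of the vertices \<open>V\<close>, where every vertex lies in exactly one
  edge of \<open>E\<close>. When \<open>\<kappa>\<close> is the delta, the two end points of an edge carry the same variable,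
  and there is one integration with respect to \<open>B\<close> per edge.\<close>

definition correlation_measure ::
    "'a::euclidean_space correlation \<Rightarrow> 'a measure \<Rightarrow> 'v set \<Rightarrow> ('v \<times> 'v) set \<Rightarrow> ('v \<Rightarrow> 'a) measure" where
  "correlation_measure \<kappa> B V E =
     (case \<kappa> of
        Kernel k \<Rightarrow> density (\<Pi>\<^sub>M v\<in>V. B) (\<lambda>z. \<Prod>(a, b)\<in>E. ennreal (k (z a - z b)))
      | Delta \<Rightarrow> distr (\<Pi>\<^sub>M e\<in>E. B) (\<Pi>\<^sub>M v\<in>V. B)
                   (\<lambda>w. \<lambda>v\<in>V. w (THE e. e \<in> E \<and> (v = fst e \<or> v = snd e))))"

definition noise_measure ::
    "real correlation \<Rightarrow> (real ^ 'd) correlation \<Rightarrow> 'v set \<Rightarrow> ('v \<times> 'v) set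
       \<Rightarrow> (('v \<Rightarrow> real) \<times> ('v \<Rightarrow> real ^ 'd)) measure" where
  "noise_measure \<gamma> \<Lambda> V E =
     correlation_measure \<gamma> (restrict_space lborel {0..}) V E \<Otimes>\<^sub>M correlation_measure \<Lambda> lborel V E"

definition noise_inner ::
    "real correlation \<Rightarrow> (real ^ 'd) correlation \<Rightarrow> (real \<times> (real ^ 'd) \<Rightarrow> real)
       \<Rightarrow> (real \<times> (real ^ 'd) \<Rightarrow> real) \<Rightarrow> real" where
  "noise_inner \<gamma> \<Lambda> \<phi> \<psi> =
     (\<integral>(\<tau>, \<xi>). \<phi> (\<tau> 1, \<xi> 1) * \<psi> (\<tau> 2, \<xi> 2) \<partial>noise_measure \<gamma> \<Lambda> {1, 2 :: nat} {(1, 2)})"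

text \<open>The Hilbert space \<open>\<H>\<close> is the type \<open>'h\<close>, as a completion of the test functions
  with embedding \<open>\<iota>\<close>. Only the values on \<open>\<real>\<^sub>+ \<times> \<real>\<^sup>d\<close> enter the inner product,
  so the test functions stand for their restrictions to that set. Linearity of \<open>\<iota>\<close> on test
  functions follows from the inner product formula.\<close>

definition is_noise_space ::
    "real correlation \<Rightarrow> (real ^ 'd) correlation
       \<Rightarrow> ((real \<times> (real ^ 'd) \<Rightarrow> real) \<Rightarrow> 'h::{real_inner, banach}) \<Rightarrow> bool" where
  "is_noise_space \<gamma> \<Lambda> \<iota> \<longleftrightarrow>
     (\<forall>\<phi>\<in>test_functions. \<forall>\<psi>\<in>test_functions. \<iota> \<phi> \<bullet> \<iota> \<psi> = noise_inner \<gamma> \<Lambda> \<phi> \<psi>) \<and>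
     closure (\<iota> ` test_functions) = UNIV"

definition centered_gaussian :: "'w measure \<Rightarrow> ('w \<Rightarrow> real) \<Rightarrow> bool" where
  "centered_gaussian M X \<longleftrightarrow> X \<in> borel_measurable M \<and>
     ((AE \<omega> in M. X \<omega> = 0) \<or> (\<exists>\<sigma>>0. distributed M lborel X (normal_density 0 \<sigma>)))"

definition isonormal_process :: "'w measure \<Rightarrow> ('h::real_inner \<Rightarrow> 'w \<Rightarrow> real) \<Rightarrow> bool" where
  "isonormal_process M W \<longleftrightarrow> prob_space M \<and>
     (\<forall>S a. finite S \<longrightarrow> centered_gaussian M (\<lambda>\<omega>. \<Sum>h\<in>S. a h * W h \<omega>)) \<and>
     (\<forall>g h. (\<integral>\<omega>. W g \<omega> * W h \<omega> \<partial>M) = g \<bullet> h)"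

section \<open>Hilbert tensor powers and multiple integrals\<close>

text \<open>\<open>T n u\<close> is the elementary tensor \<open>u 1 \<otimes> \<dots> \<otimes> u n\<close>. All the tensor powers are
  realised inside one ambient Hilbert space \<open>'k\<close>. Multilinearity, and independence of the
  values of \<open>u\<close> outside \<open>{1..n}\<close>, follow from the inner product formula.\<close>

definition is_tensor_power ::
    "(nat \<Rightarrow> (nat \<Rightarrow> 'h::real_inner) \<Rightarrow> 'k::{real_inner, banach}) \<Rightarrow> bool" where
  "is_tensor_power T \<longleftrightarrow> (\<forall>n u v. T n u \<bullet> T n v = (\<Prod>i\<in>{1..n}. u i \<bullet> v i))"

definition tensor_space ::
    "(nat \<Rightarrow> (nat \<Rightarrow> 'h::real_inner) \<Rightarrow> 'k::{real_inner, banach}) \<Rightarrow> nat \<Rightarrow> 'k set" where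
  "tensor_space T n = closure (span (range (T n)))"

text \<open>Invariance under the permutations of the factors, which are unitary; this is expressed
  by pairing with elementary tensors.\<close>

definition symmetric_tensors ::
    "(nat \<Rightarrow> (nat \<Rightarrow> 'h::real_inner) \<Rightarrow> 'k::{real_inner, banach}) \<Rightarrow> nat \<Rightarrow> 'k set" where
  "symmetric_tensors T n =
     {F \<in> tensor_space T n. \<forall>\<sigma> u. \<sigma> permutes {1..n} \<longrightarrow> F \<bullet> T n (u \<circ> \<sigma>) = F \<bullet> T n u}"

text \<open>The probabilists' Hermite polynomials.\<close>

fun hermite :: "nat \<Rightarrow> real \<Rightarrow> real" where
  "hermite 0 x = 1"
| "hermite (Suc 0) x = x"
| "hermite (Suc (Suc n)) x = x * hermite (Suc n) x - real (Suc n) * hermite n x"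

text \<open>\<open>J n\<close> is the \<open>n\<close>-fold multiple Wiener--Ito integral: the linear map from symmetric tensors
  to square integrable variables with \<open>J n (h \<otimes> \<dots> \<otimes> h) = hermite n (W h)\<close> for unit
  vectors \<open>h\<close> and \<open>\<E> (J n F)\<^sup>2 = n! \<parallel>F\<parallel>\<^sup>2\<close>. The tensor powers of unit vectors span a dense
  subspace of the symmetric tensors, so this determines \<open>J n F\<close> almost surely.\<close>

definition is_multiple_integral ::
    "'w measure \<Rightarrow> ('h::real_inner \<Rightarrow> 'w \<Rightarrow> real)
       \<Rightarrow> (nat \<Rightarrow> (nat \<Rightarrow> 'h) \<Rightarrow> 'k::{real_inner, banach}) \<Rightarrow> (nat \<Rightarrow> 'k \<Rightarrow> 'w \<Rightarrow> real) \<Rightarrow> bool" where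
  "is_multiple_integral M W T J \<longleftrightarrow> (\<forall>n\<ge>1.
     (\<forall>F\<in>symmetric_tensors T n. J n F \<in> borel_measurable M \<and>
        integrable M (\<lambda>\<omega>. (J n F \<omega>)\<^sup>2) \<and>
        (\<integral>\<omega>. (J n F \<omega>)\<^sup>2 \<partial>M) = fact n * (norm F)\<^sup>2) \<and>
     (\<forall>F\<in>symmetric_tensors T n. \<forall>F'\<in>symmetric_tensors T n. \<forall>a b.
        AE \<omega> in M. J n (a *\<^sub>R F + b *\<^sub>R F') \<omega> = a * J n F \<omega> + b * J n F' \<omega>) \<and>
     (\<forall>h. norm h = 1 \<longrightarrow> (AE \<omega> in M. J n (T n (\<lambda>_. h)) \<omega> = hermite n (W h \<omega>))))"

section \<open>Diagrams\<close>

definition vertices :: "nat \<Rightarrow> (nat \<Rightarrow> nat) \<Rightarrow> (nat \<times> nat) set" where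
  "vertices m n = (SIGMA k:{1..m}. {1..n k})"

definition diagrams :: "nat \<Rightarrow> (nat \<Rightarrow> nat) \<Rightarrow> ((nat \<times> nat) \<times> (nat \<times> nat)) set set" where
  "diagrams m n =
     {D. (\<forall>(a, b)\<in>D. a \<in> vertices m n \<and> b \<in> vertices m n \<and> fst a < fst b) \<and>
         (\<forall>v\<in>vertices m n. \<exists>!e. e \<in> D \<and> (v = fst e \<or> v = snd e))}"

text \<open>A function of \<open>n\<close> space-time variables is a function of the time configuration
  and the space configuration, both indexed by \<open>{1..n}\<close>.\<close>

type_synonym 'd kernel = "(nat \<Rightarrow> real) \<Rightarrow> (nat \<Rightarrow> real ^ 'd) \<Rightarrow> real"

definition diagram_integrand ::
    "nat \<Rightarrow> (nat \<Rightarrow> nat) \<Rightarrow> (nat \<Rightarrow> 'd kernel)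
       \<Rightarrow> (nat \<times> nat \<Rightarrow> real) \<times> (nat \<times> nat \<Rightarrow> real ^ 'd) \<Rightarrow> real" where
  "diagram_integrand m n g =
     (\<lambda>(\<tau>, \<xi>). \<Prod>k\<in>{1..m}. g k (\<lambda>r\<in>{1..n k}. \<tau> (k, r)) (\<lambda>r\<in>{1..n k}. \<xi> (k, r)))"

definition diagram_integrable ::
    "real correlation \<Rightarrow> (real ^ 'd) correlation \<Rightarrow> nat \<Rightarrow> (nat \<Rightarrow> nat)
       \<Rightarrow> ((nat \<times> nat) \<times> (nat \<times> nat)) set \<Rightarrow> (nat \<Rightarrow> 'd kernel) \<Rightarrow> bool" where
  "diagram_integrable \<gamma> \<Lambda> m n D g \<longleftrightarrow>
     integrable (noise_measure \<gamma> \<Lambda> (vertices m n) D) (diagram_integrand m n g)"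

definition diagram_integral ::
    "real correlation \<Rightarrow> (real ^ 'd) correlation \<Rightarrow> nat \<Rightarrow> (nat \<Rightarrow> nat)
       \<Rightarrow> ((nat \<times> nat) \<times> (nat \<times> nat)) set \<Rightarrow> (nat \<Rightarrow> 'd kernel) \<Rightarrow> real" where
  "diagram_integral \<gamma> \<Lambda> m n D g =
     integral\<^sup>L (noise_measure \<gamma> \<Lambda> (vertices m n) D) (diagram_integrand m n g)"

section \<open>Kernels\<close>

text \<open>The inner product of \<open>\<H>\<^sup>\<otimes>\<^sup>n\<close> on functions \<open>f\<close>, \<open>g\<close> of \<open>n\<close> variables is
  \[ \int f(z) g(z') \prod_{i=1}^n \gamma(t_i - t'_i) \Lambda(x_i - x'_i) \, dz \, dz' , \]
  that is, the integral along the following diagram with two rows of length \<open>n\<close>.\<close>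

definition straight_diagram :: "nat \<Rightarrow> ((nat \<times> nat) \<times> (nat \<times> nat)) set" where
  "straight_diagram n = (\<lambda>i. ((1, i), (2, i))) ` {1..n}"

text \<open>The function \<open>f\<close> lies in \<open>\<H>\<^sup>\<otimes>\<^sup>n\<close> as the element \<open>F\<close>: the integral
  defining its inner product with itself converges absolutely, and \<open>F\<close> has the same inner
  products as \<open>f\<close> with the tensor products of test functions.\<close>

definition represents ::
    "real correlation \<Rightarrow> (real ^ 'd) correlation
       \<Rightarrow> ((real \<times> (real ^ 'd) \<Rightarrow> real) \<Rightarrow> 'h::{real_inner, banach})
       \<Rightarrow> (nat \<Rightarrow> (nat \<Rightarrow> 'h) \<Rightarrow> 'k::{real_inner, banach}) \<Rightarrow> nat \<Rightarrow> 'd kernel \<Rightarrow> 'k \<Rightarrow> bool" where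
  "represents \<gamma> \<Lambda> \<iota> T n f F \<longleftrightarrow>
     (\<lambda>(\<tau>, \<xi>). f \<tau> \<xi>) \<in> borel_measurable
        ((\<Pi>\<^sub>M r\<in>{1..n}. restrict_space lborel {0..}) \<Otimes>\<^sub>M (\<Pi>\<^sub>M r\<in>{1..n}. lborel)) \<and>
     diagram_integrable \<gamma> \<Lambda> 2 (\<lambda>_. n) (straight_diagram n) (\<lambda>_. f) \<and>
     F \<in> tensor_space T n \<and>
     (\<forall>\<phi>. (\<forall>i. \<phi> i \<in> test_functions) \<longrightarrow>
        F \<bullet> T n (\<lambda>i. \<iota> (\<phi> i)) =
          diagram_integral \<gamma> \<Lambda> 2 (\<lambda>_. n) (straight_diagram n)
            (\<lambda>k. if k = 1 then f else (\<lambda>\<tau> \<xi>. \<Prod>i\<in>{1..n}. \<phi> i (\<tau> i, \<xi> i))))"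

text \<open>The time-ordered product of Green's functions, with the conventions
  \<open>t\<^bsub>n+1\<^esub> = t\<close> and \<open>x\<^bsub>n+1\<^esub> = x\<close>.\<close>

definition ordered_kernel ::
    "(real \<Rightarrow> real ^ 'd \<Rightarrow> real ^ 'd \<Rightarrow> real) \<Rightarrow> (real \<Rightarrow> real ^ 'd \<Rightarrow> real)
       \<Rightarrow> real \<Rightarrow> real ^ 'd \<Rightarrow> nat \<Rightarrow> 'd kernel" where
  "ordered_kernel G I0 t x n \<tau> \<xi> =
     (let s = \<tau>(Suc n := t); y = \<xi>(Suc n := x) in
        I0 (s 1) (y 1) *
        (if 0 < s 1 \<and> (\<forall>r\<in>{1..n}. s r < s (Suc r)) then 1 else 0) *
        (\<Prod>r\<in>{1..n}. G (s (Suc r) - s r) (y (Suc r)) (y r)))"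

definition chaos_kernel ::
    "(real \<Rightarrow> real ^ 'd \<Rightarrow> real ^ 'd \<Rightarrow> real) \<Rightarrow> (real \<Rightarrow> real ^ 'd \<Rightarrow> real)
       \<Rightarrow> real \<Rightarrow> real ^ 'd \<Rightarrow> nat \<Rightarrow> 'd kernel" where
  "chaos_kernel G I0 t x n \<tau> \<xi> =
     1 / fact n * (\<Sum>\<sigma> | \<sigma> permutes {1..n}. ordered_kernel G I0 t x n (\<tau> \<circ> \<sigma>) (\<xi> \<circ> \<sigma>))"

end

theory Submission
  imports Defs
begin

text \<open>Gaussian part: integration by parts, obtained by polarizing the moments of a single
  Gaussian variable, gives a recursion for the expectation of a product of Hermite polynomials;
  removing a vertex of a diagram together with its partner gives the same recursion. Hence the
  formula holds for kernels that are combinations of tensor powers of test functions.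

  Limit: Riesz composition writes each correlation, up to constants, as
  \<open>\<integral> \<theta>(x, w) \<theta>(y, w) \<mu>(dw)\<close>. In the variables \<open>w\<close> every edge is shared by two
  rows, so repeated use of the Cauchy--Schwarz inequality bounds the integral along any diagram
  by the product of the norms of the absolute values of its rows. Symmetric kernels are limits of tensor powers
  in these norms, hence the diagram integrals converge; applied to a diagram with every row
  doubled, the same argument bounds the second moments, so the expectations converge too.

  Finally, the ordered kernel is \<open>n!\<close> times the chaos kernel on a simplex, and
  permuting the vertices within the rows permutes the diagrams.\<close>

section \<open>Pairings and correlation measures\<close>

text \<open>Positive definiteness controls the form of two functions, but not an integral that links
  three or more rows, and it says nothing about absolute values. Applying the Cauchy--Schwarz
  inequality along a diagram to nonnegative functions calls for a factorization of each correlation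
  with nonnegative factors. A correlation that is merely bounded above and below by a power is not
  assumed to have one; the power does, up to constants. Hence every estimate carries a constant
  depending on the diagram, and the norm of absolute values is treated as a quasi-norm only.

  The approximants have to converge twice: as functions in that norm, for the diagram integrals, and
  as elements of the Hilbert space, for the multiple integrals. The second follows from the first,
  because the Hilbert norm is bounded by the norm of the absolute value. An element of the
  completion is known only through its inner products with products of test functions; these
  identify the limit.

  A delta edge is one variable shared by two vertices. Its measure is singular, so the arguments are
  phrased for measures on configurations.\<close>

definition pairing :: "'v set \<Rightarrow> ('v \<times> 'v) set \<Rightarrow> bool" where
  "pairing V E \<longleftrightarrow> finite V \<and> (\<forall>(a, b)\<in>E. a \<in> V \<and> b \<in> V \<and> a \<noteq> b) \<and>
     (\<forall>v\<in>V. \<exists>!e. e \<in> E \<and> (v = fst e \<or> v = snd e))"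

text \<open>The same description operator occurs in \<open>correlation_measure\<close> for the
  delta, so folding this definition there makes the edge map accessible to the lemmas on
  matchings.\<close>

definition edge_at :: "('v \<times> 'v) set \<Rightarrow> 'v \<Rightarrow> 'v \<times> 'v" where
  "edge_at E v = (THE e. e \<in> E \<and> (v = fst e \<or> v = snd e))"

lemma pairingI:
  assumes "finite V" "\<And>a b. (a, b) \<in> E \<Longrightarrow> a \<in> V \<and> b \<in> V \<and> a \<noteq> b"
    and "\<And>v. v \<in> V \<Longrightarrow> \<exists>!e. e \<in> E \<and> (v = fst e \<or> v = snd e)"
  shows "pairing V E"
  unfolding pairing_def using assms by blast

lemma pairing_edge: "pairing V E \<Longrightarrow> (a, b) \<in> E \<Longrightarrow> a \<in> V \<and> b \<in> V \<and> a \<noteq> b"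
  unfolding pairing_def by blast

lemma pairing_ex1: "pairing V E \<Longrightarrow> v \<in> V \<Longrightarrow> \<exists>!e. e \<in> E \<and> (v = fst e \<or> v = snd e)"
  unfolding pairing_def by blast

lemma pairing_subset: "pairing V E \<Longrightarrow> E \<subseteq> V \<times> V"
  using pairing_edge by fast

lemma pairing_finite:
  assumes "pairing V E"
  shows "finite V \<and> finite E"
proof -
  have "finite V" using assms unfolding pairing_def by (rule conjunct1)
  then show ?thesis using finite_subset[OF pairing_subset[OF assms]] by simp
qed

lemma edge_at_eq:
  assumes "pairing V E" "e \<in> E" "v = fst e \<or> v = snd e"
  shows "edge_at E v = e"
proof -
  have "v \<in> V" using assms(2,3) pairing_edge[OF assms(1), of "fst e" "snd e"] by auto
  from pairing_ex1[OF assms(1) this] show ?thesis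
    unfolding edge_at_def using assms(2,3) by (intro the1_equality) simp_all
qed

lemma edge_at_in:
  assumes "pairing V E" "v \<in> V"
  shows "edge_at E v \<in> E" and "v = fst (edge_at E v) \<or> v = snd (edge_at E v)"
  using theI'[OF pairing_ex1[OF assms]] unfolding edge_at_def by simp_all

lemma pairing_empty [simp]: "pairing {} {}"
  by (rule pairingI) simp_all

lemma pairing_insert:
  assumes "pairing V E" "a \<notin> V" "b \<notin> V" "a \<noteq> b"
  shows "pairing (insert a (insert b V)) (insert (a, b) E)"
proof (rule pairingI)
  note E = pairing_edge[OF assms(1)]
  show "finite (insert a (insert b V))" using pairing_finite[OF assms(1)] by simp
  show "c \<in> insert a (insert b V) \<and> d \<in> insert a (insert b V) \<and> c \<noteq> d" if "(c, d) \<in> insert (a, b) E" for c d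
    using that E[of c d] assms(4) by auto
  fix v assume v: "v \<in> insert a (insert b V)"
  show "\<exists>!e. e \<in> insert (a, b) E \<and> (v = fst e \<or> v = snd e)"
  proof (cases "v \<in> V")
    case True
    have "e = edge_at E v" if "e \<in> insert (a, b) E" "v = fst e \<or> v = snd e" for e
      using that True assms edge_at_eq[OF assms(1), of e v] by auto
    then show ?thesis using edge_at_in[OF assms(1) True] by (intro ex1I[of _ "edge_at E v"]) simp_all
  next
    case False
    have "e = (a, b)" if "e \<in> insert (a, b) E" "v = fst e \<or> v = snd e" for e
      using that False E[of "fst e" "snd e"] by auto
    then show ?thesis using v False by (intro ex1I[of _ "(a, b)"]) auto
  qed
qed

lemma pairing_remove:
  assumes "pairing V E" "(a, b) \<in> E"
  shows "pairing (V - {a, b}) (E - {(a, b)})"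
proof (rule pairingI)
  have ab: "edge_at E a = (a, b)" "edge_at E b = (a, b)"
    using edge_at_eq[OF assms] by simp_all
  show "finite (V - {a, b})" using pairing_finite[OF assms(1)] by simp
  show "c \<in> V - {a, b} \<and> d \<in> V - {a, b} \<and> c \<noteq> d" if "(c, d) \<in> E - {(a, b)}" for c d
  proof -
    have "edge_at E c = (c, d)" "edge_at E d = (c, d)"
      using edge_at_eq[OF assms(1), of "(c, d)"] that by simp_all
    then show ?thesis using that ab pairing_edge[OF assms(1), of c d] by auto
  qed
  fix v assume v: "v \<in> V - {a, b}"
  then have vV: "v \<in> V" by simp
  note ev = edge_at_in[OF assms(1) vV]
  have "edge_at E v \<noteq> (a, b)"
  proof
    assume "edge_at E v = (a, b)"
    from ev(2)[unfolded this] v show False by simp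
  qed
  then have "edge_at E v \<in> E - {(a, b)}" using ev(1) by blast
  moreover have "e = edge_at E v" if "e \<in> E - {(a, b)}" "v = fst e \<or> v = snd e" for e
    using that edge_at_eq[OF assms(1), of e v] by simp
  ultimately show "\<exists>!e. e \<in> E - {(a, b)} \<and> (v = fst e \<or> v = snd e)"
    using ev(2) by (intro ex1I[of _ "edge_at E v"]) blast+
qed

text \<open>Deleting an edge together with its end points from a matching leaves a matching, so a
  matching can be built edge by edge. Products over edges and integrals over configurations are
  computed this way.\<close>

lemma pairing_induct [consumes 1, case_names empty insert]:
  assumes "pairing V E"
    and "P {} {}"
    and "\<And>V E a b. pairing V E \<Longrightarrow> a \<notin> V \<Longrightarrow> b \<notin> V \<Longrightarrow> a \<noteq> b \<Longrightarrow> P V E \<Longrightarrow>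
           P (insert a (insert b V)) (insert (a, b) E)"
  shows "P V E"
proof -
  have "finite E" using pairing_finite[OF assms(1)] by auto
  then show ?thesis using assms(1)
  proof (induction "card E" arbitrary: V E)
    case 0
    then have E: "E = {}" by simp
    have "V = {}"
    proof (rule equals0I)
      fix v assume "v \<in> V"
      from edge_at_in(1)[OF 0(3) this] E show False by blast
    qed
    with E assms(2) show ?case by simp
  next
    case (Suc n)
    have "E \<noteq> {}" using Suc(2) by auto
    then obtain e where "e \<in> E" by blast
    then obtain a b where ab: "(a, b) \<in> E" by (cases e) blast
    have "n = card (E - {(a, b)})" using Suc(2) ab by (simp add: card_Diff_singleton)
    then have "P (V - {a, b}) (E - {(a, b)})"
      using Suc(1)[OF _ _ pairing_remove[OF Suc.prems(2) ab]] Suc.prems(1) by blast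
    moreover have "a \<in> V" "b \<in> V" "a \<noteq> b" using pairing_edge[OF Suc.prems(2) ab] by auto
    ultimately have "P (insert a (insert b (V - {a, b}))) (insert (a, b) (E - {(a, b)}))"
      using assms(3)[OF pairing_remove[OF Suc.prems(2) ab], of a b] by blast
    moreover have "insert a (insert b (V - {a, b})) = V" "insert (a, b) (E - {(a, b)}) = E"
      using \<open>a \<in> V\<close> \<open>b \<in> V\<close> ab by auto
    ultimately show ?case by simp
  qed
qed

lemma edge_at_insert:
  assumes "pairing V E" "a \<notin> V" "b \<notin> V" "a \<noteq> b"
  shows "edge_at (insert (a, b) E) a = (a, b)" "edge_at (insert (a, b) E) b = (a, b)"
    "v \<in> V \<Longrightarrow> edge_at (insert (a, b) E) v = edge_at E v"
proof -
  note eq = edge_at_eq[OF pairing_insert[OF assms]]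
  show "edge_at (insert (a, b) E) a = (a, b)" "edge_at (insert (a, b) E) b = (a, b)"
    by (rule eq; simp)+
  show "edge_at (insert (a, b) E) v = edge_at E v" if "v \<in> V"
    using edge_at_in[OF assms(1) that] by (intro eq insertI2)
qed

lemma pairing_new_edge: "pairing V E \<Longrightarrow> a \<notin> V \<Longrightarrow> (a, b) \<notin> E"
  using pairing_edge by fast

text \<open>Once the correlations are superpositions with one auxiliary variable per edge, this
  regroups the weights attached to the vertices into two weights for each edge.\<close>

lemma prod_vertices_edges:
  fixes f :: "'v \<Rightarrow> 'v \<times> 'v \<Rightarrow> 'a::comm_monoid_mult"
  assumes "pairing V E"
  shows "(\<Prod>v\<in>V. f v (edge_at E v)) = (\<Prod>(a, b)\<in>E. f a (a, b) * f b (a, b))"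
  using assms
proof (induction rule: pairing_induct)
  case (insert V E a b)
  have fin: "finite V" "finite E" using pairing_finite[OF insert(1)] by auto
  have "(\<Prod>v\<in>V. f v (edge_at (insert (a, b) E) v)) = (\<Prod>v\<in>V. f v (edge_at E v))"
    by (intro prod.cong) (auto simp: edge_at_insert[OF insert(1-4)])
  then show ?case using fin insert pairing_new_edge[OF insert(1,2)]
    by (simp add: edge_at_insert[OF insert(1-4)] ac_simps)
qed simp

text \<open>Time and space are treated together: \<open>B\<close> is Lebesgue measure on the
  half-line or on the whole space. The half-line is a restricted space, so its sigma-algebra is not
  the Borel one of the line; measurability of the identity lets Borel functions be used on
  it.\<close>

locale correlation_base =
  fixes \<kappa> :: "'a::euclidean_space correlation" and B :: "'a measure"
  assumes sigma_finite_B: "sigma_finite_measure B"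
    and id_B: "(\<lambda>x. x) \<in> B \<rightarrow>\<^sub>M borel"
    and kernel_measurable: "\<And>k. \<kappa> = Kernel k \<Longrightarrow> k \<in> borel_measurable borel"
begin

sublocale B: sigma_finite_measure B by (rule sigma_finite_B)
sublocale PB: product_sigma_finite "\<lambda>_. B" by standard

abbreviation \<B> :: "'v set \<Rightarrow> ('v \<Rightarrow> 'a) measure" where
  "\<B> V \<equiv> \<Pi>\<^sub>M v\<in>V. B"

abbreviation \<C> :: "'v set \<Rightarrow> ('v \<times> 'v) set \<Rightarrow> ('v \<Rightarrow> 'a) measure" where
  "\<C> \<equiv> correlation_measure \<kappa> B"

lemma component_borel: "v \<in> V \<Longrightarrow> (\<lambda>z. z v) \<in> borel_measurable (\<B> V)"
  using measurable_compose[OF measurable_component_singleton[of v V "\<lambda>_. B"] id_B] .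

lemma sets_correlation_measure [measurable_cong]:
  "sets (\<C> V E) = sets (\<B> V)"
  by (auto simp: correlation_measure_def split: correlation.split)

lemma space_correlation_measure:
  "space (\<C> V E) = space (\<B> V)"
  by (rule sets_eq_imp_space_eq) (rule sets_correlation_measure)

lemma edge_density_measurable:
  assumes "E \<subseteq> V \<times> V" "\<kappa> = Kernel k"
  shows "(\<lambda>z. \<Prod>(a, b)\<in>E. ennreal (k (z a - z b))) \<in> borel_measurable (\<B> V)"
proof (intro borel_measurable_prod_ennreal)
  fix e assume "e \<in> E"
  have [measurable]: "k \<in> borel_measurable borel" using kernel_measurable assms by auto
  have "fst e \<in> V" "snd e \<in> V" using assms \<open>e \<in> E\<close> by auto
  from this[THEN component_borel]
  have [measurable]: "(\<lambda>z. z (fst e)) \<in> borel_measurable (\<B> V)" "(\<lambda>z. z (snd e)) \<in> borel_measurable (\<B> V)" .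
  show "(\<lambda>z. case e of (a, b) \<Rightarrow> ennreal (k (z a - z b))) \<in> borel_measurable (\<B> V)"
    unfolding case_prod_beta by measurable
qed

lemma edge_map_measurable:
  assumes "pairing V E"
  shows "(\<lambda>w. \<lambda>v\<in>V. w (edge_at E v)) \<in> (\<Pi>\<^sub>M e\<in>E. B) \<rightarrow>\<^sub>M (\<B> V)"
  using edge_at_in[OF assms] by (intro measurable_restrict measurable_component_singleton) auto

lemma nn_integral_correlation_Kernel:
  assumes "pairing V E" "\<kappa> = Kernel k" "g \<in> borel_measurable (\<B> V)"
  shows "(\<integral>\<^sup>+z. g z \<partial>\<C> V E) =
    (\<integral>\<^sup>+z. (\<Prod>(a, b)\<in>E. ennreal (k (z a - z b))) * g z \<partial>(\<B> V))"
proof -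
  have "E \<subseteq> V \<times> V" using pairing_subset[OF assms(1)] .
  then show ?thesis unfolding correlation_measure_def using assms
    by (simp add: nn_integral_density edge_density_measurable)
qed

lemma nn_integral_correlation_Delta:
  assumes "pairing V E" "\<kappa> = Delta" "g \<in> borel_measurable (\<B> V)"
  shows "(\<integral>\<^sup>+z. g z \<partial>\<C> V E) =
    (\<integral>\<^sup>+w. g (\<lambda>v\<in>V. w (edge_at E v)) \<partial>(\<Pi>\<^sub>M e\<in>E. B))"
  using assms edge_map_measurable[OF assms(1)]
  unfolding correlation_measure_def edge_at_def[symmetric]
  by (simp add: nn_integral_distr)

text \<open>A kernel gives a density that is finite everywhere. For the delta, an image measure need
  not inherit sigma-finiteness, but the edge map is injective: reading each edge variable off the
  first end point undoes it, and the preimages under this left inverse of sets of finite measure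
  have finite measure again.\<close>

lemma sigma_finite_correlation:
  assumes P: "pairing V E"
  shows "sigma_finite_measure (\<C> V E)"
proof (cases \<kappa>)
  case (Kernel k)
  have fin: "finite V" "finite E" and sub: "E \<subseteq> V \<times> V" using pairing_finite[OF P] pairing_subset[OF P] by auto
  interpret V: sigma_finite_measure "\<Pi>\<^sub>M v\<in>V. B" using PB.sigma_finite fin by auto
  have "sigma_finite_measure (density (\<B> V) (\<lambda>z. \<Prod>(a, b)\<in>E. ennreal (k (z a - z b))))"
    using edge_density_measurable[OF sub Kernel]
    by (subst V.sigma_finite_iff_density_finite) (auto simp: ennreal_prod_eq_top fin)
  then show ?thesis by (simp add: correlation_measure_def Kernel)
next
  case Delta
  have fin: "finite V" "finite E" using pairing_finite[OF P] by auto
  interpret E: sigma_finite_measure "\<Pi>\<^sub>M e\<in>E. B" using PB.sigma_finite fin by auto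
  from E.sigma_finite_countable obtain A where A: "countable A" "A \<subseteq> sets (\<Pi>\<^sub>M e\<in>E. B)"
    "\<Union>A = space (\<Pi>\<^sub>M e\<in>E. B)" "\<forall>a\<in>A. emeasure (\<Pi>\<^sub>M e\<in>E. B) a \<noteq> \<infinity>" by auto
  define s where "s = (\<lambda>z::_ \<Rightarrow> 'a. \<lambda>e\<in>E. z (fst e))"
  have s [measurable]: "s \<in> (\<B> V) \<rightarrow>\<^sub>M (\<Pi>\<^sub>M e\<in>E. B)"
    unfolding s_def using P by (intro measurable_restrict measurable_component_singleton) (use pairing_subset[OF P] in auto)
  define D where "D = (\<lambda>w::_ \<Rightarrow> 'a. \<lambda>v\<in>V. w (edge_at E v))"
  have D [measurable]: "D \<in> (\<Pi>\<^sub>M e\<in>E. B) \<rightarrow>\<^sub>M (\<B> V)"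
    unfolding D_def by (rule edge_map_measurable[OF P])
  have sD: "s (D w) = w" if "w \<in> space (\<Pi>\<^sub>M e\<in>E. B)" for w
  proof
    fix e show "s (D w) e = w e"
    proof (cases "e \<in> E")
      case True
      then have "fst e \<in> V" "edge_at E (fst e) = e" using pairing_subset[OF P] edge_at_eq[OF P] by auto
      then show ?thesis using True by (simp add: s_def D_def)
    next
      case False
      then show ?thesis using that by (cases e) (auto simp: s_def space_PiM PiE_def extensional_def)
    qed
  qed
  have eq: "\<C> V E = distr (\<Pi>\<^sub>M e\<in>E. B) (\<B> V) D"
    by (simp add: correlation_measure_def Delta D_def edge_at_def)
  let ?C = "(\<lambda>a. s -` a \<inter> space (\<B> V)) ` A"
  have vim: "D -` (s -` a \<inter> space (\<B> V)) \<inter> space (\<Pi>\<^sub>M e\<in>E. B) = a" if "a \<in> A" for a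
  proof -
    have "a \<subseteq> space (\<Pi>\<^sub>M e\<in>E. B)" using that A(3) by blast
    then show ?thesis using measurable_space[OF D] by (auto simp: sD subset_eq)
  qed
  show ?thesis
    unfolding eq
  proof (standard, intro exI[of _ ?C] conjI ballI)
    show "countable ?C" using A by simp
    show "?C \<subseteq> sets (distr (\<Pi>\<^sub>M e\<in>E. B) (\<B> V) D)" using A(2) by auto
    show "\<Union>?C = space (distr (\<Pi>\<^sub>M e\<in>E. B) (\<B> V) D)"
      using measurable_space[OF s, folded A(3)] by auto
    fix c assume "c \<in> ?C"
    then show "emeasure (distr (\<Pi>\<^sub>M e\<in>E. B) (\<B> V) D) c \<noteq> \<infinity>"
      using A vim by (auto simp: emeasure_distr)
  qed
qed

text \<open>The integral over the two variables of one edge, written as an iterated integral so that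
  it can be formed for every \<open>h\<close>; joint measurability enters where it is compared with
  a measure.\<close>

definition pair_integral :: "('a \<Rightarrow> 'a \<Rightarrow> ennreal) \<Rightarrow> ennreal" where
  "pair_integral h = (case \<kappa> of Kernel k \<Rightarrow> \<integral>\<^sup>+y. \<integral>\<^sup>+x. ennreal (k (x - y)) * h x y \<partial>B \<partial>B
     | Delta \<Rightarrow> \<integral>\<^sup>+x. h x x \<partial>B)"

lemma pair_integral_Kernel:
  "\<kappa> = Kernel k \<Longrightarrow> pair_integral h = (\<integral>\<^sup>+y. \<integral>\<^sup>+x. ennreal (k (x - y)) * h x y \<partial>B \<partial>B)"
  unfolding pair_integral_def by simp

lemma pair_integral_Delta: "\<kappa> = Delta \<Longrightarrow> pair_integral h = (\<integral>\<^sup>+x. h x x \<partial>B)"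
  unfolding pair_integral_def by simp

text \<open>Tonelli's theorem for one edge. With a kernel, the density of the old edges does not
  depend on the new variables and can be pulled out; with the delta, the new edge brings a single
  variable that is placed at both new vertices. The two kinds of correlation thereby obey one
  recursion.\<close>

lemma nn_integral_correlation_insert:
  assumes P: "pairing V E" "a \<notin> V" "b \<notin> V" "a \<noteq> b"
    and g: "g \<in> borel_measurable (\<B> (insert a (insert b V)))"
  shows "(\<integral>\<^sup>+z. g z \<partial>\<C> (insert a (insert b V)) (insert (a, b) E)) =
    (\<integral>\<^sup>+z. pair_integral (\<lambda>x y. g (z(b := y, a := x))) \<partial>\<C> V E)"
proof -
  note fin = pairing_finite[OF P(1)]
  have "z \<in> space (\<B> V) \<Longrightarrow> (\<lambda>(x, y). z(b := y, a := x)) \<in> B \<Otimes>\<^sub>M B \<rightarrow>\<^sub>M (\<B> (insert a (insert b V)))" for z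
    unfolding case_prod_beta
    by (intro measurable_fun_upd[where J="insert b V"] measurable_fun_upd[where J=V] measurable_const) auto
  note upd = this
  have updm: "(\<lambda>p. (fst p)(b := fst (snd p), a := snd (snd p))) \<in> (\<B> V) \<Otimes>\<^sub>M (B \<Otimes>\<^sub>M B) \<rightarrow>\<^sub>M (\<B> (insert a (insert b V)))"
    by (intro measurable_fun_upd[where J="insert b V"] measurable_fun_upd[where J=V]) auto
  have gm [measurable]: "(\<lambda>p. g ((fst p)(b := fst (snd p), a := snd (snd p)))) \<in> borel_measurable ((\<B> V) \<Otimes>\<^sub>M (B \<Otimes>\<^sub>M B))"
    by (rule measurable_compose[OF updm g])
  have idB [measurable]: "(\<lambda>x. x) \<in> B \<rightarrow>\<^sub>M borel" by (rule id_B)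
  show ?thesis
  proof (cases \<kappa>)
    case (Kernel k)
    have [measurable]: "k \<in> borel_measurable borel" using kernel_measurable[OF Kernel] .
    have sub: "E \<subseteq> V \<times> V" "insert (a, b) E \<subseteq> insert a (insert b V) \<times> insert a (insert b V)"
      using pairing_subset[OF P(1)] by auto
    let ?d = "\<lambda>E z. \<Prod>(a, b)\<in>E. ennreal (k (z a - z b))"
    have [measurable]: "?d E \<in> borel_measurable (\<B> V)" using edge_density_measurable[OF sub(1) Kernel] .
    have m1: "(\<lambda>z. ?d (insert (a, b) E) z * g z) \<in> borel_measurable (\<B> (insert a (insert b V)))"
      using edge_density_measurable[OF sub(2) Kernel] g by measurable
    have "(\<integral>\<^sup>+z. g z \<partial>\<C> (insert a (insert b V)) (insert (a, b) E)) =
      (\<integral>\<^sup>+z. ?d (insert (a, b) E) z * g z \<partial>(\<B> (insert a (insert b V))))"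
      by (rule nn_integral_correlation_Kernel[OF pairing_insert[OF P] Kernel g])
    also have "\<dots> = (\<integral>\<^sup>+z. (\<integral>\<^sup>+x. ?d (insert (a, b) E) (z(a := x)) * g (z(a := x)) \<partial>B) \<partial>(\<Pi>\<^sub>M v\<in>insert b V. B))"
      using P fin m1 by (intro PB.product_nn_integral_insert) auto
    also have "\<dots> = (\<integral>\<^sup>+z. \<integral>\<^sup>+y. \<integral>\<^sup>+x. ?d (insert (a, b) E) (z(b := y, a := x)) * g (z(b := y, a := x)) \<partial>B \<partial>B \<partial>(\<B> V))"
    proof (intro PB.product_nn_integral_insert)
      have "(\<lambda>(z, x). z(a := x)) \<in> (\<Pi>\<^sub>M v\<in>insert b V. B) \<Otimes>\<^sub>M B \<rightarrow>\<^sub>M (\<B> (insert a (insert b V)))"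
        by (rule measurable_add_dim)
      from measurable_compose[OF this m1]
      show "(\<lambda>z. \<integral>\<^sup>+x. ?d (insert (a, b) E) (z(a := x)) * g (z(a := x)) \<partial>B) \<in> borel_measurable (\<Pi>\<^sub>M v\<in>insert b V. B)"
        by (intro B.borel_measurable_nn_integral) (simp add: case_prod_beta)
    qed (use P fin in auto)
    also have "\<dots> = (\<integral>\<^sup>+z. ?d E z * pair_integral (\<lambda>x y. g (z(b := y, a := x))) \<partial>(\<B> V))"
    proof (rule nn_integral_cong)
      fix z assume z: "z \<in> space (\<B> V)"
      \<comment> \<open>The old edges end in \<open>V\<close>, so their factors do not see the
        values at \<open>a\<close> and \<open>b\<close>.\<close>
      have "?d E (z(b := y, a := x)) = ?d E z" for x y
        using sub(1) P by (intro prod.cong) auto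
      then have 1: "?d (insert (a, b) E) (z(b := y, a := x)) = ennreal (k (x - y)) * ?d E z" for x y
        using fin P pairing_new_edge[OF P(1,2)] by (simp del: fun_upd_apply add: fun_upd_same fun_upd_other)
      have gz: "(\<lambda>(x, y). g (z(b := y, a := x))) \<in> borel_measurable (B \<Otimes>\<^sub>M B)"
        using measurable_compose[OF upd[OF z] g] by (simp add: case_prod_beta)
      have gz2 [measurable]: "(\<lambda>p. g (z(b := fst p, a := snd p))) \<in> borel_measurable (B \<Otimes>\<^sub>M B)"
        using measurable_compose[OF measurable_Pair[OF measurable_snd measurable_fst] gz] by (simp add: case_prod_beta)
      have "(\<lambda>x. ennreal (k (x - y)) * g (z(b := y, a := x))) \<in> borel_measurable B" if [measurable]: "y \<in> space B" for y
        using measurable_compose[OF measurable_Pair1'[OF that] gz2] by simp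
      then have "(\<integral>\<^sup>+y. \<integral>\<^sup>+x. ?d (insert (a, b) E) (z(b := y, a := x)) * g (z(b := y, a := x)) \<partial>B \<partial>B) =
         (\<integral>\<^sup>+y. ?d E z * (\<integral>\<^sup>+x. ennreal (k (x - y)) * g (z(b := y, a := x)) \<partial>B) \<partial>B)"
        unfolding 1 by (intro nn_integral_cong) (simp add: mult_ac nn_integral_cmult[symmetric])
      also have "\<dots> = ?d E z * (\<integral>\<^sup>+y. \<integral>\<^sup>+x. ennreal (k (x - y)) * g (z(b := y, a := x)) \<partial>B \<partial>B)"
      proof (intro nn_integral_cmult B.borel_measurable_nn_integral)
        have "(\<lambda>p. ennreal (k (snd p - fst p)) * g (z(b := fst p, a := snd p))) \<in> borel_measurable (B \<Otimes>\<^sub>M B)" by measurable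
        then show "(\<lambda>(y, x). ennreal (k (x - y)) * g (z(b := y, a := x))) \<in> borel_measurable (B \<Otimes>\<^sub>M B)"
          by (simp add: case_prod_beta)
      qed
      finally show "(\<integral>\<^sup>+y. \<integral>\<^sup>+x. ?d (insert (a, b) E) (z(b := y, a := x)) * g (z(b := y, a := x)) \<partial>B \<partial>B) =
        ?d E z * pair_integral (\<lambda>x y. g (z(b := y, a := x)))"
        by (simp only: pair_integral_Kernel[OF Kernel])
    qed
    also have "\<dots> = (\<integral>\<^sup>+z. pair_integral (\<lambda>x y. g (z(b := y, a := x))) \<partial>\<C> V E)"
    proof (rule nn_integral_correlation_Kernel[OF P(1) Kernel, symmetric])
      have "(\<lambda>p. ennreal (k (snd (snd p) - fst (snd p))) * g ((fst p)(b := fst (snd p), a := snd (snd p)))) \<in> borel_measurable ((\<B> V) \<Otimes>\<^sub>M (B \<Otimes>\<^sub>M B))"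
        by measurable
      moreover have "(\<lambda>p. (fst (fst p), (snd (fst p), snd p))) \<in> ((\<B> V) \<Otimes>\<^sub>M B) \<Otimes>\<^sub>M B \<rightarrow>\<^sub>M (\<B> V) \<Otimes>\<^sub>M (B \<Otimes>\<^sub>M B)"
        by measurable
      ultimately have "(\<lambda>q. (\<lambda>p. ennreal (k (snd (snd p) - fst (snd p))) * g ((fst p)(b := fst (snd p), a := snd (snd p)))) ((\<lambda>p. (fst (fst p), (snd (fst p), snd p))) q)) \<in> borel_measurable (((\<B> V) \<Otimes>\<^sub>M B) \<Otimes>\<^sub>M B)"
        by (rule measurable_compose[rotated])
      then show "(\<lambda>z. pair_integral (\<lambda>x y. g (z(b := y, a := x)))) \<in> borel_measurable (\<B> V)"
        unfolding pair_integral_Kernel[OF Kernel]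
        by - (rule B.borel_measurable_nn_integral, unfold split_def, rule B.borel_measurable_nn_integral, unfold split_def, simp)
    qed
    finally show ?thesis .
  next
    case Delta
    note E' = edge_map_measurable[OF pairing_insert[OF P]]
    have new: "(a, b) \<notin> E" using pairing_new_edge[OF P(1,2)] .
    have "(\<integral>\<^sup>+z. g z \<partial>\<C> (insert a (insert b V)) (insert (a, b) E)) =
      (\<integral>\<^sup>+w. g (\<lambda>v\<in>insert a (insert b V). w (edge_at (insert (a, b) E) v)) \<partial>(\<Pi>\<^sub>M e\<in>insert (a, b) E. B))"
      by (rule nn_integral_correlation_Delta[OF pairing_insert[OF P] Delta g])
    also have "\<dots> = (\<integral>\<^sup>+w. \<integral>\<^sup>+x. g (\<lambda>v\<in>insert a (insert b V). (w((a, b) := x)) (edge_at (insert (a, b) E) v)) \<partial>B \<partial>(\<Pi>\<^sub>M e\<in>E. B))"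
      using fin new measurable_compose[OF E' g] by (intro PB.product_nn_integral_insert) auto
    also have "\<dots> = (\<integral>\<^sup>+w. pair_integral (\<lambda>x y. g ((\<lambda>v\<in>V. w (edge_at E v))(b := y, a := x))) \<partial>(\<Pi>\<^sub>M e\<in>E. B))"
    proof -
      \<comment> \<open>Both \<open>a\<close> and \<open>b\<close> read the coordinate of the new
        edge, the old vertices their old coordinates.\<close>
      have eq: "(\<lambda>v\<in>insert a (insert b V). (w((a, b) := x)) (edge_at (insert (a, b) E) v)) =
          (\<lambda>v\<in>V. w (edge_at E v))(b := x, a := x)" for w x
        using edge_at_insert[OF P] new edge_at_in[OF P(1)]
        by (auto simp: fun_eq_iff restrict_def) metis+
      show ?thesis by (simp only: pair_integral_Delta[OF Delta] eq)
    qed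
    also have "\<dots> = (\<integral>\<^sup>+z. pair_integral (\<lambda>x y. g (z(b := y, a := x))) \<partial>\<C> V E)"
    proof (rule nn_integral_correlation_Delta[OF P(1) Delta, symmetric])
      have "(\<lambda>(z,x). (z,(x,x))) \<in> (\<B> V) \<Otimes>\<^sub>M B \<rightarrow>\<^sub>M (\<B> V) \<Otimes>\<^sub>M (B \<Otimes>\<^sub>M B)"
        by measurable
      from measurable_compose[OF this gm]
      have "(\<lambda>(z, x). g (z(b := x, a := x))) \<in> borel_measurable ((\<B> V) \<Otimes>\<^sub>M B)"
        by (simp add: case_prod_beta)
      then show "(\<lambda>z. pair_integral (\<lambda>x y. g (z(b := y, a := x)))) \<in> borel_measurable (\<B> V)"
        unfolding pair_integral_Delta[OF Delta]
        by (intro B.borel_measurable_nn_integral) (simp add: case_prod_beta)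
    qed
    finally show ?thesis .
  qed
qed

end

section \<open>Relabelling of the vertices\<close>

lemma pairing_12: "pairing {1, 2 :: nat} {(1, 2)}"
  using pairing_insert[OF pairing_empty, of 1 "2 :: nat"] by simp

lemma pairing_image:
  assumes P: "pairing V E" and \<pi>: "bij_betw \<pi> V V'"
  shows "pairing V' (map_prod \<pi> \<pi> ` E)"
proof (rule pairingI)
  have inj: "inj_on \<pi> V" and V': "\<pi> ` V = V'" using \<pi> by (auto simp: bij_betw_def)
  note edge = pairing_edge[OF P]
  show "finite V'" using pairing_finite[OF P] V' by blast
  show "a \<in> V' \<and> b \<in> V' \<and> a \<noteq> b" if ab: "(a, b) \<in> map_prod \<pi> \<pi> ` E" for a b
  proof -
    obtain c d where cd: "(c, d) \<in> E" "a = \<pi> c" "b = \<pi> d" using ab by auto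
    show ?thesis using edge[OF cd(1)] inj V' cd by (auto dest: inj_onD)
  qed
  fix v' assume "v' \<in> V'"
  then obtain v where v: "v \<in> V" "v' = \<pi> v" using V' by auto
  have iff: "(v' = fst (map_prod \<pi> \<pi> e) \<or> v' = snd (map_prod \<pi> \<pi> e)) = (v = fst e \<or> v = snd e)" if "e \<in> E" for e
  proof -
    have "fst e \<in> V" "snd e \<in> V" using edge[of "fst e" "snd e"] that by simp_all
    then show ?thesis using v inj by (auto simp: inj_on_def)
  qed
  from pairing_ex1[OF P v(1)] obtain e where e: "e \<in> E" "v = fst e \<or> v = snd e"
    "\<And>e'. e' \<in> E \<and> (v = fst e' \<or> v = snd e') \<Longrightarrow> e' = e" by blast
  show "\<exists>!e. e \<in> map_prod \<pi> \<pi> ` E \<and> (v' = fst e \<or> v' = snd e)"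
  proof (rule ex1I[of _ "map_prod \<pi> \<pi> e"])
    show "map_prod \<pi> \<pi> e \<in> map_prod \<pi> \<pi> ` E \<and> (v' = fst (map_prod \<pi> \<pi> e) \<or> v' = snd (map_prod \<pi> \<pi> e))"
      using e(1,2) iff[OF e(1)] by blast
    fix e' assume e': "e' \<in> map_prod \<pi> \<pi> ` E \<and> (v' = fst e' \<or> v' = snd e')"
    from conjunct1[OF e'] obtain d where d: "e' = map_prod \<pi> \<pi> d" "d \<in> E" by (rule imageE)
    have "d = e"
      by (rule e(3)) (rule conjI[OF d(2) iffD1[OF iff[OF d(2)] conjunct2[OF e'[unfolded d(1)]]]])
    then show "e' = map_prod \<pi> \<pi> e" using d(1) by simp
  qed
qed

lemma inj_on_map_prod_edges:
  assumes "pairing V E" "inj_on \<pi> V"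
  shows "inj_on (map_prod \<pi> \<pi>) E"
proof -
  have "inj_on (map_prod \<pi> \<pi>) (V \<times> V)" using assms(2) by (simp add: map_prod_inj_on)
  then show ?thesis using pairing_subset[OF assms(1)] by (rule inj_on_subset)
qed

text \<open>A product of sigma-finite measures is determined by its values on boxes, and the
  preimage of a box under a bijective relabelling of the coordinates is again a box.\<close>

lemma distr_PiM_bij:
  assumes B: "sigma_finite_measure B" and \<pi>: "bij_betw \<pi> I K" and fin: "finite I"
  shows "distr (\<Pi>\<^sub>M k\<in>K. B) (\<Pi>\<^sub>M i\<in>I. B) (\<lambda>w. \<lambda>i\<in>I. w (\<pi> i)) = (\<Pi>\<^sub>M i\<in>I. B)"
proof -
  interpret B: sigma_finite_measure B by fact
  interpret PI: product_sigma_finite "\<lambda>_. B" by standard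
  interpret PK: product_sigma_finite "\<lambda>_. B" by standard
  have inj: "inj_on \<pi> I" and K: "\<pi> ` I = K" using \<pi> by (auto simp: bij_betw_def)
  have [simp]: "finite K" using fin K by blast
  interpret K: finite_product_sigma_finite "\<lambda>_. B" K by standard simp
  show ?thesis
  proof (rule PI.PiM_eqI[OF fin])
    have m: "(\<lambda>w. \<lambda>i\<in>I. w (\<pi> i)) \<in> (\<Pi>\<^sub>M k\<in>K. B) \<rightarrow>\<^sub>M (\<Pi>\<^sub>M i\<in>I. B)"
      using K by (intro measurable_restrict measurable_component_singleton) auto
    fix A assume A: "\<And>i. i \<in> I \<Longrightarrow> A i \<in> sets B"
    let ?A = "\<lambda>k. A (the_inv_into I \<pi> k)"
    have inv: "the_inv_into I \<pi> (\<pi> i) = i" if "i \<in> I" for i using the_inv_into_f_f[OF inj that] .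
    have vim: "(\<lambda>w. \<lambda>i\<in>I. w (\<pi> i)) -` Pi\<^sub>E I A \<inter> space (\<Pi>\<^sub>M k\<in>K. B) = Pi\<^sub>E K ?A"
    proof (intro set_eqI iffI)
      fix w assume "w \<in> (\<lambda>w. \<lambda>i\<in>I. w (\<pi> i)) -` Pi\<^sub>E I A \<inter> space (\<Pi>\<^sub>M k\<in>K. B)"
      then have "\<And>i. i \<in> I \<Longrightarrow> w (\<pi> i) \<in> A i" "w \<in> extensional K" by (auto simp: space_PiM PiE_def Pi_def)
      then show "w \<in> Pi\<^sub>E K ?A" unfolding K[symmetric] by (auto simp: PiE_def inv)
    next
      fix w assume w: "w \<in> Pi\<^sub>E K ?A"
      have 1: "w (\<pi> i) \<in> A i" if "i \<in> I" for i
      proof -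
        have "\<pi> i \<in> K" using that K by blast
        from PiE_mem[OF w this] show ?thesis by (simp add: inv[OF that])
      qed
      have "w (\<pi> i) \<in> space B" if "i \<in> I" for i
        using 1[OF that] sets.sets_into_space[OF A[OF that]] by blast
      then have "w k \<in> space B" if "k \<in> K" for k using that K by blast
      then show "w \<in> (\<lambda>w. \<lambda>i\<in>I. w (\<pi> i)) -` Pi\<^sub>E I A \<inter> space (\<Pi>\<^sub>M k\<in>K. B)"
        using w 1 by (simp add: space_PiM PiE_def)
    qed
    have "emeasure (distr (\<Pi>\<^sub>M k\<in>K. B) (\<Pi>\<^sub>M i\<in>I. B) (\<lambda>w. \<lambda>i\<in>I. w (\<pi> i))) (Pi\<^sub>E I A) = emeasure (\<Pi>\<^sub>M k\<in>K. B) (Pi\<^sub>E K ?A)"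
      using A fin by (subst emeasure_distr[OF m]) (auto simp: vim)
    also have "\<dots> = (\<Prod>k\<in>K. emeasure B (?A k))"
      using A K by (intro K.measure_times) (auto simp: inv)
    also have "\<dots> = (\<Prod>i\<in>I. emeasure B (A i))"
      unfolding K[symmetric] by (subst prod.reindex[OF inj]) (auto intro!: prod.cong simp: inv)
    finally show "emeasure (distr (\<Pi>\<^sub>M k\<in>K. B) (\<Pi>\<^sub>M i\<in>I. B) (\<lambda>w. \<lambda>i\<in>I. w (\<pi> i))) (Pi\<^sub>E I A) = (\<Prod>i\<in>I. emeasure B (A i))" .
  qed simp
qed

lemma measurable_relabel:
  assumes "\<pi> ` I \<subseteq> K"
  shows "(\<lambda>w. \<lambda>i\<in>I. w (\<pi> i)) \<in> (\<Pi>\<^sub>M k\<in>K. B) \<rightarrow>\<^sub>M (\<Pi>\<^sub>M i\<in>I. B)"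
  using assms by (intro measurable_restrict measurable_component_singleton) auto

text \<open>Tests equality of measures on nonnegative functions, for which Tonelli's theorem and the
  formulas for densities and image measures apply without integrability conditions.\<close>

lemma measure_eqI_nn:
  assumes "sets M = sets N" "\<And>f. f \<in> borel_measurable M \<Longrightarrow> (\<integral>\<^sup>+x. f x \<partial>M) = (\<integral>\<^sup>+x. f x \<partial>N)"
  shows "M = N"
proof (rule measure_eqI[OF assms(1)])
  fix A assume A: "A \<in> sets M"
  then have "emeasure M A = (\<integral>\<^sup>+x. indicator A x \<partial>M)" by simp
  also have "\<dots> = (\<integral>\<^sup>+x. indicator A x \<partial>N)" using A by (intro assms(2)) simp
  also have "\<dots> = emeasure N A" using A assms(1) by simp
  finally show "emeasure M A = emeasure N A" .
qed

context correlation_base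
begin

text \<open>The edges move along with the vertices, so the density, or the edge map for the delta,
  is the old one after relabelling. What remains is the invariance of a power of \<open>B\<close>
  under bijections of its index set: of the vertices in the first case, of the edges in the
  second.\<close>

lemma correlation_measure_relabel:
  assumes P: "pairing V E" and \<pi>: "bij_betw \<pi> V V'"
  shows "distr (\<C> V' (map_prod \<pi> \<pi> ` E)) (\<B> V) (\<lambda>z. \<lambda>v\<in>V. z (\<pi> v)) =
    \<C> V E"
proof (rule measure_eqI_nn)
  show "sets (distr (\<C> V' (map_prod \<pi> \<pi> ` E)) (\<B> V) (\<lambda>z. \<lambda>v\<in>V. z (\<pi> v))) =
    sets (\<C> V E)" by (simp add: sets_correlation_measure)
  have inj: "inj_on \<pi> V" and V': "\<pi> ` V = V'" using \<pi> by (auto simp: bij_betw_def)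
  note P' = pairing_image[OF P \<pi>]
  note fin = pairing_finite[OF P]
  let ?r = "\<lambda>z. \<lambda>v\<in>V. z (\<pi> v)" and ?E = "map_prod \<pi> \<pi> ` E"
  note injE = inj_on_map_prod_edges[OF P inj]
  have r: "?r \<in> (\<B> V') \<rightarrow>\<^sub>M (\<B> V)" using V' by (intro measurable_relabel) simp
  have r': "?r \<in> \<C> V' ?E \<rightarrow>\<^sub>M (\<B> V)"
    using r by (simp only: measurable_cong_sets[OF sets_correlation_measure refl])
  fix g :: "_ \<Rightarrow> ennreal" assume "g \<in> borel_measurable (distr (\<C> V' ?E) (\<B> V) ?r)"
  then have g [measurable]: "g \<in> borel_measurable (\<B> V)" by simp
  have gr: "(\<lambda>z. g (?r z)) \<in> borel_measurable (\<B> V')" by (rule measurable_compose[OF r g])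
  have "(\<integral>\<^sup>+z. g z \<partial>distr (\<C> V' ?E) (\<B> V) ?r) =
    (\<integral>\<^sup>+z. g (?r z) \<partial>\<C> V' ?E)"
    using r' by (rule nn_integral_distr) simp
  also have "\<dots> = (\<integral>\<^sup>+z. g z \<partial>\<C> V E)"
  proof (cases \<kappa>)
    case (Kernel k)
    let ?d = "\<lambda>E z. \<Prod>(a, b)\<in>E. ennreal (k (z a - z b))"
    have [measurable]: "?d E \<in> borel_measurable (\<B> V)"
      using edge_density_measurable[OF pairing_subset[OF P] Kernel] .
    have d: "?d ?E z = ?d E (?r z)" for z
      by (subst prod.reindex[OF injE]) (use pairing_edge[OF P] in \<open>auto intro!: prod.cong\<close>)
    have "(\<integral>\<^sup>+z. g (?r z) \<partial>\<C> V' ?E) = (\<integral>\<^sup>+z. ?d E (?r z) * g (?r z) \<partial>(\<B> V'))"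
      unfolding d[symmetric] by (rule nn_integral_correlation_Kernel[OF P' Kernel gr])
    also have "\<dots> = (\<integral>\<^sup>+z. ?d E z * g z \<partial>distr (\<B> V') (\<B> V) ?r)"
      using r by (rule nn_integral_distr[symmetric]) simp
    also have "distr (\<B> V') (\<B> V) ?r = (\<B> V)"
      using fin by (intro distr_PiM_bij[OF sigma_finite_B \<pi>]) simp
    finally show ?thesis unfolding nn_integral_correlation_Kernel[OF P Kernel g] .
  next
    case Delta
    let ?r' = "\<lambda>w. \<lambda>e\<in>E. w (map_prod \<pi> \<pi> e)"
    have bij: "bij_betw (map_prod \<pi> \<pi>) E ?E" using injE by (rule inj_on_imp_bij_betw)
    have r2: "?r' \<in> (\<Pi>\<^sub>M e\<in>?E. B) \<rightarrow>\<^sub>M (\<Pi>\<^sub>M e\<in>E. B)" by (intro measurable_relabel) simp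
    have e: "?r (\<lambda>v\<in>V'. w (edge_at ?E v)) = (\<lambda>v\<in>V. ?r' w (edge_at E v))" for w
    proof (rule restrict_ext)
      fix v assume v: "v \<in> V"
      have "edge_at ?E (\<pi> v) = map_prod \<pi> \<pi> (edge_at E v)"
        using edge_at_in[OF P v] by (intro edge_at_eq[OF P']) force+
      then show "(\<lambda>v\<in>V'. w (edge_at ?E v)) (\<pi> v) = ?r' w (edge_at E v)"
        using v V' edge_at_in(1)[OF P v] by auto
    qed
    have "(\<integral>\<^sup>+z. g (?r z) \<partial>\<C> V' ?E) =
      (\<integral>\<^sup>+w. g (\<lambda>v\<in>V. ?r' w (edge_at E v)) \<partial>(\<Pi>\<^sub>M e\<in>?E. B))"
      unfolding e[symmetric] by (rule nn_integral_correlation_Delta[OF P' Delta gr])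
    also have "\<dots> = (\<integral>\<^sup>+w. g (\<lambda>v\<in>V. w (edge_at E v)) \<partial>distr (\<Pi>\<^sub>M e\<in>?E. B) (\<Pi>\<^sub>M e\<in>E. B) ?r')"
      using measurable_compose[OF edge_map_measurable[OF P] g] by (intro nn_integral_distr[OF r2, symmetric]) simp
    also have "distr (\<Pi>\<^sub>M e\<in>?E. B) (\<Pi>\<^sub>M e\<in>E. B) ?r' = (\<Pi>\<^sub>M e\<in>E. B)"
      using fin by (intro distr_PiM_bij[OF sigma_finite_B bij]) simp
    finally show ?thesis unfolding nn_integral_correlation_Delta[OF P Delta g] .
  qed
  finally show "(\<integral>\<^sup>+z. g z \<partial>distr (\<C> V' ?E) (\<B> V) ?r) =
    (\<integral>\<^sup>+z. g z \<partial>\<C> V E)" .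
qed

text \<open>The base case of inductions over edges: an empty product of measures is a point
  mass.\<close>

lemma emeasure_correlation_empty:
  "emeasure (\<C> {} {}) (space (\<C> {} {})) = 1"
proof -
  have "(\<integral>\<^sup>+z. 1 \<partial>\<C> {} {}) = 1"
  proof (cases \<kappa>)
    case (Kernel k)
    show ?thesis
      by (subst nn_integral_correlation_Kernel[OF pairing_empty Kernel]; (subst PB.nn_integral_empty)?) simp_all
  next
    case Delta
    show ?thesis
      by (subst nn_integral_correlation_Delta[OF pairing_empty Delta]; (subst PB.nn_integral_empty)?) simp_all
  qed
  then show ?thesis by (simp only: nn_integral_const mult_1)
qed

lemma pair_integral_measurable_eq:
  assumes h: "(\<lambda>(x, y). h x y) \<in> borel_measurable (B \<Otimes>\<^sub>M B)"
  shows "pair_integral h = (\<integral>\<^sup>+z. h (z 1) (z 2) \<partial>\<C> {1, 2 :: nat} {(1, 2)})"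
proof -
  have "(\<lambda>z. (z 1, z 2)) \<in> (\<B> ({1, 2 :: nat})) \<rightarrow>\<^sub>M B \<Otimes>\<^sub>M B" by measurable
  from measurable_compose[OF this h]
  have m: "(\<lambda>z. h (z 1) (z 2)) \<in> borel_measurable (\<B> ({1, 2 :: nat}))" by simp
  have "(\<integral>\<^sup>+z. h (z 1) (z 2) \<partial>\<C> {1, 2 :: nat} {(1, 2)}) =
    (\<integral>\<^sup>+z. pair_integral h \<partial>\<C> ({} :: nat set) {})"
    using nn_integral_correlation_insert[OF pairing_empty _ _ _ m] by simp
  also have "\<dots> = pair_integral h"
    by (simp only: nn_integral_const emeasure_correlation_empty mult_1_right)
  finally show ?thesis by simp
qed

text \<open>Phrasing the integral over one edge as an integral over configurations of the two points
  1 and 2 makes it an object of the same kind for time and for space, so that both can be combined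
  into one measure for an edge.\<close>

lemma nn_integral_correlation_insert':
  assumes P: "pairing V E" "a \<notin> V" "b \<notin> V" "a \<noteq> b"
    and g: "g \<in> borel_measurable (\<B> (insert a (insert b V)))"
  shows "(\<integral>\<^sup>+z. g z \<partial>\<C> (insert a (insert b V)) (insert (a, b) E)) =
    (\<integral>\<^sup>+z. \<integral>\<^sup>+y. g (z(b := y 2, a := y 1)) \<partial>\<C> {1, 2 :: nat} {(1, 2)} \<partial>\<C> V E)"
  unfolding nn_integral_correlation_insert[OF assms]
proof (intro nn_integral_cong pair_integral_measurable_eq)
  fix z assume "z \<in> space (\<C> V E)"
  then have z: "z \<in> space (\<B> V)" by (simp add: space_correlation_measure)
  have "(\<lambda>(x, y). z(b := y, a := x)) \<in> B \<Otimes>\<^sub>M B \<rightarrow>\<^sub>M (\<B> (insert a (insert b V)))"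
    unfolding case_prod_beta using z
    by (intro measurable_fun_upd[where J="insert b V"] measurable_fun_upd[where J=V] measurable_const) auto
  from measurable_compose[OF this g]
  show "(\<lambda>(x, y). g (z(b := y, a := x))) \<in> borel_measurable (B \<Otimes>\<^sub>M B)" by (simp add: split_def)
qed

end

lemma measurable_two_updates:
  "(\<lambda>p. (fst p)(b := snd p (2::nat), a := snd p 1)) \<in> (\<Pi>\<^sub>M v\<in>V. M) \<Otimes>\<^sub>M (\<Pi>\<^sub>M v\<in>{1, 2}. M) \<rightarrow>\<^sub>M (\<Pi>\<^sub>M v\<in>insert a (insert b V). M)"
  by (intro measurable_fun_upd[where J="insert b V"] measurable_fun_upd[where J=V]) auto

section \<open>The space-time noise measure\<close>

type_synonym ('v, 'd) configuration = "('v \<Rightarrow> real) \<times> ('v \<Rightarrow> real ^ 'd)"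

locale noise =
  fixes \<gamma> :: "real correlation" and \<Lambda> :: "(real ^ 'd) correlation"
  assumes \<gamma>_measurable: "\<And>k. \<gamma> = Kernel k \<Longrightarrow> k \<in> borel_measurable borel"
    and \<Lambda>_measurable: "\<And>k. \<Lambda> = Kernel k \<Longrightarrow> k \<in> borel_measurable borel"
begin

abbreviation half_line :: "real measure" where "half_line \<equiv> restrict_space lborel {0..}"

abbreviation config :: "'v set \<Rightarrow> ('v, 'd) configuration measure" where
  "config V \<equiv> (\<Pi>\<^sub>M v\<in>V. half_line) \<Otimes>\<^sub>M (\<Pi>\<^sub>M v\<in>V. lborel)"

abbreviation \<nu> :: "'v set \<Rightarrow> ('v \<times> 'v) set \<Rightarrow> ('v, 'd) configuration measure" where
  "\<nu> \<equiv> noise_measure \<gamma> \<Lambda>"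

abbreviation \<F> :: "nat \<Rightarrow> ((nat, 'd) configuration \<Rightarrow> 'x::topological_space) set" where
  "\<F> l \<equiv> borel_measurable (config {1..l})"

abbreviation \<Omega> :: "nat \<Rightarrow> (nat, 'd) configuration set" where
  "\<Omega> l \<equiv> space (config {1..l})"

abbreviation noise12 :: "(nat, 'd) configuration measure" where
  "noise12 \<equiv> \<nu> {1, 2} {(1, 2)}"

lemma id_half_line: "(\<lambda>x. x) \<in> half_line \<rightarrow>\<^sub>M borel"
  by (rule measurable_restrict_space1) simp

sublocale T: correlation_base \<gamma> half_line
proof (rule correlation_base.intro)
  show "sigma_finite_measure half_line"
    by (rule sigma_finite_measure_restrict_space[OF sigma_finite_lborel]) simp
qed (rule id_half_line, rule \<gamma>_measurable)

sublocale X: correlation_base \<Lambda> "lborel :: (real ^ 'd) measure"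
proof (rule correlation_base.intro)
  show "sigma_finite_measure (lborel :: (real ^ 'd) measure)" by (rule sigma_finite_lborel)
  show "(\<lambda>x. x) \<in> (lborel :: (real ^ 'd) measure) \<rightarrow>\<^sub>M borel" by simp
qed (rule \<Lambda>_measurable)

lemma sets_noise [measurable_cong]: "sets (\<nu> V E) = sets (config V)"
  unfolding noise_measure_def
  by (intro sets_pair_measure_cong T.sets_correlation_measure X.sets_correlation_measure)

lemma measurable_noise: "measurable (\<nu> V E) N = measurable (config V) N"
  by (rule measurable_cong_sets[OF sets_noise refl])

lemma sigma_finite_noise:
  assumes "pairing V E"
  shows "sigma_finite_measure (\<nu> V E)"
proof -
  interpret pair_sigma_finite "correlation_measure \<gamma> half_line V E" "correlation_measure \<Lambda> lborel V E"
    using T.sigma_finite_correlation[OF assms] X.sigma_finite_correlation[OF assms]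
    by (rule pair_sigma_finite.intro)
  show ?thesis unfolding noise_measure_def ..
qed

lemma nn_integral_noise:
  assumes "pairing V E" "f \<in> borel_measurable (config V)"
  shows "(\<integral>\<^sup>+z. f z \<partial>\<nu> V E) =
    (\<integral>\<^sup>+\<tau>. \<integral>\<^sup>+\<xi>. f (\<tau>, \<xi>) \<partial>correlation_measure \<Lambda> lborel V E \<partial>correlation_measure \<gamma> half_line V E)"
proof -
  interpret S: sigma_finite_measure "correlation_measure \<Lambda> lborel V E" by (rule X.sigma_finite_correlation[OF assms(1)])
  show ?thesis using assms(2) unfolding noise_measure_def
    by (subst S.nn_integral_fst[symmetric]) (simp_all add: measurable_noise[unfolded noise_measure_def])
qed

definition join :: "'v \<Rightarrow> 'v \<Rightarrow> ('v, 'd) configuration \<times> (nat, 'd) configuration \<Rightarrow>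
    ('v, 'd) configuration" where
  "join a b = (\<lambda>((\<tau>, \<xi>), (\<tau>', \<xi>')). (\<tau>(b := \<tau>' 2, a := \<tau>' 1), \<xi>(b := \<xi>' 2, a := \<xi>' 1)))"

lemma join_measurable: "join a b \<in> config V \<Otimes>\<^sub>M config {1, 2} \<rightarrow>\<^sub>M config (insert a (insert b V))"
proof -
  have 1: "(\<lambda>p. (fst (fst p), fst (snd p))) \<in> config V \<Otimes>\<^sub>M config {1, 2 :: nat} \<rightarrow>\<^sub>M (\<Pi>\<^sub>M v\<in>V. half_line) \<Otimes>\<^sub>M (\<Pi>\<^sub>M v\<in>{1, 2 :: nat}. half_line)"
    by measurable
  have 2: "(\<lambda>p. (snd (fst p), snd (snd p))) \<in> config V \<Otimes>\<^sub>M config {1, 2 :: nat} \<rightarrow>\<^sub>M (\<Pi>\<^sub>M v\<in>V. lborel :: (real ^ 'd) measure) \<Otimes>\<^sub>M (\<Pi>\<^sub>M v\<in>{1, 2 :: nat}. lborel)"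
    by measurable
  show ?thesis
    using measurable_Pair[OF measurable_compose[OF 1 measurable_two_updates[of b a]] measurable_compose[OF 2 measurable_two_updates[of b a]]]
    unfolding join_def split_def by simp
qed

text \<open>Edges are independent: an additional edge multiplies the measure by that of a single
  edge. The new variables are split off separately in time and in space, and one exchange of
  integrals brings the two parts together.\<close>

lemma noise_insert:
  assumes P: "pairing V E" "a \<notin> V" "b \<notin> V" "a \<noteq> b"
  shows "\<nu> (insert a (insert b V)) (insert (a, b) E) =
    distr (\<nu> V E \<Otimes>\<^sub>M noise12) (config (insert a (insert b V))) (join a b)"
proof (rule measure_eqI_nn)
  let ?V = "insert a (insert b V)" and ?E = "insert (a, b) E"
  show "sets (\<nu> ?V ?E) = sets (distr (\<nu> V E \<Otimes>\<^sub>M noise12) (config ?V) (join a b))"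
    by (simp add: sets_noise)
  fix f :: "_ \<Rightarrow> ennreal" assume "f \<in> borel_measurable (\<nu> ?V ?E)"
  then have f: "f \<in> borel_measurable (config ?V)" by (simp add: measurable_noise)
  note P' = pairing_insert[OF P]
  let ?T = "\<lambda>V E. correlation_measure \<gamma> half_line V E" and ?X = "\<lambda>V E. correlation_measure \<Lambda> lborel V E"
  let ?T2 = "?T {1, 2 :: nat} {(1, 2)}" and ?X2 = "?X {1, 2 :: nat} {(1, 2)}"
  interpret ST: sigma_finite_measure "?T V E" by (rule T.sigma_finite_correlation[OF P(1)])
  interpret SX: sigma_finite_measure "?X V E" by (rule X.sigma_finite_correlation[OF P(1)])
  interpret SX': sigma_finite_measure "?X ?V ?E" by (rule X.sigma_finite_correlation[OF P'])
  interpret T2: sigma_finite_measure ?T2 by (rule T.sigma_finite_correlation[OF pairing_12])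
  interpret X2: sigma_finite_measure ?X2 by (rule X.sigma_finite_correlation[OF pairing_12])
  interpret N2: sigma_finite_measure noise12 by (rule sigma_finite_noise[OF pairing_12])
  interpret XT2: pair_sigma_finite "?X V E" ?T2 ..
  note [measurable_cong] = T.sets_correlation_measure X.sets_correlation_measure
  have F: "(\<lambda>p. f (join a b p)) \<in> borel_measurable (config V \<Otimes>\<^sub>M config {1, 2})"
    by (rule measurable_compose[OF join_measurable f])
  have [measurable]: "f \<in> borel_measurable ((\<Pi>\<^sub>M v\<in>?V. half_line) \<Otimes>\<^sub>M ?X ?V ?E)"
    using f by (simp cong: measurable_cong_sets sets_pair_measure_cong add: X.sets_correlation_measure)
  have [measurable]: "(\<lambda>p. f (join a b p)) \<in> borel_measurable ((?T V E \<Otimes>\<^sub>M ?X V E) \<Otimes>\<^sub>M (?T2 \<Otimes>\<^sub>M ?X2))"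
  proof -
    have "sets ((?T V E \<Otimes>\<^sub>M ?X V E) \<Otimes>\<^sub>M (?T2 \<Otimes>\<^sub>M ?X2)) = sets (config V \<Otimes>\<^sub>M config {1, 2})"
      by (intro sets_pair_measure_cong T.sets_correlation_measure X.sets_correlation_measure)
    from measurable_cong_sets[OF this refl] F show ?thesis by blast
  qed
  have F': "(\<lambda>p. f (join a b p)) \<in> borel_measurable (\<nu> V E \<Otimes>\<^sub>M noise12)"
    using F by (simp only: measurable_cong_sets[OF sets_pair_measure_cong[OF sets_noise sets_noise] refl])
  have "(\<integral>\<^sup>+z. f z \<partial>\<nu> ?V ?E) = (\<integral>\<^sup>+\<tau>. \<integral>\<^sup>+\<xi>. f (\<tau>, \<xi>) \<partial>?X ?V ?E \<partial>?T ?V ?E)"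
    by (rule nn_integral_noise[OF P' f])
  also have "\<dots> = (\<integral>\<^sup>+\<tau>. \<integral>\<^sup>+\<tau>'. \<integral>\<^sup>+\<xi>. f (\<tau>(b := \<tau>' 2, a := \<tau>' 1), \<xi>) \<partial>?X ?V ?E \<partial>?T2 \<partial>?T V E)"
    by (rule T.nn_integral_correlation_insert'[OF P]) measurable
  also have "\<dots> = (\<integral>\<^sup>+\<tau>. \<integral>\<^sup>+\<tau>'. \<integral>\<^sup>+\<xi>. \<integral>\<^sup>+\<xi>'. f (join a b ((\<tau>, \<xi>), (\<tau>', \<xi>'))) \<partial>?X2 \<partial>?X V E \<partial>?T2 \<partial>?T V E)"
  proof (intro nn_integral_cong)
    fix \<tau> \<tau>' assume "\<tau> \<in> space (?T V E)" "\<tau>' \<in> space ?T2"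
    then have *: "\<tau>(b := \<tau>' 2, a := \<tau>' 1) \<in> space (\<Pi>\<^sub>M v\<in>?V. half_line)"
      by (auto simp: T.space_correlation_measure space_PiM PiE_def extensional_def Pi_def)
    show "(\<integral>\<^sup>+\<xi>. f (\<tau>(b := \<tau>' 2, a := \<tau>' 1), \<xi>) \<partial>?X ?V ?E) =
      (\<integral>\<^sup>+\<xi>. \<integral>\<^sup>+\<xi>'. f (join a b ((\<tau>, \<xi>), (\<tau>', \<xi>'))) \<partial>?X2 \<partial>?X V E)"
      unfolding join_def prod.case
      by (rule X.nn_integral_correlation_insert'[OF P]) (rule measurable_compose[OF measurable_Pair1'[OF *] f])
  qed
  \<comment> \<open>The one exchange: the new time variables against the old space
    variables.\<close>
  also have "\<dots> = (\<integral>\<^sup>+\<tau>. \<integral>\<^sup>+\<xi>. \<integral>\<^sup>+\<tau>'. \<integral>\<^sup>+\<xi>'. f (join a b ((\<tau>, \<xi>), (\<tau>', \<xi>'))) \<partial>?X2 \<partial>?T2 \<partial>?X V E \<partial>?T V E)"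
    by (intro nn_integral_cong XT2.Fubini') measurable
  also have "\<dots> = (\<integral>\<^sup>+\<tau>. \<integral>\<^sup>+\<xi>. \<integral>\<^sup>+w. f (join a b ((\<tau>, \<xi>), w)) \<partial>noise12 \<partial>?X V E \<partial>?T V E)"
    unfolding noise_measure_def by (intro nn_integral_cong X2.nn_integral_fst) measurable
  also have "\<dots> = (\<integral>\<^sup>+z. \<integral>\<^sup>+w. f (join a b (z, w)) \<partial>noise12 \<partial>\<nu> V E)"
  proof (rule nn_integral_noise[OF P(1), symmetric])
    have "(\<lambda>p. f (join a b p)) \<in> borel_measurable (config V \<Otimes>\<^sub>M noise12)"
      using F by (simp only: measurable_cong_sets[OF sets_pair_measure_cong[OF refl sets_noise] refl])
    then show "(\<lambda>z. \<integral>\<^sup>+w. f (join a b (z, w)) \<partial>noise12) \<in> borel_measurable (config V)"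
      by (intro N2.borel_measurable_nn_integral) (simp add: split_def)
  qed
  also have "\<dots> = (\<integral>\<^sup>+p. f (join a b p) \<partial>(\<nu> V E \<Otimes>\<^sub>M noise12))"
    by (rule N2.nn_integral_fst[OF F'])
  also have "\<dots> = (\<integral>\<^sup>+z. f z \<partial>distr (\<nu> V E \<Otimes>\<^sub>M noise12) (config ?V) (join a b))"
    using f join_measurable
    by (intro nn_integral_distr[symmetric]) (simp_all add: measurable_cong_sets[OF sets_pair_measure_cong[OF sets_noise sets_noise] refl])
  finally show "(\<integral>\<^sup>+z. f z \<partial>\<nu> ?V ?E) =
    (\<integral>\<^sup>+z. f z \<partial>distr (\<nu> V E \<Otimes>\<^sub>M noise12) (config ?V) (join a b))" .
qed

lemma emeasure_noise_empty:
  "emeasure (\<nu> {} {}) (space (\<nu> {} {})) = 1"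
proof -
  have "(\<integral>\<^sup>+z. 1 \<partial>\<nu> {} {}) = 1"
    by (subst nn_integral_noise[OF pairing_empty])
      (simp_all only: measurable_const space_borel UNIV_I nn_integral_const T.emeasure_correlation_empty X.emeasure_correlation_empty mult_1)
  then show ?thesis by (simp only: nn_integral_const mult_1)
qed

lemma noise_relabel:
  assumes P: "pairing V E" and \<pi>: "bij_betw \<pi> V V'"
  shows "distr (\<nu> V' (map_prod \<pi> \<pi> ` E)) (config V)
      (\<lambda>(\<tau>, \<xi>). (\<lambda>v\<in>V. \<tau> (\<pi> v), \<lambda>v\<in>V. \<xi> (\<pi> v))) = \<nu> V E"
proof -
  have V': "\<pi> ` V \<subseteq> V'" using \<pi> by (auto simp: bij_betw_def)
  have 1: "(\<lambda>z. \<lambda>v\<in>V. z (\<pi> v)) \<in> correlation_measure \<gamma> half_line V' (map_prod \<pi> \<pi> ` E) \<rightarrow>\<^sub>M (\<Pi>\<^sub>M v\<in>V. half_line)"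
    using measurable_relabel[OF V'] by (simp only: measurable_cong_sets[OF T.sets_correlation_measure refl])
  have 2: "(\<lambda>z. \<lambda>v\<in>V. z (\<pi> v)) \<in> correlation_measure \<Lambda> lborel V' (map_prod \<pi> \<pi> ` E) \<rightarrow>\<^sub>M (\<Pi>\<^sub>M v\<in>V. lborel)"
    using measurable_relabel[OF V'] by (simp only: measurable_cong_sets[OF X.sets_correlation_measure refl])
  have 3: "sigma_finite_measure (distr (correlation_measure \<Lambda> lborel V' (map_prod \<pi> \<pi> ` E)) (\<Pi>\<^sub>M v\<in>V. lborel) (\<lambda>z. \<lambda>v\<in>V. z (\<pi> v)))"
    unfolding X.correlation_measure_relabel[OF P \<pi>] by (rule X.sigma_finite_correlation[OF P])
  from pair_measure_distr[OF 1 2 3] show ?thesis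
    unfolding X.correlation_measure_relabel[OF P \<pi>] T.correlation_measure_relabel[OF P \<pi>]
    by (simp add: noise_measure_def)
qed

lemma vertex_measurable:
  assumes "v \<in> V" "(\<lambda>(s, y). \<psi> s y) \<in> half_line \<Otimes>\<^sub>M lborel \<rightarrow>\<^sub>M N"
  shows "(\<lambda>z. \<psi> (fst z v) (snd z v)) \<in> config V \<rightarrow>\<^sub>M N"
proof -
  have "(\<lambda>z. (fst z v, snd z v)) \<in> config V \<rightarrow>\<^sub>M half_line \<Otimes>\<^sub>M lborel"
    using assms(1) by (intro measurable_Pair measurable_compose[OF measurable_fst measurable_component_singleton]
      measurable_compose[OF measurable_snd measurable_component_singleton])
  from measurable_compose[OF this assms(2)] show ?thesis by simp
qed

lemma prod_join:
  assumes P: "pairing V E" "a \<notin> V" "b \<notin> V" "a \<noteq> b"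
  shows "(\<Prod>v\<in>insert a (insert b V). f v (fst (join a b (z, w)) v) (snd (join a b (z, w)) v)) =
    (\<Prod>v\<in>V. f v (fst z v) (snd z v)) * (f a (fst w 1) (snd w 1) * f b (fst w 2) (snd w 2))"
proof -
  have "(\<Prod>v\<in>V. f v (fst (join a b (z, w)) v) (snd (join a b (z, w)) v)) = (\<Prod>v\<in>V. f v (fst z v) (snd z v))"
    using P by (intro prod.cong refl) (auto simp: join_def split_def)
  then show ?thesis using P pairing_finite[OF P(1)]
    by (simp add: mult_ac) (simp add: join_def split_def mult_ac)
qed

text \<open>The measure is a product over the edges, and a product over the vertices splits
  accordingly. For test functions this turns a diagram integral into a product of inner products,
  one for each edge.\<close>

lemma integral_noise_prod:
  fixes \<psi> :: "'v \<Rightarrow> real \<Rightarrow> real ^ 'd \<Rightarrow> real"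
  assumes "pairing V E" and \<psi>: "\<And>v. (\<lambda>(s, y). \<psi> v s y) \<in> borel_measurable (half_line \<Otimes>\<^sub>M lborel)"
    and int: "\<And>a b. integrable noise12 (\<lambda>w. \<psi> a (fst w 1) (snd w 1) * \<psi> b (fst w 2) (snd w 2))"
  shows "integrable (\<nu> V E) (\<lambda>z. \<Prod>v\<in>V. \<psi> v (fst z v) (snd z v)) \<and>
    (\<integral>z. (\<Prod>v\<in>V. \<psi> v (fst z v) (snd z v)) \<partial>\<nu> V E) =
    (\<Prod>(a, b)\<in>E. \<integral>w. \<psi> a (fst w 1) (snd w 1) * \<psi> b (fst w 2) (snd w 2) \<partial>noise12)"
  using assms(1)
proof (induction rule: pairing_induct)
  case empty
  interpret N: prob_space "\<nu> {} {}" by (rule prob_spaceI) (rule emeasure_noise_empty)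
  show ?case by (simp add: N.prob_space)
next
  case (insert V E a b)
  note P = insert(1-4)
  interpret N: sigma_finite_measure "\<nu> V E" by (rule sigma_finite_noise[OF P(1)])
  interpret N2: sigma_finite_measure noise12 by (rule sigma_finite_noise[OF pairing_12])
  interpret NN: pair_sigma_finite "\<nu> V E" noise12 ..
  let ?f = "\<lambda>V z. \<Prod>v\<in>V. \<psi> v (fst z v) (snd z v)" and ?V = "insert a (insert b V)"
  let ?g = "\<lambda>w. \<psi> a (fst w 1) (snd w 1) * \<psi> b (fst w 2) (snd w 2)"
  have m: "?f V \<in> borel_measurable (config V)" for V :: "'v set"
    using \<psi> by (intro borel_measurable_prod vertex_measurable)
  have jm: "join a b \<in> \<nu> V E \<Otimes>\<^sub>M noise12 \<rightarrow>\<^sub>M config ?V"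
    using join_measurable by (simp only: measurable_cong_sets[OF sets_pair_measure_cong[OF sets_noise sets_noise] refl])
  have fj: "?f ?V (join a b (z, w)) = ?f V z * ?g w" for z w by (rule prod_join[OF P])
  have iV: "integrable (\<nu> V E) (?f V)" and
    IH: "(\<integral>z. ?f V z \<partial>\<nu> V E) = (\<Prod>(a, b)\<in>E. \<integral>w. \<psi> a (fst w 1) (snd w 1) * \<psi> b (fst w 2) (snd w 2) \<partial>noise12)"
    using insert.IH by blast+
  have int2: "integrable (\<nu> V E \<Otimes>\<^sub>M noise12) (\<lambda>p. ?f ?V (join a b p))"
  proof (rule NN.Fubini_integrable[OF measurable_compose[OF jm m]])
    show "integrable (\<nu> V E) (\<lambda>z. \<integral>w. norm (?f ?V (join a b (z, w))) \<partial>noise12)"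
      unfolding fj norm_mult[of "?f V _"] integral_mult_right_zero
      using iV by (intro integrable_mult_left integrable_norm)
    show "AE z in \<nu> V E. integrable noise12 (\<lambda>w. ?f ?V (join a b (z, w)))"
      unfolding fj using int by (intro AE_I2 integrable_mult_right)
  qed
  have "integrable (\<nu> ?V (insert (a, b) E)) (?f ?V)"
    unfolding noise_insert[OF P] integrable_distr_eq[OF jm m] by (rule int2)
  moreover have "(\<integral>z. ?f ?V z \<partial>\<nu> ?V (insert (a, b) E)) =
    (\<integral>p. ?f ?V (join a b p) \<partial>(\<nu> V E \<Otimes>\<^sub>M noise12))"
    unfolding noise_insert[OF P] by (rule integral_distr[OF jm m])
  moreover have "\<dots> = (\<integral>z. \<integral>w. ?f ?V (join a b (z, w)) \<partial>noise12 \<partial>\<nu> V E)"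
    by (rule NN.integral_fst'[OF int2, symmetric])
  moreover have "\<dots> = (\<integral>z. ?f V z \<partial>\<nu> V E) * (\<integral>w. ?g w \<partial>noise12)"
    unfolding fj integral_mult_right_zero integral_mult_left_zero ..
  ultimately show ?case
    using pairing_finite[OF P(1)] pairing_new_edge[OF P(1,2)] IH by (simp add: mult.commute)
qed

end

section \<open>The Cauchy--Schwarz inequality along a diagram\<close>

text \<open>A square root on [0, \<infinity>]: with it the Cauchy--Schwarz inequality can be
  iterated for nonnegative measurable functions without discussing finiteness at every step.\<close>

definition esqrt :: "ennreal \<Rightarrow> ennreal" where
  "esqrt x = (if x = \<top> then \<top> else ennreal (sqrt (enn2real x)))"

lemma esqrt_square [simp]: "(esqrt x)\<^sup>2 = x"
  by (cases x) (auto simp: esqrt_def ennreal_power ennreal_top_eq_mult_iff power2_eq_square ennreal_mult[symmetric])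

lemma esqrt_measurable [measurable]: "esqrt \<in> borel_measurable borel"
  unfolding esqrt_def by measurable

lemma ennreal_square_le_imp_le:
  fixes a b :: ennreal
  assumes "a\<^sup>2 \<le> b\<^sup>2"
  shows "a \<le> b"
proof (cases b)
  case (real r)
  show ?thesis
  proof (cases a)
    case (real s)
    with \<open>b = ennreal r\<close> \<open>0 \<le> r\<close> assms have "s\<^sup>2 \<le> r\<^sup>2" by (simp add: ennreal_power)
    then have "s \<le> r" using \<open>0 \<le> r\<close> by (rule power2_le_imp_le)
    then show ?thesis using real \<open>b = ennreal r\<close> by (simp add: ennreal_leI)
  next
    case top
    then show ?thesis using assms real by (simp add: ennreal_power power2_eq_square ennreal_top_mult ennreal_mult[symmetric] top_unique)
  qed
qed simp

lemma esqrt_of_square [simp]: "esqrt (x\<^sup>2) = x"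
  by (rule antisym; rule ennreal_square_le_imp_le) simp_all

lemma esqrt_mono: "x \<le> y \<Longrightarrow> esqrt x \<le> esqrt y"
  by (rule ennreal_square_le_imp_le) simp

lemma esqrt_mult: "esqrt (x * y) = esqrt x * esqrt y"
  by (rule antisym; rule ennreal_square_le_imp_le) (simp_all add: power_mult_distrib)

lemma esqrt_eq_top_iff [simp]: "esqrt x = \<top> \<longleftrightarrow> x = \<top>"
  by (simp add: esqrt_def)

lemma nn_integral_mult_le_esqrt:
  assumes "f \<in> borel_measurable M" "g \<in> borel_measurable M"
  shows "(\<integral>\<^sup>+x. f x * g x \<partial>M) \<le> esqrt (\<integral>\<^sup>+x. (f x)\<^sup>2 \<partial>M) * esqrt (\<integral>\<^sup>+x. (g x)\<^sup>2 \<partial>M)"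
  by (rule ennreal_square_le_imp_le) (simp add: power_mult_distrib Cauchy_Schwarz_nn_integral[OF assms])

text \<open>Each coordinate is shared by exactly two factors, so integrating it out by the
  Cauchy--Schwarz inequality replaces both by their \<open>L\<^sup>2\<close> norms in that coordinate.\<close>

lemma nn_integral_PiM_Cauchy_Schwarz:
  fixes a :: "'k \<Rightarrow> ('e \<Rightarrow> 'w) \<Rightarrow> ennreal"
  assumes \<mu>: "sigma_finite_measure \<mu>" and "finite E" "finite R"
    and "\<And>k. k \<in> R \<Longrightarrow> S k \<subseteq> E" "\<And>e. e \<in> E \<Longrightarrow> card {k \<in> R. e \<in> S k} = 2"
    and "\<And>k. k \<in> R \<Longrightarrow> a k \<in> borel_measurable (\<Pi>\<^sub>M e\<in>S k. \<mu>)"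
  shows "(\<integral>\<^sup>+w. (\<Prod>k\<in>R. a k (restrict w (S k))) \<partial>(\<Pi>\<^sub>M e\<in>E. \<mu>)) \<le>
    (\<Prod>k\<in>R. esqrt (\<integral>\<^sup>+w. (a k w)\<^sup>2 \<partial>(\<Pi>\<^sub>M e\<in>S k. \<mu>)))"
  using assms(2,4-)
proof (induction E arbitrary: S a rule: finite_induct)
  case empty
  interpret \<mu>: sigma_finite_measure \<mu> by fact
  interpret P: product_sigma_finite "\<lambda>_ :: 'e. \<mu>" by standard
  have S: "S k = {}" if "k \<in> R" for k using empty that by blast
  have eq: "(\<Prod>k\<in>R. a k (restrict w (S k))) = (\<Prod>k\<in>R. esqrt (\<integral>\<^sup>+w. (a k w)\<^sup>2 \<partial>(\<Pi>\<^sub>M e\<in>S k. \<mu>)))" for w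
    by (intro prod.cong refl) (simp add: S P.nn_integral_empty restrict_def)
  show ?case by (subst P.nn_integral_empty) (simp_all only: eq order_refl zero_le)
next
  case (insert e E)
  interpret \<mu>: sigma_finite_measure \<mu> by fact
  interpret P: product_sigma_finite "\<lambda>_ :: 'e. \<mu>" by standard
  define S' where "S' k = S k - {e}" for k
  \<comment> \<open>A factor that depends on the coordinate \<open>e\<close> is replaced by its L2
    norm in that coordinate, the others are kept. The L2 norm of each factor over all its
    coordinates stays the same.\<close>
  define a' where "a' k w = (if e \<in> S k then esqrt (\<integral>\<^sup>+y. (a k (w(e := y)))\<^sup>2 \<partial>\<mu>) else a k w)" for k w
  have fin: "finite (S k)" if "k \<in> R" for k using insert(1) insert.prems(1)[OF that] by (meson finite.insertI finite_subset)
  have ins: "insert e (S' k) = S k" if "e \<in> S k" for k using that by (auto simp: S'_def)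
  have S'E: "S' k \<subseteq> E" if "k \<in> R" for k using insert.prems(1)[OF that] by (auto simp: S'_def)
  have S'S: "S' k = S k" if "e \<notin> S k" for k using that by (auto simp: S'_def)
  have am: "(\<lambda>(w, y). a k (w(e := y))) \<in> borel_measurable ((\<Pi>\<^sub>M e\<in>S' k. \<mu>) \<Otimes>\<^sub>M \<mu>)" if "k \<in> R" "e \<in> S k" for k
  proof -
    have "(\<lambda>(w, y). w(e := y)) \<in> (\<Pi>\<^sub>M e\<in>S' k. \<mu>) \<Otimes>\<^sub>M \<mu> \<rightarrow>\<^sub>M (\<Pi>\<^sub>M e\<in>insert e (S' k). \<mu>)"
      by (rule measurable_add_dim)
    from measurable_compose[OF this[unfolded ins[OF that(2)]] insert.prems(3)[OF that(1)]]
    show ?thesis unfolding split_def .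
  qed
  have a'm: "a' k \<in> borel_measurable (\<Pi>\<^sub>M e\<in>S' k. \<mu>)" if "k \<in> R" for k
  proof (cases "e \<in> S k")
    case True
    from am[OF that True] have "(\<lambda>(w, y). (a k (w(e := y)))\<^sup>2) \<in> borel_measurable ((\<Pi>\<^sub>M e\<in>S' k. \<mu>) \<Otimes>\<^sub>M \<mu>)"
      by (simp add: split_def)
    then have "(\<lambda>w. \<integral>\<^sup>+y. (a k (w(e := y)))\<^sup>2 \<partial>\<mu>) \<in> borel_measurable (\<Pi>\<^sub>M e\<in>S' k. \<mu>)"
      by (rule \<mu>.borel_measurable_nn_integral)
    then show ?thesis using True by (simp add: a'_def[abs_def])
  next
    case False
    then show ?thesis using insert.prems(3)[OF that] by (simp add: a'_def[abs_def] S'S)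
  qed
  have a'2: "(\<integral>\<^sup>+w. (a' k w)\<^sup>2 \<partial>(\<Pi>\<^sub>M e\<in>S' k. \<mu>)) = (\<integral>\<^sup>+w. (a k w)\<^sup>2 \<partial>(\<Pi>\<^sub>M e\<in>S k. \<mu>))" if "k \<in> R" for k
  proof (cases "e \<in> S k")
    case True
    have m: "(\<lambda>w. (a k w)\<^sup>2) \<in> borel_measurable (\<Pi>\<^sub>M e\<in>insert e (S' k). \<mu>)"
      using insert.prems(3)[OF that] unfolding ins[OF True] by measurable
    have "(\<integral>\<^sup>+w. (a k w)\<^sup>2 \<partial>(\<Pi>\<^sub>M e\<in>insert e (S' k). \<mu>)) = (\<integral>\<^sup>+w. \<integral>\<^sup>+y. (a k (w(e := y)))\<^sup>2 \<partial>\<mu> \<partial>(\<Pi>\<^sub>M e\<in>S' k. \<mu>))"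
      using fin[OF that] m by (intro P.product_nn_integral_insert) (auto simp: S'_def)
    then show ?thesis using True ins[OF True] by (simp add: a'_def)
  next
    case False
    then show ?thesis by (simp add: a'_def S'S)
  qed
  have "card {k \<in> R. e \<in> S k} = 2" using insert.prems(2) by simp
  then obtain k1 k2 where k12: "{k \<in> R. e \<in> S k} = {k1, k2}" "k1 \<noteq> k2" by (auto simp: card_2_iff)
  then have k: "k1 \<in> R" "e \<in> S k1" "k2 \<in> R" "e \<in> S k2" and other: "\<And>k. k \<in> R - {k1, k2} \<Longrightarrow> e \<notin> S k" by auto
  have r1: "restrict (w(e := y)) (S k) = (restrict w (S' k))(e := y)" if "e \<in> S k" for w y k
    using that by (auto simp: S'_def fun_eq_iff)
  have r2: "restrict (w(e := y)) (S k) = restrict w (S' k)" if "e \<notin> S k" for w y k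
    using that by (auto simp: S'_def fun_eq_iff)
  have split: "(\<Prod>k\<in>R. f k) = f k1 * f k2 * (\<Prod>k\<in>R - {k1, k2}. f k)" for f :: "'k \<Rightarrow> ennreal"
  proof -
    have "R = insert k1 (insert k2 (R - {k1, k2}))" using k by blast
    then have "prod f R = prod f (insert k1 (insert k2 (R - {k1, k2})))" by simp
    then show ?thesis using k12(2) assms(3) by (simp add: mult.assoc)
  qed
  have m: "(\<lambda>w. \<Prod>k\<in>R. a k (restrict w (S k))) \<in> borel_measurable (\<Pi>\<^sub>M e\<in>insert e E. \<mu>)"
  proof (rule borel_measurable_prod_ennreal)
    fix k assume k: "k \<in> R"
    show "(\<lambda>w. a k (restrict w (S k))) \<in> borel_measurable (\<Pi>\<^sub>M e\<in>insert e E. \<mu>)"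
      by (rule measurable_compose[OF measurable_restrict_subset[OF insert.prems(1)[OF k]] insert.prems(3)[OF k]])
  qed
  have "(\<integral>\<^sup>+w. (\<Prod>k\<in>R. a k (restrict w (S k))) \<partial>(\<Pi>\<^sub>M e\<in>insert e E. \<mu>)) =
    (\<integral>\<^sup>+w. \<integral>\<^sup>+y. (\<Prod>k\<in>R. a k (restrict (w(e := y)) (S k))) \<partial>\<mu> \<partial>(\<Pi>\<^sub>M e\<in>E. \<mu>))"
    using insert(1,2) m by (rule P.product_nn_integral_insert)
  also have "\<dots> \<le> (\<integral>\<^sup>+w. (\<Prod>k\<in>R. a' k (restrict w (S' k))) \<partial>(\<Pi>\<^sub>M e\<in>E. \<mu>))"
  proof (rule nn_integral_mono)
    fix w assume w: "w \<in> space (\<Pi>\<^sub>M e\<in>E. \<mu>)"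
    let ?w = "\<lambda>k. restrict w (S' k)"
    \<comment> \<open>All factors but \<open>k1\<close> and \<open>k2\<close> do not depend on the
      coordinate \<open>e\<close>, so their product \<open>?c\<close> comes out of the integral over
      it.\<close>
    let ?c = "\<Prod>k\<in>R - {k1, k2}. a k (?w k)"
    have [measurable]: "(\<lambda>y. a k ((?w k)(e := y))) \<in> borel_measurable \<mu>" if "k \<in> R" "e \<in> S k" for k
    proof -
      have "?w k \<in> space (\<Pi>\<^sub>M e\<in>S' k. \<mu>)" using w S'E[OF that(1)] by (auto simp: space_PiM)
      from measurable_compose[OF measurable_Pair1'[OF this] am[OF that]] show ?thesis by simp
    qed
    have "(\<integral>\<^sup>+y. (\<Prod>k\<in>R. a k (restrict (w(e := y)) (S k))) \<partial>\<mu>) =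
      (\<integral>\<^sup>+y. a k1 ((?w k1)(e := y)) * a k2 ((?w k2)(e := y)) * ?c \<partial>\<mu>)"
      unfolding split by (intro nn_integral_cong arg_cong2[where f="(*)"] prod.cong) (simp_all add: r1 r2 k other S'S)
    also have "\<dots> = (\<integral>\<^sup>+y. a k1 ((?w k1)(e := y)) * a k2 ((?w k2)(e := y)) \<partial>\<mu>) * ?c"
      using k by (intro nn_integral_multc) measurable
    also have "\<dots> \<le> a' k1 (?w k1) * a' k2 (?w k2) * ?c"
      using k by (intro mult_right_mono) (simp_all add: a'_def nn_integral_mult_le_esqrt)
    also have "\<dots> = (\<Prod>k\<in>R. a' k (?w k))"
      unfolding split by (intro arg_cong2[where f="(*)"] prod.cong) (simp_all add: other a'_def)
    finally show "(\<integral>\<^sup>+y. (\<Prod>k\<in>R. a k (restrict (w(e := y)) (S k))) \<partial>\<mu>) \<le> (\<Prod>k\<in>R. a' k (?w k))" .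
  qed
  also have "\<dots> \<le> (\<Prod>k\<in>R. esqrt (\<integral>\<^sup>+w. (a' k w)\<^sup>2 \<partial>(\<Pi>\<^sub>M e\<in>S' k. \<mu>)))"
  proof (rule insert.IH[OF S'E _ a'm])
    fix e' assume e': "e' \<in> E"
    then have "{k \<in> R. e' \<in> S' k} = {k \<in> R. e' \<in> S k}" using insert(2) by (auto simp: S'_def)
    then show "card {k \<in> R. e' \<in> S' k} = 2" using insert.prems(2) e' by simp
  qed
  also have "\<dots> = (\<Prod>k\<in>R. esqrt (\<integral>\<^sup>+w. (a k w)\<^sup>2 \<partial>(\<Pi>\<^sub>M e\<in>S k. \<mu>)))"
    by (intro prod.cong refl) (simp add: a'2)
  finally show ?case .
qed

lemma nn_integral_PiM_bij:
  assumes "sigma_finite_measure B" "bij_betw \<pi> I K" "finite I" "g \<in> borel_measurable (\<Pi>\<^sub>M i\<in>I. B)"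
  shows "(\<integral>\<^sup>+w. g (\<lambda>i\<in>I. w (\<pi> i)) \<partial>(\<Pi>\<^sub>M k\<in>K. B)) = (\<integral>\<^sup>+z. g z \<partial>(\<Pi>\<^sub>M i\<in>I. B))"
proof -
  have m: "(\<lambda>w. \<lambda>i\<in>I. w (\<pi> i)) \<in> (\<Pi>\<^sub>M k\<in>K. B) \<rightarrow>\<^sub>M (\<Pi>\<^sub>M i\<in>I. B)"
    using assms(2) by (intro measurable_relabel) (simp add: bij_betw_def)
  have "(\<integral>\<^sup>+w. g (\<lambda>i\<in>I. w (\<pi> i)) \<partial>(\<Pi>\<^sub>M k\<in>K. B)) =
    (\<integral>\<^sup>+z. g z \<partial>distr (\<Pi>\<^sub>M k\<in>K. B) (\<Pi>\<^sub>M i\<in>I. B) (\<lambda>w. \<lambda>i\<in>I. w (\<pi> i)))"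
    using assms(4) by (intro nn_integral_distr[OF m, symmetric]) simp
  then show ?thesis by (simp only: distr_PiM_bij[OF assms(1-3)])
qed

text \<open>The rows are disjoint blocks of coordinates, so Tonelli's theorem factorizes the
  integral; the induction splits off one block at a time.\<close>

lemma nn_integral_PiM_Sigma:
  fixes h :: "'k \<Rightarrow> ('i \<Rightarrow> 'a) \<Rightarrow> ennreal"
  assumes B: "sigma_finite_measure B" and "finite R" and I: "\<And>k. finite (I k)"
    and h: "\<And>k. k \<in> R \<Longrightarrow> h k \<in> borel_measurable (\<Pi>\<^sub>M i\<in>I k. B)"
  shows "(\<integral>\<^sup>+z. (\<Prod>k\<in>R. h k (\<lambda>i\<in>I k. z (k, i))) \<partial>(\<Pi>\<^sub>M v\<in>Sigma R I. B)) = (\<Prod>k\<in>R. \<integral>\<^sup>+z. h k z \<partial>(\<Pi>\<^sub>M i\<in>I k. B))"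
  using assms(2,4)
proof (induction R rule: finite_induct)
  case empty
  interpret B: sigma_finite_measure B by fact
  interpret P: product_sigma_finite "\<lambda>_ :: 'k \<times> 'i. B" by standard
  show ?case by (subst Sigma_empty1, subst P.nn_integral_empty) simp_all
next
  case (insert k R)
  interpret B: sigma_finite_measure B by fact
  interpret P: product_sigma_finite "\<lambda>_ :: 'k \<times> 'i. B" by standard
  let ?g = "\<lambda>R z. \<Prod>k\<in>R. h k (\<lambda>i\<in>I k. z (k, i))" and ?K = "Pair k ` I k"
  have row: "(\<lambda>z. \<lambda>i\<in>I j. z (j, i)) \<in> (\<Pi>\<^sub>M v\<in>V. B) \<rightarrow>\<^sub>M (\<Pi>\<^sub>M i\<in>I j. B)" if "Pair j ` I j \<subseteq> V" for j V
    using measurable_relabel[OF that] .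
  have gm: "?g R' \<in> borel_measurable (\<Pi>\<^sub>M v\<in>Sigma R' I. B)" if "R' \<subseteq> insert k R" for R'
    using insert.prems that by (intro borel_measurable_prod_ennreal measurable_compose[OF row]) auto
  have km: "(\<lambda>y. h k (\<lambda>i\<in>I k. y (k, i))) \<in> borel_measurable (\<Pi>\<^sub>M v\<in>?K. B)"
    using insert.prems by (intro measurable_compose[OF row]) auto
  have eq: "Sigma R I \<union> ?K = Sigma (insert k R) I" by auto
  have "(\<integral>\<^sup>+z. ?g (insert k R) z \<partial>(\<Pi>\<^sub>M v\<in>Sigma R I \<union> ?K. B)) =
    (\<integral>\<^sup>+x. \<integral>\<^sup>+y. ?g (insert k R) (merge (Sigma R I) ?K (x, y)) \<partial>(\<Pi>\<^sub>M v\<in>?K. B) \<partial>(\<Pi>\<^sub>M v\<in>Sigma R I. B))"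
    using insert(1,2) I gm[of "insert k R"] eq by (intro P.product_nn_integral_fold) auto
  also have "\<dots> = (\<integral>\<^sup>+x. \<integral>\<^sup>+y. h k (\<lambda>i\<in>I k. y (k, i)) * ?g R x \<partial>(\<Pi>\<^sub>M v\<in>?K. B) \<partial>(\<Pi>\<^sub>M v\<in>Sigma R I. B))"
  proof (intro nn_integral_cong)
    fix x y :: "'k \<times> 'i \<Rightarrow> 'a"
    let ?m = "merge (Sigma R I) ?K (x, y)"
    have 1: "(\<lambda>i\<in>I k. ?m (k, i)) = (\<lambda>i\<in>I k. y (k, i))"
      using insert(2) by (intro restrict_ext) (auto simp: merge_def)
    have 2: "(\<lambda>i\<in>I j. ?m (j, i)) = (\<lambda>i\<in>I j. x (j, i))" if "j \<in> R" for j
      using that by (intro restrict_ext) (auto simp: merge_def)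
    show "?g (insert k R) ?m = h k (\<lambda>i\<in>I k. y (k, i)) * ?g R x"
      using insert(1,2) by (simp add: 1 2 cong: prod.cong)
  qed
  also have "\<dots> = (\<integral>\<^sup>+y. h k (\<lambda>i\<in>I k. y (k, i)) \<partial>(\<Pi>\<^sub>M v\<in>?K. B)) * (\<integral>\<^sup>+x. ?g R x \<partial>(\<Pi>\<^sub>M v\<in>Sigma R I. B))"
    using km gm[of R] by (simp add: nn_integral_multc nn_integral_cmult subset_insertI)
  also have "(\<integral>\<^sup>+y. h k (\<lambda>i\<in>I k. y (k, i)) \<partial>(\<Pi>\<^sub>M v\<in>?K. B)) = (\<integral>\<^sup>+z. h k z \<partial>(\<Pi>\<^sub>M i\<in>I k. B))"
  proof -
    have "bij_betw (Pair k) (I k) ?K" by (auto simp: bij_betw_def inj_on_def)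
    from nn_integral_PiM_bij[OF B this I] show ?thesis using insert.prems by simp
  qed
  finally show ?case using insert eq by simp
qed

text \<open>A matching between rows with the orientation of the edges forgotten. Since the ends of
  an edge lie in different rows, it meets exactly two rows, once each, and this count is what the
  Cauchy--Schwarz inequality over edge variables uses.\<close>

locale row_pairing =
  fixes R :: "'k set" and I :: "'k \<Rightarrow> 'i set" and D :: "(('k \<times> 'i) \<times> ('k \<times> 'i)) set"
  assumes finite_R: "finite R" and finite_I: "\<And>k. finite (I k)"
    and pairing: "pairing (Sigma R I) D"
    and distinct_rows: "\<And>a b. (a, b) \<in> D \<Longrightarrow> fst a \<noteq> fst b"
begin

abbreviation row_edge :: "'k \<Rightarrow> 'i \<Rightarrow> ('k \<times> 'i) \<times> ('k \<times> 'i)" where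
  "row_edge k i \<equiv> edge_at D (k, i)"

lemma row_edge_in: "k \<in> R \<Longrightarrow> i \<in> I k \<Longrightarrow> row_edge k i \<in> D"
  using edge_at_in(1)[OF pairing] by simp

text \<open>Two distinct vertices of one row on a common edge would be its two ends, which lie in
  different rows. So a row reads a family of distinct edge variables.\<close>

lemma row_edge_bij:
  assumes "k \<in> R"
  shows "bij_betw (row_edge k) (I k) (row_edge k ` I k)"
proof (rule inj_on_imp_bij_betw, rule inj_onI)
  fix i j assume ij: "i \<in> I k" "j \<in> I k" "row_edge k i = row_edge k j"
  note i = edge_at_in[OF pairing, of "(k, i)"] and j = edge_at_in(2)[OF pairing, of "(k, j)"]
  obtain x y where xy: "row_edge k i = (x, y)" by (cases "row_edge k i") auto
  have xy': "row_edge k j = (x, y)" using ij(3) xy by simp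
  have "fst x \<noteq> fst y" using i(1) ij assms xy distinct_rows[of x y] by simp
  moreover have "(k, i) = x \<or> (k, i) = y" "(k, j) = x \<or> (k, j) = y"
    using i(2)[unfolded xy] j[unfolded xy'] ij(1,2) assms by simp_all
  ultimately show "i = j" by auto
qed

lemma row_Cauchy_Schwarz:
  assumes \<mu>: "sigma_finite_measure \<mu>"
    and b: "\<And>k. k \<in> R \<Longrightarrow> b k \<in> borel_measurable (\<Pi>\<^sub>M i\<in>I k. \<mu>)"
  shows "(\<integral>\<^sup>+w. (\<Prod>k\<in>R. b k (\<lambda>i\<in>I k. w (row_edge k i))) \<partial>(\<Pi>\<^sub>M e\<in>D. \<mu>)) \<le>
    (\<Prod>k\<in>R. esqrt (\<integral>\<^sup>+w. (b k w)\<^sup>2 \<partial>(\<Pi>\<^sub>M i\<in>I k. \<mu>)))"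
proof -
  let ?S = "\<lambda>k. row_edge k ` I k" and ?a = "\<lambda>k w. b k (\<lambda>i\<in>I k. w (row_edge k i))"
  have fin: "finite D" using pairing_finite[OF pairing] by simp
  have row: "(\<lambda>w. \<lambda>i\<in>I k. w (row_edge k i)) \<in> (\<Pi>\<^sub>M e\<in>?S k. \<mu>) \<rightarrow>\<^sub>M (\<Pi>\<^sub>M i\<in>I k. \<mu>)" for k
    by (rule measurable_relabel) simp
  have am: "?a k \<in> borel_measurable (\<Pi>\<^sub>M e\<in>?S k. \<mu>)" if "k \<in> R" for k
    by (rule measurable_compose[OF row b[OF that]])
  have a2: "(\<integral>\<^sup>+w. (?a k w)\<^sup>2 \<partial>(\<Pi>\<^sub>M e\<in>?S k. \<mu>)) = (\<integral>\<^sup>+w. (b k w)\<^sup>2 \<partial>(\<Pi>\<^sub>M i\<in>I k. \<mu>))" if "k \<in> R" for k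
    using b[OF that] by (intro nn_integral_PiM_bij[OF \<mu> row_edge_bij[OF that] finite_I]) simp
  \<comment> \<open>An edge belongs to the rows of its two end points and to no other row.\<close>
  have card: "card {k \<in> R. e \<in> ?S k} = 2" if "e \<in> D" for e
  proof -
    obtain x y where e: "e = (x, y)" by (cases e)
    have xy: "x \<in> Sigma R I" "y \<in> Sigma R I" using pairing_edge[OF pairing] that e by blast+
    have "edge_at D x = e" "edge_at D y = e" using edge_at_eq[OF pairing that] e by simp_all
    then have "e = row_edge (fst x) (snd x)" "e = row_edge (fst y) (snd y)" by simp_all
    moreover have "fst x \<in> R" "snd x \<in> I (fst x)" "fst y \<in> R" "snd y \<in> I (fst y)"
      using xy by (cases x; cases y; simp)+
    ultimately have "fst x \<in> {k \<in> R. e \<in> ?S k}" "fst y \<in> {k \<in> R. e \<in> ?S k}" by blast+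
    moreover have "k = fst x \<or> k = fst y" if "k \<in> R" "i \<in> I k" "e = row_edge k i" for k i
      using edge_at_in(2)[OF pairing, of "(k, i)"] that(1,2) unfolding that(3)[symmetric] e by auto
    ultimately have "{k \<in> R. e \<in> ?S k} = {fst x, fst y}" by blast
    then show ?thesis using distinct_rows[of x y] that e by simp
  qed
  have "(\<integral>\<^sup>+w. (\<Prod>k\<in>R. ?a k w) \<partial>(\<Pi>\<^sub>M e\<in>D. \<mu>)) = (\<integral>\<^sup>+w. (\<Prod>k\<in>R. ?a k (restrict w (?S k))) \<partial>(\<Pi>\<^sub>M e\<in>D. \<mu>))"
    by (intro nn_integral_cong prod.cong refl arg_cong[where f="b _"] restrict_ext) auto
  also have "\<dots> \<le> (\<Prod>k\<in>R. esqrt (\<integral>\<^sup>+w. (?a k w)\<^sup>2 \<partial>(\<Pi>\<^sub>M e\<in>?S k. \<mu>)))"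
    using row_edge_in by (intro nn_integral_PiM_Cauchy_Schwarz[OF \<mu> fin finite_R _ card am]) auto
  also have "\<dots> = (\<Prod>k\<in>R. esqrt (\<integral>\<^sup>+w. (b k w)\<^sup>2 \<partial>(\<Pi>\<^sub>M i\<in>I k. \<mu>)))"
    by (intro prod.cong refl arg_cong[where f=esqrt] a2)
  finally show ?thesis .
qed

end

text \<open>A correlation is compared with a superposition of products: \<open>\<kappa>(x - y)\<close> with
  \<open>\<integral> \<theta>(x, w) \<theta>(y, w) \<mu>(dw)\<close>, and the delta with the point evaluation.\<close>

datatype ('a, 'w) feature = Weight "'a \<Rightarrow> 'w \<Rightarrow> ennreal" | Point "'w \<Rightarrow> 'a"

text \<open>The comparison is two-sided because one direction serves the diagram and the other the
  norms of the rows. It is required almost everywhere only: the size of a correlation is prescribed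
  off the origin, or off the coordinate hyperplanes.\<close>

locale feature = correlation_base \<kappa> B
  for \<kappa> :: "'a::euclidean_space correlation" and B :: "'a measure" +
  fixes \<mu> :: "'w measure" and Q :: "('a, 'w) feature" and C :: ennreal
  assumes sigma_finite_\<mu>: "sigma_finite_measure \<mu>"
    and C: "1 \<le> C" "C \<noteq> \<top>"
    and weight_measurable: "\<And>\<theta>. Q = Weight \<theta> \<Longrightarrow> (\<lambda>(x, w). \<theta> x w) \<in> borel_measurable (B \<Otimes>\<^sub>M \<mu>)"
    and weight_kernel: "\<And>\<theta>. Q = Weight \<theta> \<Longrightarrow> \<exists>k. \<kappa> = Kernel k \<and> (\<forall>y\<in>space B. AE x in B.
          ennreal (k (x - y)) \<le> C * (\<integral>\<^sup>+w. \<theta> x w * \<theta> y w \<partial>\<mu>) \<and> (\<integral>\<^sup>+w. \<theta> x w * \<theta> y w \<partial>\<mu>) \<le> C * ennreal (k (x - y)))"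
    and point: "\<And>\<pi>. Q = Point \<pi> \<Longrightarrow> \<kappa> = Delta \<and> \<pi> \<in> \<mu> \<rightarrow>\<^sub>M B \<and> distr \<mu> B \<pi> = B"
begin

sublocale M: sigma_finite_measure \<mu> by (rule sigma_finite_\<mu>)
sublocale PM: product_sigma_finite "\<lambda>_. \<mu>" by standard

abbreviation \<M> :: "'e set \<Rightarrow> ('e \<Rightarrow> 'w) measure" where
  "\<M> E \<equiv> \<Pi>\<^sub>M e\<in>E. \<mu>"

text \<open>The function of one row seen in the auxiliary variables. For nonnegative functions the
  inner product becomes, up to constants, the L2 product of the transforms, so this acts as a square
  root of the covariance in each variable.\<close>

definition transform :: "'i set \<Rightarrow> (('i \<Rightarrow> 'a) \<Rightarrow> ennreal) \<Rightarrow> ('i \<Rightarrow> 'w) \<Rightarrow> ennreal" where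
  "transform I g \<omega> = (case Q of
      Weight \<theta> \<Rightarrow> \<integral>\<^sup>+z. g z * (\<Prod>i\<in>I. \<theta> (z i) (\<omega> i)) \<partial>(\<Pi>\<^sub>M i\<in>I. B)
    | Point \<pi> \<Rightarrow> g (\<lambda>i\<in>I. \<pi> (\<omega> i)))"

lemma transform_Weight:
  "Q = Weight \<theta> \<Longrightarrow> transform I g \<omega> = (\<integral>\<^sup>+z. g z * (\<Prod>i\<in>I. \<theta> (z i) (\<omega> i)) \<partial>(\<Pi>\<^sub>M i\<in>I. B))"
  unfolding transform_def by simp

lemma transform_Point: "Q = Point \<pi> \<Longrightarrow> transform I g \<omega> = g (\<lambda>i\<in>I. \<pi> (\<omega> i))"
  unfolding transform_def by simp

lemma weight_measurable':
  assumes "Q = Weight \<theta>" "f \<in> N \<rightarrow>\<^sub>M B" "g \<in> N \<rightarrow>\<^sub>M \<mu>"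
  shows "(\<lambda>x. \<theta> (f x) (g x)) \<in> borel_measurable N"
  using measurable_compose[OF measurable_Pair[OF assms(2,3)] weight_measurable[OF assms(1)]] by simp

text \<open>The parameter \<open>y\<close> stands for variables that are not transformed: space is
  treated with the time variables fixed, and time with the auxiliary variables of space
  fixed.\<close>

lemma transform_measurable:
  assumes f: "f \<in> borel_measurable (N \<Otimes>\<^sub>M (\<Pi>\<^sub>M i\<in>I. B))" and fin: "finite I"
  shows "(\<lambda>(y, \<omega>). transform I (\<lambda>z. f (y, z)) \<omega>) \<in> borel_measurable (N \<Otimes>\<^sub>M (\<Pi>\<^sub>M i\<in>I. \<mu>))"
proof (cases Q)
  case (Weight \<theta>)
  interpret S: sigma_finite_measure "\<Pi>\<^sub>M i\<in>I. B" by (rule PB.sigma_finite[OF fin])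
  let ?N = "(N \<Otimes>\<^sub>M (\<Pi>\<^sub>M i\<in>I. \<mu>)) \<Otimes>\<^sub>M (\<Pi>\<^sub>M i\<in>I. B)"
  have 1: "(\<lambda>p. f (fst (fst p), snd p)) \<in> borel_measurable ?N"
    by (rule measurable_compose[OF _ f]) simp
  have 2: "(\<lambda>p. \<Prod>i\<in>I. \<theta> (snd p i) (snd (fst p) i)) \<in> borel_measurable ?N"
  proof (rule borel_measurable_prod_ennreal, rule weight_measurable'[OF Weight])
    fix i assume i: "i \<in> I"
    show "(\<lambda>p. snd p i) \<in> ?N \<rightarrow>\<^sub>M B" using i by simp
    show "(\<lambda>p. snd (fst p) i) \<in> ?N \<rightarrow>\<^sub>M \<mu>"
      using i by (intro measurable_compose[OF measurable_compose[OF measurable_fst measurable_snd] measurable_component_singleton])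
  qed
  have "(\<lambda>q. \<integral>\<^sup>+z. f (fst q, z) * (\<Prod>i\<in>I. \<theta> (z i) (snd q i)) \<partial>(\<Pi>\<^sub>M i\<in>I. B)) \<in> borel_measurable (N \<Otimes>\<^sub>M (\<Pi>\<^sub>M i\<in>I. \<mu>))"
    using borel_measurable_times_ennreal[OF 1 2] by (intro S.borel_measurable_nn_integral) (simp only: split_def)
  then show ?thesis by (simp only: split_def transform_Weight[OF Weight])
next
  case (Point \<pi>)
  then have \<pi>: "\<pi> \<in> \<mu> \<rightarrow>\<^sub>M B" using point by blast
  have "(\<lambda>q. (fst q, \<lambda>i\<in>I. \<pi> (snd q i))) \<in> N \<Otimes>\<^sub>M (\<Pi>\<^sub>M i\<in>I. \<mu>) \<rightarrow>\<^sub>M N \<Otimes>\<^sub>M (\<Pi>\<^sub>M i\<in>I. B)"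
    by (intro measurable_Pair measurable_restrict measurable_compose[OF _ \<pi>] measurable_fst
        measurable_compose[OF measurable_snd measurable_component_singleton])
  from measurable_compose[OF this f] show ?thesis by (simp only: split_def transform_Point[OF Point])
qed

text \<open>For one edge the exceptional set is null in the variable at \<open>a\<close> when all
  others are fixed, hence null by Tonelli's theorem; there are finitely many edges.\<close>

lemma AE_edges:
  assumes P: "pairing V E" and Q: "Q = Weight \<theta>" and \<kappa>: "\<kappa> = Kernel k"
  shows "AE z in (\<B> V). \<forall>(a, b)\<in>E.
    ennreal (k (z a - z b)) \<le> C * (\<integral>\<^sup>+w. \<theta> (z a) w * \<theta> (z b) w \<partial>\<mu>) \<and>
    (\<integral>\<^sup>+w. \<theta> (z a) w * \<theta> (z b) w \<partial>\<mu>) \<le> C * ennreal (k (z a - z b))"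
proof -
  let ?K = "\<lambda>x y. \<integral>\<^sup>+w. \<theta> x w * \<theta> y w \<partial>\<mu>"
  let ?P = "\<lambda>x y. ennreal (k (x - y)) \<le> C * ?K x y \<and> ?K x y \<le> C * ennreal (k (x - y))"
  have [measurable]: "k \<in> borel_measurable borel" using kernel_measurable[OF \<kappa>] .
  have idB [measurable]: "(\<lambda>x. x) \<in> B \<rightarrow>\<^sub>M borel" by (rule id_B)
  have "(\<lambda>q. \<theta> (fst (fst q)) (snd q)) \<in> borel_measurable ((B \<Otimes>\<^sub>M B) \<Otimes>\<^sub>M \<mu>)"
    "(\<lambda>q. \<theta> (snd (fst q)) (snd q)) \<in> borel_measurable ((B \<Otimes>\<^sub>M B) \<Otimes>\<^sub>M \<mu>)"
    by (rule weight_measurable'[OF Q]; measurable)+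
  from borel_measurable_times_ennreal[OF this]
  have [measurable]: "(\<lambda>p. ?K (fst p) (snd p)) \<in> borel_measurable (B \<Otimes>\<^sub>M B)"
    by (intro M.borel_measurable_nn_integral) (simp only: split_def)
  have [measurable]: "(\<lambda>p. ennreal (k (fst p - snd p))) \<in> borel_measurable (B \<Otimes>\<^sub>M B)" by measurable
  have Pm: "Measurable.pred (B \<Otimes>\<^sub>M B) (\<lambda>p. ?P (fst p) (snd p))" by measurable
  have ae: "AE x in B. ?P x y" if "y \<in> space B" for y
    using weight_kernel[OF Q] \<kappa> that by auto
  have one: "AE z in (\<B> V). ?P (z a) (z b)" if ab: "(a, b) \<in> E" for a b
  proof -
    let ?V = "V - {a}"
    have V: "insert a ?V = V" and b: "b \<in> ?V" and fin: "finite ?V"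
      using pairing_edge[OF P ab] pairing_finite[OF P] by auto
    have pr: "(\<lambda>z. (z a, z b)) \<in> (\<B> V) \<rightarrow>\<^sub>M B \<Otimes>\<^sub>M B"
      using pairing_edge[OF P ab] by (intro measurable_Pair measurable_component_singleton) auto
    have Pz: "Measurable.pred (\<B> V) (\<lambda>z. ?P (z a) (z b))"
      using measurable_compose[OF pr Pm] by simp
    then have m: "{z \<in> space (\<B> V). \<not> ?P (z a) (z b)} \<in> sets (\<B> V)" by measurable
    let ?A = "{z \<in> space (\<B> V). \<not> ?P (z a) (z b)}"
    have "emeasure (\<B> V) ?A = (\<integral>\<^sup>+z. indicator ?A z \<partial>(\<Pi>\<^sub>M v\<in>insert a ?V. B))"
      unfolding V by (rule nn_integral_indicator[OF m, symmetric])
    also have "\<dots> = (\<integral>\<^sup>+z. \<integral>\<^sup>+y. indicator ?A (z(a := y)) \<partial>B \<partial>(\<Pi>\<^sub>M v\<in>?V. B))"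
      using fin m V by (intro PB.product_nn_integral_insert) (auto intro!: borel_measurable_indicator)
    also have "\<dots> = (\<integral>\<^sup>+z. 0 \<partial>(\<Pi>\<^sub>M v\<in>?V. B))"
    proof (rule nn_integral_cong)
      fix z assume z: "z \<in> space (\<Pi>\<^sub>M v\<in>?V. B)"
      then have zb: "z b \<in> space B" using b by (auto simp: space_PiM)
      have ba: "b \<noteq> a" using b by auto
      have "AE y in B. indicator ?A (z(a := y)) = (0 :: ennreal)"
        using ae[OF zb] by eventually_elim (simp add: indicator_def ba)
      then have "(\<integral>\<^sup>+y. indicator ?A (z(a := y)) \<partial>B) = (\<integral>\<^sup>+y. 0 \<partial>B)" by (rule nn_integral_cong_AE)
      then show "(\<integral>\<^sup>+y. indicator ?A (z(a := y)) \<partial>B) = 0" by simp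
    qed
    finally have "emeasure (\<B> V) ?A = 0" by simp
    with m show ?thesis by (subst AE_iff_measurable[OF m refl])
  qed
  have "AE z in (\<B> V). \<forall>e\<in>E. ?P (z (fst e)) (z (snd e))"
    using pairing_finite[OF P] one by (intro AE_finite_allI) auto
  then show ?thesis by (simp only: split_def)
qed

end

lemma prod_le_power_mult:
  fixes f g :: "'e \<Rightarrow> ennreal"
  assumes "finite E" "\<And>e. e \<in> E \<Longrightarrow> f e \<le> C * g e"
  shows "(\<Prod>e\<in>E. f e) \<le> C ^ card E * (\<Prod>e\<in>E. g e)"
proof -
  have "(\<Prod>e\<in>E. f e) \<le> (\<Prod>e\<in>E. C * g e)"
    using assms by (induction rule: finite_induct) (auto intro!: mult_mono)
  also have "\<dots> = C ^ card E * (\<Prod>e\<in>E. g e)" by (simp add: prod.distrib)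
  finally show ?thesis .
qed

locale feature_rows = feature \<kappa> B \<mu> Q C + row_pairing R I D
  for \<kappa> :: "'a::euclidean_space correlation" and B \<mu> and Q :: "('a, 'w) feature" and C
    and R :: "'k set" and I :: "'k \<Rightarrow> 'i set" and D
begin

abbreviation row :: "'k \<Rightarrow> ('k \<times> 'i \<Rightarrow> 'x) \<Rightarrow> 'i \<Rightarrow> 'x" where
  "row k z \<equiv> (\<lambda>i\<in>I k. z (k, i))"

abbreviation edge_row :: "'k \<Rightarrow> (('k \<times> 'i) \<times> ('k \<times> 'i) \<Rightarrow> 'x) \<Rightarrow> 'i \<Rightarrow> 'x" where
  "edge_row k w \<equiv> (\<lambda>i\<in>I k. w (row_edge k i))"

lemma row_measurable: "k \<in> R \<Longrightarrow> row k \<in> (\<Pi>\<^sub>M v\<in>Sigma R I. N) \<rightarrow>\<^sub>M (\<Pi>\<^sub>M i\<in>I k. N)"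
  by (rule measurable_relabel) auto

lemma rows_measurable:
  assumes "\<And>k. k \<in> R \<Longrightarrow> g k \<in> borel_measurable (\<Pi>\<^sub>M i\<in>I k. N)"
  shows "(\<lambda>z. \<Prod>k\<in>R. (g k (row k z) :: ennreal)) \<in> borel_measurable (\<Pi>\<^sub>M v\<in>Sigma R I. N)"
proof (rule borel_measurable_prod_ennreal)
  fix k assume k: "k \<in> R"
  show "(\<lambda>z. g k (row k z)) \<in> borel_measurable (\<Pi>\<^sub>M v\<in>Sigma R I. N)"
    by (rule measurable_compose[OF row_measurable[OF k] assms[OF k]])
qed

text \<open>Each correlation factor is an integral over one auxiliary variable attached to its edge.
  After exchanging the integrals the original variables are integrated first, and with the auxiliary
  variables fixed nothing links the rows any more.\<close>

lemma nn_integral_rows_Weight: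
  assumes Q: "Q = Weight \<theta>" and g: "\<And>k. k \<in> R \<Longrightarrow> g k \<in> borel_measurable (\<Pi>\<^sub>M i\<in>I k. B)"
  shows "(\<integral>\<^sup>+z. (\<Prod>(a, b)\<in>D. \<integral>\<^sup>+w. \<theta> (z a) w * \<theta> (z b) w \<partial>\<mu>) * (\<Prod>k\<in>R. g k (row k z)) \<partial>(\<Pi>\<^sub>M v\<in>Sigma R I. B)) =
    (\<integral>\<^sup>+w. (\<Prod>k\<in>R. transform (I k) (g k) (edge_row k w)) \<partial>(\<M> D))"
proof -
  let ?V = "Sigma R I" and ?g = "\<lambda>z. \<Prod>k\<in>R. g k (row k z)"
  note fin = pairing_finite[OF pairing]
  interpret SB: sigma_finite_measure "\<Pi>\<^sub>M v\<in>?V. B" using PB.sigma_finite fin by auto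
  interpret SM: sigma_finite_measure "\<Pi>\<^sub>M e\<in>D. \<mu>" using PM.sigma_finite fin by auto
  interpret S: pair_sigma_finite "\<Pi>\<^sub>M v\<in>?V. B" "\<Pi>\<^sub>M e\<in>D. \<mu>" ..
  let ?t = "\<lambda>z w. \<Prod>v\<in>?V. \<theta> (z v) (w (edge_at D v))"
  have tm: "(\<lambda>p. ?t (fst p) (snd p)) \<in> borel_measurable ((\<Pi>\<^sub>M v\<in>?V. B) \<Otimes>\<^sub>M (\<M> D))"
    by (intro borel_measurable_prod_ennreal weight_measurable'[OF Q]
        measurable_compose[OF measurable_fst measurable_component_singleton]
        measurable_compose[OF measurable_snd measurable_component_singleton] edge_at_in(1)[OF pairing])
  have gm: "?g \<in> borel_measurable (\<Pi>\<^sub>M v\<in>?V. B)" by (rule rows_measurable[OF g])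
  have tm1: "?t z \<in> borel_measurable (\<M> D)" if "z \<in> space (\<Pi>\<^sub>M v\<in>?V. B)" for z
    using measurable_compose[OF measurable_Pair1'[OF that] tm] by simp
  have K: "(\<Prod>(a, b)\<in>D. \<integral>\<^sup>+w. \<theta> (z a) w * \<theta> (z b) w \<partial>\<mu>) = (\<integral>\<^sup>+w. ?t z w \<partial>(\<M> D))"
    if z: "z \<in> space (\<Pi>\<^sub>M v\<in>?V. B)" for z
  proof -
    have m: "(\<lambda>w. \<theta> (z v) w) \<in> borel_measurable \<mu>" if "v \<in> ?V" for v
    proof -
      have "z v \<in> space B" using PiE_mem[OF z[unfolded space_PiM] that] .
      then show ?thesis by (intro weight_measurable'[OF Q]) simp_all
    qed
    have "(\<Prod>(a, b)\<in>D. \<integral>\<^sup>+w. \<theta> (z a) w * \<theta> (z b) w \<partial>\<mu>) = (\<Prod>e\<in>D. \<integral>\<^sup>+w. \<theta> (z (fst e)) w * \<theta> (z (snd e)) w \<partial>\<mu>)"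
      by (simp only: split_def)
    also have "\<dots> = (\<integral>\<^sup>+w. (\<Prod>e\<in>D. \<theta> (z (fst e)) (w e) * \<theta> (z (snd e)) (w e)) \<partial>(\<M> D))"
    proof (rule PM.product_nn_integral_prod[symmetric])
      fix e assume "e \<in> D"
      then have "fst e \<in> ?V" "snd e \<in> ?V" using pairing_edge[OF pairing, of "fst e" "snd e"] by simp_all
      then show "(\<lambda>w. \<theta> (z (fst e)) w * \<theta> (z (snd e)) w) \<in> borel_measurable \<mu>"
        by (intro borel_measurable_times_ennreal m)
    qed (use fin in simp)
    also have "\<dots> = (\<integral>\<^sup>+w. ?t z w \<partial>(\<M> D))"
      by (subst prod_vertices_edges[OF pairing, of "\<lambda>v e. \<theta> (z v) (_ e)"]) (simp only: split_def prod.collapse)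
    finally show ?thesis .
  qed
  have "(\<integral>\<^sup>+z. (\<Prod>(a, b)\<in>D. \<integral>\<^sup>+w. \<theta> (z a) w * \<theta> (z b) w \<partial>\<mu>) * ?g z \<partial>(\<Pi>\<^sub>M v\<in>?V. B)) =
    (\<integral>\<^sup>+z. \<integral>\<^sup>+w. ?t z w * ?g z \<partial>(\<M> D) \<partial>(\<Pi>\<^sub>M v\<in>?V. B))"
    by (intro nn_integral_cong) (simp add: K nn_integral_multc[OF tm1])
  also have "\<dots> = (\<integral>\<^sup>+w. \<integral>\<^sup>+z. ?t z w * ?g z \<partial>(\<Pi>\<^sub>M v\<in>?V. B) \<partial>(\<M> D))"
  proof (rule S.Fubini'[symmetric])
    show "(\<lambda>(z, w). ?t z w * ?g z) \<in> borel_measurable ((\<Pi>\<^sub>M v\<in>?V. B) \<Otimes>\<^sub>M (\<M> D))"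
      unfolding split_def by (intro borel_measurable_times_ennreal tm measurable_compose[OF measurable_fst gm])
  qed
  also have "\<dots> = (\<integral>\<^sup>+w. (\<Prod>k\<in>R. transform (I k) (g k) (edge_row k w)) \<partial>(\<M> D))"
  proof (rule nn_integral_cong)
    fix w assume w: "w \<in> space (\<M> D)"
    let ?h = "\<lambda>k z. g k z * (\<Prod>i\<in>I k. \<theta> (z i) (edge_row k w i))"
    have h: "?h k \<in> borel_measurable (\<Pi>\<^sub>M i\<in>I k. B)" if k: "k \<in> R" for k
    proof (intro borel_measurable_times_ennreal g[OF k] borel_measurable_prod_ennreal weight_measurable'[OF Q]
        measurable_component_singleton measurable_const)
      fix i assume i: "i \<in> I k"
      show "edge_row k w i \<in> space \<mu>" using w row_edge_in[OF k i] i by (simp add: space_PiM PiE_iff)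
    qed
    have eqz: "?t z w * ?g z = (\<Prod>k\<in>R. ?h k (row k z))" for z
    proof -
      have "?t z w = (\<Prod>k\<in>R. \<Prod>i\<in>I k. \<theta> (z (k, i)) (w (row_edge k i)))"
        using finite_R finite_I by (subst prod.Sigma) (auto simp: split_def)
      then show ?thesis by (simp add: prod.distrib mult.commute)
    qed
    have "(\<integral>\<^sup>+z. ?t z w * ?g z \<partial>(\<Pi>\<^sub>M v\<in>?V. B)) = (\<Prod>k\<in>R. \<integral>\<^sup>+z. ?h k z \<partial>(\<Pi>\<^sub>M i\<in>I k. B))"
      unfolding eqz by (rule nn_integral_PiM_Sigma[OF sigma_finite_B finite_R finite_I h])
    then show "(\<integral>\<^sup>+z. ?t z w * ?g z \<partial>(\<Pi>\<^sub>M v\<in>?V. B)) = (\<Prod>k\<in>R. transform (I k) (g k) (edge_row k w))"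
      by (simp only: transform_Weight[OF Q])
  qed
  finally show ?thesis .
qed

text \<open>For the delta the comparison is an equality: the auxiliary measure is transported to
  \<open>B\<close>, hence its power to the power of \<open>B\<close>, and both ends of an edge read
  the same auxiliary variable.\<close>

lemma nn_integral_rows_Point:
  assumes Q: "Q = Point \<pi>" and g: "\<And>k. k \<in> R \<Longrightarrow> g k \<in> borel_measurable (\<Pi>\<^sub>M i\<in>I k. B)"
  shows "(\<integral>\<^sup>+z. (\<Prod>k\<in>R. g k (row k z)) \<partial>\<C> (Sigma R I) D) =
    (\<integral>\<^sup>+w. (\<Prod>k\<in>R. transform (I k) (g k) (edge_row k w)) \<partial>(\<M> D))"
proof -
  have \<kappa>: "\<kappa> = Delta" and \<pi>: "\<pi> \<in> \<mu> \<rightarrow>\<^sub>M B" "distr \<mu> B \<pi> = B" using point[OF Q] by auto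
  note fin = pairing_finite[OF pairing]
  let ?V = "Sigma R I" and ?g = "\<lambda>z. \<Prod>k\<in>R. g k (row k z)"
  have gm: "?g \<in> borel_measurable (\<Pi>\<^sub>M v\<in>?V. B)" by (rule rows_measurable[OF g])
  let ?\<Pi> = "\<lambda>w. \<lambda>e\<in>D. \<pi> (w e)"
  have \<Pi>m: "?\<Pi> \<in> (\<M> D) \<rightarrow>\<^sub>M (\<Pi>\<^sub>M e\<in>D. B)"
    by (intro measurable_restrict measurable_compose[OF measurable_component_singleton[where M="\<lambda>_. \<mu>"] \<pi>(1)])
  have "distr (\<M> D) (\<Pi>\<^sub>M e\<in>D. B) ?\<Pi> = (\<Pi>\<^sub>M e\<in>D. B)"
  proof (rule PB.PiM_eqI)
    fix A assume A: "\<And>e. e \<in> D \<Longrightarrow> A e \<in> sets B"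
    interpret PMD: finite_product_sigma_finite "\<lambda>_. \<mu>" D by standard (use fin in simp)
    have "?\<Pi> -` Pi\<^sub>E D A \<inter> space (\<M> D) = (\<Pi>\<^sub>E e\<in>D. \<pi> -` A e \<inter> space \<mu>)"
      by (auto simp: space_PiM PiE_iff)
    then have "emeasure (distr (\<M> D) (\<Pi>\<^sub>M e\<in>D. B) ?\<Pi>) (Pi\<^sub>E D A) =
      emeasure (\<M> D) (\<Pi>\<^sub>E e\<in>D. \<pi> -` A e \<inter> space \<mu>)"
      using A fin by (subst emeasure_distr[OF \<Pi>m]) (auto intro!: sets_PiM_I_finite)
    also have "\<dots> = (\<Prod>e\<in>D. emeasure \<mu> (\<pi> -` A e \<inter> space \<mu>))"
      using A \<pi>(1) by (intro PMD.measure_times) (auto intro: measurable_sets)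
    also have "\<dots> = (\<Prod>e\<in>D. emeasure B (A e))"
      using A emeasure_distr[OF \<pi>(1)] \<pi>(2) by (intro prod.cong refl) metis
    finally show "emeasure (distr (\<M> D) (\<Pi>\<^sub>M e\<in>D. B) ?\<Pi>) (Pi\<^sub>E D A) = (\<Prod>e\<in>D. emeasure B (A e))" .
  qed (use fin in simp_all)
  then have "(\<integral>\<^sup>+z. ?g z \<partial>\<C> ?V D) =
    (\<integral>\<^sup>+w. ?g (\<lambda>v\<in>?V. w (edge_at D v)) \<partial>distr (\<M> D) (\<Pi>\<^sub>M e\<in>D. B) ?\<Pi>)"
    by (simp only: nn_integral_correlation_Delta[OF pairing \<kappa> gm])
  also have "\<dots> = (\<integral>\<^sup>+w. ?g (\<lambda>v\<in>?V. ?\<Pi> w (edge_at D v)) \<partial>(\<M> D))"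
    using measurable_compose[OF edge_map_measurable[OF pairing] gm] by (intro nn_integral_distr[OF \<Pi>m]) simp
  also have "\<dots> = (\<integral>\<^sup>+w. (\<Prod>k\<in>R. transform (I k) (g k) (edge_row k w)) \<partial>(\<M> D))"
  proof (intro nn_integral_cong prod.cong refl)
    fix w k assume k: "k \<in> R"
    have "row k (\<lambda>v\<in>?V. ?\<Pi> w (edge_at D v)) = (\<lambda>i\<in>I k. \<pi> (edge_row k w i))"
      by (rule restrict_ext) (simp add: k row_edge_in)
    then show "g k (row k (\<lambda>v\<in>?V. ?\<Pi> w (edge_at D v))) = transform (I k) (g k) (edge_row k w)"
      by (simp only: transform_Point[OF Q])
  qed
  finally show ?thesis .
qed

text \<open>The constant of the comparison is paid once for each edge.\<close>

lemma nn_integral_rows: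
  assumes g: "\<And>k. k \<in> R \<Longrightarrow> g k \<in> borel_measurable (\<Pi>\<^sub>M i\<in>I k. B)"
  shows "(\<integral>\<^sup>+z. (\<Prod>k\<in>R. g k (row k z)) \<partial>\<C> (Sigma R I) D) \<le>
      C ^ card D * (\<integral>\<^sup>+w. (\<Prod>k\<in>R. transform (I k) (g k) (edge_row k w)) \<partial>(\<M> D))"
    and "(\<integral>\<^sup>+w. (\<Prod>k\<in>R. transform (I k) (g k) (edge_row k w)) \<partial>(\<M> D)) \<le>
      C ^ card D * (\<integral>\<^sup>+z. (\<Prod>k\<in>R. g k (row k z)) \<partial>\<C> (Sigma R I) D)"
proof -
  let ?L = "\<integral>\<^sup>+z. (\<Prod>k\<in>R. g k (row k z)) \<partial>\<C> (Sigma R I) D"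
  let ?T = "\<integral>\<^sup>+w. (\<Prod>k\<in>R. transform (I k) (g k) (edge_row k w)) \<partial>(\<M> D)"
  have "?L \<le> C ^ card D * ?T \<and> ?T \<le> C ^ card D * ?L"
  proof (cases Q)
    case (Weight \<theta>)
    obtain k where \<kappa>: "\<kappa> = Kernel k" using weight_kernel[OF Weight] by blast
    let ?V = "Sigma R I" and ?g = "\<lambda>z. \<Prod>k\<in>R. g k (row k z)"
    let ?K = "\<lambda>z. \<Prod>(a, b)\<in>D. \<integral>\<^sup>+w. \<theta> (z a) w * \<theta> (z b) w \<partial>\<mu>" and ?k = "\<lambda>z. \<Prod>(a, b)\<in>D. ennreal (k (z a - z b))"
    have gm: "?g \<in> borel_measurable (\<Pi>\<^sub>M v\<in>?V. B)" by (rule rows_measurable[OF g])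
    have fin: "finite D" using pairing_finite[OF pairing] by simp
    note km = edge_density_measurable[OF pairing_subset[OF pairing] \<kappa>]
    have L: "?L = (\<integral>\<^sup>+z. ?k z * ?g z \<partial>(\<Pi>\<^sub>M v\<in>?V. B))"
      by (rule nn_integral_correlation_Kernel[OF pairing \<kappa> gm])
    have T: "?T = (\<integral>\<^sup>+z. ?K z * ?g z \<partial>(\<Pi>\<^sub>M v\<in>?V. B))"
      by (rule nn_integral_rows_Weight[OF Weight g, symmetric])
    have ae: "AE z in (\<Pi>\<^sub>M v\<in>?V. B). ?k z \<le> C ^ card D * ?K z \<and> ?K z \<le> C ^ card D * ?k z"
      using AE_edges[OF pairing Weight \<kappa>]
      by eventually_elim (intro conjI prod_le_power_mult[OF fin]; auto)
    have Km: "?K \<in> borel_measurable (\<Pi>\<^sub>M v\<in>?V. B)"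
    proof (rule borel_measurable_prod_ennreal)
      fix e assume e: "e \<in> D"
      then have v: "fst e \<in> ?V" "snd e \<in> ?V" using pairing_edge[OF pairing, of "fst e" "snd e"] by simp_all
      have "(\<lambda>p. \<theta> (fst p (fst e)) (snd p) * \<theta> (fst p (snd e)) (snd p)) \<in> borel_measurable ((\<Pi>\<^sub>M v\<in>?V. B) \<Otimes>\<^sub>M \<mu>)"
        by (intro borel_measurable_times_ennreal weight_measurable'[OF Weight] measurable_snd
            measurable_compose[OF measurable_fst measurable_component_singleton] v)
      then show "(\<lambda>z. case e of (a, b) \<Rightarrow> \<integral>\<^sup>+w. \<theta> (z a) w * \<theta> (z b) w \<partial>\<mu>) \<in> borel_measurable (\<Pi>\<^sub>M v\<in>?V. B)"
        unfolding split_def by (intro M.borel_measurable_nn_integral) (simp only: split_def)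
    qed
    have "(\<integral>\<^sup>+z. ?k z * ?g z \<partial>(\<Pi>\<^sub>M v\<in>?V. B)) \<le> (\<integral>\<^sup>+z. C ^ card D * (?K z * ?g z) \<partial>(\<Pi>\<^sub>M v\<in>?V. B))"
    proof (rule nn_integral_mono_AE)
      show "AE z in (\<Pi>\<^sub>M v\<in>?V. B). ?k z * ?g z \<le> C ^ card D * (?K z * ?g z)"
        using ae by eventually_elim (auto simp: mult.assoc[symmetric] intro: mult_right_mono)
    qed
    also have "\<dots> = C ^ card D * (\<integral>\<^sup>+z. ?K z * ?g z \<partial>(\<Pi>\<^sub>M v\<in>?V. B))"
      by (intro nn_integral_cmult borel_measurable_times_ennreal Km gm)
    finally have 1: "?L \<le> C ^ card D * ?T" unfolding L T .
    have "(\<integral>\<^sup>+z. ?K z * ?g z \<partial>(\<Pi>\<^sub>M v\<in>?V. B)) \<le> (\<integral>\<^sup>+z. C ^ card D * (?k z * ?g z) \<partial>(\<Pi>\<^sub>M v\<in>?V. B))"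
    proof (rule nn_integral_mono_AE)
      show "AE z in (\<Pi>\<^sub>M v\<in>?V. B). ?K z * ?g z \<le> C ^ card D * (?k z * ?g z)"
        using ae by eventually_elim (auto simp: mult.assoc[symmetric] intro: mult_right_mono)
    qed
    also have "\<dots> = C ^ card D * (\<integral>\<^sup>+z. ?k z * ?g z \<partial>(\<Pi>\<^sub>M v\<in>?V. B))"
      by (intro nn_integral_cmult borel_measurable_times_ennreal km gm)
    finally have "?T \<le> C ^ card D * ?L" unfolding L T .
    with 1 show ?thesis by blast
  next
    case (Point \<pi>)
    have "?L = ?T" by (rule nn_integral_rows_Point[OF Point g])
    moreover have "?T \<le> C ^ card D * ?T"
      using mult_right_mono[OF one_le_power[OF C(1)], of ?T "card D"] by simp
    ultimately show ?thesis by simp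
  qed
  then show "?L \<le> C ^ card D * ?T" "?T \<le> C ^ card D * ?L" by auto
qed

end

section \<open>Admissible diagrams as matchings between rows\<close>

lemma edge_at_straight:
  assumes "i \<in> {1..l}"
  shows "edge_at (straight_diagram l) (1, i) = ((1, i), (2, i))" "edge_at (straight_diagram l) (2, i) = ((1, i), (2, i))"
  using assms unfolding edge_at_def straight_diagram_def by (auto intro!: the_equality)

lemma pairing_diagram:
  assumes "D \<in> diagrams m n"
  shows "pairing (vertices m n) D"
proof (rule pairingI)
  show "finite (vertices m n)" by (simp add: vertices_def)
  have D: "\<forall>(a, b)\<in>D. a \<in> vertices m n \<and> b \<in> vertices m n \<and> fst a < fst b"
    "\<forall>v\<in>vertices m n. \<exists>!e. e \<in> D \<and> (v = fst e \<or> v = snd e)"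
    using assms unfolding diagrams_def by blast+
  show "a \<in> vertices m n \<and> b \<in> vertices m n \<and> a \<noteq> b" if "(a, b) \<in> D" for a b
    using D(1) that by fastforce
  show "\<exists>!e. e \<in> D \<and> (v = fst e \<or> v = snd e)" if "v \<in> vertices m n" for v
    by (rule bspec[OF D(2) that])
qed

lemma row_pairing_diagram:
  assumes "D \<in> diagrams m n"
  shows "row_pairing {1..m} (\<lambda>k. {1..n k}) D"
proof
  show "pairing (Sigma {1..m} (\<lambda>k. {1..n k})) D"
    using pairing_diagram[OF assms] by (simp only: vertices_def)
  have D: "\<forall>(a, b)\<in>D. a \<in> vertices m n \<and> b \<in> vertices m n \<and> fst a < fst b"
    using assms unfolding diagrams_def by blast
  show "fst a \<noteq> fst b" if "(a, b) \<in> D" for a b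
    using bspec[OF D that] by simp
qed simp_all

lemma straight_diagram_in: "straight_diagram l \<in> diagrams 2 (\<lambda>_. l)"
  unfolding diagrams_def
proof (intro CollectI conjI ballI)
  fix e assume "e \<in> straight_diagram l"
  then show "case e of (a, b) \<Rightarrow> a \<in> vertices 2 (\<lambda>_. l) \<and> b \<in> vertices 2 (\<lambda>_. l) \<and> fst a < fst b"
    by (auto simp: straight_diagram_def vertices_def)
next
  fix v :: "nat \<times> nat" assume v: "v \<in> vertices 2 (\<lambda>_. l)"
  obtain k i where ki: "v = (k, i)" by (cases v)
  then have k: "k = 1 \<or> k = 2" and i: "i \<in> {1..l}" using v by (auto simp: vertices_def)
  show "\<exists>!e. e \<in> straight_diagram l \<and> (v = fst e \<or> v = snd e)"
  proof (rule ex1I[of _ "((1, i), (2, i))"])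
    show "((1, i), (2, i)) \<in> straight_diagram l \<and> (v = fst ((1, i), (2, i)) \<or> v = snd ((1, i), (2, i)))"
      using k i ki by (auto simp: straight_diagram_def)
    fix e assume "e \<in> straight_diagram l \<and> (v = fst e \<or> v = snd e)"
    then show "e = ((1, i), (2, i))" using ki by (auto simp: straight_diagram_def)
  qed
qed

lemma finite_diagrams: "finite (diagrams m n)"
proof (rule finite_subset)
  show "diagrams m n \<subseteq> Pow (vertices m n \<times> vertices m n)"
    using pairing_subset[OF pairing_diagram] by blast
qed (simp add: vertices_def)

context noise
begin

definition row :: "(nat \<Rightarrow> nat) \<Rightarrow> nat \<Rightarrow> (nat \<times> nat, 'd) configuration \<Rightarrow>
    (nat, 'd) configuration" where
  "row n k z = (\<lambda>i\<in>{1..n k}. fst z (k, i), \<lambda>i\<in>{1..n k}. snd z (k, i))"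

lemma row_measurable: "k \<in> {1..m} \<Longrightarrow> row n k \<in> config (vertices m n) \<rightarrow>\<^sub>M config {1..n k}"
  unfolding row_def
  by (intro measurable_Pair measurable_compose[OF measurable_fst measurable_relabel]
      measurable_compose[OF measurable_snd measurable_relabel]) (auto simp: vertices_def)

text \<open>For nonnegative \<open>g\<close>, the squared norm in the tensor power, with the value
  \<infinity> allowed.\<close>

definition sq_norm :: "nat \<Rightarrow> ((nat, 'd) configuration \<Rightarrow> ennreal) \<Rightarrow> ennreal" where
  "sq_norm l g = (\<integral>\<^sup>+z. g (row (\<lambda>_. l) 1 z) * g (row (\<lambda>_. l) 2 z)
     \<partial>\<nu> (vertices 2 (\<lambda>_. l)) (straight_diagram l))"

end

text \<open>The auxiliary variables as row \<open>k\<close> sees them: each vertex reads the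
  variable of its edge, so every variable is read by two rows.\<close>

definition edge_config :: "(nat \<Rightarrow> nat) \<Rightarrow> ((nat \<times> nat) \<times> (nat \<times> nat)) set \<Rightarrow> nat \<Rightarrow>
    ((nat \<times> nat) \<times> (nat \<times> nat) \<Rightarrow> 'w) \<Rightarrow> nat \<Rightarrow> 'w" where
  "edge_config n D k w = (\<lambda>i\<in>{1..n k}. w (edge_at D (k, i)))"

lemma edge_config_measurable:
  assumes "D \<in> diagrams m n" "k \<in> {1..m}"
  shows "edge_config n D k \<in> (\<Pi>\<^sub>M e\<in>D. \<mu>) \<rightarrow>\<^sub>M (\<Pi>\<^sub>M i\<in>{1..n k}. \<mu>)"
proof -
  interpret row_pairing "{1..m}" "\<lambda>k. {1..n k}" D by (rule row_pairing_diagram[OF assms(1)])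
  show ?thesis unfolding edge_config_def[abs_def] using row_edge_in[OF assms(2)]
    by (intro measurable_relabel) auto
qed

lemma diagram_Cauchy_Schwarz:
  assumes D: "D \<in> diagrams m n" and \<mu>: "sigma_finite_measure \<mu>"
    and b: "\<And>k. k \<in> {1..m} \<Longrightarrow> b k \<in> borel_measurable (\<Pi>\<^sub>M i\<in>{1..n k}. \<mu>)"
  shows "(\<integral>\<^sup>+w. (\<Prod>k\<in>{1..m}. b k (edge_config n D k w)) \<partial>(\<Pi>\<^sub>M e\<in>D. \<mu>)) \<le>
    (\<Prod>k\<in>{1..m}. esqrt (\<integral>\<^sup>+w. (b k w)\<^sup>2 \<partial>(\<Pi>\<^sub>M i\<in>{1..n k}. \<mu>)))"
proof -
  interpret row_pairing "{1..m}" "\<lambda>k. {1..n k}" D by (rule row_pairing_diagram[OF D])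
  show ?thesis unfolding edge_config_def by (rule row_Cauchy_Schwarz[OF \<mu> b])
qed

locale noise_features = noise \<gamma> \<Lambda> + FT: feature \<gamma> half_line \<mu>1 Q1 C1 + FX: feature \<Lambda> lborel \<mu>2 Q2 C2
  for \<gamma> and \<Lambda> :: "(real ^ 'd) correlation" and \<mu>1 :: "'w1 measure" and Q1 C1 and \<mu>2 :: "'w2 measure" and Q2 C2
begin

definition partial_transform where
  "partial_transform l g = (\<lambda>(\<tau>, \<omega>2). FX.transform {1..l :: nat} (\<lambda>\<xi>. g (\<tau>, \<xi>)) \<omega>2)"

text \<open>Space is transformed before time, so the arguments are the auxiliary variables of space
  first and those of time second.\<close>

definition full_transform where
  "full_transform l g = (\<lambda>(\<omega>2, \<omega>1). FT.transform {1..l :: nat} (\<lambda>\<tau>. partial_transform l g (\<tau>, \<omega>2)) \<omega>1)"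

lemma partial_transform_measurable:
  assumes "g \<in> \<F> l"
  shows "partial_transform l g \<in> borel_measurable ((\<Pi>\<^sub>M i\<in>{1..l}. half_line) \<Otimes>\<^sub>M (\<Pi>\<^sub>M i\<in>{1..l}. \<mu>2))"
  unfolding partial_transform_def by (rule FX.transform_measurable[OF assms]) simp

lemma full_transform_measurable:
  assumes "g \<in> \<F> l"
  shows "full_transform l g \<in> borel_measurable ((\<Pi>\<^sub>M i\<in>{1..l}. \<mu>2) \<Otimes>\<^sub>M (\<Pi>\<^sub>M i\<in>{1..l}. \<mu>1))"
proof -
  have "(\<lambda>p. partial_transform l g (snd p, fst p)) \<in> borel_measurable ((\<Pi>\<^sub>M i\<in>{1..l}. \<mu>2) \<Otimes>\<^sub>M (\<Pi>\<^sub>M i\<in>{1..l}. half_line))"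
    by (rule measurable_compose[OF _ partial_transform_measurable[OF assms]]) (intro measurable_Pair measurable_snd measurable_fst)
  from FT.transform_measurable[OF this finite_atLeastAtMost] show ?thesis
    unfolding full_transform_def by simp
qed

definition feature_norm :: "nat \<Rightarrow> ((nat, 'd) configuration \<Rightarrow> ennreal) \<Rightarrow> ennreal" where
  "feature_norm l g = (\<integral>\<^sup>+\<omega>2. \<integral>\<^sup>+\<omega>1. (full_transform l g (\<omega>2, \<omega>1))\<^sup>2 \<partial>(\<Pi>\<^sub>M i\<in>{1..l}. \<mu>1) \<partial>(\<Pi>\<^sub>M i\<in>{1..l}. \<mu>2))"

text \<open>The comparison for a single correlation is used twice: for the space variables with time
  fixed, and for the time variables with the auxiliary variables of space fixed. Each edge costs
  \<open>C1 * C2\<close> in either direction.\<close>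

lemma diagram_two_sided:
  fixes n :: "nat \<Rightarrow> nat"
  assumes D: "D \<in> diagrams m n"
    and g: "\<And>k. k \<in> {1..m} \<Longrightarrow> g k \<in> \<F> (n k)"
  defines "L \<equiv> \<integral>\<^sup>+z. (\<Prod>k\<in>{1..m}. g k (row n k z)) \<partial>\<nu> (vertices m n) D"
    and "F \<equiv> \<integral>\<^sup>+w2. \<integral>\<^sup>+w1. (\<Prod>k\<in>{1..m}. full_transform (n k) (g k) (edge_config n D k w2, edge_config n D k w1)) \<partial>(\<Pi>\<^sub>M e\<in>D. \<mu>1) \<partial>(\<Pi>\<^sub>M e\<in>D. \<mu>2)"
  shows "L \<le> (C1 * C2) ^ card D * F" "F \<le> (C1 * C2) ^ card D * L"
proof -
  let ?V = "vertices m n" and ?K = "{1..m}" and ?T = "correlation_measure \<gamma> half_line (vertices m n) D"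
  let ?X = "correlation_measure \<Lambda> lborel (vertices m n) D" and ?r = "\<lambda>k z. \<lambda>i\<in>{1..n k}. z (k, i)"
  let ?P1 = "\<Pi>\<^sub>M e\<in>D. \<mu>1" and ?P2 = "\<Pi>\<^sub>M e\<in>D. \<mu>2" and ?N = "card D"
  note P = pairing_diagram[OF D]
  interpret RP: row_pairing ?K "\<lambda>k. {1..n k}" D by (rule row_pairing_diagram[OF D])
  interpret RT: feature_rows \<gamma> half_line \<mu>1 Q1 C1 ?K "\<lambda>k. {1..n k}" D ..
  interpret RX: feature_rows \<Lambda> lborel \<mu>2 Q2 C2 ?K "\<lambda>k. {1..n k}" D ..
  have V: "?V = Sigma ?K (\<lambda>k. {1..n k})" by (simp add: vertices_def)
  have fin: "finite D" using pairing_finite[OF P] by simp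
  interpret ST: sigma_finite_measure ?T by (rule T.sigma_finite_correlation[OF P])
  interpret S2: sigma_finite_measure ?P2 by (rule FX.PM.sigma_finite[OF fin])
  interpret S1: sigma_finite_measure ?P1 by (rule FT.PM.sigma_finite[OF fin])
  interpret ST2: pair_sigma_finite ?T ?P2 ..
  have rowm: "?r k \<in> (\<Pi>\<^sub>M v\<in>?V. N) \<rightarrow>\<^sub>M (\<Pi>\<^sub>M i\<in>{1..n k}. N)" if "k \<in> ?K" for k and N :: "real measure"
    unfolding V using that by (rule RT.row_measurable)
  note erm1 = edge_config_measurable[OF D, where \<mu>=\<mu>1] and erm2 = edge_config_measurable[OF D, where \<mu>=\<mu>2]
  have fm: "(\<lambda>z. \<Prod>k\<in>?K. g k (row n k z)) \<in> borel_measurable (config ?V)"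
  proof (rule borel_measurable_prod_ennreal)
    fix k assume k: "k \<in> ?K"
    show "(\<lambda>z. g k (row n k z)) \<in> borel_measurable (config ?V)"
      by (rule measurable_compose[OF row_measurable[OF k, of n] g[OF k]])
  qed
  \<comment> \<open>Half-way: the space variables have been replaced by auxiliary ones, the time
    variables not yet.\<close>
  define H where "H \<tau> = (\<integral>\<^sup>+w2. (\<Prod>k\<in>?K. partial_transform (n k) (g k) (?r k \<tau>, edge_config n D k w2)) \<partial>?P2)" for \<tau>
  let ?G = "\<lambda>\<tau>. \<integral>\<^sup>+\<xi>. (\<Prod>k\<in>?K. g k (?r k \<tau>, ?r k \<xi>)) \<partial>?X"
  have L: "L = (\<integral>\<^sup>+\<tau>. ?G \<tau> \<partial>?T)"
    unfolding L_def by (subst nn_integral_noise[OF P fm]) (simp add: row_def)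
  have pm: "(\<lambda>p. \<Prod>k\<in>?K. partial_transform (n k) (g k) (?r k (fst p), edge_config n D k (snd p))) \<in> borel_measurable ((\<Pi>\<^sub>M v\<in>?V. half_line) \<Otimes>\<^sub>M ?P2)"
    by (intro borel_measurable_prod_ennreal measurable_compose[OF _ partial_transform_measurable[OF g]] measurable_Pair
        measurable_compose[OF measurable_fst rowm] measurable_compose[OF measurable_snd erm2])
  have pm': "(\<lambda>(\<tau>, w2). \<Prod>k\<in>?K. partial_transform (n k) (g k) (?r k \<tau>, edge_config n D k w2)) \<in> borel_measurable (?T \<Otimes>\<^sub>M ?P2)"
    using pm by (simp only: split_def measurable_cong_sets[OF sets_pair_measure_cong[OF T.sets_correlation_measure refl] refl])
  have Hm: "H \<in> borel_measurable ?T"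
    unfolding H_def[abs_def] by (rule S2.borel_measurable_nn_integral[OF pm'])
  have GH: "?G \<tau> \<le> C2 ^ ?N * H \<tau>" "H \<tau> \<le> C2 ^ ?N * ?G \<tau>" if \<tau>: "\<tau> \<in> space (\<Pi>\<^sub>M v\<in>?V. half_line)" for \<tau>
  proof -
    have "(\<lambda>\<xi>. g k (?r k \<tau>, \<xi>)) \<in> borel_measurable (\<Pi>\<^sub>M i\<in>{1..n k}. lborel)" if "k \<in> ?K" for k
      by (rule measurable_compose[OF measurable_Pair1'[OF measurable_space[OF rowm[OF that] \<tau>]] g[OF that]])
    note RX.nn_integral_rows[OF this]
    then show "?G \<tau> \<le> C2 ^ ?N * H \<tau>" "H \<tau> \<le> C2 ^ ?N * ?G \<tau>"
      unfolding H_def V partial_transform_def edge_config_def by (simp_all only: prod.case)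
  qed
  have spT: "space ?T = space (\<Pi>\<^sub>M v\<in>?V. half_line)" by (rule T.space_correlation_measure)
  have Gm: "?G \<in> borel_measurable ?T"
  proof -
    interpret SX: sigma_finite_measure ?X by (rule X.sigma_finite_correlation[OF P])
    have "(\<lambda>z. \<Prod>k\<in>?K. g k (row n k z)) \<in> borel_measurable (\<nu> ?V D)"
      using fm by (simp only: measurable_noise)
    then show ?thesis unfolding noise_measure_def row_def
      by (intro SX.borel_measurable_nn_integral) (simp only: split_def)
  qed
  \<comment> \<open>The same integrand as in \<open>H\<close>, integrated over time first;
    \<open>A'\<close> results when the time variables are replaced as well.\<close>
  define A where "A w2 = (\<integral>\<^sup>+\<tau>. (\<Prod>k\<in>?K. partial_transform (n k) (g k) (?r k \<tau>, edge_config n D k w2)) \<partial>?T)" for w2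
  define A' where "A' w2 = (\<integral>\<^sup>+w1. (\<Prod>k\<in>?K. full_transform (n k) (g k) (edge_config n D k w2, edge_config n D k w1)) \<partial>?P1)" for w2
  have HA: "(\<integral>\<^sup>+\<tau>. H \<tau> \<partial>?T) = (\<integral>\<^sup>+w2. A w2 \<partial>?P2)"
    unfolding H_def A_def by (rule ST2.Fubini'[OF pm', symmetric])
  have Am: "A \<in> borel_measurable ?P2"
  proof -
    have "(\<lambda>p. \<Prod>k\<in>?K. partial_transform (n k) (g k) (?r k (snd p), edge_config n D k (fst p))) \<in> borel_measurable (?P2 \<Otimes>\<^sub>M ?T)"
      using measurable_compose[OF measurable_pair_swap' pm'] by (simp add: split_def)
    then show ?thesis unfolding A_def[abs_def] by (intro ST.borel_measurable_nn_integral) (simp only: split_def)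
  qed
  have A'm: "A' \<in> borel_measurable ?P2"
  proof -
    have "(\<lambda>p. \<Prod>k\<in>?K. full_transform (n k) (g k) (edge_config n D k (fst p), edge_config n D k (snd p))) \<in> borel_measurable (?P2 \<Otimes>\<^sub>M ?P1)"
      by (intro borel_measurable_prod_ennreal measurable_compose[OF _ full_transform_measurable[OF g]] measurable_Pair
        measurable_compose[OF measurable_fst erm2] measurable_compose[OF measurable_snd erm1])
    then show ?thesis unfolding A'_def[abs_def] by (intro S1.borel_measurable_nn_integral) (simp only: split_def)
  qed
  have AA': "A w2 \<le> C1 ^ ?N * A' w2" "A' w2 \<le> C1 ^ ?N * A w2" if w2: "w2 \<in> space ?P2" for w2
  proof -
    have "(\<lambda>\<tau>. partial_transform (n k) (g k) (\<tau>, edge_config n D k w2)) \<in> borel_measurable (\<Pi>\<^sub>M i\<in>{1..n k}. half_line)" if "k \<in> ?K" for k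
      by (rule measurable_compose[OF measurable_Pair2'[OF measurable_space[OF erm2[OF that] w2]] partial_transform_measurable[OF g[OF that]]])
    note RT.nn_integral_rows[OF this]
    then show "A w2 \<le> C1 ^ ?N * A' w2" "A' w2 \<le> C1 ^ ?N * A w2"
      unfolding A_def A'_def V full_transform_def edge_config_def by (simp_all only: prod.case)
  qed
  have F: "F = (\<integral>\<^sup>+w2. A' w2 \<partial>?P2)" unfolding F_def A'_def ..
  have "L \<le> (\<integral>\<^sup>+\<tau>. C2 ^ ?N * H \<tau> \<partial>?T)" unfolding L by (intro nn_integral_mono GH) (simp only: spT)
  also have "\<dots> = C2 ^ ?N * (\<integral>\<^sup>+w2. A w2 \<partial>?P2)" by (simp only: nn_integral_cmult[OF Hm] HA)
  also have "\<dots> \<le> C2 ^ ?N * (\<integral>\<^sup>+w2. C1 ^ ?N * A' w2 \<partial>?P2)"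
    by (intro mult_left_mono nn_integral_mono AA') simp_all
  also have "\<dots> = (C1 * C2) ^ ?N * F" by (subst nn_integral_cmult[OF A'm]) (simp add: F power_mult_distrib mult_ac)
  finally show "L \<le> (C1 * C2) ^ ?N * F" .
  have "F \<le> (\<integral>\<^sup>+w2. C1 ^ ?N * A w2 \<partial>?P2)" unfolding F by (intro nn_integral_mono AA')
  also have "\<dots> = C1 ^ ?N * (\<integral>\<^sup>+\<tau>. H \<tau> \<partial>?T)" by (simp only: nn_integral_cmult[OF Am] HA)
  also have "\<dots> \<le> C1 ^ ?N * (\<integral>\<^sup>+\<tau>. C2 ^ ?N * ?G \<tau> \<partial>?T)"
    by (intro mult_left_mono nn_integral_mono GH) (simp_all only: spT zero_le)
  also have "\<dots> = (C1 * C2) ^ ?N * L" by (simp only: nn_integral_cmult[OF Gm] L power_mult_distrib mult_ac)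
  finally show "F \<le> (C1 * C2) ^ ?N * L" .
qed

text \<open>On the straight diagram both rows read the same auxiliary variables, so the product of
  the two transforms is a square, and the second of the two-sided bounds applies.\<close>

lemma feature_norm_le:
  assumes g: "g \<in> \<F> l"
  shows "feature_norm l g \<le> (C1 * C2) ^ card (straight_diagram l) * sq_norm l g"
proof -
  let ?D = "straight_diagram l" and ?e = "\<lambda>i :: nat. ((1 :: nat, i), (2 :: nat, i))"
  let ?er = "edge_config (\<lambda>_. l) ?D" and ?f = "full_transform l g"
  have bij: "bij_betw ?e {1..l} ?D" by (auto simp: bij_betw_def straight_diagram_def inj_on_def)
  have er': "?er 1 w = (\<lambda>i\<in>{1..l}. w (?e i))" "?er 2 w = (\<lambda>i\<in>{1..l}. w (?e i))" for w :: "_ \<Rightarrow> 'w1"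
    using edge_at_straight unfolding edge_config_def by (auto intro!: restrict_ext)
  have er'': "?er 1 w = (\<lambda>i\<in>{1..l}. w (?e i))" "?er 2 w = (\<lambda>i\<in>{1..l}. w (?e i))" for w :: "_ \<Rightarrow> 'w2"
    using edge_at_straight unfolding edge_config_def by (auto intro!: restrict_ext)
  have set12: "{1..2 :: nat} = {1, 2}" by auto
  have two: "(\<Prod>k\<in>{1..2 :: nat}. f k) = f 1 * f 2" for f :: "nat \<Rightarrow> ennreal" unfolding set12 by simp
  have fm: "(\<lambda>p. (?f p)\<^sup>2) \<in> borel_measurable ((\<Pi>\<^sub>M i\<in>{1..l}. \<mu>2) \<Otimes>\<^sub>M (\<Pi>\<^sub>M i\<in>{1..l}. \<mu>1))"
    using full_transform_measurable[OF g] by measurable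
  have rm1: "(\<lambda>w. \<lambda>i\<in>{1..l}. w (?e i)) \<in> (\<Pi>\<^sub>M e\<in>?D. \<mu>1) \<rightarrow>\<^sub>M (\<Pi>\<^sub>M i\<in>{1..l}. \<mu>1)"
    using bij by (intro measurable_relabel) (simp add: bij_betw_def)
  have rm2: "(\<lambda>w. \<lambda>i\<in>{1..l}. w (?e i)) \<in> (\<Pi>\<^sub>M e\<in>?D. \<mu>2) \<rightarrow>\<^sub>M (\<Pi>\<^sub>M i\<in>{1..l}. \<mu>2)"
    using bij by (intro measurable_relabel) (simp add: bij_betw_def)
  interpret S1: sigma_finite_measure "\<Pi>\<^sub>M i\<in>{1..l}. \<mu>1" by (rule FT.PM.sigma_finite) simp
  have "(\<integral>\<^sup>+w2. \<integral>\<^sup>+w1. (\<Prod>k\<in>{1..2}. ?f (?er k w2, ?er k w1)) \<partial>(\<Pi>\<^sub>M e\<in>?D. \<mu>1) \<partial>(\<Pi>\<^sub>M e\<in>?D. \<mu>2)) =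
    (\<integral>\<^sup>+w2. \<integral>\<^sup>+w1. (?f ((\<lambda>i\<in>{1..l}. w2 (?e i)), (\<lambda>i\<in>{1..l}. w1 (?e i))))\<^sup>2 \<partial>(\<Pi>\<^sub>M e\<in>?D. \<mu>1) \<partial>(\<Pi>\<^sub>M e\<in>?D. \<mu>2))"
    by (simp only: two er' er'' power2_eq_square)
  also have "\<dots> = (\<integral>\<^sup>+w2. \<integral>\<^sup>+\<omega>1. (?f ((\<lambda>i\<in>{1..l}. w2 (?e i)), \<omega>1))\<^sup>2 \<partial>(\<Pi>\<^sub>M i\<in>{1..l}. \<mu>1) \<partial>(\<Pi>\<^sub>M e\<in>?D. \<mu>2))"
  proof (rule nn_integral_cong)
    fix w2 assume w2: "w2 \<in> space (\<Pi>\<^sub>M e\<in>?D. \<mu>2)"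
    have "(\<lambda>\<omega>1. (?f ((\<lambda>i\<in>{1..l}. w2 (?e i)), \<omega>1))\<^sup>2) \<in> borel_measurable (\<Pi>\<^sub>M i\<in>{1..l}. \<mu>1)"
      by (rule measurable_compose[OF measurable_Pair1'[OF measurable_space[OF rm2 w2]] fm])
    then show "(\<integral>\<^sup>+w1. (?f ((\<lambda>i\<in>{1..l}. w2 (?e i)), (\<lambda>i\<in>{1..l}. w1 (?e i))))\<^sup>2 \<partial>(\<Pi>\<^sub>M e\<in>?D. \<mu>1)) =
      (\<integral>\<^sup>+\<omega>1. (?f ((\<lambda>i\<in>{1..l}. w2 (?e i)), \<omega>1))\<^sup>2 \<partial>(\<Pi>\<^sub>M i\<in>{1..l}. \<mu>1))"
      by (rule nn_integral_PiM_bij[OF FT.sigma_finite_\<mu> bij finite_atLeastAtMost])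
  qed
  also have "\<dots> = feature_norm l g"
    unfolding feature_norm_def
    by (rule nn_integral_PiM_bij[OF FX.sigma_finite_\<mu> bij finite_atLeastAtMost S1.borel_measurable_nn_integral_fst[OF fm]])
  finally have "feature_norm l g = (\<integral>\<^sup>+w2. \<integral>\<^sup>+w1. (\<Prod>k\<in>{1..2}. ?f (?er k w2, ?er k w1)) \<partial>(\<Pi>\<^sub>M e\<in>?D. \<mu>1) \<partial>(\<Pi>\<^sub>M e\<in>?D. \<mu>2))" ..
  also have "\<dots> \<le> (C1 * C2) ^ card ?D * (\<integral>\<^sup>+z. (\<Prod>k\<in>{1..2}. g (row (\<lambda>_. l) k z)) \<partial>\<nu> (vertices 2 (\<lambda>_. l)) ?D)"
    using diagram_two_sided(2)[OF straight_diagram_in, of "\<lambda>_. g"] g by blast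
  finally show ?thesis unfolding two sq_norm_def .
qed

text \<open>In the auxiliary variables an edge is a coordinate shared by two rows. The
  Cauchy--Schwarz inequality is applied to the time coordinates with those of space fixed, then to
  the space coordinates with the resulting norms as factors; what comes out is the product of the L2
  norms of the transforms.\<close>

lemma diagram_bound:
  assumes D: "D \<in> diagrams m n"
  shows "\<exists>c. c \<noteq> \<top> \<and> (\<forall>g. (\<forall>k\<in>{1..m}. g k \<in> \<F> (n k)) \<longrightarrow>
    (\<integral>\<^sup>+z. (\<Prod>k\<in>{1..m}. g k (row n k z)) \<partial>\<nu> (vertices m n) D) \<le>
      c * (\<Prod>k\<in>{1..m}. esqrt (sq_norm (n k) (g k))))"
proof (intro exI conjI allI impI)
  \<comment> \<open>The first factor pays for passing to the auxiliary variables, the square roots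
    for returning from the norms of the transforms to those of the rows. The functions
    \<open>g\<close> do not enter.\<close>
  let ?c = "(C1 * C2) ^ card D * (\<Prod>k\<in>{1..m}. esqrt ((C1 * C2) ^ card (straight_diagram (n k))))"
  show "?c \<noteq> \<top>" using FT.C FX.C by (simp add: ennreal_mult_eq_top_iff ennreal_prod_eq_top power_eq_top_ennreal)
  fix g :: "nat \<Rightarrow> (nat, 'd) configuration \<Rightarrow> ennreal"
  assume "\<forall>k\<in>{1..m}. g k \<in> \<F> (n k)"
  then have g: "\<And>k. k \<in> {1..m} \<Longrightarrow> g k \<in> \<F> (n k)" by blast
  let ?er = "edge_config n D" and ?f = "\<lambda>k. full_transform (n k) (g k)"
  have S1: "sigma_finite_measure (\<Pi>\<^sub>M i\<in>{1..n k}. \<mu>1)" for k by (rule FT.PM.sigma_finite) simp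
  let ?h = "\<lambda>k \<omega>2. esqrt (\<integral>\<^sup>+\<omega>1. (?f k (\<omega>2, \<omega>1))\<^sup>2 \<partial>(\<Pi>\<^sub>M i\<in>{1..n k}. \<mu>1))"
  note erm2 = edge_config_measurable[OF D, where \<mu>=\<mu>2]
  have hm: "?h k \<in> borel_measurable (\<Pi>\<^sub>M i\<in>{1..n k}. \<mu>2)" if "k \<in> {1..m}" for k
  proof -
    have "(\<lambda>p. (?f k p)\<^sup>2) \<in> borel_measurable ((\<Pi>\<^sub>M i\<in>{1..n k}. \<mu>2) \<Otimes>\<^sub>M (\<Pi>\<^sub>M i\<in>{1..n k}. \<mu>1))"
      using full_transform_measurable[OF g[OF that]] by measurable
    from sigma_finite_measure.borel_measurable_nn_integral_fst[OF S1 this] show ?thesis by measurable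
  qed
  have "(\<integral>\<^sup>+z. (\<Prod>k\<in>{1..m}. g k (row n k z)) \<partial>\<nu> (vertices m n) D) \<le>
    (C1 * C2) ^ card D * (\<integral>\<^sup>+w2. \<integral>\<^sup>+w1. (\<Prod>k\<in>{1..m}. ?f k (?er k w2, ?er k w1)) \<partial>(\<Pi>\<^sub>M e\<in>D. \<mu>1) \<partial>(\<Pi>\<^sub>M e\<in>D. \<mu>2))"
    by (rule diagram_two_sided(1)[OF D g])
  also have "\<dots> \<le> (C1 * C2) ^ card D * (\<integral>\<^sup>+w2. (\<Prod>k\<in>{1..m}. ?h k (?er k w2)) \<partial>(\<Pi>\<^sub>M e\<in>D. \<mu>2))"
  proof (intro mult_left_mono nn_integral_mono)
    fix w2 assume w2: "w2 \<in> space (\<Pi>\<^sub>M e\<in>D. \<mu>2)"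
    show "(\<integral>\<^sup>+w1. (\<Prod>k\<in>{1..m}. ?f k (?er k w2, ?er k w1)) \<partial>(\<Pi>\<^sub>M e\<in>D. \<mu>1)) \<le> (\<Prod>k\<in>{1..m}. ?h k (?er k w2))"
    proof (rule diagram_Cauchy_Schwarz[OF D FT.sigma_finite_\<mu>])
      fix k assume k: "k \<in> {1..m}"
      show "(\<lambda>\<omega>1. ?f k (?er k w2, \<omega>1)) \<in> borel_measurable (\<Pi>\<^sub>M i\<in>{1..n k}. \<mu>1)"
        by (rule measurable_compose[OF measurable_Pair1'[OF measurable_space[OF erm2[OF k] w2]] full_transform_measurable[OF g[OF k]]])
    qed
  qed simp_all
  also have "\<dots> \<le> (C1 * C2) ^ card D * (\<Prod>k\<in>{1..m}. esqrt (\<integral>\<^sup>+\<omega>2. (?h k \<omega>2)\<^sup>2 \<partial>(\<Pi>\<^sub>M i\<in>{1..n k}. \<mu>2)))"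
    by (intro mult_left_mono diagram_Cauchy_Schwarz[OF D FX.sigma_finite_\<mu> hm]) simp_all
  also have "\<dots> = (C1 * C2) ^ card D * (\<Prod>k\<in>{1..m}. esqrt (feature_norm (n k) (g k)))"
    by (simp only: esqrt_square feature_norm_def)
  also have "\<dots> \<le> (C1 * C2) ^ card D * (\<Prod>k\<in>{1..m}. esqrt ((C1 * C2) ^ card (straight_diagram (n k))) * esqrt (sq_norm (n k) (g k)))"
  proof (intro mult_left_mono)
    have "esqrt (feature_norm (n k) (g k)) \<le> esqrt ((C1 * C2) ^ card (straight_diagram (n k))) * esqrt (sq_norm (n k) (g k))" if "k \<in> {1..m}" for k
      unfolding esqrt_mult[symmetric] by (rule esqrt_mono[OF feature_norm_le[OF g[OF that]]])
    then show "(\<Prod>k\<in>{1..m}. esqrt (feature_norm (n k) (g k))) \<le> (\<Prod>k\<in>{1..m}. esqrt ((C1 * C2) ^ card (straight_diagram (n k))) * esqrt (sq_norm (n k) (g k)))"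
      using prod_le_power_mult[of "{1..m}" "\<lambda>k. esqrt (feature_norm (n k) (g k))" 1] by (simp del: One_nat_def)
  qed simp
  also have "\<dots> = ?c * (\<Prod>k\<in>{1..m}. esqrt (sq_norm (n k) (g k)))" by (simp only: prod.distrib mult.assoc)
  finally show "(\<integral>\<^sup>+z. (\<Prod>k\<in>{1..m}. g k (row n k z)) \<partial>\<nu> (vertices m n) D) \<le>
      ?c * (\<Prod>k\<in>{1..m}. esqrt (sq_norm (n k) (g k)))" .
qed

end

section \<open>Riesz kernels\<close>

lemma indicator_ball_measurable [measurable, simp]:
  "(indicator (ball c r) :: 'a::euclidean_space \<Rightarrow> ennreal) \<in> borel_measurable borel"
  by (rule borel_measurable_indicator) simp

lemma nn_integral_powr_tail:
  assumes "0 < l" "0 < a"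
  shows "(\<integral>\<^sup>+s. ennreal (s powr (- l - 1)) * indicator {a..} s \<partial>lborel) = ennreal (a powr (- l) / l)"
proof -
  have "((\<lambda>s. s powr (- l - 1)) has_integral - (a powr (- l - 1 + 1)) / (- l - 1 + 1)) {a..}"
    using assms by (intro has_integral_powr_to_inf) auto
  then have "((\<lambda>s. s powr (- l - 1)) has_integral a powr (- l) / l) {a..}" by simp
  then show ?thesis by (rule nn_integral_has_integral_lebesgue'[rotated]) simp
qed

lemma nn_integral_powr_head:
  assumes "- 1 < b" "0 \<le> c"
  shows "(\<integral>\<^sup>+s. ennreal (s powr b) * indicator {0..c} s \<partial>lborel) = ennreal (c powr (b + 1) / (b + 1))"
  using has_integral_powr_from_0[OF assms] by (rule nn_integral_has_integral_lebesgue'[rotated]) simp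

lemma emeasure_ball_eq:
  fixes c :: "'a::euclidean_space"
  assumes "0 \<le> r"
  shows "emeasure lborel (ball c r) = ennreal (r ^ DIM('a) * measure lborel (ball (0 :: 'a) 1))"
proof -
  have "emeasure lborel (ball c r) = ennreal (measure lborel (ball c r))"
    using emeasure_lborel_ball_finite[of c r] by (subst emeasure_eq_ennreal_measure) auto
  then show ?thesis by (simp only: content_ball_conv_unit_ball[OF assms])
qed

text \<open>Averaging indicators of balls over centre and radius with the weight \<open>s\<^bsup>-l-d-1\<^esup>\<close>
  gives a kernel comparable to \<open>|x - y|\<^bsup>-l\<^esup>\<close>.\<close>

definition riesz :: "real \<Rightarrow> 'a::euclidean_space \<Rightarrow> 'a \<times> real \<Rightarrow> ennreal" where
  "riesz l x = (\<lambda>(w, s). indicator (ball x s) w * ennreal (s powr (- (l + real DIM('a) + 1) / 2)))"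

lemma riesz_measurable [measurable]:
  "(\<lambda>(x, w). riesz l x w) \<in> borel_measurable ((borel :: 'a::euclidean_space measure) \<Otimes>\<^sub>M (lborel \<Otimes>\<^sub>M lborel))"
proof -
  have "(\<lambda>p :: 'a \<times> 'a \<times> real. indicator {p. dist (fst p) (fst (snd p)) < snd (snd p)} p * ennreal (snd (snd p) powr (- (l + real DIM('a) + 1) / 2)) :: ennreal)
    \<in> borel_measurable (borel \<Otimes>\<^sub>M (lborel \<Otimes>\<^sub>M lborel))"
    by measurable
  then show ?thesis by (simp add: riesz_def split_def indicator_def)
qed

text \<open>Balls of radius s about two points at distance r are disjoint for s < r/2; for s \<ge> r
  both contain the ball of radius s/2 about the midpoint, and their common volume is never more than
  that of one ball. With volumes of order s^d, the integral of s^(-l-1) from r/2, or from r, gives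
  the power r^(-l).\<close>

lemma riesz_kernel:
  fixes x y :: "'a::euclidean_space"
  assumes l: "0 < l" and xy: "x \<noteq> y"
  defines "K \<equiv> \<integral>\<^sup>+p. riesz l x p * riesz l y p \<partial>(lborel \<Otimes>\<^sub>M lborel)"
    and "v \<equiv> measure lborel (ball (0 :: 'a) 1)" and "r \<equiv> norm (x - y)"
  shows "K \<le> ennreal (v * 2 powr l / l * r powr (- l))"
    and "ennreal (v / 2 ^ DIM('a) / l * r powr (- l)) \<le> K"
proof -
  let ?d = "DIM('a)"
  have r: "0 < r" using xy by (simp add: r_def)
  have v: "0 < v" unfolding v_def by (rule content_ball_pos) simp
  let ?p = "\<lambda>s. s powr (- l - real ?d - 1)"
  \<comment> \<open>Each of the two factors carries half of the exponent of the weight.\<close>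
  have pp: "s powr (- (l + real ?d + 1) / 2) * s powr (- (l + real ?d + 1) / 2) = ?p s" for s
  proof -
    have "- (l + real ?d + 1) / 2 + - (l + real ?d + 1) / 2 = - l - real ?d - 1" by (simp add: field_simps)
    then show ?thesis by (simp only: powr_add[symmetric])
  qed
  have "(\<lambda>p. riesz l z p) \<in> borel_measurable (lborel \<Otimes>\<^sub>M lborel)" for z :: 'a
    using measurable_compose[OF measurable_Pair1' riesz_measurable, of z l] by simp
  then have m: "(\<lambda>p. riesz l x p * riesz l y p) \<in> borel_measurable (lborel \<Otimes>\<^sub>M lborel)" by measurable
  have K: "K = (\<integral>\<^sup>+s. emeasure lborel (ball x s \<inter> ball y s) * ennreal (?p s) \<partial>lborel)"
  proof -
    have "K = (\<integral>\<^sup>+s. \<integral>\<^sup>+w. riesz l x (w, s) * riesz l y (w, s) \<partial>lborel \<partial>lborel)"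
      unfolding K_def using m by (subst lborel_pair.nn_integral_snd[symmetric]) (simp_all add: split_def)
    also have "\<dots> = (\<integral>\<^sup>+s. \<integral>\<^sup>+w. indicator (ball x s \<inter> ball y s) w * ennreal (?p s) \<partial>lborel \<partial>lborel)"
      unfolding riesz_def pp[symmetric]
      by (intro nn_integral_cong) (auto simp: indicator_def ennreal_mult)
    also have "\<dots> = (\<integral>\<^sup>+s. emeasure lborel (ball x s \<inter> ball y s) * ennreal (?p s) \<partial>lborel)"
      by (intro nn_integral_cong, subst nn_integral_multc) (simp_all add: borel_measurable_indicator)
    finally show ?thesis .
  qed
  have pd: "s ^ ?d * ?p s = s powr (- l - 1)" if "0 < s" for s
    using that by (simp add: powr_realpow[symmetric] powr_add[symmetric])
  have up: "emeasure lborel (ball x s \<inter> ball y s) * ennreal (?p s) \<le> ennreal v * (ennreal (s powr (- l - 1)) * indicator {r / 2..} s)" for s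
  proof (cases "r / 2 \<le> s")
    case True
    then have s: "0 < s" using r by linarith
    have "emeasure lborel (ball x s \<inter> ball y s) \<le> emeasure lborel (ball x s)" by (intro emeasure_mono) auto
    also have "\<dots> = ennreal (s ^ ?d * v)" unfolding v_def using s by (intro emeasure_ball_eq) simp
    finally have "emeasure lborel (ball x s \<inter> ball y s) * ennreal (?p s) \<le> ennreal (s ^ ?d * v) * ennreal (?p s)"
      by (rule mult_right_mono) simp
    also have "\<dots> = ennreal (v * (s ^ ?d * ?p s))" using s v by (simp add: ennreal_mult'[symmetric] mult_ac)
    also have "\<dots> = ennreal v * (ennreal (s powr (- l - 1)) * indicator {r / 2..} s)"
      using True v by (simp add: pd[OF s] ennreal_mult')
    finally show ?thesis .
  next
    case False
    have "ball x s \<inter> ball y s = {}"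
    proof (rule equals0I)
      fix w assume "w \<in> ball x s \<inter> ball y s"
      then have "dist x w < s" "dist w y < s" by (auto simp: dist_commute)
      then have "dist x y < 2 * s" using dist_triangle[of x y w] by linarith
      then show False using False by (simp add: r_def dist_norm)
    qed
    then show ?thesis by simp
  qed
  have "K \<le> (\<integral>\<^sup>+s. ennreal v * (ennreal (s powr (- l - 1)) * indicator {r / 2..} s) \<partial>lborel)"
    unfolding K by (intro nn_integral_mono up)
  also have "\<dots> = ennreal v * ennreal ((r / 2) powr (- l) / l)"
    using nn_integral_powr_tail[OF l, of "r / 2"] r by (simp add: nn_integral_cmult)
  also have "\<dots> = ennreal (v * 2 powr l / l * r powr (- l))"
    using v r by (simp add: ennreal_mult'[symmetric] powr_divide powr_minus_divide mult_ac)
  finally show "K \<le> ennreal (v * 2 powr l / l * r powr (- l))" .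
  have lo: "ennreal (v / 2 ^ ?d) * (ennreal (s powr (- l - 1)) * indicator {r..} s) \<le> emeasure lborel (ball x s \<inter> ball y s) * ennreal (?p s)" for s
  proof (cases "r \<le> s")
    case True
    then have s: "0 < s" using r by linarith
    let ?c = "(1 / 2) *\<^sub>R (x + y)"
    have d: "dist x ?c = r / 2" "dist y ?c = r / 2"
    proof -
      have "x - ?c = (1 / 2) *\<^sub>R (x - y)" "y - ?c = (1 / 2) *\<^sub>R (y - x)"
        by (simp_all add: algebra_simps flip: scaleR_add_left)
      then show "dist x ?c = r / 2" "dist y ?c = r / 2" by (simp_all add: dist_norm r_def norm_minus_commute)
    qed
    have "ball ?c (s / 2) \<subseteq> ball x s \<inter> ball y s"
    proof
      fix w assume "w \<in> ball ?c (s / 2)"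
      then have "dist ?c w < s / 2" by simp
      then have "dist x w < s" "dist y w < s"
        using dist_triangle[of x w ?c] dist_triangle[of y w ?c] d True by linarith+
      then show "w \<in> ball x s \<inter> ball y s" by simp
    qed
    then have "emeasure lborel (ball ?c (s / 2)) \<le> emeasure lborel (ball x s \<inter> ball y s)"
      by (rule emeasure_mono) simp
    moreover have "emeasure lborel (ball ?c (s / 2)) = ennreal ((s / 2) ^ ?d * v)"
      unfolding v_def using s by (intro emeasure_ball_eq) simp
    ultimately have "ennreal ((s / 2) ^ ?d * v) * ennreal (?p s) \<le> emeasure lborel (ball x s \<inter> ball y s) * ennreal (?p s)"
      by (intro mult_right_mono) simp_all
    moreover have "ennreal ((s / 2) ^ ?d * v) * ennreal (?p s) = ennreal (v / 2 ^ ?d * (s ^ ?d * ?p s))"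
      using s v by (simp add: ennreal_mult'[symmetric] mult_ac power_divide)
    moreover have "\<dots> = ennreal (v / 2 ^ ?d) * (ennreal (s powr (- l - 1)) * indicator {r..} s)"
      using True v by (simp add: pd[OF s] ennreal_mult'[symmetric])
    ultimately show ?thesis by simp
  qed simp
  have "ennreal (v / 2 ^ ?d / l * r powr (- l)) = ennreal (v / 2 ^ ?d) * ennreal (r powr (- l) / l)"
    using v by (simp add: ennreal_mult'[symmetric])
  also have "\<dots> = (\<integral>\<^sup>+s. ennreal (v / 2 ^ ?d) * (ennreal (s powr (- l - 1)) * indicator {r..} s) \<partial>lborel)"
    using nn_integral_powr_tail[OF l r] by (simp add: nn_integral_cmult)
  also have "\<dots> \<le> K" unfolding K by (intro nn_integral_mono lo)
  finally show "ennreal (v / 2 ^ ?d / l * r powr (- l)) \<le> K" .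
qed

lemma riesz_comparable:
  assumes l: "0 < l"
  obtains A where "1 \<le> A" "\<And>x y :: 'a::euclidean_space. x \<noteq> y \<Longrightarrow>
     (\<integral>\<^sup>+p. riesz l x p * riesz l y p \<partial>(lborel \<Otimes>\<^sub>M lborel)) \<le> ennreal A * ennreal (norm (x - y) powr (- l)) \<and>
     ennreal (norm (x - y) powr (- l)) \<le> ennreal A * (\<integral>\<^sup>+p. riesz l x p * riesz l y p \<partial>(lborel \<Otimes>\<^sub>M lborel))"
proof
  let ?v = "measure lborel (ball (0 :: 'a) 1)"
  let ?a = "?v * 2 powr l / l" and ?b = "l * 2 ^ DIM('a) / ?v"
  let ?A = "max 1 (max ?a ?b)"
  have v: "0 < ?v" by (rule content_ball_pos) simp
  show "1 \<le> ?A" by simp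
  fix x y :: 'a assume xy: "x \<noteq> y"
  let ?K = "\<integral>\<^sup>+p. riesz l x p * riesz l y p \<partial>(lborel \<Otimes>\<^sub>M lborel)" and ?r = "norm (x - y) powr (- l)"
  have "?K \<le> ennreal (?a * ?r)" by (rule riesz_kernel(1)[OF l xy])
  also have "\<dots> \<le> ennreal (?A * ?r)" by (intro ennreal_leI mult_right_mono) auto
  finally have 1: "?K \<le> ennreal ?A * ennreal ?r" by (simp add: ennreal_mult')
  have "ennreal ?r = ennreal ?b * ennreal (?v / 2 ^ DIM('a) / l * ?r)"
    using v l by (simp add: ennreal_mult'[symmetric])
  also have "\<dots> \<le> ennreal ?A * ?K"
    using riesz_kernel(2)[OF l xy] by (intro mult_mono ennreal_leI) auto
  finally show "?K \<le> ennreal ?A * ennreal ?r \<and> ennreal ?r \<le> ennreal ?A * ?K" using 1 by blast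
qed

text \<open>Comparability passes from the power to a kernel lying between two multiples of it. The
  two directions produce the constants A*C and A/c; A times (C + 1/c) serves both.\<close>

lemma comparable_trans:
  fixes k p :: real and K :: ennreal
  assumes "c * p \<le> k" "k \<le> C * p" "K \<le> ennreal A * ennreal p" "ennreal p \<le> ennreal A * K" "0 < c" "0 < C" "1 \<le> A" "0 \<le> p"
  shows "ennreal k \<le> ennreal (A * (C + 1 / c)) * K" "K \<le> ennreal (A * (C + 1 / c)) * ennreal k"
proof -
  have "ennreal k \<le> ennreal C * ennreal p" using assms(2,6) by (simp add: ennreal_mult'[symmetric] ennreal_leI)
  also have "\<dots> \<le> ennreal C * (ennreal A * K)" by (intro mult_left_mono assms(4)) simp
  also have "\<dots> = ennreal (A * C) * K" using assms(6,7) by (simp add: ennreal_mult mult_ac)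
  also have "\<dots> \<le> ennreal (A * (C + 1 / c)) * K" using assms by (intro mult_right_mono ennreal_leI mult_left_mono) auto
  finally show "ennreal k \<le> ennreal (A * (C + 1 / c)) * K" .
  have "p \<le> 1 / c * k" using assms(1,5) by (simp add: field_simps)
  then have "K \<le> ennreal A * ennreal (1 / c * k)" using assms(3) by (meson ennreal_leI mult_left_mono order_trans zero_le)
  also have "\<dots> = ennreal (A * (1 / c)) * ennreal k"
  proof -
    have "0 \<le> k" using assms(1,5,8) by (meson mult_nonneg_nonneg less_imp_le order_trans)
    then show ?thesis using assms(5,7) by (simp add: ennreal_mult'[symmetric] mult_ac)
  qed
  also have "\<dots> \<le> ennreal (A * (C + 1 / c)) * ennreal k" using assms by (intro mult_right_mono ennreal_leI mult_left_mono) auto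
  finally show "K \<le> ennreal (A * (C + 1 / c)) * ennreal k" .
qed

lemma sigma_finite_lborel_pair: "sigma_finite_measure ((lborel :: 'a::euclidean_space measure) \<Otimes>\<^sub>M (lborel :: real measure))"
proof -
  interpret pair_sigma_finite "lborel :: 'a measure" "lborel :: real measure" ..
  show ?thesis ..
qed

lemma feature_riesz:
  fixes k :: "'a::euclidean_space \<Rightarrow> real"
  assumes base: "correlation_base (Kernel k) B" and ae: "\<And>y. AE x in B. x \<noteq> y"
    and l: "0 < l" and c: "0 < c" "0 < C"
    and k: "\<And>x. x \<noteq> 0 \<Longrightarrow> c * norm x powr (- l) \<le> k x \<and> k x \<le> C * norm x powr (- l)"
  shows "\<exists>A. feature (Kernel k) B (lborel \<Otimes>\<^sub>M lborel) (Weight (riesz l)) A"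
proof -
  interpret correlation_base "Kernel k" B by fact
  obtain A where A: "1 \<le> A" "\<And>x y :: 'a. x \<noteq> y \<Longrightarrow>
     (\<integral>\<^sup>+p. riesz l x p * riesz l y p \<partial>(lborel \<Otimes>\<^sub>M lborel)) \<le> ennreal A * ennreal (norm (x - y) powr (- l)) \<and>
     ennreal (norm (x - y) powr (- l)) \<le> ennreal A * (\<integral>\<^sup>+p. riesz l x p * riesz l y p \<partial>(lborel \<Otimes>\<^sub>M lborel))"
    using riesz_comparable[OF l] by blast
  \<comment> \<open>The maximum with 1 provides the normalization demanded of the constant of a
    feature.\<close>
  let ?A = "max 1 (A * (C + 1 / c))"
  have "feature (Kernel k) B (lborel \<Otimes>\<^sub>M lborel) (Weight (riesz l)) (ennreal ?A)"
  proof (rule feature.intro[OF base], rule feature_axioms.intro, goal_cases)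
    case 1
    show ?case by (rule sigma_finite_lborel_pair)
  next
    case 2
    show ?case using ennreal_leI[of 1 ?A] by simp
  next
    case 3
    show ?case by simp
  next
    case (4 \<theta>)
    then have \<theta>: "\<theta> = riesz l" by simp
    have "(\<lambda>p. (fst p, snd p)) \<in> B \<Otimes>\<^sub>M (lborel \<Otimes>\<^sub>M lborel) \<rightarrow>\<^sub>M borel \<Otimes>\<^sub>M (lborel \<Otimes>\<^sub>M lborel)"
      by (intro measurable_Pair measurable_snd measurable_compose[OF measurable_fst id_B])
    from measurable_compose[OF this riesz_measurable] show ?case by (simp add: \<theta> split_def)
  next
    case (5 \<theta>)
    then have \<theta>: "\<theta> = riesz l" by simp
    show ?case unfolding \<theta>
    proof (intro exI[of _ k] conjI ballI refl)
      fix y assume "y \<in> space B"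
      show "AE x in B. ennreal (k (x - y)) \<le> ennreal ?A * (\<integral>\<^sup>+w. riesz l x w * riesz l y w \<partial>(lborel \<Otimes>\<^sub>M lborel)) \<and>
        (\<integral>\<^sup>+w. riesz l x w * riesz l y w \<partial>(lborel \<Otimes>\<^sub>M lborel)) \<le> ennreal ?A * ennreal (k (x - y))"
        using ae[of y]
      proof eventually_elim
        case (elim x)
        have kk: "c * norm (x - y) powr (- l) \<le> k (x - y)" "k (x - y) \<le> C * norm (x - y) powr (- l)"
          using k[of "x - y"] elim by auto
        note cmp = comparable_trans[OF kk conjunct1[OF A(2)[OF elim]] conjunct2[OF A(2)[OF elim]] c A(1)]
        have "ennreal (A * (C + 1 / c)) \<le> ennreal ?A" by (intro ennreal_leI) simp
        then show ?case using cmp by (meson mult_right_mono order_trans powr_ge_zero zero_le)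
      qed
    qed
  next
    case (6 \<pi>)
    then show ?case by simp
  qed
  then show ?thesis ..
qed

section \<open>Features of the delta and of product kernels\<close>

lemma feature_Delta:
  assumes "correlation_base Delta B"
  shows "feature Delta B B (Point (\<lambda>x. x)) 1"
proof -
  interpret correlation_base Delta B by fact
  show ?thesis
  proof (rule feature.intro[OF assms], rule feature_axioms.intro, goal_cases)
    case 1
    show ?case by (rule sigma_finite_B)
  next
    case (6 \<pi>)
    then have "\<pi> = (\<lambda>x. x)" by simp
    then show ?case by (simp add: distr_id2)
  qed simp_all
qed

text \<open>The product bounds are given off the coordinate hyperplanes, which are thereby seen to
  be negligible.\<close>

lemma hyperplane_AE:
  fixes j :: "'d::finite"
  shows "AE x in (lborel :: (real ^ 'd) measure). x $ j \<noteq> c"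
proof -
  have "negligible {x :: real ^ 'd. x \<bullet> axis j 1 = c}"
    by (rule negligible_standard_hyperplane) (auto simp: Basis_vec_def)
  then have "{x :: real ^ 'd. x $ j = c} \<in> null_sets lebesgue"
    by (simp add: negligible_iff_null_sets inner_axis)
  moreover have "{x :: real ^ 'd. x $ j = c} \<in> sets lborel" by measurable
  ultimately have "{x :: real ^ 'd. x $ j = c} \<in> null_sets lborel"
    by (simp add: null_sets_completion_iff)
  then show ?thesis by (rule AE_I') auto
qed

lemma vec_nth_measurable [measurable]: "(\<lambda>x :: real ^ 'd. x $ j) \<in> borel_measurable borel"
  by (rule borel_measurable_continuous_onI) (intro continuous_intros)

text \<open>A product of one-dimensional powers is represented by the tensor product of the
  one-dimensional features, with one pair of centre and radius for every coordinate.\<close>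

definition product_riesz :: "('d \<Rightarrow> real) \<Rightarrow> real ^ 'd \<Rightarrow> ('d \<Rightarrow> real \<times> real) \<Rightarrow> ennreal" where
  "product_riesz l x \<omega> = (\<Prod>j\<in>UNIV. riesz (l j) (x $ j) (\<omega> j))"

abbreviation riesz_base :: "('d :: finite \<Rightarrow> real \<times> real) measure" where
  "riesz_base \<equiv> \<Pi>\<^sub>M j\<in>UNIV. lborel \<Otimes>\<^sub>M lborel"

lemma product_riesz_measurable:
  fixes l :: "'d::finite \<Rightarrow> real"
  shows "(\<lambda>(x, w). product_riesz l x w) \<in> borel_measurable (borel \<Otimes>\<^sub>M riesz_base)"
proof -
  have "(\<lambda>p. riesz (l j) ((fst p :: real ^ 'd) $ j) (snd p j)) \<in> borel_measurable (borel \<Otimes>\<^sub>M riesz_base)" for j :: 'd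
  proof -
    have "(\<lambda>p. ((fst p :: real ^ 'd) $ j, snd p j)) \<in> borel \<Otimes>\<^sub>M riesz_base \<rightarrow>\<^sub>M borel \<Otimes>\<^sub>M (lborel \<Otimes>\<^sub>M lborel)"
      by (intro measurable_Pair measurable_compose[OF measurable_snd measurable_component_singleton[OF UNIV_I]])
        (rule measurable_compose[OF measurable_fst], rule vec_nth_measurable)
    from measurable_compose[OF this riesz_measurable] show ?thesis by simp
  qed
  then show ?thesis unfolding product_riesz_def split_def by (intro borel_measurable_prod_ennreal)
qed

lemma product_riesz_kernel:
  "(\<integral>\<^sup>+\<omega>. product_riesz l x \<omega> * product_riesz l y \<omega> \<partial>riesz_base) =
    (\<Prod>j\<in>UNIV. \<integral>\<^sup>+p. riesz (l j) (x $ j) p * riesz (l j) (y $ j) p \<partial>(lborel \<Otimes>\<^sub>M lborel))"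
proof -
  interpret product_sigma_finite "\<lambda>_ :: 'a. (lborel :: real measure) \<Otimes>\<^sub>M (lborel :: real measure)"
    using sigma_finite_lborel_pair by (rule product_sigma_finite.intro)
  have m: "riesz (l j) z \<in> borel_measurable (lborel \<Otimes>\<^sub>M lborel)" for j and z :: real
    using measurable_compose[OF measurable_Pair1' riesz_measurable, of z "l j"] by simp
  show ?thesis unfolding product_riesz_def prod.distrib[symmetric]
    by (rule product_nn_integral_prod) (auto intro!: borel_measurable_times_ennreal m)
qed

lemma product_riesz_comparable:
  fixes l :: "'d::finite \<Rightarrow> real"
  assumes l: "\<And>j. 0 < l j"
  obtains A where "1 \<le> A" "\<And>x y. (\<And>j. x $ j \<noteq> y $ j) \<Longrightarrow>
     (\<integral>\<^sup>+p. product_riesz l x p * product_riesz l y p \<partial>riesz_base) \<le> ennreal A * ennreal (\<Prod>j\<in>UNIV. \<bar>(x - y) $ j\<bar> powr (- l j)) \<and>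
     ennreal (\<Prod>j\<in>UNIV. \<bar>(x - y) $ j\<bar> powr (- l j)) \<le> ennreal A * (\<integral>\<^sup>+p. product_riesz l x p * product_riesz l y p \<partial>riesz_base)"
proof -
  let ?K = "\<lambda>j x y. \<integral>\<^sup>+p. riesz (l j) (x :: real) p * riesz (l j) y p \<partial>(lborel \<Otimes>\<^sub>M lborel)"
  have "\<forall>j. \<exists>A. 1 \<le> A \<and> (\<forall>x y. x \<noteq> y \<longrightarrow> ?K j x y \<le> ennreal A * ennreal (norm (x - y) powr (- l j)) \<and>
     ennreal (norm (x - y) powr (- l j)) \<le> ennreal A * ?K j x y)"
  proof
    fix j
    show "\<exists>A. 1 \<le> A \<and> (\<forall>x y. x \<noteq> y \<longrightarrow> ?K j x y \<le> ennreal A * ennreal (norm (x - y) powr (- l j)) \<and>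
      ennreal (norm (x - y) powr (- l j)) \<le> ennreal A * ?K j x y)"
      by (rule riesz_comparable[OF l, where 'a=real]) blast
  qed
  from choice[OF this] obtain A where A': "\<forall>j. 1 \<le> A j \<and> (\<forall>x y. x \<noteq> y \<longrightarrow> ?K j x y \<le> ennreal (A j) * ennreal (norm (x - y) powr (- l j)) \<and>
     ennreal (norm (x - y) powr (- l j)) \<le> ennreal (A j) * ?K j x y)" ..
  have A: "1 \<le> A j" "x \<noteq> y \<Longrightarrow> ?K j x y \<le> ennreal (A j) * ennreal (norm (x - y) powr (- l j))"
     "x \<noteq> y \<Longrightarrow> ennreal (norm (x - y) powr (- l j)) \<le> ennreal (A j) * ?K j x y" for j x y
    using spec[OF A', of j] by blast+
  have A0: "0 \<le> A j" for j using A(1)[of j] by linarith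
  show thesis
  proof (rule that)
    show "1 \<le> (\<Prod>j\<in>UNIV. A j)" using A(1) by (intro prod_ge_1) auto
    fix x y :: "real ^ 'd" assume xy: "\<And>j. x $ j \<noteq> y $ j"
    have "(\<Prod>j\<in>UNIV. ?K j (x $ j) (y $ j)) \<le> (\<Prod>j\<in>UNIV. ennreal (A j) * ennreal (norm (x $ j - y $ j) powr (- l j)))"
      using prod_le_power_mult[of UNIV "\<lambda>j. ?K j (x $ j) (y $ j)" 1] A(2)[OF xy] by simp
    moreover have "(\<Prod>j\<in>UNIV. ennreal (norm (x $ j - y $ j) powr (- l j))) \<le> (\<Prod>j\<in>UNIV. ennreal (A j) * ?K j (x $ j) (y $ j))"
      using prod_le_power_mult[of UNIV "\<lambda>j. ennreal (norm (x $ j - y $ j) powr (- l j))" 1] A(3)[OF xy] by simp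
    ultimately show "(\<integral>\<^sup>+p. product_riesz l x p * product_riesz l y p \<partial>riesz_base) \<le> ennreal (\<Prod>j\<in>UNIV. A j) * ennreal (\<Prod>j\<in>UNIV. \<bar>(x - y) $ j\<bar> powr (- l j)) \<and>
     ennreal (\<Prod>j\<in>UNIV. \<bar>(x - y) $ j\<bar> powr (- l j)) \<le> ennreal (\<Prod>j\<in>UNIV. A j) * (\<integral>\<^sup>+p. product_riesz l x p * product_riesz l y p \<partial>riesz_base)"
      unfolding product_riesz_kernel using A0 by (simp add: prod.distrib prod_ennreal)
  qed
qed

lemma feature_product_riesz:
  fixes k :: "real ^ 'd \<Rightarrow> real"
  assumes base: "correlation_base (Kernel k) lborel"
    and l: "\<And>j. 0 < l j" and c: "0 < c" "0 < C"
    and k: "\<And>x. (\<And>j. x $ j \<noteq> 0) \<Longrightarrow> c * (\<Prod>j\<in>UNIV. \<bar>x $ j\<bar> powr (- l j)) \<le> k x \<and>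
      k x \<le> C * (\<Prod>j\<in>UNIV. \<bar>x $ j\<bar> powr (- l j))"
  shows "\<exists>A. feature (Kernel k) lborel riesz_base (Weight (product_riesz l)) A"
proof -
  interpret correlation_base "Kernel k" lborel by fact
  obtain A where A: "1 \<le> A" "\<And>x y. (\<And>j. x $ j \<noteq> y $ j) \<Longrightarrow>
     (\<integral>\<^sup>+p. product_riesz l x p * product_riesz l y p \<partial>riesz_base) \<le> ennreal A * ennreal (\<Prod>j\<in>UNIV. \<bar>(x - y) $ j\<bar> powr (- l j)) \<and>
     ennreal (\<Prod>j\<in>UNIV. \<bar>(x - y) $ j\<bar> powr (- l j)) \<le> ennreal A * (\<integral>\<^sup>+p. product_riesz l x p * product_riesz l y p \<partial>riesz_base)"
    using product_riesz_comparable[of l, OF l] by blast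
  let ?A = "max 1 (A * (C + 1 / c))"
  have "feature (Kernel k) lborel riesz_base (Weight (product_riesz l)) (ennreal ?A)"
  proof (rule feature.intro[OF base], rule feature_axioms.intro, goal_cases)
    case 1
    interpret P: product_sigma_finite "\<lambda>_ :: 'd. (lborel :: real measure) \<Otimes>\<^sub>M (lborel :: real measure)"
      using sigma_finite_lborel_pair by (rule product_sigma_finite.intro)
    show ?case by (rule P.sigma_finite) simp
  next
    case 2
    show ?case using ennreal_leI[of 1 ?A] by simp
  next
    case 3
    show ?case by simp
  next
    case (4 \<theta>)
    then have \<theta>: "\<theta> = product_riesz l" by simp
    show ?case using product_riesz_measurable[of l] unfolding \<theta>
      by (simp cong: measurable_cong_sets sets_pair_measure_cong)
  next
    case (5 \<theta>)
    then have \<theta>: "\<theta> = product_riesz l" by simp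
    show ?case unfolding \<theta>
    proof (intro exI[of _ k] conjI ballI refl)
      fix y :: "real ^ 'd" assume "y \<in> space lborel"
      have "AE x in (lborel :: (real ^ 'd) measure). \<forall>j\<in>UNIV. x $ j \<noteq> y $ j"
        by (intro AE_finite_allI hyperplane_AE) simp
      then show "AE x in lborel. ennreal (k (x - y)) \<le> ennreal ?A * (\<integral>\<^sup>+w. product_riesz l x w * product_riesz l y w \<partial>riesz_base) \<and>
        (\<integral>\<^sup>+w. product_riesz l x w * product_riesz l y w \<partial>riesz_base) \<le> ennreal ?A * ennreal (k (x - y))"
      proof eventually_elim
        case (elim x)
        then have xy: "x $ j \<noteq> y $ j" for j by simp
        let ?p = "\<Prod>j\<in>UNIV. \<bar>(x - y) $ j\<bar> powr (- l j)"
        have kk: "c * ?p \<le> k (x - y)" "k (x - y) \<le> C * ?p"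
          using k[of "x - y"] xy by auto
        have p0: "0 \<le> ?p" by (intro prod_nonneg) simp
        note cmp = comparable_trans[OF kk conjunct1[OF A(2)[OF xy]] conjunct2[OF A(2)[OF xy]] c A(1) p0]
        have "ennreal (A * (C + 1 / c)) \<le> ennreal ?A" by (intro ennreal_leI) simp
        then show ?case using cmp by (meson mult_right_mono order_trans zero_le)
      qed
    qed
  next
    case (6 \<pi>)
    then show ?case by simp
  qed
  then show ?thesis ..
qed

text \<open>The two quantitative properties through which the noise enters the approximation
  argument: integrals along diagrams are bounded by the norms of the rows, and bounded sets have
  finite norm. The auxiliary spaces, whose types vary with the noise, are hidden behind the
  first.\<close>

locale tame_noise = noise \<gamma> \<Lambda> for \<gamma> and \<Lambda> :: "(real ^ 'd) correlation" +
  assumes diagram_bound: "\<And>m n D. D \<in> diagrams m n \<Longrightarrow>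
      \<exists>c. c \<noteq> \<top> \<and> (\<forall>g. (\<forall>k\<in>{1..m}. g k \<in> \<F> (n k)) \<longrightarrow>
        (\<integral>\<^sup>+z. (\<Prod>k\<in>{1..m}. g k (row n k z)) \<partial>\<nu> (vertices m n) D) \<le>
          c * (\<Prod>k\<in>{1..m}. esqrt (sq_norm (n k) (g k))))"
    and bounded_finite: "\<And>r. (\<integral>\<^sup>+z. indicator (cball 0 r) (fst z 1, snd z 1) * indicator (cball 0 r) (fst z 2, snd z 2)
      \<partial>\<nu> {1, 2 :: nat} {(1, 2)}) < \<infinity>"

section \<open>Local integrability of the correlations\<close>

lemma powr_locally_integrable:
  fixes r :: real
  assumes l: "l < 1"
  shows "(\<integral>\<^sup>+u. ennreal (\<bar>u\<bar> powr (- l)) * indicator (ball 0 r) u \<partial>lborel) < \<infinity>"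
proof -
  define g where "g s = ennreal (s powr (- l)) * indicator {0..\<bar>r\<bar>} s" for s
  have g: "g \<in> borel_measurable borel" unfolding g_def by measurable
  have "(\<integral>\<^sup>+u. g (- u) \<partial>lborel) = (\<integral>\<^sup>+u. g u \<partial>distr lborel borel uminus)"
    by (rule nn_integral_distr[symmetric]) (use g in simp_all)
  then have sym: "(\<integral>\<^sup>+u. g (- u) \<partial>lborel) = (\<integral>\<^sup>+u. g u \<partial>lborel)" by (simp only: lborel_distr_uminus)
  have "(\<integral>\<^sup>+u. ennreal (\<bar>u\<bar> powr (- l)) * indicator (ball 0 r) u \<partial>lborel) \<le> (\<integral>\<^sup>+u. g u + g (- u) \<partial>lborel)"
    by (intro nn_integral_mono) (auto simp: g_def indicator_def abs_if)
  also have "\<dots> = (\<integral>\<^sup>+u. g u \<partial>lborel) + (\<integral>\<^sup>+u. g u \<partial>lborel)"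
    using g by (subst nn_integral_add) (simp_all add: sym)
  also have "\<dots> < \<infinity>" using nn_integral_powr_head[of "- l" "\<bar>r\<bar>"] l unfolding g_def by simp
  finally show ?thesis .
qed

context correlation_base
begin

definition locally_finite :: bool where
  "locally_finite \<longleftrightarrow> (\<forall>r. (\<integral>\<^sup>+z. indicator (ball 0 r) (z 1) * indicator (ball 0 r) (z 2)
     \<partial>\<C> {1, 2 :: nat} {(1, 2)}) < \<infinity>)"

text \<open>For x and y in the ball of radius r the difference lies in the ball of radius 2r, and by
  translation invariance of Lebesgue measure the resulting bound on the integral over x does not
  depend on y. The hypothesis on \<open>B\<close> covers the half-line as well as the whole
  space.\<close>

lemma locally_finite_Kernel:
  assumes \<kappa>: "\<kappa> = Kernel k"
    and B: "\<And>f. f \<in> borel_measurable borel \<Longrightarrow> (\<integral>\<^sup>+x. f x \<partial>B) \<le> (\<integral>\<^sup>+x. f x \<partial>lborel)"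
    and k: "\<And>r. (\<integral>\<^sup>+u. ennreal (k u) * indicator (ball 0 r) u \<partial>lborel) < \<infinity>"
  shows locally_finite
  unfolding locally_finite_def
proof
  fix r :: real
  let ?k = "(\<integral>\<^sup>+u. ennreal (k u) * indicator (ball 0 (2 * r)) u \<partial>lborel)"
  have [measurable]: "k \<in> borel_measurable borel" using kernel_measurable[OF \<kappa>] .
  let ?i = "indicator (ball (0 :: 'a) r) :: 'a \<Rightarrow> ennreal"
  have i [measurable]: "?i \<in> borel_measurable borel" by (rule borel_measurable_indicator) simp
  have iB [measurable]: "?i \<in> borel_measurable B" by (rule measurable_compose[OF id_B i])
  have [measurable]: "(indicator (ball 0 (2 * r)) :: 'a \<Rightarrow> ennreal) \<in> borel_measurable borel"
    by (rule borel_measurable_indicator) simp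
  have m: "(\<lambda>(x, y). ?i x * ?i y) \<in> borel_measurable (B \<Otimes>\<^sub>M B)" by measurable
  have "(\<integral>\<^sup>+z. ?i (z 1) * ?i (z 2) \<partial>\<C> {1, 2 :: nat} {(1, 2)}) =
    (\<integral>\<^sup>+y. \<integral>\<^sup>+x. ennreal (k (x - y)) * (?i x * ?i y) \<partial>B \<partial>B)"
    by (simp only: pair_integral_measurable_eq[OF m, symmetric] pair_integral_Kernel[OF \<kappa>])
  also have "\<dots> \<le> (\<integral>\<^sup>+y. ?k * ?i y \<partial>B)"
  proof (rule nn_integral_mono)
    fix y
    have "(\<integral>\<^sup>+x. ennreal (k (x - y)) * (?i x * ?i y) \<partial>B) \<le> (\<integral>\<^sup>+x. ennreal (k (x - y)) * (?i x * ?i y) \<partial>lborel)"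
      by (rule B) measurable
    also have "\<dots> \<le> (\<integral>\<^sup>+x. (ennreal (k (x - y)) * indicator (ball 0 (2 * r)) (x - y)) * ?i y \<partial>lborel)"
    proof (rule nn_integral_mono)
      fix x
      have "norm (x - y) < 2 * r" if "norm x < r" "norm y < r" using that norm_triangle_ineq4[of x y] by linarith
      then show "ennreal (k (x - y)) * (?i x * ?i y) \<le> (ennreal (k (x - y)) * indicator (ball 0 (2 * r)) (x - y)) * ?i y"
        by (auto simp: indicator_def)
    qed
    also have "\<dots> = (\<integral>\<^sup>+x. ennreal (k (x - y)) * indicator (ball 0 (2 * r)) (x - y) \<partial>lborel) * ?i y"
      by (rule nn_integral_multc) measurable
    also have "(\<integral>\<^sup>+x. ennreal (k (x - y)) * indicator (ball 0 (2 * r)) (x - y) \<partial>lborel) =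
      (\<integral>\<^sup>+u. ennreal (k u) * indicator (ball 0 (2 * r)) u \<partial>distr lborel borel (\<lambda>x. - y + x))"
      by (subst nn_integral_distr) (simp_all only: measurable_lborel1 add.commute[of "- y"] diff_conv_add_uminus[symmetric], measurable)
    also have "distr lborel borel (\<lambda>x. - y + x) = lborel" by (rule lborel_distr_plus)
    finally show "(\<integral>\<^sup>+x. ennreal (k (x - y)) * (?i x * ?i y) \<partial>B) \<le>
      ?k * ?i y" .
  qed
  also have "\<dots> = ?k * (\<integral>\<^sup>+y. ?i y \<partial>B)"
    by (rule nn_integral_cmult) measurable
  also have "\<dots> \<le> ?k * (\<integral>\<^sup>+y. ?i y \<partial>lborel)"
    by (intro mult_left_mono B) simp_all
  also have "\<dots> < \<infinity>"
    using k[of "2 * r"] emeasure_lborel_ball_finite[of "0 :: 'a" r] by (simp add: ennreal_mult_less_top)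
  finally show "(\<integral>\<^sup>+z. ?i (z 1) * ?i (z 2) \<partial>\<C> {1, 2 :: nat} {(1, 2)}) < \<infinity>" .
qed

lemma locally_finite_Delta:
  assumes \<kappa>: "\<kappa> = Delta"
    and B: "\<And>f. f \<in> borel_measurable borel \<Longrightarrow> (\<integral>\<^sup>+x. f x \<partial>B) \<le> (\<integral>\<^sup>+x. f x \<partial>lborel)"
  shows locally_finite
  unfolding locally_finite_def
proof
  fix r :: real
  let ?i = "indicator (ball (0 :: 'a) r) :: 'a \<Rightarrow> ennreal"
  have i [measurable]: "?i \<in> borel_measurable borel" by (rule borel_measurable_indicator) simp
  have iB [measurable]: "?i \<in> borel_measurable B" by (rule measurable_compose[OF id_B i])
  have m: "(\<lambda>(x, y). ?i x * ?i y) \<in> borel_measurable (B \<Otimes>\<^sub>M B)" by measurable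
  have "(\<integral>\<^sup>+z. ?i (z 1) * ?i (z 2) \<partial>\<C> {1, 2 :: nat} {(1, 2)}) = (\<integral>\<^sup>+x. ?i x * ?i x \<partial>B)"
    by (simp only: pair_integral_measurable_eq[OF m, symmetric] pair_integral_Delta[OF \<kappa>])
  also have "\<dots> = (\<integral>\<^sup>+x. ?i x \<partial>B)" by (intro nn_integral_cong) (simp add: indicator_def)
  also have "\<dots> \<le> (\<integral>\<^sup>+x. ?i x \<partial>lborel)" by (rule B) simp
  also have "\<dots> < \<infinity>" using emeasure_lborel_ball_finite[of "0 :: 'a" r] by simp
  finally show "(\<integral>\<^sup>+z. ?i (z 1) * ?i (z 2) \<partial>\<C> {1, 2 :: nat} {(1, 2)}) < \<infinity>" .
qed

end

lemma kernel_locally_integrable: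
  fixes k :: "real \<Rightarrow> real"
  assumes l: "l < 1" and C: "0 < C" and k: "\<And>x. x \<noteq> 0 \<Longrightarrow> k x \<le> C * \<bar>x\<bar> powr (- l)"
  shows "(\<integral>\<^sup>+u. ennreal (k u) * indicator (ball 0 r) u \<partial>lborel) < \<infinity>"
proof -
  have "(\<integral>\<^sup>+u. ennreal (k u) * indicator (ball 0 r) u \<partial>lborel) \<le>
    (\<integral>\<^sup>+u. ennreal C * (ennreal (\<bar>u\<bar> powr (- l)) * indicator (ball 0 r) u) \<partial>lborel)"
  proof (rule nn_integral_mono_AE, rule eventually_mono[OF AE_lborel_singleton[of 0]])
    fix u :: real assume "u \<noteq> 0"
    then have "ennreal (k u) \<le> ennreal C * ennreal (\<bar>u\<bar> powr (- l))"
      using k[of u] C by (simp add: ennreal_mult'[symmetric] ennreal_leI)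
    then show "ennreal (k u) * indicator (ball 0 r) u \<le> ennreal C * (ennreal (\<bar>u\<bar> powr (- l)) * indicator (ball 0 r) u)"
      by (auto simp: indicator_def)
  qed
  also have "\<dots> = ennreal C * (\<integral>\<^sup>+u. ennreal (\<bar>u\<bar> powr (- l)) * indicator (ball 0 r) u \<partial>lborel)"
    by (rule nn_integral_cmult) measurable
  also have "\<dots> < \<infinity>" using powr_locally_integrable[OF l, of r] by (simp add: ennreal_mult_less_top)
  finally show ?thesis .
qed

text \<open>Each coordinate is at most the norm in absolute value, and the exponent is divided
  evenly among the coordinates. For l < d the new exponents l/d are below 1, so local integrability
  of the isotropic kernel reduces to the product case.\<close>

lemma norm_powr_le_product:
  fixes x :: "real ^ 'd"
  assumes "0 < l" "\<And>j. x $ j \<noteq> 0"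
  shows "norm x powr (- l) \<le> (\<Prod>j\<in>UNIV. \<bar>x $ j\<bar> powr (- (l / real CARD('d))))"
proof -
  have x: "0 < norm x" using assms(2)[of undefined] by auto
  have "norm x powr (- l) = (norm x powr (- (l / real CARD('d)))) ^ CARD('d)"
    using x by (simp add: powr_realpow[symmetric] powr_powr)
  also have "\<dots> = (\<Prod>j\<in>(UNIV :: 'd set). norm x powr (- (l / real CARD('d))))" by simp
  also have "\<dots> \<le> (\<Prod>j\<in>UNIV. \<bar>x $ j\<bar> powr (- (l / real CARD('d))))"
    using assms component_le_norm_cart[of x] by (intro prod_mono) (auto intro!: powr_mono2')
  finally show ?thesis .
qed

text \<open>The ball lies in a cube, over which the integral of the bound splits into
  one-dimensional integrals with exponents below 1.\<close>

lemma product_kernel_locally_integrable: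
  fixes k :: "real ^ 'd \<Rightarrow> real"
  assumes l: "\<And>j. 0 < l j" "\<And>j. l j < 1" and C: "0 < C"
    and k: "\<And>x. (\<And>j. x $ j \<noteq> 0) \<Longrightarrow> k x \<le> C * (\<Prod>j\<in>UNIV. \<bar>x $ j\<bar> powr (- l j))"
  shows "(\<integral>\<^sup>+u. ennreal (k u) * indicator (ball 0 r) u \<partial>lborel) < \<infinity>"
proof -
  let ?i = "indicator (ball (0 :: real) r) :: real \<Rightarrow> ennreal"
  \<comment> \<open>The inverse of \<open>\<lambda>j. axis j 1\<close>: the product formula for
    Lebesgue measure is indexed by basis vectors, the exponents by coordinates.\<close>
  define ix where "ix b = (SOME j. b = (axis j 1 :: real ^ 'd))" for b
  have ix: "ix (axis j 1) = j" for j
    unfolding ix_def by (rule some_equality) (auto simp: axis_eq_axis)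
  let ?f = "\<lambda>b x. ennreal (\<bar>x\<bar> powr (- l (ix b))) * ?i x"
  have Basis: "Basis = (\<lambda>j. axis j 1 :: real ^ 'd) ` UNIV" by (auto simp: Basis_vec_def)
  have pr: "(\<Prod>b\<in>Basis. ?f b (x \<bullet> b)) = (\<Prod>j\<in>UNIV. ennreal (\<bar>x $ j\<bar> powr (- l j)) * ?i (x $ j))" for x :: "real ^ 'd"
    unfolding Basis by (subst prod.reindex) (auto simp: inj_on_def axis_eq_axis ix inner_axis)
  have ae: "AE x in (lborel :: (real ^ 'd) measure). \<forall>j\<in>UNIV. x $ j \<noteq> 0"
    by (intro AE_finite_allI hyperplane_AE) simp
  have "(\<integral>\<^sup>+u. ennreal (k u) * indicator (ball 0 r) u \<partial>lborel) \<le>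
    (\<integral>\<^sup>+u. ennreal C * (\<Prod>b\<in>Basis. ?f b (u \<bullet> b)) \<partial>lborel)"
  proof (rule nn_integral_mono_AE)
    show "AE u in lborel. ennreal (k u) * indicator (ball 0 r) u \<le> ennreal C * (\<Prod>b\<in>Basis. ?f b (u \<bullet> b))"
      using ae
    proof eventually_elim
    case (elim u)
    show ?case
    proof (cases "u \<in> ball 0 r")
      case True
      have "norm (u $ j) < r" for j using True component_le_norm_cart[of u j] by (simp add: le_less_trans)
      then have i: "?i (u $ j) = 1" for j by (simp add: indicator_def)
      have "ennreal (k u) \<le> ennreal (C * (\<Prod>j\<in>UNIV. \<bar>u $ j\<bar> powr (- l j)))"
        using k[of u] elim by (intro ennreal_leI) simp
      also have "\<dots> = ennreal C * (\<Prod>j\<in>UNIV. ennreal (\<bar>u $ j\<bar> powr (- l j)))"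
        using C by (simp add: ennreal_mult' prod_ennreal)
      finally show ?thesis using True by (simp add: pr i)
    qed simp
    qed
  qed
  also have "\<dots> = ennreal C * (\<Prod>b\<in>Basis. \<integral>\<^sup>+x. ?f b x \<partial>lborel)"
  proof -
    have fm: "?f b \<in> borel_measurable borel" for b by measurable
    have "(\<lambda>u :: real ^ 'd. \<Prod>b\<in>Basis. ?f b (u \<bullet> b)) \<in> borel_measurable lborel"
    proof (rule borel_measurable_prod_ennreal)
      fix b :: "real ^ 'd"
      have "(\<lambda>u. u \<bullet> b) \<in> lborel \<rightarrow>\<^sub>M borel" by simp
      from measurable_compose[OF this fm] show "(\<lambda>u. ?f b (u \<bullet> b)) \<in> borel_measurable lborel" .
    qed
    then have "(\<integral>\<^sup>+u. ennreal C * (\<Prod>b\<in>Basis. ?f b (u \<bullet> b)) \<partial>(lborel :: (real ^ 'd) measure)) =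
      ennreal C * (\<integral>\<^sup>+u. (\<Prod>b\<in>Basis. ?f b (u \<bullet> b)) \<partial>(lborel :: (real ^ 'd) measure))"
      by (rule nn_integral_cmult)
    also have "(\<integral>\<^sup>+u. (\<Prod>b\<in>Basis. ?f b (u \<bullet> b)) \<partial>(lborel :: (real ^ 'd) measure)) = (\<Prod>b\<in>Basis. \<integral>\<^sup>+x. ?f b x \<partial>lborel)"
      by (rule nn_integral_lborel_prod[OF fm]) simp
    finally show ?thesis .
  qed
  also have "\<dots> < \<infinity>"
  proof -
    have "(\<integral>\<^sup>+x. ?f b x \<partial>lborel) < \<infinity>" for b
      using powr_locally_integrable[of "l (ix b)" r] l by simp
    then have "(\<integral>\<^sup>+x. ?f b x \<partial>lborel) \<noteq> \<top>" for b by (simp add: less_top[symmetric])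
    then have "(\<Prod>b\<in>(Basis :: (real ^ 'd) set). \<integral>\<^sup>+x. ?f b x \<partial>lborel) \<noteq> \<top>"
      by (auto simp only: ennreal_prod_eq_top)
    then show ?thesis by (simp add: ennreal_mult_less_top less_top)
  qed
  finally show ?thesis .
qed

text \<open>A closed ball of radius r in space-time lies in the product of the open balls of radius
  r + 1, so the double integral is at most a time integral multiplied by a space integral.\<close>

lemma (in noise) bounded_finite_if_locally_finite:
  assumes T: "T.locally_finite" and X: "X.locally_finite"
  shows "(\<integral>\<^sup>+z. indicator (cball 0 r) (fst z 1, snd z 1) * indicator (cball 0 r) (fst z 2, snd z 2)
      \<partial>\<nu> {1, 2 :: nat} {(1, 2)}) < \<infinity>"
proof -
  let ?T = "correlation_measure \<gamma> half_line {1, 2 :: nat} {(1, 2)}" and ?X = "correlation_measure \<Lambda> lborel {1, 2 :: nat} {(1, 2)}"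
  let ?i = "indicator (ball (0 :: real) (r + 1)) :: real \<Rightarrow> ennreal" and ?j = "indicator (ball (0 :: real ^ 'd) (r + 1)) :: _ \<Rightarrow> ennreal"
  have im: "(\<lambda>\<tau>. ?i (\<tau> v)) \<in> borel_measurable (\<Pi>\<^sub>M v\<in>{1, 2 :: nat}. half_line)" if "v \<in> {1, 2}" for v :: nat
    by (rule measurable_compose[OF T.component_borel[OF that]]) simp
  have jm: "(\<lambda>\<xi>. ?j (\<xi> v)) \<in> borel_measurable (\<Pi>\<^sub>M v\<in>{1, 2 :: nat}. lborel)" if "v \<in> {1, 2}" for v :: nat
    by (rule measurable_compose[OF X.component_borel[OF that]]) simp
  have im2: "(\<lambda>\<tau>. ?i (\<tau> 1) * ?i (\<tau> 2)) \<in> borel_measurable (\<Pi>\<^sub>M v\<in>{1, 2 :: nat}. half_line)"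
    using im[of 1] im[of 2] by (intro borel_measurable_times_ennreal) auto
  have jm2: "(\<lambda>\<xi>. ?j (\<xi> 1) * ?j (\<xi> 2)) \<in> borel_measurable (\<Pi>\<^sub>M v\<in>{1, 2 :: nat}. lborel)"
    using jm[of 1] jm[of 2] by (intro borel_measurable_times_ennreal) auto
  have m: "(\<lambda>z. (?i (fst z 1) * ?i (fst z 2)) * (?j (snd z 1) * ?j (snd z 2))) \<in> borel_measurable (config {1, 2 :: nat})"
    by (intro borel_measurable_times_ennreal[OF measurable_compose[OF measurable_fst im2] measurable_compose[OF measurable_snd jm2]])
  have "(\<integral>\<^sup>+z. indicator (cball 0 r) (fst z 1, snd z 1) * indicator (cball 0 r) (fst z 2, snd z 2) \<partial>noise12) \<le>
    (\<integral>\<^sup>+z. (?i (fst z 1) * ?i (fst z 2)) * (?j (snd z 1) * ?j (snd z 2)) \<partial>noise12)"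
  proof (rule nn_integral_mono)
    fix z :: "(nat, 'd) configuration"
    have *: "indicator (cball 0 r) (s, y) \<le> ?i s * ?j y" for s y
    proof -
      have "norm s < r + 1" "norm y < r + 1" if "norm (s, y) \<le> r"
        using that norm_fst_le[of s y] norm_snd_le[of y s] by linarith+
      then show ?thesis by (auto simp: indicator_def)
    qed
    have "indicator (cball 0 r) (fst z 1, snd z 1) * indicator (cball 0 r) (fst z 2, snd z 2) \<le>
      (?i (fst z 1) * ?j (snd z 1)) * (?i (fst z 2) * ?j (snd z 2))"
      by (intro mult_mono *) simp_all
    then show "indicator (cball 0 r) (fst z 1, snd z 1) * indicator (cball 0 r) (fst z 2, snd z 2) \<le>
      (?i (fst z 1) * ?i (fst z 2)) * (?j (snd z 1) * ?j (snd z 2))" by (simp only: mult_ac)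
  qed
  also have "\<dots> = (\<integral>\<^sup>+\<tau>. \<integral>\<^sup>+\<xi>. (?i (\<tau> 1) * ?i (\<tau> 2)) * (?j (\<xi> 1) * ?j (\<xi> 2)) \<partial>?X \<partial>?T)"
    by (subst nn_integral_noise[OF pairing_12 m]) (simp only: fst_conv snd_conv)
  also have "\<dots> = (\<integral>\<^sup>+\<tau>. (?i (\<tau> 1) * ?i (\<tau> 2)) * (\<integral>\<^sup>+\<xi>. ?j (\<xi> 1) * ?j (\<xi> 2) \<partial>?X) \<partial>?T)"
    using jm2 by (intro nn_integral_cong nn_integral_cmult) (simp only: measurable_cong_sets[OF X.sets_correlation_measure refl])
  also have "\<dots> = (\<integral>\<^sup>+\<tau>. ?i (\<tau> 1) * ?i (\<tau> 2) \<partial>?T) * (\<integral>\<^sup>+\<xi>. ?j (\<xi> 1) * ?j (\<xi> 2) \<partial>?X)"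
    using im2 by (intro nn_integral_multc) (simp only: measurable_cong_sets[OF T.sets_correlation_measure refl])
  also have "\<dots> < \<infinity>"
    using T X unfolding T.locally_finite_def X.locally_finite_def by (simp add: ennreal_mult_less_top del: One_nat_def)
  finally show ?thesis .
qed

lemma half_line_le_lborel:
  assumes "f \<in> borel_measurable borel"
  shows "(\<integral>\<^sup>+x. f x \<partial>restrict_space lborel {0 :: real..}) \<le> (\<integral>\<^sup>+x. f x \<partial>lborel)"
  using assms by (subst nn_integral_restrict_space) (auto intro!: nn_integral_mono simp: indicator_def)

lemma admissible_tame_noise:
  fixes \<gamma> :: "real correlation" and \<Lambda> :: "(real ^ 'd) correlation"
  assumes "admissible_noise \<gamma> \<Lambda>"
  shows "tame_noise \<gamma> \<Lambda>"
proof -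
  have gk: "covariance_function k \<and> (\<exists>\<gamma>0 c C. 0 < \<gamma>0 \<and> \<gamma>0 < 1 \<and> 0 < c \<and> 0 < C \<and>
             (\<forall>t>0. c * \<bar>t\<bar> powr (- \<gamma>0) \<le> k t \<and> k t \<le> C * \<bar>t\<bar> powr (- \<gamma>0)))" if "\<gamma> = Kernel k" for k
    using assms that unfolding admissible_noise_def by simp
  have Lk: "covariance_function k \<and>
          ((\<exists>l c C. 0 < l \<and> l < real CARD('d) \<and> 0 < c \<and> 0 < C \<and>
              (\<forall>x. x \<noteq> 0 \<longrightarrow> c * norm x powr (- l) \<le> k x \<and> k x \<le> C * norm x powr (- l))) \<or>
           (\<exists>(l :: 'd \<Rightarrow> real) c C. (\<forall>j. 0 < l j \<and> l j < 1) \<and> 0 < c \<and> 0 < C \<and>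
              (\<forall>x. (\<forall>j. x $ j \<noteq> 0) \<longrightarrow>
                 c * (\<Prod>j\<in>UNIV. \<bar>x $ j\<bar> powr (- l j)) \<le> k x \<and>
                 k x \<le> C * (\<Prod>j\<in>UNIV. \<bar>x $ j\<bar> powr (- l j)))))" if "\<Lambda> = Kernel k" for k
    using assms that unfolding admissible_noise_def by simp
  interpret noise \<gamma> \<Lambda>
    by standard (use gk Lk in \<open>auto simp: covariance_function_def\<close>)
  \<comment> \<open>The auxiliary spaces have different types, so the possible features are kept as
    alternatives with the types written out.\<close>
  have "((\<exists>A Q. feature \<gamma> half_line ((lborel :: real measure) \<Otimes>\<^sub>M (lborel :: real measure)) Q A) \<or>
      feature \<gamma> half_line half_line (Point (\<lambda>x. x)) 1) \<and> T.locally_finite"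
  proof (cases \<gamma>)
    case (Kernel k)
    obtain l c C where l: "0 < l" "l < 1" and c: "0 < c" "0 < C"
      and k: "\<And>t. 0 < t \<Longrightarrow> c * \<bar>t\<bar> powr (- l) \<le> k t \<and> k t \<le> C * \<bar>t\<bar> powr (- l)"
      using gk[OF Kernel] by blast
    \<comment> \<open>The bounds are given for positive times; by symmetry of the covariance they
      hold everywhere off the origin.\<close>
    have ev: "k (- x) = k x" for x using gk[OF Kernel] unfolding covariance_function_def by blast
    have k': "c * norm x powr (- l) \<le> k x \<and> k x \<le> C * norm x powr (- l)" if "x \<noteq> 0" for x
      using k[of "\<bar>x\<bar>"] ev[of x] that by (cases "0 \<le> x") auto
    have ae: "AE x in half_line. x \<noteq> y" for y
      using AE_lborel_singleton[of y] by (auto simp: AE_restrict_space_iff elim: eventually_mono)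
    have base: "correlation_base (Kernel k) half_line" using T.correlation_base_axioms Kernel by simp
    have "\<exists>A. feature (Kernel k) half_line (lborel \<Otimes>\<^sub>M lborel) (Weight (riesz l)) A"
      by (rule feature_riesz[OF base ae l(1) c k'])
    moreover have "T.locally_finite"
      using kernel_locally_integrable[of l C k] l c k'
      by (intro T.locally_finite_Kernel[OF Kernel half_line_le_lborel]) auto
    ultimately show ?thesis unfolding Kernel by blast
  next
    case Delta
    have base: "correlation_base Delta half_line" using T.correlation_base_axioms Delta by simp
    have "feature Delta half_line half_line (Point (\<lambda>x. x)) 1" by (rule feature_Delta[OF base])
    moreover have "T.locally_finite" by (rule T.locally_finite_Delta[OF Delta half_line_le_lborel])
    ultimately show ?thesis unfolding Delta by blast
  qed
  then have timeF: "(\<exists>A Q. feature \<gamma> half_line ((lborel :: real measure) \<Otimes>\<^sub>M (lborel :: real measure)) Q A) \<or>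
      feature \<gamma> half_line half_line (Point (\<lambda>x. x)) 1" and timeL: "T.locally_finite" by blast+
  let ?X = "lborel :: (real ^ 'd) measure"
  have "((\<exists>A Q. feature \<Lambda> ?X (?X \<Otimes>\<^sub>M (lborel :: real measure)) Q A) \<or>
      (\<exists>A Q. feature \<Lambda> ?X (riesz_base :: ('d \<Rightarrow> _) measure) Q A) \<or> feature \<Lambda> ?X ?X (Point (\<lambda>x. x)) 1) \<and> X.locally_finite"
  proof (cases \<Lambda>)
    case (Kernel k)
    have base: "correlation_base (Kernel k) ?X" using X.correlation_base_axioms Kernel by simp
    from Lk[OF Kernel] consider
      (R) l c C where "0 < l" "l < real CARD('d)" "0 < c" "0 < C"
            "\<And>x. x \<noteq> 0 \<Longrightarrow> c * norm x powr (- l) \<le> k x \<and> k x \<le> C * norm x powr (- l)"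
      | (P) l c C where "\<And>j :: 'd. 0 < l j" "\<And>j. l j < 1" "0 < c" "0 < C"
            "\<And>x. (\<And>j. x $ j \<noteq> 0) \<Longrightarrow> c * (\<Prod>j\<in>UNIV. \<bar>x $ j\<bar> powr (- l j)) \<le> k x \<and>
               k x \<le> C * (\<Prod>j\<in>UNIV. \<bar>x $ j\<bar> powr (- l j))"
      by blast
    then show ?thesis
    proof cases
      case R
      have "\<exists>A. feature (Kernel k) ?X (lborel \<Otimes>\<^sub>M lborel) (Weight (riesz l)) A"
        by (rule feature_riesz[OF base AE_lborel_singleton R(1,3,4,5)])
      moreover have "X.locally_finite"
      proof (rule X.locally_finite_Kernel[OF Kernel order_refl])
        fix r
        show "(\<integral>\<^sup>+u. ennreal (k u) * indicator (ball 0 r) u \<partial>lborel) < \<infinity>"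
        proof (rule product_kernel_locally_integrable[where l="\<lambda>_. l / real CARD('d)", OF _ _ R(4)])
          fix x :: "real ^ 'd" assume x: "\<And>j. x $ j \<noteq> 0"
          then have "x \<noteq> 0" by (metis zero_index)
          then have "k x \<le> C * norm x powr (- l)" using R(5) by blast
          also have "\<dots> \<le> C * (\<Prod>j\<in>UNIV. \<bar>x $ j\<bar> powr (- (l / real CARD('d))))"
            using R(1,4) x by (intro mult_left_mono norm_powr_le_product) simp_all
          finally show "k x \<le> C * (\<Prod>j\<in>UNIV. \<bar>x $ j\<bar> powr (- (l / real CARD('d))))" .
        qed (use R(1,2) in simp_all)
      qed
      ultimately show ?thesis unfolding Kernel by blast
    next
      case P
      have "\<exists>A. feature (Kernel k) ?X riesz_base (Weight (product_riesz l)) A"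
        by (rule feature_product_riesz[OF base P(1,3,4,5)])
      moreover have "X.locally_finite"
      proof (rule X.locally_finite_Kernel[OF Kernel order_refl])
        fix r
        show "(\<integral>\<^sup>+u. ennreal (k u) * indicator (ball 0 r) u \<partial>lborel) < \<infinity>"
          by (rule product_kernel_locally_integrable[OF P(1,2,4) conjunct2[OF P(5)]])
      qed
      ultimately show ?thesis unfolding Kernel by blast
    qed
  next
    case Delta
    have base: "correlation_base Delta ?X" using X.correlation_base_axioms Delta by simp
    have "feature Delta ?X ?X (Point (\<lambda>x. x)) 1" by (rule feature_Delta[OF base])
    moreover have "X.locally_finite" by (rule X.locally_finite_Delta[OF Delta order_refl])
    ultimately show ?thesis unfolding Delta by blast
  qed
  then have spaceF: "(\<exists>A Q. feature \<Lambda> ?X (?X \<Otimes>\<^sub>M (lborel :: real measure)) Q A) \<or>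
      (\<exists>A Q. feature \<Lambda> ?X (riesz_base :: ('d \<Rightarrow> _) measure) Q A) \<or> feature \<Lambda> ?X ?X (Point (\<lambda>x. x)) 1" and spaceL: "X.locally_finite"
    by blast+
  note bound = noise_features.diagram_bound[OF noise_features.intro[OF noise_axioms]]
  show ?thesis
  proof (rule tame_noise.intro[OF noise_axioms], rule tame_noise_axioms.intro)
    fix m n and D :: "((nat \<times> nat) \<times> (nat \<times> nat)) set" assume D: "D \<in> diagrams m n"
    show "\<exists>c. c \<noteq> \<top> \<and> (\<forall>g. (\<forall>k\<in>{1..m}. g k \<in> \<F> (n k)) \<longrightarrow>
        (\<integral>\<^sup>+z. (\<Prod>k\<in>{1..m}. g k (row n k z)) \<partial>\<nu> (vertices m n) D) \<le>
          c * (\<Prod>k\<in>{1..m}. esqrt (sq_norm (n k) (g k))))"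
      using timeF spaceF by - (elim disjE exE; rule bound[OF _ _ D]; assumption)
  next
    fix r :: real
    show "(\<integral>\<^sup>+z. indicator (cball 0 r) (fst z 1, snd z 1) * indicator (cball 0 r) (fst z 2, snd z 2)
      \<partial>\<nu> {1, 2 :: nat} {(1, 2)}) < \<infinity>"
      by (rule bounded_finite_if_locally_finite[OF timeL spaceL])
  qed
qed

section \<open>Test functions\<close>

text \<open>The functions p(1/s) e^(-1/s), extended by 0 to s \<le> 0: the derivatives of all orders
  of the classical flat function e^(-1/s) have this form.\<close>

definition flat :: "real poly \<Rightarrow> real \<Rightarrow> real" where
  "flat p s = (if 0 < s then poly p (1 / s) * exp (- 1 / s) else 0)"

lemma poly_exp_decay: "((\<lambda>y. poly p y * exp (- y)) \<longlongrightarrow> 0) at_top" for p :: "real poly"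
proof -
  have "((\<lambda>y. \<Sum>i\<le>degree p. coeff p i * (y ^ i / exp y)) \<longlongrightarrow> (\<Sum>i\<le>degree p. coeff p i * 0)) at_top"
    by (intro tendsto_sum tendsto_mult tendsto_const tendsto_power_div_exp_0)
  then show ?thesis by (simp add: poly_altdef sum_distrib_right exp_minus divide_inverse mult.assoc)
qed

text \<open>The derivative of p(1/s) contributes -p'(1/s)/s^2 and that of the exponential
  e^(-1/s)/s^2, whence the polynomial (p - p') X^2. At 0 the difference quotient is 0 on the left
  and on the right the same kind of function with polynomial p X, which tends to 0.\<close>

lemma flat_has_derivative:
  "(flat p has_real_derivative flat ((p - pderiv p) * [:0, 0, 1:]) s) (at s)"
proof -
  consider "0 < s" | "s < 0" | "s = 0" by linarith
  then show ?thesis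
  proof cases
    case 1
    have "((\<lambda>s. poly p (1 / s) * exp (- 1 / s)) has_real_derivative
      poly (pderiv p) (1 / s) * (- 1 / s\<^sup>2) * exp (- 1 / s) + poly p (1 / s) * (exp (- 1 / s) * (1 / s\<^sup>2))) (at s)"
      using 1 by (auto intro!: derivative_eq_intros DERIV_chain'[where g="poly p" and f="\<lambda>s. 1 / s"] poly_DERIV simp: power2_eq_square field_simps)
    moreover have "poly (pderiv p) (1 / s) * (- 1 / s\<^sup>2) * exp (- 1 / s) + poly p (1 / s) * (exp (- 1 / s) * (1 / s\<^sup>2)) =
      flat ((p - pderiv p) * [:0, 0, 1:]) s"
      using 1 by (simp add: flat_def field_simps power2_eq_square)
    ultimately have "((\<lambda>s. poly p (1 / s) * exp (- 1 / s)) has_real_derivative flat ((p - pderiv p) * [:0, 0, 1:]) s) (at s)"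
      by simp
    then show ?thesis
      by (rule has_field_derivative_transform_within_open[where S="{0<..}"]) (use 1 in \<open>auto simp: flat_def\<close>)
  next
    case 2
    have "((\<lambda>s. 0) has_real_derivative flat ((p - pderiv p) * [:0, 0, 1:]) s) (at s)"
      using 2 by (simp add: flat_def)
    then show ?thesis
      by (rule has_field_derivative_transform_within_open[where S="{..<0}"]) (use 2 in \<open>auto simp: flat_def\<close>)
  next
    case 3
    have "((\<lambda>h. flat p h / h) \<longlongrightarrow> 0) (at 0)"
    proof (rule filterlim_split_at_real)
      have "((\<lambda>h. 0) \<longlongrightarrow> (0 :: real)) (at_left 0)" by simp
      then show "((\<lambda>h. flat p h / h) \<longlongrightarrow> 0) (at_left 0)"
        by (rule Lim_transform_eventually) (auto simp: eventually_at_filter flat_def intro!: always_eventually)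
      have "((\<lambda>h. poly (p * [:0, 1:]) (inverse h) * exp (- inverse h)) \<longlongrightarrow> 0) (at_right 0)"
        by (rule filterlim_compose[OF poly_exp_decay filterlim_inverse_at_top_right])
      then show "((\<lambda>h. flat p h / h) \<longlongrightarrow> 0) (at_right 0)"
        by (rule Lim_transform_eventually) (auto simp: eventually_at_filter flat_def field_simps intro!: always_eventually)
    qed
    then show ?thesis using 3 by (simp add: DERIV_def flat_def)
  qed
qed

text \<open>A class of functions that is visibly closed under directional derivatives.\<close>

inductive_set nice :: "('a::euclidean_space \<Rightarrow> real) set" where
  nice_const: "(\<lambda>x. c) \<in> nice"
| nice_flat: "(\<lambda>x. flat p (x \<bullet> v + c)) \<in> nice"
| nice_add: "f \<in> nice \<Longrightarrow> g \<in> nice \<Longrightarrow> (\<lambda>x. f x + g x) \<in> nice"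
| nice_mult: "f \<in> nice \<Longrightarrow> g \<in> nice \<Longrightarrow> (\<lambda>x. f x * g x) \<in> nice"

lemma nice_derivative:
  assumes "f \<in> nice"
  shows "\<exists>d. (\<forall>x. (f has_derivative d x) (at x)) \<and> (\<forall>v. (\<lambda>x. d x v) \<in> nice)"
  using assms
proof induction
  case (nice_const c)
  show ?case by (intro exI[of _ "\<lambda>x v. 0"] conjI allI has_derivative_const nice.nice_const)
next
  case (nice_flat p v c)
  let ?q = "(p - pderiv p) * [:0, 0, 1:]"
  have "((\<lambda>x. flat p (x \<bullet> v + c)) has_derivative (\<lambda>w. flat ?q (x \<bullet> v + c) * (w \<bullet> v))) (at x)" for x
  proof -
    have "((\<lambda>x. x \<bullet> v + c) has_derivative (\<lambda>w. w \<bullet> v)) (at x)" by (auto intro!: derivative_eq_intros)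
    from has_derivative_compose[OF this flat_has_derivative[unfolded has_field_derivative_def]]
    show ?thesis by simp
  qed
  moreover have "(\<lambda>x. flat ?q (x \<bullet> v + c) * (w \<bullet> v)) \<in> nice" for w
    by (intro nice.nice_mult nice.nice_flat nice.nice_const)
  ultimately show ?case by (intro exI[of _ "\<lambda>x w. flat ?q (x \<bullet> v + c) * (w \<bullet> v)"]) blast
next
  case (nice_add f g)
  then obtain df dg where d: "\<And>x. (f has_derivative df x) (at x)" "\<And>x. (g has_derivative dg x) (at x)"
    "\<And>v. (\<lambda>x. df x v) \<in> nice" "\<And>v. (\<lambda>x. dg x v) \<in> nice" by blast
  show ?case
    by (intro exI[of _ "\<lambda>x v. df x v + dg x v"] conjI allI has_derivative_add nice.nice_add d)
next
  case (nice_mult f g)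
  then obtain df dg where d: "\<And>x. (f has_derivative df x) (at x)" "\<And>x. (g has_derivative dg x) (at x)"
    "\<And>v. (\<lambda>x. df x v) \<in> nice" "\<And>v. (\<lambda>x. dg x v) \<in> nice" by blast
  show ?case
    by (intro exI[of _ "\<lambda>x v. f x * dg x v + df x v * g x"] conjI allI has_derivative_mult nice.nice_add nice.nice_mult d nice_mult.hyps)
qed

lemma directional_deriv_eq: "(f has_derivative d) (at x) \<Longrightarrow> directional_deriv v f x = d v"
  unfolding directional_deriv_def using frechet_derivative_at by metis

lemma nice_directional_deriv:
  assumes "f \<in> nice"
  shows "directional_deriv v f \<in> nice"
proof -
  obtain d where d: "\<And>x. (f has_derivative d x) (at x)" "\<And>v. (\<lambda>x. d x v) \<in> nice"
    using nice_derivative[OF assms] by blast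
  have "directional_deriv v f = (\<lambda>x. d x v)" using directional_deriv_eq[OF d(1)] by blast
  then show ?thesis using d(2) by simp
qed

lemma nice_smooth:
  assumes "f \<in> nice"
  shows "smooth f"
proof -
  have "foldr directional_deriv vs f \<in> nice" for vs
    using assms by (induction vs) (auto intro: nice_directional_deriv)
  then show ?thesis
    unfolding smooth_def using nice_derivative differentiableI by blast
qed

lemma nice_prod: "finite S \<Longrightarrow> (\<And>i. i \<in> S \<Longrightarrow> f i \<in> nice) \<Longrightarrow> (\<lambda>x. \<Prod>i\<in>S. f i x) \<in> nice"
  by (induction S rule: finite_induct) (auto intro: nice.intros)

section \<open>Smooth functions with bounded support\<close>

lemma smooth_differentiable: "smooth f \<Longrightarrow> f differentiable (at x)"
  unfolding smooth_def by (metis foldr_Nil id_apply)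

text \<open>Every iterated directional derivative of a sum is the sum of the iterated derivatives,
  because the intermediate functions are differentiable.\<close>

lemma smooth_add:
  assumes "smooth f" "smooth g"
  shows "smooth (\<lambda>x. f x + g x)"
proof -
  have "foldr directional_deriv vs (\<lambda>x. f x + g x) = (\<lambda>x. foldr directional_deriv vs f x + foldr directional_deriv vs g x)" for vs
  proof (induction vs)
    case (Cons v vs)
    show ?case
    proof
      fix x
      have "foldr directional_deriv vs f differentiable (at x)" "foldr directional_deriv vs g differentiable (at x)"
        using assms unfolding smooth_def by blast+
      then obtain d e where "(foldr directional_deriv vs f has_derivative d) (at x)" "(foldr directional_deriv vs g has_derivative e) (at x)"
        unfolding differentiable_def by blast
      from this directional_deriv_eq[OF has_derivative_add[OF this], of v]
      show "foldr directional_deriv (v # vs) (\<lambda>x. f x + g x) x = foldr directional_deriv (v # vs) f x + foldr directional_deriv (v # vs) g x"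
        by (simp add: Cons directional_deriv_eq)
    qed
  qed simp
  then show ?thesis using assms unfolding smooth_def by (auto intro!: differentiable_add)
qed

lemma test_function_iff: "\<phi> \<in> test_functions \<longleftrightarrow> smooth \<phi> \<and> bounded {x. \<phi> x \<noteq> 0}"
  unfolding test_functions_def by (simp add: compact_closure)

lemma test_functions_add:
  assumes "\<phi> \<in> test_functions" "\<psi> \<in> test_functions"
  shows "(\<lambda>x. \<phi> x + \<psi> x) \<in> test_functions"
proof -
  have "bounded ({x. \<phi> x \<noteq> 0} \<union> {x. \<psi> x \<noteq> 0})" using assms by (simp add: test_function_iff)
  moreover have "{x. \<phi> x + \<psi> x \<noteq> 0} \<subseteq> {x. \<phi> x \<noteq> 0} \<union> {x. \<psi> x \<noteq> 0}" by auto
  ultimately have "bounded {x. \<phi> x + \<psi> x \<noteq> 0}" by (rule bounded_subset)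
  then show ?thesis using assms by (simp add: test_function_iff smooth_add)
qed

lemma test_functions_zero: "(\<lambda>x. 0) \<in> test_functions"
  by (simp add: test_function_iff nice_smooth nice.intros)

lemma test_functions_sum:
  "finite S \<Longrightarrow> (\<And>i. i \<in> S \<Longrightarrow> \<phi> i \<in> test_functions) \<Longrightarrow> (\<lambda>x. \<Sum>i\<in>S. \<phi> i x) \<in> test_functions"
proof (induction S rule: finite_induct)
  case (insert i S)
  have 1: "\<phi> i \<in> test_functions" by (rule insert.prems) simp
  have 2: "(\<lambda>x. \<Sum>i\<in>S. \<phi> i x) \<in> test_functions"
    by (rule insert.IH, rule insert.prems) simp
  from test_functions_add[OF 1 2]
  show ?case using insert(1,2) by simp
qed (simp add: test_functions_zero)

lemma test_function_continuous:
  assumes "\<phi> \<in> test_functions"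
  shows "continuous_on UNIV \<phi>"
proof -
  have "smooth \<phi>" using assms by (simp add: test_function_iff)
  then show ?thesis
    using differentiable_imp_continuous_within[OF smooth_differentiable, of \<phi>]
    by (simp add: continuous_on_eq_continuous_within)
qed

lemma test_function_bound:
  assumes "\<phi> \<in> test_functions"
  obtains r b where "0 \<le> b" "\<And>x. \<bar>\<phi> x\<bar> \<le> b * indicator (cball 0 r) x"
proof -
  have "bounded {x. \<phi> x \<noteq> 0}" using assms by (simp add: test_function_iff)
  then obtain r where r: "\<And>x. \<phi> x \<noteq> 0 \<Longrightarrow> norm x \<le> r" by (auto simp: bounded_iff)
  have "continuous_on (cball 0 r) \<phi>" using test_function_continuous[OF assms] by (rule continuous_on_subset) simp
  then have "bounded (\<phi> ` cball 0 r)" by (intro compact_imp_bounded compact_continuous_image) auto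
  then obtain b where b: "\<forall>y\<in>\<phi> ` cball 0 r. norm y \<le> b" unfolding bounded_iff by blast
  have "\<bar>\<phi> x\<bar> \<le> max 0 b * indicator (cball 0 r) x" for x
    using r[of x] b by (force simp: indicator_def)
  then show thesis by (intro that[of "max 0 b" r]) auto
qed

text \<open>Since e^(-1/((j+1)s)) tends to 1 for s > 0, these smooth functions converge to the
  indicator of the open box. They stay below it, as dominated convergence asks.\<close>

definition box_bump :: "'a::euclidean_space \<Rightarrow> 'a \<Rightarrow> nat \<Rightarrow> 'a \<Rightarrow> real" where
  "box_bump a b j x = (\<Prod>i\<in>Basis. flat 1 (real (Suc j) * ((x - a) \<bullet> i)) * flat 1 (real (Suc j) * ((b - x) \<bullet> i)))"

lemma flat_one_bounds: "0 \<le> flat 1 s" "flat 1 s \<le> 1"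
  by (auto simp: flat_def)

lemma box_bump_bounds: "0 \<le> box_bump a b j x" "box_bump a b j x \<le> indicator (box a b) x"
proof -
  show "0 \<le> box_bump a b j x" unfolding box_bump_def
    by (intro prod_nonneg) (auto intro!: mult_nonneg_nonneg flat_one_bounds)
  show "box_bump a b j x \<le> indicator (box a b) x"
  proof (cases "x \<in> box a b")
    case True
    have "box_bump a b j x \<le> 1" unfolding box_bump_def
      by (intro prod_le_1) (auto intro!: mult_nonneg_nonneg mult_le_one flat_one_bounds)
    then show ?thesis using True by simp
  next
    case False
    then obtain i where "i \<in> Basis" "x \<bullet> i \<le> a \<bullet> i \<or> b \<bullet> i \<le> x \<bullet> i" by (force simp: mem_box not_less)
    then have "flat 1 (real (Suc j) * ((x - a) \<bullet> i)) * flat 1 (real (Suc j) * ((b - x) \<bullet> i)) = 0"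
      by (auto simp: flat_def inner_diff_left zero_less_mult_iff)
    then show ?thesis unfolding box_bump_def using \<open>i \<in> Basis\<close> False by (subst prod_zero) auto
  qed
qed

lemma box_bump_test_function: "box_bump a b j \<in> test_functions"
proof -
  have "(\<lambda>x. flat 1 (real (Suc j) * ((x - a) \<bullet> i)) * flat 1 (real (Suc j) * ((b - x) \<bullet> i))) \<in> nice" for i
    using nice.nice_mult[OF nice.nice_flat[of 1 "real (Suc j) *\<^sub>R i" "- real (Suc j) * (a \<bullet> i)"]
        nice.nice_flat[of 1 "- real (Suc j) *\<^sub>R i" "real (Suc j) * (b \<bullet> i)"]]
    by (simp add: algebra_simps inner_diff_left)
  then have "smooth (box_bump a b j)"
    unfolding box_bump_def[abs_def] by (intro nice_smooth nice_prod) auto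
  moreover have "bounded {x. box_bump a b j x \<noteq> 0}"
  proof (rule bounded_subset[OF bounded_box])
    show "{x. box_bump a b j x \<noteq> 0} \<subseteq> box a b"
    proof
      fix x assume "x \<in> {x. box_bump a b j x \<noteq> 0}"
      then show "x \<in> box a b" using box_bump_bounds[of a b j x] by (cases "x \<in> box a b") auto
    qed
  qed
  ultimately show ?thesis by (simp add: test_function_iff)
qed

lemma flat_one_tendsto: "(\<lambda>j. flat 1 (real (Suc j) * s)) \<longlonglongrightarrow> (if 0 < s then 1 else 0)"
proof (cases "0 < s")
  case True
  have "(\<lambda>j. exp (- 1 / s * (1 / real (Suc j)))) \<longlonglongrightarrow> exp (- 1 / s * 0)"
    by (intro tendsto_intros LIMSEQ_Suc[OF lim_1_over_n])
  then show ?thesis using True by (simp add: flat_def mult.commute)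
next
  case False
  then have "flat 1 (real (Suc j) * s) = 0" for j by (auto simp: flat_def zero_less_mult_iff)
  then show ?thesis using False by simp
qed

lemma box_bump_tendsto: "(\<lambda>j. box_bump a b j x) \<longlonglongrightarrow> indicator (box a b) x"
proof -
  have "(\<lambda>j. box_bump a b j x) \<longlonglongrightarrow> (\<Prod>i\<in>Basis. (if 0 < (x - a) \<bullet> i then 1 else 0) * (if 0 < (b - x) \<bullet> i then 1 else 0))"
    unfolding box_bump_def by (intro tendsto_prod tendsto_mult flat_one_tendsto)
  also have "(\<Prod>i\<in>Basis. (if 0 < (x - a) \<bullet> i then 1 else 0) * (if 0 < (b - x) \<bullet> i then 1 else 0 :: real)) = indicator (box a b) x"
  proof (cases "x \<in> box a b")
    case True
    then show ?thesis by (auto simp: mem_box inner_diff_left intro!: prod.neutral)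
  next
    case False
    then obtain i where "i \<in> Basis" "x \<bullet> i \<le> a \<bullet> i \<or> b \<bullet> i \<le> x \<bullet> i" by (force simp: mem_box not_less)
    then show ?thesis using False by (subst prod_zero) (auto simp: inner_diff_left intro!: bexI[of _ i])
  qed
  finally show ?thesis .
qed

section \<open>The norm of the absolute value\<close>

context tame_noise
begin

abbreviation row1 :: "nat \<Rightarrow> (nat \<times> nat, 'd) configuration \<Rightarrow> (nat, 'd) configuration" where
  "row1 l \<equiv> row (\<lambda>_. l) 1"

abbreviation row2 :: "nat \<Rightarrow> (nat \<times> nat, 'd) configuration \<Rightarrow> (nat, 'd) configuration" where
  "row2 l \<equiv> row (\<lambda>_. l) 2"

abbreviation straight :: "nat \<Rightarrow> (nat \<times> nat, 'd) configuration measure" where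
  "straight l \<equiv> \<nu> (vertices 2 (\<lambda>_. l)) (straight_diagram l)"

lemma rows_straight_measurable: "row1 l \<in> straight l \<rightarrow>\<^sub>M config {1..l}" "row2 l \<in> straight l \<rightarrow>\<^sub>M config {1..l}"
  unfolding measurable_noise
  using row_measurable[of 1 2 "\<lambda>_. l"] row_measurable[of 2 2 "\<lambda>_. l"] by simp_all

lemma rows_straight_compose:
  assumes "f \<in> config {1..l} \<rightarrow>\<^sub>M N"
  shows "(\<lambda>z. f (row1 l z)) \<in> straight l \<rightarrow>\<^sub>M N" "(\<lambda>z. f (row2 l z)) \<in> straight l \<rightarrow>\<^sub>M N"
  using measurable_compose[OF rows_straight_measurable(1) assms] measurable_compose[OF rows_straight_measurable(2) assms] by simp_all

lemma rows_straight_space: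
  assumes "z \<in> space (straight l)"
  shows "row1 l z \<in> \<Omega> l" "row2 l z \<in> \<Omega> l"
  using measurable_space[OF rows_straight_measurable(1) assms] measurable_space[OF rows_straight_measurable(2) assms] by simp_all

text \<open>A substitute for the Cauchy--Schwarz inequality of the inner product, on nonnegative
  functions and up to a constant.\<close>

lemma two_rows_bound:
  "\<exists>c. c \<noteq> \<top> \<and> (\<forall>g h. g \<in> \<F> l \<longrightarrow> h \<in> \<F> l \<longrightarrow>
    (\<integral>\<^sup>+z. g (row1 l z) * h (row2 l z) \<partial>straight l) \<le> c * (esqrt (sq_norm l g) * esqrt (sq_norm l h)))"
proof -
  have set12: "{1..2 :: nat} = {1, 2}" by auto
  obtain c where c: "c \<noteq> \<top>" "\<And>g. (\<forall>k\<in>{1..2}. g k \<in> \<F> l) \<Longrightarrow>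
      (\<integral>\<^sup>+z. (\<Prod>k\<in>{1..2}. g k (row (\<lambda>_. l) k z)) \<partial>straight l) \<le> c * (\<Prod>k\<in>{1..2}. esqrt (sq_norm l (g k)))"
    using diagram_bound[OF straight_diagram_in, of l] by blast
  have "(\<integral>\<^sup>+z. g (row1 l z) * h (row2 l z) \<partial>straight l) \<le> c * (esqrt (sq_norm l g) * esqrt (sq_norm l h))"
    if "g \<in> \<F> l" "h \<in> \<F> l" for g h
    using c(2)[of "\<lambda>k. if k = 1 then g else h"] that by (simp add: set12 del: One_nat_def)
  with c(1) show ?thesis by blast
qed

lemma sq_norm_mono:
  assumes "\<And>z. z \<in> \<Omega> l \<Longrightarrow> g z \<le> h z"
  shows "sq_norm l g \<le> sq_norm l h"
  unfolding sq_norm_def using assms rows_straight_space by (intro nn_integral_mono mult_mono) auto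

lemma sq_norm_cong:
  assumes "\<And>z. z \<in> \<Omega> l \<Longrightarrow> g z = h z"
  shows "sq_norm l g = sq_norm l h"
  using assms by (intro antisym sq_norm_mono) auto

lemma sq_norm_cmult:
  assumes g: "g \<in> \<F> l"
  shows "sq_norm l (\<lambda>z. c * g z) = c\<^sup>2 * sq_norm l g"
proof -
  have "(\<lambda>z. g (row1 l z) * g (row2 l z)) \<in> borel_measurable (straight l)"
    by (intro borel_measurable_times_ennreal rows_straight_compose g)
  from nn_integral_cmult[OF this, of "c\<^sup>2"] show ?thesis
    unfolding sq_norm_def by (simp add: power2_eq_square mult_ac)
qed

lemma sq_norm_zero: "sq_norm l (\<lambda>z. 0) = 0"
  by (simp add: sq_norm_def)

text \<open>Expanding the square leaves two mixed terms, each at most c times the product of the two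
  norms, and that product is at most the larger square. This is the origin of the constant 1 + 2c,
  and the reason for speaking of a quasi-norm.\<close>

lemma sq_norm_add_bound:
  "\<exists>c. c \<noteq> \<top> \<and> (\<forall>g h. g \<in> \<F> l \<longrightarrow> h \<in> \<F> l \<longrightarrow>
    sq_norm l (\<lambda>z. g z + h z) \<le> c * (sq_norm l g + sq_norm l h))"
proof -
  obtain c where c: "c \<noteq> \<top>" "\<And>g h. g \<in> \<F> l \<Longrightarrow> h \<in> \<F> l \<Longrightarrow>
    (\<integral>\<^sup>+z. g (row1 l z) * h (row2 l z) \<partial>straight l) \<le> c * (esqrt (sq_norm l g) * esqrt (sq_norm l h))"
    using two_rows_bound[of l] by blast
  have "sq_norm l (\<lambda>z. g z + h z) \<le> (1 + 2 * c) * (sq_norm l g + sq_norm l h)"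
    if g: "g \<in> \<F> l" and h: "h \<in> \<F> l" for g h
  proof -
    let ?x = "esqrt (sq_norm l g)" and ?y = "esqrt (sq_norm l h)"
    have xy: "?x * ?y \<le> sq_norm l g + sq_norm l h"
    proof (cases "?x \<le> ?y")
      case True
      then have "?x * ?y \<le> ?y\<^sup>2" unfolding power2_eq_square by (rule mult_right_mono) simp
      then show ?thesis by (simp add: add_increasing)
    next
      case False
      then have "?x * ?y \<le> ?x\<^sup>2" unfolding power2_eq_square by (intro mult_left_mono) auto
      then show ?thesis by (simp add: add_increasing2)
    qed
    note m = rows_straight_compose[OF g] rows_straight_compose[OF h]
    have "sq_norm l (\<lambda>z. g z + h z) = (\<integral>\<^sup>+z. (g (row1 l z) * g (row2 l z) + h (row1 l z) * h (row2 l z)) +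
      (g (row1 l z) * h (row2 l z) + h (row1 l z) * g (row2 l z)) \<partial>straight l)"
      unfolding sq_norm_def by (intro nn_integral_cong) (simp add: algebra_simps)
    also have "\<dots> = (sq_norm l g + sq_norm l h) + ((\<integral>\<^sup>+z. g (row1 l z) * h (row2 l z) \<partial>straight l) + (\<integral>\<^sup>+z. h (row1 l z) * g (row2 l z) \<partial>straight l))"
      unfolding sq_norm_def by (subst nn_integral_add; (intro borel_measurable_add borel_measurable_times_ennreal m)?)+ simp
    also have "\<dots> \<le> (sq_norm l g + sq_norm l h) + (c * (sq_norm l g + sq_norm l h) + c * (sq_norm l g + sq_norm l h))"
    proof (intro add_left_mono add_mono)
      show "(\<integral>\<^sup>+z. g (row1 l z) * h (row2 l z) \<partial>straight l) \<le> c * (sq_norm l g + sq_norm l h)"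
        using c(2)[OF g h] mult_left_mono[OF xy, of c] by (auto intro: order_trans)
      show "(\<integral>\<^sup>+z. h (row1 l z) * g (row2 l z) \<partial>straight l) \<le> c * (sq_norm l g + sq_norm l h)"
        using c(2)[OF h g] mult_left_mono[OF xy, of c] by (auto intro: order_trans simp: mult.commute)
    qed
    finally show ?thesis by (simp add: algebra_simps mult_2)
  qed
  moreover have "1 + 2 * c \<noteq> \<top>" using c(1) by (simp add: ennreal_mult_eq_top_iff)
  ultimately show ?thesis by blast
qed

text \<open>The squared norm of the absolute value. It dominates the squared Hilbert norm and
  controls integrals along arbitrary diagrams.\<close>

definition sqn :: "nat \<Rightarrow> ((nat, 'd) configuration \<Rightarrow> real) \<Rightarrow> ennreal" where
  "sqn l f = sq_norm l (\<lambda>z. ennreal \<bar>f z\<bar>)"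

definition finite_norm :: "nat \<Rightarrow> ((nat, 'd) configuration \<Rightarrow> real) set" where
  "finite_norm l = {f. f \<in> \<F> l \<and> sqn l f < \<top>}"

lemma finite_norm_measurable: "f \<in> finite_norm l \<Longrightarrow> f \<in> \<F> l"
  by (simp add: finite_norm_def)

lemma abs_measurable: "f \<in> borel_measurable N \<Longrightarrow> (\<lambda>z. ennreal \<bar>f z\<bar>) \<in> borel_measurable N" for f :: "_ \<Rightarrow> real"
  by measurable

lemma sqn_cong: "(\<And>z. z \<in> \<Omega> l \<Longrightarrow> f z = g z) \<Longrightarrow> sqn l f = sqn l g"
  unfolding sqn_def by (rule sq_norm_cong) simp

lemma sqn_mono: "(\<And>z. z \<in> \<Omega> l \<Longrightarrow> \<bar>f z\<bar> \<le> g z) \<Longrightarrow> sqn l f \<le> sqn l g"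
  unfolding sqn_def by (intro sq_norm_mono ennreal_leI) force

lemma sqn_cmult: "f \<in> \<F> l \<Longrightarrow> sqn l (\<lambda>z. c * f z) = (ennreal \<bar>c\<bar>)\<^sup>2 * sqn l f"
  unfolding sqn_def by (simp add: abs_mult ennreal_mult sq_norm_cmult[OF abs_measurable])

lemma sqn_add_bound:
  "\<exists>c. c < \<top> \<and> (\<forall>f g. f \<in> \<F> l \<longrightarrow> g \<in> \<F> l \<longrightarrow>
    sqn l (\<lambda>z. f z + g z) \<le> c * (sqn l f + sqn l g))"
proof -
  obtain c where c: "c \<noteq> \<top>" "\<And>g h. g \<in> \<F> l \<Longrightarrow> h \<in> \<F> l \<Longrightarrow>
    sq_norm l (\<lambda>z. g z + h z) \<le> c * (sq_norm l g + sq_norm l h)"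
    using sq_norm_add_bound[of l] by blast
  have "sqn l (\<lambda>z. f z + g z) \<le> c * (sqn l f + sqn l g)"
    if "f \<in> \<F> l" "g \<in> \<F> l" for f g
  proof -
    have "sqn l (\<lambda>z. f z + g z) \<le> sq_norm l (\<lambda>z. ennreal \<bar>f z\<bar> + ennreal \<bar>g z\<bar>)"
      unfolding sqn_def by (intro sq_norm_mono) (simp add: ennreal_plus[symmetric] ennreal_leI abs_triangle_ineq del: ennreal_plus)
    also have "\<dots> \<le> c * (sqn l f + sqn l g)" unfolding sqn_def by (intro c abs_measurable that)
    finally show ?thesis .
  qed
  with c(1) show ?thesis by (auto simp: less_top)
qed

lemma finite_norm_dominated:
  assumes "f \<in> \<F> l" "g \<in> finite_norm l" "\<And>z. z \<in> \<Omega> l \<Longrightarrow> \<bar>f z\<bar> \<le> g z"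
  shows "f \<in> finite_norm l"
  using assms(1,2) le_less_trans[OF sqn_mono[OF assms(3)]] by (simp add: finite_norm_def)

lemma finite_norm_abs: "f \<in> finite_norm l \<Longrightarrow> (\<lambda>z. \<bar>f z\<bar>) \<in> finite_norm l"
  by (auto simp: finite_norm_def sqn_def intro!: borel_measurable_abs)

lemma finite_norm_cmult: "f \<in> finite_norm l \<Longrightarrow> (\<lambda>z. c * f z) \<in> finite_norm l"
  by (auto simp: finite_norm_def sqn_cmult ennreal_mult_less_top ennreal_power intro!: borel_measurable_times)

lemma finite_norm_add: "f \<in> finite_norm l \<Longrightarrow> g \<in> finite_norm l \<Longrightarrow> (\<lambda>z. f z + g z) \<in> finite_norm l"
proof -
  assume fg: "f \<in> finite_norm l" "g \<in> finite_norm l"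
  obtain c where c: "c < \<top>" "sqn l (\<lambda>z. f z + g z) \<le> c * (sqn l f + sqn l g)"
    using sqn_add_bound[of l] fg by (auto simp: finite_norm_def)
  have "c * (sqn l f + sqn l g) < \<top>" using fg c(1) by (simp add: finite_norm_def ennreal_mult_less_top)
  then show ?thesis using c(2) fg by (auto simp: finite_norm_def intro: le_less_trans)
qed

lemma finite_norm_zero: "(\<lambda>z. 0) \<in> finite_norm l"
  by (simp add: finite_norm_def sqn_def sq_norm_zero)

lemma finite_norm_diff: "f \<in> finite_norm l \<Longrightarrow> g \<in> finite_norm l \<Longrightarrow> (\<lambda>z. f z - g z) \<in> finite_norm l"
  using finite_norm_add[OF _ finite_norm_cmult[of g l "- 1"], of f] by simp

definition norm_conv :: "nat \<Rightarrow> (nat \<Rightarrow> (nat, 'd) configuration \<Rightarrow> real) \<Rightarrow> ((nat, 'd) configuration \<Rightarrow> real) \<Rightarrow> bool" where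
  "norm_conv l p f \<longleftrightarrow> (\<forall>j. p j \<in> finite_norm l) \<and> f \<in> finite_norm l \<and> (\<lambda>j. sqn l (\<lambda>z. p j z - f z)) \<longlonglongrightarrow> 0"

lemma ennreal_tendsto_zero_bound:
  fixes u v :: "nat \<Rightarrow> ennreal"
  assumes bound: "\<And>j. u j \<le> c * v j" and c: "c < \<top>" and v: "v \<longlonglongrightarrow> 0"
  shows "u \<longlonglongrightarrow> 0"
proof -
  have "(\<lambda>j. c * v j) \<longlonglongrightarrow> c * 0" by (rule ennreal_tendsto_cmult[OF c v])
  then have v: "(\<lambda>j. c * v j) \<longlonglongrightarrow> 0" by simp
  have "eventually (\<lambda>j. 0 \<le> u j) sequentially" "eventually (\<lambda>j. u j \<le> c * v j) sequentially"
    by (simp_all add: bound)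
  from tendsto_sandwich[OF this tendsto_const v] show ?thesis .
qed

lemma norm_convD:
  assumes "norm_conv l p f"
  shows "p j \<in> finite_norm l" "f \<in> finite_norm l" "(\<lambda>j. sqn l (\<lambda>z. p j z - f z)) \<longlonglongrightarrow> 0"
    "(\<lambda>z. p j z - f z) \<in> \<F> l"
proof -
  show fn: "p j \<in> finite_norm l" "f \<in> finite_norm l" "(\<lambda>j. sqn l (\<lambda>z. p j z - f z)) \<longlonglongrightarrow> 0"
    using assms unfolding norm_conv_def by blast+
  show "(\<lambda>z. p j z - f z) \<in> \<F> l"
    by (rule finite_norm_measurable[OF finite_norm_diff[OF fn(1,2)]])
qed

lemma norm_convI:
  assumes "\<And>j. p j \<in> finite_norm l" "f \<in> finite_norm l" "(\<lambda>j. sqn l (\<lambda>z. p j z - f z)) \<longlonglongrightarrow> 0"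
  shows "norm_conv l p f"
  using assms unfolding norm_conv_def by blast

lemma norm_conv_add:
  assumes p: "norm_conv l p f" and q: "norm_conv l q g"
  shows "norm_conv l (\<lambda>j z. p j z + q j z) (\<lambda>z. f z + g z)"
proof (rule norm_convI)
  obtain c where c: "c < \<top>" "\<And>f g. f \<in> \<F> l \<Longrightarrow> g \<in> \<F> l \<Longrightarrow>
    sqn l (\<lambda>z. f z + g z) \<le> c * (sqn l f + sqn l g)"
    using sqn_add_bound[of l] by blast
  show "(\<lambda>z. p j z + q j z) \<in> finite_norm l" for j by (rule finite_norm_add[OF norm_convD(1)[OF p] norm_convD(1)[OF q]])
  show "(\<lambda>z. f z + g z) \<in> finite_norm l" by (rule finite_norm_add[OF norm_convD(2)[OF p] norm_convD(2)[OF q]])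
  have 1: "sqn l (\<lambda>z. (p j z + q j z) - (f z + g z)) \<le> c * (sqn l (\<lambda>z. p j z - f z) + sqn l (\<lambda>z. q j z - g z))" for j
    using c(2)[OF norm_convD(4)[OF p, of j] norm_convD(4)[OF q, of j]] by (simp add: add_diff_add)
  have "(\<lambda>j. sqn l (\<lambda>z. p j z - f z) + sqn l (\<lambda>z. q j z - g z)) \<longlonglongrightarrow> 0 + 0"
    by (rule tendsto_add[OF norm_convD(3)[OF p] norm_convD(3)[OF q]])
  then have 2: "(\<lambda>j. sqn l (\<lambda>z. p j z - f z) + sqn l (\<lambda>z. q j z - g z)) \<longlonglongrightarrow> 0" by simp
  show "(\<lambda>j. sqn l (\<lambda>z. (p j z + q j z) - (f z + g z))) \<longlonglongrightarrow> 0"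
    by (rule ennreal_tendsto_zero_bound[OF 1 c(1) 2])
qed

lemma norm_conv_cmult:
  assumes p: "norm_conv l p f"
  shows "norm_conv l (\<lambda>j z. c * p j z) (\<lambda>z. c * f z)"
proof (rule norm_convI)
  show "(\<lambda>z. c * p j z) \<in> finite_norm l" for j by (rule finite_norm_cmult[OF norm_convD(1)[OF p]])
  show "(\<lambda>z. c * f z) \<in> finite_norm l" by (rule finite_norm_cmult[OF norm_convD(2)[OF p]])
  have "sqn l (\<lambda>z. c * p j z - c * f z) = (ennreal \<bar>c\<bar>)\<^sup>2 * sqn l (\<lambda>z. p j z - f z)" for j
    using sqn_cmult[OF norm_convD(4)[OF p, of j], of c] by (simp add: right_diff_distrib)
  then have 1: "sqn l (\<lambda>z. c * p j z - c * f z) \<le> (ennreal \<bar>c\<bar>)\<^sup>2 * sqn l (\<lambda>z. p j z - f z)" for j by simp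
  have 2: "(ennreal \<bar>c\<bar>)\<^sup>2 < \<top>" by (simp add: ennreal_power)
  show "(\<lambda>j. sqn l (\<lambda>z. c * p j z - c * f z)) \<longlonglongrightarrow> 0"
    by (rule ennreal_tendsto_zero_bound[OF 1 2 norm_convD(3)[OF p]])
qed

lemma norm_conv_const: "f \<in> finite_norm l \<Longrightarrow> norm_conv l (\<lambda>j. f) f"
  by (simp add: norm_conv_def sqn_def sq_norm_zero)

text \<open>Dominated convergence in both rows of the straight diagram at once: the differences are
  bounded by \<open>2 * h\<close>, which has finite norm, and a product of two null sequences is
  null.\<close>

lemma norm_conv_dominated:
  assumes p: "\<And>j. p j \<in> \<F> l" and f: "f \<in> \<F> l"
    and h: "h \<in> finite_norm l" "\<And>j z. z \<in> \<Omega> l \<Longrightarrow> \<bar>p j z\<bar> \<le> h z"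
    and lim: "\<And>z. z \<in> \<Omega> l \<Longrightarrow> (\<lambda>j. p j z) \<longlonglongrightarrow> f z"
  shows "norm_conv l p f"
proof -
  have fh: "\<bar>f z\<bar> \<le> h z" if "z \<in> \<Omega> l" for z
    by (rule LIMSEQ_le_const2[OF tendsto_rabs[OF lim[OF that]]]) (use h(2)[OF that] in blast)
  have fn: "\<And>j. p j \<in> finite_norm l" "f \<in> finite_norm l"
    using finite_norm_dominated[OF _ h(1)] p f h(2) fh by blast+
  let ?e = "\<lambda>j z. ennreal \<bar>p j z - f z\<bar>" and ?h = "\<lambda>z. ennreal (2 * h z)"
  note em = abs_measurable[OF finite_norm_measurable[OF finite_norm_diff[OF fn]]]
  have hm: "?h \<in> \<F> l" using finite_norm_measurable[OF h(1)] by measurable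
  have eh: "?e j z \<le> ?h z" if "z \<in> \<Omega> l" for j z
    using h(2)[OF that, of j] fh[OF that] by (intro ennreal_leI) linarith
  have "(\<lambda>j. \<integral>\<^sup>+z. ?e j (row1 l z) * ?e j (row2 l z) \<partial>straight l) \<longlonglongrightarrow> (\<integral>\<^sup>+z. 0 \<partial>straight l)"
  proof (rule nn_integral_dominated_convergence)
    show "(\<lambda>z. ?e j (row1 l z) * ?e j (row2 l z)) \<in> borel_measurable (straight l)" for j
      by (intro borel_measurable_times_ennreal rows_straight_compose em)
    show "(\<lambda>z. ?h (row1 l z) * ?h (row2 l z)) \<in> borel_measurable (straight l)"
      by (intro borel_measurable_times_ennreal rows_straight_compose hm)
    show "AE z in straight l. ?e j (row1 l z) * ?e j (row2 l z) \<le> ?h (row1 l z) * ?h (row2 l z)" for j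
      using eh rows_straight_space by (intro AE_I2 mult_mono) auto
    have "(\<lambda>z. 2 * h z) \<in> finite_norm l" by (rule finite_norm_cmult[OF h(1)])
    moreover have "0 \<le> h z" if "z \<in> \<Omega> l" for z using fh[OF that] by linarith
    ultimately have "sq_norm l ?h < \<infinity>"
      using sq_norm_cong[of l ?h "\<lambda>z. ennreal \<bar>2 * h z\<bar>"] by (simp add: finite_norm_def sqn_def)
    then show "(\<integral>\<^sup>+z. ?h (row1 l z) * ?h (row2 l z) \<partial>straight l) < \<infinity>" by (simp add: sq_norm_def)
    have lim0: "(\<lambda>j. ?e j z) \<longlonglongrightarrow> 0" if "z \<in> \<Omega> l" for z
    proof -
      have "(\<lambda>j. \<bar>p j z - f z\<bar>) \<longlonglongrightarrow> \<bar>f z - f z\<bar>" by (intro tendsto_intros lim[OF that])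
      then have "(\<lambda>j. ennreal \<bar>p j z - f z\<bar>) \<longlonglongrightarrow> ennreal \<bar>f z - f z\<bar>" by (rule tendsto_ennrealI)
      then show ?thesis by simp
    qed
    have "(\<lambda>j. ?e j (row1 l z) * ?e j (row2 l z)) \<longlonglongrightarrow> 0 * 0" if "z \<in> space (straight l)" for z
      using lim0 rows_straight_space[OF that] by (intro tendsto_mult_ennreal) auto
    then show "AE z in straight l. (\<lambda>j. ?e j (row1 l z) * ?e j (row2 l z)) \<longlonglongrightarrow> 0" by (intro AE_I2) simp
  qed simp
  then show ?thesis using fn by (simp add: norm_conv_def sqn_def sq_norm_def)
qed

definition dense_in :: "nat \<Rightarrow> ((nat, 'd) configuration \<Rightarrow> real) set \<Rightarrow> ((nat, 'd) configuration \<Rightarrow> real) \<Rightarrow> bool" where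
  "dense_in l X f \<longleftrightarrow> (\<exists>p. range p \<subseteq> X \<and> norm_conv l p f)"

text \<open>The j-th approximant is chosen with squared distance below 1/(j+1) from the j-th
  function; the triangle inequality up to a constant is then enough.\<close>

lemma dense_in_limit:
  assumes f: "\<And>j. dense_in l X (f j)" and lim: "norm_conv l f g"
  shows "dense_in l X g"
proof -
  have ex: "\<exists>p. p \<in> X \<and> p \<in> finite_norm l \<and> sqn l (\<lambda>z. p z - f j z) < ennreal (1 / real (Suc j))" for j
  proof -
    obtain p where p: "range p \<subseteq> X" "norm_conv l p (f j)" using f[of j] by (auto simp: dense_in_def)
    have "eventually (\<lambda>i. sqn l (\<lambda>z. p i z - f j z) < ennreal (1 / real (Suc j))) sequentially"
      by (rule order_tendstoD(2)[OF norm_convD(3)[OF p(2)]]) simp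
    then obtain i where "sqn l (\<lambda>z. p i z - f j z) < ennreal (1 / real (Suc j))" by (auto simp: eventually_sequentially)
    then show ?thesis using p(1) norm_convD(1)[OF p(2)] by blast
  qed
  from choice[OF allI[OF ex]] obtain p where
    "\<forall>j. p j \<in> X \<and> p j \<in> finite_norm l \<and> sqn l (\<lambda>z. p j z - f j z) < ennreal (1 / real (Suc j))" ..
  then have p: "\<And>j. p j \<in> X" "\<And>j. p j \<in> finite_norm l" "\<And>j. sqn l (\<lambda>z. p j z - f j z) < ennreal (1 / real (Suc j))"
    by blast+
  obtain c where c: "c < \<top>" "\<And>f g. f \<in> \<F> l \<Longrightarrow> g \<in> \<F> l \<Longrightarrow>
    sqn l (\<lambda>z. f z + g z) \<le> c * (sqn l f + sqn l g)"
    using sqn_add_bound[of l] by blast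
  have 1: "sqn l (\<lambda>z. p j z - g z) \<le> c * (ennreal (1 / real (Suc j)) + sqn l (\<lambda>z. f j z - g z))" for j
  proof -
    have "sqn l (\<lambda>z. p j z - g z) \<le> c * (sqn l (\<lambda>z. p j z - f j z) + sqn l (\<lambda>z. f j z - g z))"
      using c(2)[OF finite_norm_measurable[OF finite_norm_diff[OF p(2)[of j] norm_convD(1)[OF lim, of j]]] norm_convD(4)[OF lim, of j]] by simp
    also have "\<dots> \<le> c * (ennreal (1 / real (Suc j)) + sqn l (\<lambda>z. f j z - g z))"
      using p(3)[of j] by (intro mult_left_mono add_right_mono) auto
    finally show ?thesis .
  qed
  have "(\<lambda>j. ennreal (1 / real (Suc j)) + sqn l (\<lambda>z. f j z - g z)) \<longlonglongrightarrow> ennreal 0 + 0"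
    by (intro tendsto_add tendsto_ennrealI LIMSEQ_Suc[OF lim_1_over_n] norm_convD(3)[OF lim])
  then have 2: "(\<lambda>j. ennreal (1 / real (Suc j)) + sqn l (\<lambda>z. f j z - g z)) \<longlonglongrightarrow> 0" by simp
  have "norm_conv l p g"
    by (rule norm_convI[OF p(2) norm_convD(2)[OF lim] ennreal_tendsto_zero_bound[OF 1 c(1) 2]])
  then show ?thesis using p(1) unfolding dense_in_def by blast
qed

lemma dense_in_member: "p \<in> X \<Longrightarrow> p \<in> finite_norm l \<Longrightarrow> dense_in l X p"
  unfolding dense_in_def by (intro exI[of _ "\<lambda>_. p"] conjI norm_conv_const) auto

lemma dense_in_add:
  assumes "\<And>p q. p \<in> X \<Longrightarrow> q \<in> X \<Longrightarrow> (\<lambda>z. p z + q z) \<in> X" "dense_in l X f" "dense_in l X g"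
  shows "dense_in l X (\<lambda>z. f z + g z)"
proof -
  obtain p q where "range p \<subseteq> X" "norm_conv l p f" "range q \<subseteq> X" "norm_conv l q g"
    using assms by (auto simp: dense_in_def)
  then show ?thesis unfolding dense_in_def
    by (intro exI[of _ "\<lambda>j z. p j z + q j z"] conjI norm_conv_add) (auto intro!: assms(1))
qed

lemma dense_in_cmult:
  assumes "\<And>p c. p \<in> X \<Longrightarrow> (\<lambda>z. c * p z) \<in> X" "dense_in l X f"
  shows "dense_in l X (\<lambda>z. c * f z)"
proof -
  obtain p where "range p \<subseteq> X" "norm_conv l p f" using assms by (auto simp: dense_in_def)
  then show ?thesis unfolding dense_in_def
    by (intro exI[of _ "\<lambda>j z. c * p j z"] conjI norm_conv_cmult) (auto intro!: assms(1))
qed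

lemma diagram_norm_bound:
  assumes D: "D \<in> diagrams m n"
  shows "\<exists>C. 0 \<le> C \<and> (\<forall>f. (\<forall>k\<in>{1..m}. f k \<in> finite_norm (n k)) \<longrightarrow>
    (\<integral>\<^sup>+z. ennreal (norm (\<Prod>k\<in>{1..m}. f k (row n k z))) \<partial>\<nu> (vertices m n) D) \<le>
      ennreal (C * (\<Prod>k\<in>{1..m}. sqrt (enn2real (sqn (n k) (f k))))))"
proof -
  obtain c where c: "c \<noteq> \<top>" "\<And>g. (\<forall>k\<in>{1..m}. g k \<in> \<F> (n k)) \<Longrightarrow>
        (\<integral>\<^sup>+z. (\<Prod>k\<in>{1..m}. g k (row n k z)) \<partial>\<nu> (vertices m n) D) \<le>
          c * (\<Prod>k\<in>{1..m}. esqrt (sq_norm (n k) (g k)))"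
    using diagram_bound[OF D] by blast
  have "(\<integral>\<^sup>+z. ennreal (norm (\<Prod>k\<in>{1..m}. f k (row n k z))) \<partial>\<nu> (vertices m n) D) \<le>
      ennreal (enn2real c * (\<Prod>k\<in>{1..m}. sqrt (enn2real (sqn (n k) (f k)))))"
    if f: "\<forall>k\<in>{1..m}. f k \<in> finite_norm (n k)" for f
  proof -
    have "esqrt (sqn (n k) (f k)) = ennreal (sqrt (enn2real (sqn (n k) (f k))))" if "k \<in> {1..m}" for k
      using bspec[OF f that] by (simp add: finite_norm_def esqrt_def less_top)
    then have eq: "(\<Prod>k\<in>{1..m}. esqrt (sqn (n k) (f k))) = ennreal (\<Prod>k\<in>{1..m}. sqrt (enn2real (sqn (n k) (f k))))"
      by (simp add: prod_ennreal cong: prod.cong_simp)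
    have "(\<integral>\<^sup>+z. (\<Prod>k\<in>{1..m}. ennreal \<bar>f k (row n k z)\<bar>) \<partial>\<nu> (vertices m n) D) \<le> c * (\<Prod>k\<in>{1..m}. esqrt (sqn (n k) (f k)))"
      unfolding sqn_def using f by (intro c(2) ballI abs_measurable finite_norm_measurable) auto
    moreover have "c = ennreal (enn2real c)" using c(1) by (simp add: less_top)
    ultimately show ?thesis unfolding eq by (simp add: abs_prod prod_ennreal ennreal_mult' prod_nonneg)
  qed
  then show ?thesis by (intro exI[of _ "enn2real c"]) simp
qed

lemma diagram_integrable_finite_norm:
  assumes D: "D \<in> diagrams m n" and f: "\<And>k. k \<in> {1..m} \<Longrightarrow> f k \<in> finite_norm (n k)"
  shows "integrable (\<nu> (vertices m n) D) (\<lambda>z. \<Prod>k\<in>{1..m}. f k (row n k z))"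
proof (rule integrableI_bounded)
  show "(\<lambda>z. \<Prod>k\<in>{1..m}. f k (row n k z)) \<in> borel_measurable (\<nu> (vertices m n) D)"
    unfolding measurable_noise
  proof (rule borel_measurable_prod)
    fix k assume k: "k \<in> {1..m}"
    show "(\<lambda>z. f k (row n k z)) \<in> borel_measurable (config (vertices m n))"
      by (rule measurable_compose[OF row_measurable[OF k, of n] finite_norm_measurable[OF f[OF k]]])
  qed
  show "(\<integral>\<^sup>+z. ennreal (norm (\<Prod>k\<in>{1..m}. f k (row n k z))) \<partial>\<nu> (vertices m n) D) < \<infinity>"
  proof -
    obtain C where "\<forall>f. (\<forall>k\<in>{1..m}. f k \<in> finite_norm (n k)) \<longrightarrow>
      (\<integral>\<^sup>+z. ennreal (norm (\<Prod>k\<in>{1..m}. f k (row n k z))) \<partial>\<nu> (vertices m n) D) \<le>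
        ennreal (C * (\<Prod>k\<in>{1..m}. sqrt (enn2real (sqn (n k) (f k)))))" using diagram_norm_bound[OF D] by blast
    from le_less_trans[OF mp[OF spec[OF this] ballI[OF f]] ennreal_less_top] show ?thesis by (simp only: infinity_ennreal_def)
  qed
qed

text \<open>Write each row as (p - f) + f and expand the product over the rows. A term in which some
  row carries a difference is bounded by a product of norms containing a factor that tends to 0;
  only the term made of the limits remains.\<close>

lemma diagram_integral_tendsto:
  assumes D: "D \<in> diagrams m n" and lim: "\<And>k. k \<in> {1..m} \<Longrightarrow> norm_conv (n k) (p k) (f k)"
  shows "(\<lambda>j. \<integral>z. (\<Prod>k\<in>{1..m}. p k j (row n k z)) \<partial>\<nu> (vertices m n) D) \<longlonglongrightarrow>
    (\<integral>z. (\<Prod>k\<in>{1..m}. f k (row n k z)) \<partial>\<nu> (vertices m n) D)"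
proof -
  let ?N = "\<nu> (vertices m n) D" and ?K = "{1..m}"
  define u where "u S k j = (if k \<in> S then (\<lambda>z. p k j z - f k z) else f k)" for S k j
  let ?I = "\<lambda>S j. \<integral>z. (\<Prod>k\<in>?K. u S k j (row n k z)) \<partial>?N"
  have u: "u S k j \<in> finite_norm (n k)" if "k \<in> ?K" for S k j
    using norm_convD[OF lim[OF that]] by (simp add: u_def finite_norm_diff)
  have "(\<Prod>k\<in>?K. p k j (row n k z)) = (\<Sum>S\<in>Pow ?K. \<Prod>k\<in>?K. u S k j (row n k z))" for j z
  proof -
    have "(\<Prod>k\<in>?K. p k j (row n k z)) = (\<Prod>k\<in>?K. (p k j (row n k z) - f k (row n k z)) + f k (row n k z))" by simp
    also have "\<dots> = (\<Sum>S\<in>Pow ?K. (\<Prod>k\<in>S. p k j (row n k z) - f k (row n k z)) * (\<Prod>k\<in>?K - S. f k (row n k z)))"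
      by (rule prod_add) simp
    also have "\<dots> = (\<Sum>S\<in>Pow ?K. \<Prod>k\<in>?K. u S k j (row n k z))"
    proof (rule sum.cong[OF refl])
      fix S assume S: "S \<in> Pow ?K"
      then show "(\<Prod>k\<in>S. p k j (row n k z) - f k (row n k z)) * (\<Prod>k\<in>?K - S. f k (row n k z)) = (\<Prod>k\<in>?K. u S k j (row n k z))"
        by (subst prod.subset_diff[of S ?K]) (auto simp: u_def mult.commute)
    qed
    finally show ?thesis .
  qed
  then have "(\<integral>z. (\<Prod>k\<in>?K. p k j (row n k z)) \<partial>?N) = (\<Sum>S\<in>Pow ?K. ?I S j)" for j
    by (simp only:) (intro Bochner_Integration.integral_sum diagram_integrable_finite_norm D u)
  moreover have "?I S \<longlonglongrightarrow> (if S = {} then ?I {} 0 else 0)" if S: "S \<in> Pow ?K" for S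
  proof (cases "S = {}")
    case False
    then obtain k0 where k0: "k0 \<in> S" "k0 \<in> ?K" using S by blast
    obtain C where C: "0 \<le> C" "\<And>f. \<forall>k\<in>?K. f k \<in> finite_norm (n k) \<Longrightarrow>
      (\<integral>\<^sup>+z. ennreal (norm (\<Prod>k\<in>?K. f k (row n k z))) \<partial>?N) \<le> ennreal (C * (\<Prod>k\<in>?K. sqrt (enn2real (sqn (n k) (f k)))))"
      using diagram_norm_bound[OF D] by blast
    let ?b = "\<lambda>j. C * (\<Prod>k\<in>?K. sqrt (enn2real (sqn (n k) (u S k j))))"
    have "norm (?I S j) \<le> ?b j" for j
    proof -
      have "ennreal (norm (?I S j)) \<le> ennreal (?b j)"
        using integral_norm_bound_ennreal[OF diagram_integrable_finite_norm[where f="\<lambda>k. u S k j", OF D u]] C(2)[of "\<lambda>k. u S k j"] u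
        by (blast intro: order_trans)
      then show ?thesis using C(1) by (simp add: prod_nonneg)
    qed
    moreover have "?b \<longlonglongrightarrow> C * (\<Prod>k\<in>?K. if k \<in> S then sqrt (enn2real 0) else sqrt (enn2real (sqn (n k) (f k))))"
    proof (intro tendsto_mult tendsto_const tendsto_prod)
      fix k assume k: "k \<in> ?K"
      show "(\<lambda>j. sqrt (enn2real (sqn (n k) (u S k j)))) \<longlonglongrightarrow> (if k \<in> S then sqrt (enn2real 0) else sqrt (enn2real (sqn (n k) (f k))))"
        using norm_convD(3)[OF lim[OF k]] by (auto simp: u_def simp del: enn2real_0 intro!: tendsto_real_sqrt tendsto_enn2real)
    qed
    moreover have "(\<Prod>k\<in>?K. if k \<in> S then sqrt (enn2real 0) else sqrt (enn2real (sqn (n k) (f k)))) = 0"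
      using k0 by (intro prod_zero bexI[of _ k0]) simp_all
    ultimately have "?I S \<longlonglongrightarrow> 0" by (intro Lim_null_comparison[of "?I S" ?b]) (simp_all only: mult_zero_right eventually_True)
    then show ?thesis using False by simp
  qed (simp add: u_def)
  then have "(\<lambda>j. \<Sum>S\<in>Pow ?K. ?I S j) \<longlonglongrightarrow> (\<Sum>S\<in>Pow ?K. if S = {} then ?I {} 0 else 0)" by (rule tendsto_sum)
  ultimately show ?thesis by (simp add: u_def)
qed

end

section \<open>Density of tensor powers\<close>

text \<open>The binomial expansion of (1 - 1)^n.\<close>

lemma sum_Pow_alternating:
  "finite A \<Longrightarrow> (\<Sum>U\<in>Pow A. (- 1) ^ card U) = (if A = {} then 1 else 0 :: real)"
proof (induction A rule: finite_induct)
  case (insert a A)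
  have inj: "inj_on (insert a) (Pow A)" using insert(2) by (auto simp: inj_on_def)
  have disj: "Pow A \<inter> insert a ` Pow A = {}" using insert(2) by auto
  have "(\<Sum>U\<in>insert a ` Pow A. (- 1) ^ card U) = (\<Sum>U\<in>Pow A. (- 1) ^ card (insert a U) :: real)"
    by (simp add: sum.reindex[OF inj])
  also have "\<dots> = (\<Sum>U\<in>Pow A. - ((- 1) ^ card U))"
  proof (rule sum.cong)
    fix U assume "U \<in> Pow A"
    then have "finite U" "a \<notin> U" using insert(1,2) by (auto intro: finite_subset)
    then show "(- 1) ^ card (insert a U) = - ((- 1) ^ card U :: real)" by simp
  qed simp
  finally show ?case using insert(1) disj by (simp add: Pow_insert sum.union_disjoint sum_negf)
qed simp

text \<open>A surjection of a finite set onto itself is a bijection. The witnesses convert between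
  the two conventions outside the set, where a permutation is the identity and an extensional
  function is undefined.\<close>

lemma sum_surjections_eq_permutations:
  fixes A :: "'i \<Rightarrow> 'i \<Rightarrow> real"
  assumes "finite S"
  shows "(\<Sum>f\<in>{f \<in> S \<rightarrow>\<^sub>E S. f ` S = S}. \<Prod>r\<in>S. A (f r) r) = (\<Sum>\<sigma> | \<sigma> permutes S. \<Prod>r\<in>S. A (\<sigma> r) r)"
proof (rule sum.reindex_bij_witness[of _ "\<lambda>\<sigma>. restrict \<sigma> S" "\<lambda>f x. if x \<in> S then f x else x"])
  fix f assume f: "f \<in> {f \<in> S \<rightarrow>\<^sub>E S. f ` S = S}"
  then have "bij_betw f S S" using assms by (auto simp: bij_betw_def eq_card_imp_inj_on)
  then have "bij_betw (\<lambda>x. if x \<in> S then f x else x) S S" by (subst bij_betw_cong[of _ _ f]) auto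
  then have "(\<lambda>x. if x \<in> S then f x else x) permutes S" by (rule bij_imp_permutes) auto
  then show "(\<lambda>x. if x \<in> S then f x else x) \<in> {\<sigma>. \<sigma> permutes S}" by simp
  show "restrict (\<lambda>x. if x \<in> S then f x else x) S = f" using f by (auto simp: fun_eq_iff PiE_def extensional_def)
  show "(\<Prod>r\<in>S. A (if r \<in> S then f r else r) r) = (\<Prod>r\<in>S. A (f r) r)" by (intro prod.cong) auto
next
  fix \<sigma> assume "\<sigma> \<in> {\<sigma>. \<sigma> permutes S}"
  then have \<sigma>: "\<sigma> permutes S" by simp
  show "(\<lambda>x. if x \<in> S then restrict \<sigma> S x else x) = \<sigma>" using \<sigma> by (auto simp: fun_eq_iff permutes_def)
  show "restrict \<sigma> S \<in> {f \<in> S \<rightarrow>\<^sub>E S. f ` S = S}" using \<sigma> permutes_image[OF \<sigma>] permutes_in_image[OF \<sigma>] by (auto simp: image_restrict_eq)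
qed

text \<open>Writes a symmetrized product of test functions as a combination of tensor powers.\<close>

lemma permanent_Ryser:
  fixes A :: "'i \<Rightarrow> 'i \<Rightarrow> real"
  assumes fin: "finite S"
  shows "(\<Sum>\<sigma> | \<sigma> permutes S. \<Prod>r\<in>S. A (\<sigma> r) r) = (\<Sum>T\<in>Pow S. (- 1) ^ card (S - T) * (\<Prod>r\<in>S. \<Sum>i\<in>T. A i r))"
proof -
  let ?P = "\<lambda>f. \<Prod>r\<in>S. A (f r) r"
  \<comment> \<open>Inclusion and exclusion: the sets between the image of \<open>f\<close> and
    \<open>S\<close> contribute alternating signs, which cancel unless \<open>f\<close> is
    onto.\<close>
  have inner: "(\<Sum>T\<in>{T \<in> Pow S. f ` S \<subseteq> T}. (- 1) ^ card (S - T)) = (if f ` S = S then 1 else 0 :: real)" if f: "f \<in> S \<rightarrow>\<^sub>E S" for f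
  proof -
    have "(\<Sum>T\<in>{T \<in> Pow S. f ` S \<subseteq> T}. (- 1) ^ card (S - T)) = (\<Sum>U\<in>Pow (S - f ` S). (- 1) ^ card U :: real)"
      using f by (intro sum.reindex_bij_witness[of _ "\<lambda>U. S - U" "\<lambda>T. S - T"]) (auto simp: double_diff)
    also have "\<dots> = (if S - f ` S = {} then 1 else 0)" using fin by (intro sum_Pow_alternating) auto
    also have "(S - f ` S = {}) = (f ` S = S)" using f by auto
    finally show ?thesis .
  qed
  have finP: "finite (S \<rightarrow>\<^sub>E S)" using fin by (intro finite_PiE)
  have "(\<Sum>T\<in>Pow S. (- 1) ^ card (S - T) * (\<Prod>r\<in>S. \<Sum>i\<in>T. A i r)) =
    (\<Sum>T\<in>Pow S. \<Sum>f\<in>{f \<in> S \<rightarrow>\<^sub>E S. f ` S \<subseteq> T}. (- 1) ^ card (S - T) * ?P f)"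
  proof (rule sum.cong)
    fix T assume T: "T \<in> Pow S"
    then have "finite T" using fin by (auto intro: finite_subset)
    then have "(\<Prod>r\<in>S. \<Sum>i\<in>T. A i r) = (\<Sum>f\<in>S \<rightarrow>\<^sub>E T. ?P f)" using fin prod_sum_PiE[of S "\<lambda>_. T" "\<lambda>r i. A i r"] by simp
    moreover have "S \<rightarrow>\<^sub>E T = {f \<in> S \<rightarrow>\<^sub>E S. f ` S \<subseteq> T}" using T by (auto simp: PiE_def Pi_def extensional_def)
    ultimately show "(- 1) ^ card (S - T) * (\<Prod>r\<in>S. \<Sum>i\<in>T. A i r) = (\<Sum>f\<in>{f \<in> S \<rightarrow>\<^sub>E S. f ` S \<subseteq> T}. (- 1) ^ card (S - T) * ?P f)"
      by (simp add: sum_distrib_left)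
  qed simp
  also have "\<dots> = (\<Sum>f\<in>S \<rightarrow>\<^sub>E S. \<Sum>T\<in>{T \<in> Pow S. f ` S \<subseteq> T}. (- 1) ^ card (S - T) * ?P f)"
    using fin finP by (intro sum.swap_restrict) auto
  also have "\<dots> = (\<Sum>f\<in>S \<rightarrow>\<^sub>E S. if f ` S = S then ?P f else 0)"
  proof (rule sum.cong)
    fix f assume f: "f \<in> S \<rightarrow>\<^sub>E S"
    have "(\<Sum>T\<in>{T \<in> Pow S. f ` S \<subseteq> T}. (- 1) ^ card (S - T) * ?P f) = (if f ` S = S then 1 else 0) * ?P f"
      by (simp only: sum_distrib_right[symmetric] inner[OF f])
    then show "(\<Sum>T\<in>{T \<in> Pow S. f ` S \<subseteq> T}. (- 1) ^ card (S - T) * ?P f) = (if f ` S = S then ?P f else 0)"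
      by (simp only: if_distribR if_distrib[of "\<lambda>x. x * _"] mult_1 mult_zero_left split: if_split)
  qed simp
  also have "\<dots> = (\<Sum>f\<in>{f \<in> S \<rightarrow>\<^sub>E S. f ` S = S}. ?P f)"
    using finP by (intro sum.mono_neutral_cong_right) auto
  also have "\<dots> = (\<Sum>\<sigma> | \<sigma> permutes S. \<Prod>r\<in>S. A (\<sigma> r) r)" by (rule sum_surjections_eq_permutations[OF fin])
  finally show ?thesis by simp
qed

definition point :: "('i \<Rightarrow> real) \<times> ('i \<Rightarrow> real ^ 'd) \<Rightarrow> 'i \<Rightarrow> real \<times> (real ^ 'd)" where
  "point z r = (fst z r, snd z r)"

inductive_set tensors :: "nat \<Rightarrow> ((nat, 'd::finite) configuration \<Rightarrow> real) set" for l where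
  tensors_base: "(\<And>r. \<phi> r \<in> test_functions) \<Longrightarrow> (\<lambda>z. \<Prod>r\<in>{1..l}. \<phi> r (point z r)) \<in> tensors l"
| tensors_zero: "(\<lambda>z. 0) \<in> tensors l"
| tensors_add: "p \<in> tensors l \<Longrightarrow> q \<in> tensors l \<Longrightarrow> (\<lambda>z. p z + q z) \<in> tensors l"
| tensors_cmult: "p \<in> tensors l \<Longrightarrow> (\<lambda>z. c * p z) \<in> tensors l"

text \<open>The multiple integral of a tensor power is a Hermite polynomial of one Gaussian
  variable, so on this class the expectation of a product can be computed.\<close>

inductive_set tensor_powers :: "nat \<Rightarrow> ((nat, 'd::finite) configuration \<Rightarrow> real) set" for l where
  powers_base: "\<phi> \<in> test_functions \<Longrightarrow> (\<lambda>z. \<Prod>r\<in>{1..l}. \<phi> (point z r)) \<in> tensor_powers l"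
| powers_zero: "(\<lambda>z. 0) \<in> tensor_powers l"
| powers_add: "p \<in> tensor_powers l \<Longrightarrow> q \<in> tensor_powers l \<Longrightarrow> (\<lambda>z. p z + q z) \<in> tensor_powers l"
| powers_cmult: "p \<in> tensor_powers l \<Longrightarrow> (\<lambda>z. c * p z) \<in> tensor_powers l"

lemma powers_sum:
  "finite S \<Longrightarrow> (\<And>i. i \<in> S \<Longrightarrow> p i \<in> tensor_powers l) \<Longrightarrow> (\<lambda>z. \<Sum>i\<in>S. p i z) \<in> tensor_powers l"
proof (induction S rule: finite_induct)
  case (insert i S)
  have 1: "p i \<in> tensor_powers l" by (rule insert.prems) simp
  have 2: "(\<lambda>z. \<Sum>i\<in>S. p i z) \<in> tensor_powers l" by (rule insert.IH, rule insert.prems) simp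
  from powers_add[OF 1 2] show ?case using insert(1,2) by simp
qed (simp add: powers_zero)

definition permute :: "nat \<Rightarrow> (nat \<Rightarrow> nat) \<Rightarrow> (nat, 'd::finite) configuration \<Rightarrow> (nat, 'd::finite) configuration" where
  "permute l \<sigma> z = (\<lambda>r\<in>{1..l}. fst z (\<sigma> r), \<lambda>r\<in>{1..l}. snd z (\<sigma> r))"

lemma point_permute: "r \<in> {1..l} \<Longrightarrow> point (permute l \<sigma> z) r = point z (\<sigma> r)"
  by (simp add: point_def permute_def)

definition average :: "nat \<Rightarrow> ((nat, 'd::finite) configuration \<Rightarrow> real) \<Rightarrow> (nat, 'd::finite) configuration \<Rightarrow> real" where
  "average l p z = 1 / fact l * (\<Sum>\<sigma> | \<sigma> permutes {1..l}. p (permute l \<sigma> z))"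

text \<open>Permuting the variables of a product of functions permutes the functions by the inverse,
  and the sum over the group does not see the inverse. The permanent that results is a signed sum of
  powers by Ryser's formula, with sums of the given functions as new test functions.\<close>

lemma average_tensors:
  assumes "p \<in> tensors l"
  shows "average l p \<in> tensor_powers l"
  using assms
proof induction
  case (tensors_base \<phi>)
  let ?S = "{1..l}"
  have "average l (\<lambda>z. \<Prod>r\<in>?S. \<phi> r (point z r)) z =
    1 / fact l * (\<Sum>T\<in>Pow ?S. (- 1) ^ card (?S - T) * (\<Prod>r\<in>?S. (\<lambda>x. \<Sum>i\<in>T. \<phi> i x) (point z r)))" for z :: "(nat \<Rightarrow> real) \<times> (nat \<Rightarrow> real ^ 'a)"
  proof -
    have "(\<Sum>\<sigma> | \<sigma> permutes ?S. \<Prod>r\<in>?S. \<phi> r (point (permute l \<sigma> z) r)) = (\<Sum>\<sigma> | \<sigma> permutes ?S. \<Prod>r\<in>?S. \<phi> r (point z (\<sigma> r)))"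
      by (intro sum.cong prod.cong refl) (simp add: point_permute)
    also have "\<dots> = (\<Sum>\<sigma> | \<sigma> permutes ?S. \<Prod>r\<in>?S. \<phi> r (point z (inv \<sigma> r)))"
      by (rule sum_permutations_inverse)
    also have "\<dots> = (\<Sum>\<sigma> | \<sigma> permutes ?S. \<Prod>r\<in>?S. \<phi> (\<sigma> r) (point z r))"
    proof (rule sum.cong)
      fix \<sigma> assume "\<sigma> \<in> {\<sigma>. \<sigma> permutes ?S}"
      then have \<sigma>: "\<sigma> permutes ?S" by simp
      show "(\<Prod>r\<in>?S. \<phi> r (point z (inv \<sigma> r))) = (\<Prod>r\<in>?S. \<phi> (\<sigma> r) (point z r))"
        by (subst prod.permute[OF \<sigma>]) (simp add: permutes_inverses(2)[OF \<sigma>])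
    qed simp
    also have "\<dots> = (\<Sum>T\<in>Pow ?S. (- 1) ^ card (?S - T) * (\<Prod>r\<in>?S. \<Sum>i\<in>T. \<phi> i (point z r)))"
      by (rule permanent_Ryser) simp
    finally show ?thesis by (simp only: average_def)
  qed
  moreover have "(\<lambda>z. 1 / fact l * (\<Sum>T\<in>Pow ?S. (- 1) ^ card (?S - T) * (\<Prod>r\<in>?S. (\<lambda>x. \<Sum>i\<in>T. \<phi> i x) (point z r)))) \<in> tensor_powers l"
  proof (rule powers_cmult, rule powers_sum)
    fix T assume "T \<in> Pow ?S"
    then have "finite T" by (auto intro: finite_subset)
    then have "(\<lambda>x. \<Sum>i\<in>T. \<phi> i x) \<in> test_functions" using tensors_base by (rule test_functions_sum)
    from powers_cmult[OF powers_base[OF this]]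
    show "(\<lambda>z. (- 1) ^ card (?S - T) * (\<Prod>r\<in>?S. (\<lambda>x. \<Sum>i\<in>T. \<phi> i x) (point z r))) \<in> tensor_powers l" .
  qed simp
  ultimately show ?case by (simp only: fun_eq_iff[symmetric] ext)
next
  case tensors_zero
  then show ?case by (simp add: average_def[abs_def] powers_zero)
next
  case (tensors_add p q)
  have "average l (\<lambda>z. p z + q z) = (\<lambda>z. average l p z + average l q z)"
    by (simp add: average_def fun_eq_iff sum.distrib distrib_left)
  then show ?case using powers_add tensors_add.IH by simp
next
  case (tensors_cmult p c)
  have "average l (\<lambda>z. c * p z) = (\<lambda>z. c * average l p z)"
    by (simp add: average_def fun_eq_iff sum_distrib_left[symmetric])
  then show ?case using powers_cmult tensors_cmult.IH by simp
qed

section \<open>Density of products of test functions\<close>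

context tame_noise
begin

lemma point_measurable:
  assumes "r \<in> V"
  shows "(\<lambda>z. point z r) \<in> config V \<rightarrow>\<^sub>M borel"
proof -
  have "(\<lambda>z. (fst z r, snd z r)) \<in> config V \<rightarrow>\<^sub>M borel \<Otimes>\<^sub>M borel"
    by (intro measurable_Pair measurable_compose[OF measurable_fst T.component_borel[OF assms]]
        measurable_compose[OF measurable_snd X.component_borel[OF assms]])
  then show ?thesis by (simp add: point_def borel_prod)
qed

lemma pair_borel_measurable:
  fixes \<phi> :: "real \<times> (real ^ 'd) \<Rightarrow> 'x::topological_space"
  assumes "\<phi> \<in> borel_measurable borel"
  shows "(\<lambda>(s, y). \<phi> (s, y)) \<in> borel_measurable (half_line \<Otimes>\<^sub>M lborel)"
proof -
  have "(\<lambda>p. (fst p, snd p)) \<in> half_line \<Otimes>\<^sub>M (lborel :: (real ^ 'd) measure) \<rightarrow>\<^sub>M borel \<Otimes>\<^sub>M borel"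
    by (intro measurable_Pair measurable_compose[OF measurable_fst id_half_line] measurable_compose[OF measurable_snd X.id_B])
  then have "(\<lambda>p. (fst p, snd p)) \<in> half_line \<Otimes>\<^sub>M (lborel :: (real ^ 'd) measure) \<rightarrow>\<^sub>M borel" by (simp add: borel_prod)
  from measurable_compose[OF this assms] show ?thesis by (simp add: split_def)
qed

lemma prod_vertices_two:
  "(\<Prod>v\<in>vertices 2 (\<lambda>_. l). f v) = (\<Prod>r\<in>{1..l}. f (1, r)) * (\<Prod>r\<in>{1..l}. f (2, r) :: 'x::comm_monoid_mult)"
proof -
  have two: "{1..2 :: nat} = {1, 2}" by auto
  have "vertices 2 (\<lambda>_. l) = Pair 1 ` {1..l} \<union> Pair 2 ` {1..l}" unfolding vertices_def two by auto
  then show ?thesis by (simp only:) (subst prod.union_disjoint, auto simp: prod.reindex inj_on_def)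
qed

lemma test_function_borel: "\<phi> \<in> test_functions \<Longrightarrow> \<phi> \<in> borel_measurable borel"
  by (rule borel_measurable_continuous_onI) (rule test_function_continuous)

text \<open>A common class for test functions and indicators of boxes: Borel, bounded, and zero off
  a ball. The products of such functions have finite norm.\<close>

definition compactly_bounded :: "(real \<times> (real ^ 'd) \<Rightarrow> real) set" where
  "compactly_bounded = {\<psi>. \<psi> \<in> borel_measurable borel \<and> (\<exists>b r. 0 \<le> b \<and> (\<forall>x. \<bar>\<psi> x\<bar> \<le> b * indicator (cball 0 r) x))}"

lemma compactly_bounded_test:
  assumes "\<phi> \<in> test_functions"
  shows "\<phi> \<in> compactly_bounded"
proof (rule test_function_bound[OF assms])
  fix r b assume "0 \<le> b" "\<And>x. \<bar>\<phi> x\<bar> \<le> b * indicator (cball 0 r) x"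
  then show ?thesis using test_function_borel[OF assms] unfolding compactly_bounded_def by blast
qed

lemma compactly_bounded_box: "indicator (box a b) \<in> compactly_bounded"
proof -
  obtain R where R: "box a b \<subseteq> ball 0 R" using bounded_subset_ballD[OF bounded_box, of a b 0] by blast
  then have "box a b \<subseteq> cball 0 R" using ball_subset_cball by (rule subset_trans)
  then have "\<bar>indicator (box a b) x :: real\<bar> \<le> 1 * indicator (cball 0 R) x" for x
    by (auto simp: indicator_def simp del: mem_ball mem_cball mem_cball_0 mem_ball_0)
  then show ?thesis unfolding compactly_bounded_def by (intro CollectI conjI exI[of _ 1] exI[of _ R] borel_measurable_indicator) auto
qed

text \<open>Both factors are dominated by multiples of the indicator of one closed ball, to which
  \<open>bounded_finite\<close> applies.\<close>

lemma compactly_bounded_pair: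
  assumes \<phi>: "\<phi> \<in> compactly_bounded" and \<psi>: "\<psi> \<in> compactly_bounded"
  shows "integrable noise12 (\<lambda>w. \<phi> (fst w 1, snd w 1) * \<psi> (fst w 2, snd w 2))"
proof -
  obtain b r where b: "0 \<le> b" "\<And>x. \<bar>\<phi> x\<bar> \<le> b * indicator (cball 0 r) x" using \<phi> unfolding compactly_bounded_def by blast
  obtain b' r' where b': "0 \<le> b'" "\<And>x. \<bar>\<psi> x\<bar> \<le> b' * indicator (cball 0 r') x" using \<psi> unfolding compactly_bounded_def by blast
  have meas: "\<phi> \<in> borel_measurable borel" "\<psi> \<in> borel_measurable borel" using \<phi> \<psi> by (simp_all add: compactly_bounded_def)
  let ?R = "max r r'" and ?i = "\<lambda>w. indicator (cball 0 (max r r')) (fst w 1, snd w 1) * indicator (cball 0 (max r r')) (fst w 2, snd w 2) :: ennreal"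
  have pm: "(\<lambda>z. \<theta> (point z v)) \<in> borel_measurable noise12" if "\<theta> \<in> borel_measurable borel" "v \<in> {1, 2 :: nat}" for \<theta> :: "_ \<Rightarrow> 'x::topological_space" and v
    unfolding measurable_noise by (rule measurable_compose[OF point_measurable[OF that(2)] that(1)])
  have im: "(indicator (cball 0 ?R) :: real \<times> (real ^ 'd) \<Rightarrow> ennreal) \<in> borel_measurable borel" by (rule borel_measurable_indicator) simp
  have bound: "ennreal \<bar>\<theta> x\<bar> \<le> ennreal c * indicator (cball 0 ?R) x" if c: "0 \<le> c" "\<And>x. \<bar>\<theta> x\<bar> \<le> c * indicator (cball 0 s) x" "s \<le> ?R"
    for \<theta> :: "real \<times> (real ^ 'd) \<Rightarrow> real" and c s x
  proof -
    have "cball (0 :: real \<times> (real ^ 'd)) s \<subseteq> cball 0 ?R" using c(3) by (rule subset_cball)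
    then have "c * indicator (cball 0 s) x \<le> c * (indicator (cball 0 ?R) x :: real)"
      using c(1) by (intro mult_left_mono) (auto simp: indicator_def simp del: mem_cball mem_cball_0)
    with c(2)[of x] have "\<bar>\<theta> x\<bar> \<le> c * indicator (cball 0 ?R) x" by (rule order_trans)
    then have "ennreal \<bar>\<theta> x\<bar> \<le> ennreal (c * indicator (cball 0 ?R) x)" by (rule ennreal_leI)
    then show ?thesis using c(1) by (simp add: ennreal_mult' ennreal_indicator)
  qed
  show ?thesis
  proof (rule integrableI_bounded)
    show "(\<lambda>w. \<phi> (fst w 1, snd w 1) * \<psi> (fst w 2, snd w 2)) \<in> borel_measurable noise12"
      using borel_measurable_times[OF pm[OF meas(1), of 1] pm[OF meas(2), of 2]] unfolding point_def by simp
    have "(\<integral>\<^sup>+w. ennreal (norm (\<phi> (fst w 1, snd w 1) * \<psi> (fst w 2, snd w 2))) \<partial>noise12) \<le> (\<integral>\<^sup>+w. (ennreal b * ennreal b') * ?i w \<partial>noise12)"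
    proof (rule nn_integral_mono)
      fix w
      have "ennreal (norm (\<phi> (fst w 1, snd w 1) * \<psi> (fst w 2, snd w 2))) = ennreal \<bar>\<phi> (fst w 1, snd w 1)\<bar> * ennreal \<bar>\<psi> (fst w 2, snd w 2)\<bar>"
        by (simp add: abs_mult ennreal_mult)
      also have "\<dots> \<le> (ennreal b * indicator (cball 0 ?R) (fst w 1, snd w 1)) * (ennreal b' * indicator (cball 0 ?R) (fst w 2, snd w 2))"
        by (intro mult_mono bound[OF b] bound[OF b']) simp_all
      finally show "ennreal (norm (\<phi> (fst w 1, snd w 1) * \<psi> (fst w 2, snd w 2))) \<le> (ennreal b * ennreal b') * ?i w" by (simp only: mult_ac)
    qed
    also have "\<dots> = (ennreal b * ennreal b') * (\<integral>\<^sup>+w. ?i w \<partial>noise12)"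
    proof (rule nn_integral_cmult)
      show "?i \<in> borel_measurable noise12"
        using borel_measurable_times_ennreal[OF pm[OF im, of 1] pm[OF im, of 2]] unfolding point_def by simp
    qed
    also have "\<dots> < \<infinity>" using bounded_finite[of ?R] by (simp add: ennreal_mult_less_top)
    finally show "(\<integral>\<^sup>+w. ennreal (norm (\<phi> (fst w 1, snd w 1) * \<psi> (fst w 2, snd w 2))) \<partial>noise12) < \<infinity>" .
  qed
qed

text \<open>Along the straight diagram a product of functions of single variables splits into
  integrals over single edges.\<close>

lemma compactly_bounded_product:
  assumes \<phi>: "\<And>r. \<phi> r \<in> compactly_bounded"
  shows "(\<lambda>z. \<Prod>r\<in>{1..l}. \<phi> r (point z r)) \<in> finite_norm l"
proof -
  have \<phi>m: "\<phi> r \<in> borel_measurable borel" and abs: "(\<lambda>x. \<bar>\<phi> r x\<bar>) \<in> compactly_bounded" for r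
    using \<phi>[of r] by (auto simp: compactly_bounded_def)
  have m: "(\<lambda>z. \<Prod>r\<in>{1..l}. \<phi> r (point z r)) \<in> \<F> l"
    by (intro borel_measurable_prod measurable_compose[OF point_measurable \<phi>m])
  have am: "(\<lambda>x. \<bar>\<phi> r x\<bar>) \<in> borel_measurable borel" for r using \<phi>m by simp
  let ?g = "\<lambda>z. \<Prod>v\<in>vertices 2 (\<lambda>_. l). \<bar>\<phi> (snd v) (fst z v, snd z v)\<bar>"
  have "integrable (straight l) ?g"
    using integral_noise_prod[OF pairing_diagram[OF straight_diagram_in], of "\<lambda>v s y. \<bar>\<phi> (snd v) (s, y)\<bar>" l,
        OF pair_borel_measurable[OF am] compactly_bounded_pair[OF abs abs]] by (rule conjunct1)
  then have "(\<integral>\<^sup>+z. ennreal (norm (?g z)) \<partial>straight l) < \<infinity>" unfolding integrable_iff_bounded by (rule conjunct2)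
  moreover have "ennreal (norm (?g z)) = ennreal \<bar>\<Prod>r\<in>{1..l}. \<phi> r (point (row1 l z) r)\<bar> * ennreal \<bar>\<Prod>r\<in>{1..l}. \<phi> r (point (row2 l z) r)\<bar>" for z
    unfolding prod_vertices_two
    by (simp add: abs_prod abs_mult point_def row_def ennreal_mult prod_nonneg cong: prod.cong_simp)
  ultimately show ?thesis using m by (simp add: finite_norm_def sqn_def sq_norm_def)
qed

lemma tensor_finite_norm:
  assumes "\<And>r. \<phi> r \<in> test_functions"
  shows "(\<lambda>z. \<Prod>r\<in>{1..l}. \<phi> r (point z r)) \<in> finite_norm l"
  by (intro compactly_bounded_product compactly_bounded_test assms)

lemma tensors_finite_norm: "p \<in> tensors l \<Longrightarrow> p \<in> finite_norm l"
proof (induction rule: tensors.induct)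
  case (tensors_base \<phi>)
  then show ?case by (rule tensor_finite_norm)
qed (simp_all only: finite_norm_zero finite_norm_add finite_norm_cmult)

lemma dense_tensors_add: "dense_in l (tensors l) f \<Longrightarrow> dense_in l (tensors l) g \<Longrightarrow> dense_in l (tensors l) (\<lambda>z. f z + g z)"
  by (rule dense_in_add[OF tensors_add])

lemma dense_tensors_cmult: "dense_in l (tensors l) f \<Longrightarrow> dense_in l (tensors l) (\<lambda>z. c * f z)"
  by (rule dense_in_cmult[OF tensors_cmult])

lemma dense_tensors_sum:
  "finite S \<Longrightarrow> (\<And>i. i \<in> S \<Longrightarrow> dense_in l (tensors l) (f i)) \<Longrightarrow> dense_in l (tensors l) (\<lambda>z. \<Sum>i\<in>S. f i z)"
proof (induction S rule: finite_induct)
  case empty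
  then show ?case by (simp add: dense_in_member[OF tensors_zero finite_norm_zero])
next
  case (insert i S)
  have 1: "dense_in l (tensors l) (f i)" by (rule insert.prems) simp
  have 2: "dense_in l (tensors l) (\<lambda>z. \<Sum>i\<in>S. f i z)" by (rule insert.IH, rule insert.prems) simp
  from dense_tensors_add[OF 1 2] show ?case using insert(1,2) by simp
qed

text \<open>Configurations outside the space of the measure, such as those with a negative time, do
  not contribute to the norm.\<close>

lemma dense_tensors_cong:
  assumes f: "dense_in l (tensors l) f" and eq: "\<And>z. z \<in> \<Omega> l \<Longrightarrow> f z = g z"
  shows "dense_in l (tensors l) g"
proof -
  obtain p where p: "range p \<subseteq> tensors l" "norm_conv l p f" using f by (auto simp: dense_in_def)
  have "g \<in> \<F> l"
    using finite_norm_measurable[OF norm_convD(2)[OF p(2)]] measurable_cong[of "config {1..l}" f g] eq by blast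
  then have "g \<in> finite_norm l" using norm_convD(2)[OF p(2)] sqn_cong[OF eq] by (simp add: finite_norm_def)
  moreover have "sqn l (\<lambda>z. p j z - g z) = sqn l (\<lambda>z. p j z - f z)" for j by (intro sqn_cong) (simp add: eq)
  ultimately have "norm_conv l p g" using norm_convD(1,3)[OF p(2)] by (intro norm_convI) simp_all
  then show ?thesis using p(1) unfolding dense_in_def by blast
qed

definition cells :: "nat \<Rightarrow> (nat \<Rightarrow> (real \<times> (real ^ 'd)) set) \<Rightarrow> (nat, 'd) configuration set" where
  "cells l U = {z \<in> \<Omega> l. \<forall>r\<in>{1..l}. point z r \<in> U r}"

lemma indicator_cells:
  "z \<in> \<Omega> l \<Longrightarrow> indicator (cells l U) z = (\<Prod>r\<in>{1..l}. indicator (U r) (point z r) :: real)"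
  by (cases "z \<in> cells l U") (auto simp: cells_def indicator_def intro: prod.neutral)

lemma cells_sets:
  assumes "\<And>r. U r \<in> sets borel"
  shows "cells l U \<in> sets (config {1..l})"
proof -
  have "{z \<in> \<Omega> l. point z r \<in> U r} \<in> sets (config {1..l})" if "r \<in> {1..l}" for r
    using measurable_sets[OF point_measurable[OF that] assms[of r]] by (simp add: vimage_def Int_def conj_commute)
  then show ?thesis unfolding cells_def by (intro sets.sets_Collect_finite_All) auto
qed

text \<open>The bump functions stay below the indicator of the box, which itself has finite norm, so
  they converge to it by domination.\<close>

lemma box_cells_finite_norm: "(indicator (cells l (\<lambda>r. box (a r) (b r))) :: _ \<Rightarrow> real) \<in> finite_norm l"
  and dense_box_cells: "dense_in l (tensors l) (indicator (cells l (\<lambda>r. box (a r) (b r))))"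
proof -
  let ?A = "cells l (\<lambda>r. box (a r) (b r))"
  have m: "(indicator ?A :: _ \<Rightarrow> real) \<in> \<F> l"
    by (intro borel_measurable_indicator cells_sets) simp
  show fn: "(indicator ?A :: _ \<Rightarrow> real) \<in> finite_norm l"
  proof (rule finite_norm_dominated[OF m compactly_bounded_product[where \<phi>="\<lambda>r. indicator (box (a r) (b r))", OF compactly_bounded_box]])
    fix z assume z: "z \<in> \<Omega> l"
    show "\<bar>indicator ?A z\<bar> \<le> (\<Prod>r\<in>{1..l}. indicator (box (a r) (b r)) (point z r) :: real)"
      unfolding indicator_cells[OF z, symmetric] by (simp only: abs_of_nonneg[OF indicator_pos_le] order_refl)
  qed
  let ?p = "\<lambda>j z. \<Prod>r\<in>{1..l}. box_bump (a r) (b r) j (point z r)"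
  have p: "?p j \<in> tensors l" for j by (rule tensors_base) (rule box_bump_test_function)
  have "norm_conv l ?p (indicator ?A)"
  proof (rule norm_conv_dominated[OF finite_norm_measurable[OF tensors_finite_norm[OF p]] m fn])
    fix j z assume z: "z \<in> \<Omega> l"
    show "\<bar>?p j z\<bar> \<le> indicator ?A z"
      unfolding indicator_cells[OF z] abs_prod by (intro prod_mono) (auto simp: box_bump_bounds)
  next
    fix z assume z: "z \<in> \<Omega> l"
    show "(\<lambda>j. ?p j z) \<longlonglongrightarrow> indicator ?A z"
      unfolding indicator_cells[OF z] by (intro tendsto_prod box_bump_tendsto)
  qed
  moreover have "range ?p \<subseteq> tensors l" by (rule image_subsetI) (rule p)
  ultimately show "dense_in l (tensors l) (indicator ?A)" unfolding dense_in_def by (intro exI[of _ ?p] conjI)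
qed

text \<open>The indicator of a set of configurations may have infinite norm. Cutting off by a
  bounded box makes it finite and supplies a dominating function.\<close>

definition window :: "nat \<Rightarrow> nat \<Rightarrow> (nat, 'd) configuration set" where
  "window l N = cells l (\<lambda>r. box (- (real N *\<^sub>R One)) (real N *\<^sub>R One))"

text \<open>Boxes form a class that is closed under intersection; the whole space is added to leave
  a coordinate unrestricted.\<close>

definition generators :: "(real \<times> (real ^ 'd)) set set" where
  "generators = insert UNIV (range (\<lambda>(a, b). box a b))"

lemma generators_UNIV: "UNIV \<in> generators"
  by (simp add: generators_def)

lemma generators_box: "box a b \<in> generators"
  unfolding generators_def by (rule insertI2) (rule range_eqI[of _ _ "(a, b)"], simp)

lemma generatorsE:
  assumes "U \<in> generators"
  obtains "U = UNIV" | a b where "U = box a b"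
  using assms unfolding generators_def by (elim insertE rangeE) (auto simp: split_def intro: that)

lemma generators_Int:
  assumes U: "U \<in> generators" and V: "V \<in> generators"
  shows "U \<inter> V \<in> generators"
proof (rule generatorsE[OF U])
  assume "U = UNIV"
  then show ?thesis using V by simp
next
  fix a b assume U: "U = box a b"
  show ?thesis
  proof (rule generatorsE[OF V])
    assume "V = UNIV"
    then show ?thesis using U generators_box by simp
  next
    fix c d assume V: "V = box c d"
    show ?thesis unfolding U V box_Int_box by (rule generators_box)
  qed
qed

text \<open>The sigma-algebra is generated by the coordinates, and the Borel sets of a coordinate by
  boxes. That times are nonnegative is built into the space, so no generator has to express
  it.\<close>

lemma sets_config_generated:
  "sets (config {1..l}) = sigma_sets (\<Omega> l) {cells l U | U. \<forall>r. U r \<in> generators}"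
proof
  let ?S = "\<Omega> l :: (nat, 'd) configuration set" and ?G = "{cells l U | U. \<forall>r. U r \<in> generators}"
  have G: "?G \<subseteq> Pow ?S" by (auto simp: cells_def)
  have borel: "U \<in> sets borel" if "U \<in> generators" for U using that by (rule generatorsE) simp_all
  show "sigma_sets ?S ?G \<subseteq> sets (config {1..l})"
  proof (rule sets.sigma_sets_subset, rule subsetI)
    fix A assume "A \<in> ?G"
    then obtain U where "A = cells l U" "\<forall>r. U r \<in> generators" by blast
    then show "A \<in> sets (config {1..l})" using cells_sets[of U l] borel by blast
  qed
  let ?M = "sigma ?S ?G"
  have coord: "(\<lambda>z. point z r) \<in> ?M \<rightarrow>\<^sub>M borel" if r: "r \<in> {1..l}" for r
    unfolding borel_eq_box
  proof (rule measurable_measure_of)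
    fix B :: "(real \<times> (real ^ 'd)) set" assume B: "B \<in> range (\<lambda>(a, b). box a b)"
    have "(\<lambda>z. point z r) -` B \<inter> space ?M = cells l (\<lambda>i. if i = r then B else UNIV)"
      using r G by (auto simp: cells_def space_measure_of)
    moreover have "B \<in> generators" using B by (simp add: generators_def)
    then have "cells l (\<lambda>i. if i = r then B else UNIV) \<in> ?G"
      by (intro CollectI exI[of _ "\<lambda>i. if i = r then B else UNIV"] conjI refl) (simp add: generators_UNIV)
    ultimately show "(\<lambda>z. point z r) -` B \<inter> space ?M \<in> sets ?M" using G by (simp add: sets_measure_of)
  qed auto
  have sp: "space ?M = ?S" using G by (simp add: space_measure_of)
  have c1: "(\<lambda>z. fst z r) \<in> ?M \<rightarrow>\<^sub>M half_line" if r: "r \<in> {1..l}" for r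
  proof (rule measurable_restrict_space2)
    have "(\<lambda>z. fst (point z r)) \<in> ?M \<rightarrow>\<^sub>M borel"
      by (rule measurable_compose[OF coord[OF r]]) (simp add: borel_prod[symmetric])
    then show "(\<lambda>z. fst z r) \<in> ?M \<rightarrow>\<^sub>M lborel" by (simp add: point_def)
    show "(\<lambda>z. fst z r) \<in> space ?M \<rightarrow> {0..}"
      unfolding sp using r by (auto simp: space_pair_measure space_PiM space_restrict_space PiE_iff)
  qed
  have c2: "(\<lambda>z. snd z r) \<in> ?M \<rightarrow>\<^sub>M lborel" if r: "r \<in> {1..l}" for r
  proof -
    have "(\<lambda>z. snd (point z r)) \<in> ?M \<rightarrow>\<^sub>M borel"
      by (rule measurable_compose[OF coord[OF r]]) (simp add: borel_prod[symmetric])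
    then show ?thesis by (simp add: point_def)
  qed
  have "(\<lambda>z. (fst z, snd z)) \<in> ?M \<rightarrow>\<^sub>M config {1..l}"
  proof (rule measurable_Pair)
    have "(\<lambda>z r. fst z r) \<in> ?M \<rightarrow>\<^sub>M (\<Pi>\<^sub>M v\<in>{1..l}. half_line)"
    proof (rule measurable_PiM_single'[OF c1])
      show "(\<lambda>z r. fst z r) \<in> space ?M \<rightarrow> (\<Pi>\<^sub>E v\<in>{1..l}. space half_line)"
        unfolding sp unfolding space_pair_measure space_PiM by (intro Pi_I) (simp only: mem_Times_iff)
    qed
    then show "fst \<in> ?M \<rightarrow>\<^sub>M (\<Pi>\<^sub>M v\<in>{1..l}. half_line)" .
    have "(\<lambda>z r. snd z r) \<in> ?M \<rightarrow>\<^sub>M (\<Pi>\<^sub>M v\<in>{1..l}. lborel)"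
    proof (rule measurable_PiM_single'[OF c2])
      show "(\<lambda>z r. snd z r) \<in> space ?M \<rightarrow> (\<Pi>\<^sub>E v\<in>{1..l}. space lborel)"
        unfolding sp unfolding space_pair_measure space_PiM by (intro Pi_I) (simp only: mem_Times_iff)
    qed
    then show "snd \<in> ?M \<rightarrow>\<^sub>M (\<Pi>\<^sub>M v\<in>{1..l}. lborel)" .
  qed
  then have id: "(\<lambda>z. z) \<in> ?M \<rightarrow>\<^sub>M config {1..l}" by simp
  show "sets (config {1..l}) \<subseteq> sigma_sets ?S ?G"
  proof
    fix A assume A: "A \<in> sets (config {1..l} :: (nat, 'd) configuration measure)"
    from measurable_sets[OF id A] have "A \<inter> ?S \<in> sets ?M" by (simp only: sp vimage_ident)
    moreover have "A \<inter> ?S = A" using sets.sets_into_space[OF A] by blast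
    ultimately show "A \<in> sigma_sets ?S ?G" using G by (simp add: sets_measure_of)
  qed
qed

lemma window_sets: "window l N \<in> sets (config {1..l})"
  unfolding window_def by (rule cells_sets) simp

lemma window_finite_norm: "(indicator (window l N) :: _ \<Rightarrow> real) \<in> finite_norm l"
  unfolding window_def by (rule box_cells_finite_norm)

text \<open>Dynkin's argument inside the window: a generator becomes a product of boxes there,
  complements are differences from the window, and a disjoint union converges under the indicator of
  the window as dominating function.\<close>

lemma dense_window:
  assumes A: "A \<in> sets (config {1..l})"
  shows "dense_in l (tensors l) (indicator (A \<inter> window l N))"
proof -
  let ?S = "\<Omega> l :: (nat, 'd) configuration set" and ?G = "{cells l U | U. \<forall>r. U r \<in> generators}"
  let ?B = "box (- (real N *\<^sub>R One)) (real N *\<^sub>R One) :: (real \<times> (real ^ 'd)) set"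
  have dw: "dense_in l (tensors l) (indicator (window l N))" unfolding window_def by (rule dense_box_cells)
  have "Int_stable ?G"
  proof (rule Int_stableI)
    fix A B assume "A \<in> ?G" "B \<in> ?G"
    then obtain U V where "A = cells l U" "B = cells l V" "\<forall>r. U r \<in> generators" "\<forall>r. V r \<in> generators" by blast
    then show "A \<inter> B \<in> ?G" by (intro CollectI exI[of _ "\<lambda>r. U r \<inter> V r"]) (auto simp: cells_def intro: generators_Int)
  qed
  moreover have "?G \<subseteq> Pow ?S" by (auto simp: cells_def)
  moreover have "A \<in> sigma_sets ?S ?G" using A by (simp only: sets_config_generated)
  ultimately show ?thesis
  proof (induction rule: sigma_sets_induct_disjoint)
    case (basic A)
    then obtain U where U: "A = cells l U" "\<forall>r. U r \<in> generators" by blast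
    have "\<exists>q. U r \<inter> ?B = box (fst q) (snd q)" for r
    proof -
      from U(2) have "U r \<in> generators" by simp
      then show ?thesis
      proof (cases rule: generatorsE)
        case 1
        then show ?thesis by (intro exI[of _ "(- (real N *\<^sub>R One), real N *\<^sub>R One)"]) simp
      next
        case 2
        have "\<exists>x y. U r \<inter> ?B = box x y" unfolding 2 box_Int_box by (intro exI) (rule refl)
        then obtain x y where "U r \<inter> ?B = box x y" by blast
        then show ?thesis by (intro exI[of _ "(x, y)"]) simp
      qed
    qed
    from choice[OF allI[OF this]] obtain q where q: "\<forall>r. U r \<inter> ?B = box (fst (q r)) (snd (q r))" ..
    have "A \<inter> window l N = cells l (\<lambda>r. U r \<inter> ?B)" unfolding U(1) window_def by (auto simp: cells_def)
    then show ?case using dense_box_cells[of l "\<lambda>r. fst (q r)" "\<lambda>r. snd (q r)"] q by simp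
  next
    case empty
    then show ?case by (simp add: dense_in_member[OF tensors_zero finite_norm_zero] indicator_def)
  next
    case (compl A)
    from dense_tensors_add[OF dw dense_tensors_cmult[OF compl(2), of "- 1"]]
    show ?case by (rule dense_tensors_cong) (auto simp: indicator_def)
  next
    case (union A)
    have Am: "A i \<in> sets (config {1..l})" for i
    proof -
      have "A i \<in> sigma_sets ?S ?G" using union(2) by blast
      then show ?thesis by (simp only: sets_config_generated)
    qed
    have conv: "norm_conv l (\<lambda>j z. \<Sum>i<j. indicator (A i \<inter> window l N) z) (indicator ((\<Union>i. A i) \<inter> window l N))"
    proof (rule norm_conv_dominated[OF _ _ window_finite_norm])
      show "(\<lambda>z. \<Sum>i<j. indicator (A i \<inter> window l N) z :: real) \<in> \<F> l" for j
        by (intro borel_measurable_sum borel_measurable_indicator sets.Int Am window_sets)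
      show "(indicator ((\<Union>i. A i) \<inter> window l N) :: _ \<Rightarrow> real) \<in> \<F> l"
        by (intro borel_measurable_indicator sets.Int window_sets sets.countable_UN) (use Am in auto)
      fix z :: "(nat, 'd) configuration"
      have eq: "(\<Sum>i<j. indicator (A i \<inter> window l N) z :: real) = indicator ((\<Union>i<j. A i) \<inter> window l N) z" for j
      proof -
        have "(\<Sum>i<j. indicator (A i) z :: real) = indicator (\<Union>i<j. A i) z"
          using union(1) by (intro indicator_UN_disjoint[symmetric]) (auto simp: disjoint_family_on_def)
        then show ?thesis by (simp add: indicator_inter_arith sum_distrib_right[symmetric])
      qed
      show "\<bar>\<Sum>i<j. indicator (A i \<inter> window l N) z :: real\<bar> \<le> indicator (window l N) z" for j
        unfolding eq by (auto simp: indicator_def)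
      show "(\<lambda>j. \<Sum>i<j. indicator (A i \<inter> window l N) z :: real) \<longlonglongrightarrow> indicator ((\<Union>i. A i) \<inter> window l N) z"
      proof (cases "z \<in> (\<Union>i. A i) \<inter> window l N")
        case True
        then obtain i where i: "z \<in> A i" by blast
        have "eventually (\<lambda>j. (\<Sum>i<j. indicator (A i \<inter> window l N) z :: real) = 1) sequentially"
          using eventually_gt_at_top[of i] by eventually_elim (use i True in \<open>simp add: eq del: sum_indicator_eq_card, auto simp: indicator_def\<close>)
        then show ?thesis using True by (simp add: tendsto_eventually)
      next
        case False
        then have "(\<Sum>i<j. indicator (A i \<inter> window l N) z :: real) = 0" for j by (auto simp: eq)
        then show ?thesis using False by simp
      qed
    qed
    show ?case
      by (rule dense_in_limit[OF _ conv]) (intro dense_tensors_sum union(3) finite_lessThan)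
  qed
qed

text \<open>Simple functions that converge to \<open>f\<close> and are bounded by
  \<open>2 * \<bar>f\<bar>\<close>, cut off to growing windows, stay under one function of finite
  norm. Each of them is a finite combination of indicators inside a window.\<close>

lemma dense_tensors:
  assumes f: "f \<in> finite_norm l"
  shows "dense_in l (tensors l) f"
proof -
  from borel_measurable_implies_sequence_metric[OF finite_norm_measurable[OF f], of 0] obtain s where
    s: "\<And>i. simple_function (config {1..l}) (s i)" "\<And>z. z \<in> \<Omega> l \<Longrightarrow> (\<lambda>i. s i z) \<longlonglongrightarrow> f z"
       "\<And>i z. z \<in> \<Omega> l \<Longrightarrow> dist (s i z) 0 \<le> 2 * dist (f z) 0" by blast
  let ?p = "\<lambda>i z. s i z * indicator (window l i) z"
  have dense: "dense_in l (tensors l) (?p i)" for i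
  proof -
    let ?A = "\<lambda>y. s i -` {y} \<inter> \<Omega> l"
    have A: "?A y \<in> sets (config {1..l})" for y using s(1)[of i] by (rule simple_functionD)
    have fin: "finite (s i ` \<Omega> l)" using s(1)[of i] by (rule simple_functionD)
    have "dense_in l (tensors l) (\<lambda>z. \<Sum>y\<in>s i ` \<Omega> l. y * indicator (?A y \<inter> window l i) z)"
      by (intro dense_tensors_sum[OF fin] dense_tensors_cmult dense_window[OF A])
    then show ?thesis
    proof (rule dense_tensors_cong)
      fix z assume z: "z \<in> space (config {1..l} :: (nat, 'd) configuration measure)"
      have "(\<Sum>y\<in>s i ` \<Omega> l. y * indicator (?A y \<inter> window l i) z) =
        (\<Sum>y\<in>s i ` \<Omega> l. if y = s i z then s i z * indicator (window l i) z else 0)"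
        using z by (intro sum.cong) (auto simp: indicator_def)
      also have "\<dots> = s i z * indicator (window l i) z" using fin z by (subst sum.delta) auto
      finally show "(\<Sum>y\<in>s i ` \<Omega> l. y * indicator (?A y \<inter> window l i) z) = s i z * indicator (window l i) z" .
    qed
  qed
  have "norm_conv l ?p f"
  proof (rule norm_conv_dominated[OF _ finite_norm_measurable[OF f] finite_norm_cmult[OF finite_norm_abs[OF f], of 2]])
    show "?p i \<in> \<F> l" for i
      by (intro borel_measurable_times borel_measurable_indicator window_sets borel_measurable_simple_function s(1))
    fix z assume z: "z \<in> space (config {1..l} :: (nat, 'd) configuration measure)"
    show "\<bar>?p i z\<bar> \<le> 2 * \<bar>f z\<bar>" for i using s(3)[OF z, of i] by (auto simp: indicator_def dist_norm)
    have "\<forall>r. \<exists>N. \<forall>i\<ge>N. point z r \<in> box (- (real i *\<^sub>R One)) (real i *\<^sub>R One)"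
    proof
      fix r
      obtain N where N: "norm (point z r) < real N" using reals_Archimedean2 by blast
      have "point z r \<in> box (- (real i *\<^sub>R One)) (real i *\<^sub>R One)" if "N \<le> i" for i
        unfolding mem_box
      proof
        fix b :: "real \<times> (real ^ 'd)" assume b: "b \<in> Basis"
        have "\<bar>point z r \<bullet> b\<bar> < real i" using Basis_le_norm[OF b, of "point z r"] N that by linarith
        then show "- (real i *\<^sub>R One) \<bullet> b < point z r \<bullet> b \<and> point z r \<bullet> b < (real i *\<^sub>R One) \<bullet> b" using b by auto
      qed
      then show "\<exists>N. \<forall>i\<ge>N. point z r \<in> box (- (real i *\<^sub>R One)) (real i *\<^sub>R One)" by blast
    qed
    from choice[OF this] obtain N where N: "\<forall>r. \<forall>i\<ge>N r. point z r \<in> box (- (real i *\<^sub>R One)) (real i *\<^sub>R One)" ..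
    \<comment> \<open>The sum of the thresholds bounds each of them, so from there on all points of
      \<open>z\<close> lie in the box.\<close>
    have "eventually (\<lambda>i. s i z = ?p i z) sequentially"
      using eventually_ge_at_top[of "\<Sum>r\<in>{1..l}. N r"]
    proof eventually_elim
      case (elim i)
      have "N r \<le> i" if "r \<in> {1..l}" for r
        using member_le_sum[OF that, of N] elim by simp
      then have "z \<in> window l i" using N z by (auto simp: window_def cells_def)
      then show ?case by simp
    qed
    from tendsto_cong[THEN iffD1, OF this s(2)[OF z]] show "(\<lambda>i. ?p i z) \<longlonglongrightarrow> f z" .
  qed
  then show ?thesis by (rule dense_in_limit[OF dense])
qed

end

section \<open>Permutations within the rows\<close>

definition shuffle :: "(nat \<Rightarrow> nat \<Rightarrow> nat) \<Rightarrow> nat \<times> nat \<Rightarrow> nat \<times> nat" where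
  "shuffle \<sigma> v = (fst v, \<sigma> (fst v) (snd v))"

lemma shuffle_bij:
  assumes "\<And>k. k \<in> {1..m} \<Longrightarrow> \<sigma> k permutes {1..n k}"
  shows "bij_betw (shuffle \<sigma>) (vertices m n) (vertices m n)"
proof (rule bij_betw_byWitness[where f'="shuffle (\<lambda>k. inv (\<sigma> k))"])
  show "\<forall>v\<in>vertices m n. shuffle (\<lambda>k. inv (\<sigma> k)) (shuffle \<sigma> v) = v"
    using permutes_inverses(2)[OF assms] unfolding vertices_def shuffle_def by (auto simp del: One_nat_def)
  show "\<forall>v\<in>vertices m n. shuffle \<sigma> (shuffle (\<lambda>k. inv (\<sigma> k)) v) = v"
    using permutes_inverses(1)[OF assms] unfolding vertices_def shuffle_def by (auto simp del: One_nat_def)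
  show "shuffle \<sigma> ` vertices m n \<subseteq> vertices m n"
  proof
    fix w assume "w \<in> shuffle \<sigma> ` vertices m n"
    then obtain k r where "w = (k, \<sigma> k r)" "k \<in> {1..m}" "r \<in> {1..n k}" unfolding vertices_def shuffle_def by force
    then show "w \<in> vertices m n" using permutes_in_image[OF assms, of k r] by (simp add: vertices_def del: One_nat_def atLeastAtMost_iff)
  qed
  show "shuffle (\<lambda>k. inv (\<sigma> k)) ` vertices m n \<subseteq> vertices m n"
  proof
    fix w assume "w \<in> shuffle (\<lambda>k. inv (\<sigma> k)) ` vertices m n"
    then obtain k r where "w = (k, inv (\<sigma> k) r)" "k \<in> {1..m}" "r \<in> {1..n k}" unfolding vertices_def shuffle_def by force
    then show "w \<in> vertices m n" using permutes_in_image[OF permutes_inv[OF assms], of k r] by (simp add: vertices_def del: One_nat_def atLeastAtMost_iff)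
  qed
qed

definition shuffle_edges :: "(nat \<Rightarrow> nat \<Rightarrow> nat) \<Rightarrow> ((nat \<times> nat) \<times> (nat \<times> nat)) set \<Rightarrow> ((nat \<times> nat) \<times> (nat \<times> nat)) set" where
  "shuffle_edges \<sigma> D = map_prod (shuffle \<sigma>) (shuffle \<sigma>) ` D"

lemma shuffle_diagram:
  assumes \<sigma>: "\<And>k. k \<in> {1..m} \<Longrightarrow> \<sigma> k permutes {1..n k}" and D: "D \<in> diagrams m n"
  shows "shuffle_edges \<sigma> D \<in> diagrams m n"
proof -
  have P: "pairing (vertices m n) (shuffle_edges \<sigma> D)"
    unfolding shuffle_edges_def by (rule pairing_image[OF pairing_diagram[OF D] shuffle_bij[OF \<sigma>]])
  have "fst a < fst b" if "(a, b) \<in> D" for a b using D that unfolding diagrams_def by fast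
  then have "fst a < fst b" if "(a, b) \<in> shuffle_edges \<sigma> D" for a b
    using that unfolding shuffle_edges_def shuffle_def by fastforce
  with pairing_edge[OF P] have 1: "\<forall>(a, b)\<in>shuffle_edges \<sigma> D. a \<in> vertices m n \<and> b \<in> vertices m n \<and> fst a < fst b" by blast
  have 2: "\<forall>v\<in>vertices m n. \<exists>!e. e \<in> shuffle_edges \<sigma> D \<and> (v = fst e \<or> v = snd e)"
    by (intro ballI pairing_ex1[OF P])
  show ?thesis unfolding diagrams_def by (intro CollectI conjI 1 2)
qed

text \<open>Shuffling within the rows keeps the rows of the end points, so it maps diagrams to
  diagrams. It is injective, and there are finitely many diagrams.\<close>

lemma sum_diagrams_shuffle:
  assumes \<sigma>: "\<And>k. k \<in> {1..m} \<Longrightarrow> \<sigma> k permutes {1..n k}"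
  shows "(\<Sum>D\<in>diagrams m n. f (shuffle_edges \<sigma> D)) = (\<Sum>D\<in>diagrams m n. f D)"
proof -
  have inj: "inj_on (map_prod (shuffle \<sigma>) (shuffle \<sigma>)) (vertices m n \<times> vertices m n)"
    using bij_betw_imp_inj_on[OF shuffle_bij[OF \<sigma>]] by (intro map_prod_inj_on)
  have "inj_on (shuffle_edges \<sigma>) (diagrams m n)"
  proof (rule inj_onI)
    fix D D' assume DD: "D \<in> diagrams m n" "D' \<in> diagrams m n" "shuffle_edges \<sigma> D = shuffle_edges \<sigma> D'"
    note sub = pairing_subset[OF pairing_diagram[OF DD(1)]] pairing_subset[OF pairing_diagram[OF DD(2)]]
    show "D = D'" using DD(3) inj_on_image_eq_iff[OF inj sub] unfolding shuffle_edges_def by blast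
  qed
  moreover from this have "shuffle_edges \<sigma> ` diagrams m n = diagrams m n"
    by (intro endo_inj_surj finite_diagrams image_subsetI shuffle_diagram[OF \<sigma>])
  ultimately show ?thesis using sum.reindex[of "shuffle_edges \<sigma>" "diagrams m n" f] by (simp add: comp_def)
qed

section \<open>Invariance of the integrals under permutations\<close>

context tame_noise
begin

definition relabel :: "nat \<Rightarrow> (nat \<Rightarrow> nat) \<Rightarrow> (nat \<Rightarrow> nat \<Rightarrow> nat) \<Rightarrow> (nat \<times> nat, 'd) configuration \<Rightarrow> (nat \<times> nat, 'd) configuration" where
  "relabel m n \<sigma> = (\<lambda>(\<tau>, \<xi>). (\<lambda>v\<in>vertices m n. \<tau> (shuffle \<sigma> v), \<lambda>v\<in>vertices m n. \<xi> (shuffle \<sigma> v)))"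

lemma relabel_measurable:
  assumes \<sigma>: "\<And>k. k \<in> {1..m} \<Longrightarrow> \<sigma> k permutes {1..n k}"
  shows "relabel m n \<sigma> \<in> config (vertices m n) \<rightarrow>\<^sub>M config (vertices m n)"
proof -
  have sub: "shuffle \<sigma> ` vertices m n \<subseteq> vertices m n" using shuffle_bij[of m \<sigma> n, OF \<sigma>] by (simp add: bij_betw_def)
  show ?thesis unfolding relabel_def split_def
    by (intro measurable_Pair measurable_compose[OF measurable_fst measurable_relabel[OF sub]]
        measurable_compose[OF measurable_snd measurable_relabel[OF sub]])
qed

lemma relabel_noise:
  assumes \<sigma>: "\<And>k. k \<in> {1..m} \<Longrightarrow> \<sigma> k permutes {1..n k}" and D: "D \<in> diagrams m n"
  shows "distr (\<nu> (vertices m n) (shuffle_edges \<sigma> D)) (config (vertices m n)) (relabel m n \<sigma>) =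
    \<nu> (vertices m n) D"
  unfolding relabel_def shuffle_edges_def by (rule noise_relabel[OF pairing_diagram[OF D] shuffle_bij[OF \<sigma>]])

lemma row_relabel:
  assumes \<sigma>: "\<And>k. k \<in> {1..m} \<Longrightarrow> \<sigma> k permutes {1..n k}" and k: "k \<in> {1..m}"
  shows "row n k (relabel m n \<sigma> z) = permute (n k) (\<sigma> k) (row n k z)"
proof -
  have "(k, i) \<in> vertices m n \<and> \<sigma> k i \<in> {1..n k}" if "i \<in> {1..n k}" for i
    using that k permutes_in_image[OF \<sigma>[OF k], of i] unfolding vertices_def by blast
  then show ?thesis by (auto simp: row_def permute_def relabel_def shuffle_def fun_eq_iff split_def simp del: One_nat_def atLeastAtMost_iff)
qed

lemma permute_measurable:
  assumes "\<sigma> permutes {1..l}"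
  shows "permute l \<sigma> \<in> config {1..l} \<rightarrow>\<^sub>M config {1..l}"
proof -
  have sub: "\<sigma> ` {1..l} \<subseteq> {1..l}" using permutes_image[OF assms] by blast
  show ?thesis unfolding permute_def
    by (intro measurable_Pair measurable_compose[OF measurable_fst measurable_relabel[OF sub]]
        measurable_compose[OF measurable_snd measurable_relabel[OF sub]])
qed

lemma shuffle_straight:
  assumes \<sigma>: "\<sigma> permutes {1..l}"
  shows "shuffle_edges (\<lambda>_. \<sigma>) (straight_diagram l) = straight_diagram l"
proof -
  have "shuffle_edges (\<lambda>_. \<sigma>) (straight_diagram l) = (\<lambda>i. ((1, i), (2, i))) ` (\<sigma> ` {1..l})"
    unfolding shuffle_edges_def straight_diagram_def image_image by (simp add: shuffle_def)
  then show ?thesis by (simp only: permutes_image[OF \<sigma>] straight_diagram_def)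
qed

text \<open>The same permutation in both rows preserves the straight diagram, so this is a change of
  variables.\<close>

lemma sqn_permute:
  assumes \<sigma>: "\<sigma> permutes {1..l}" and f: "f \<in> \<F> l"
  shows "sqn l (\<lambda>z. f (permute l \<sigma> z)) = sqn l f"
proof -
  have \<sigma>': "k \<in> {1..2} \<Longrightarrow> \<sigma> permutes {1..l}" for k :: nat by (rule \<sigma>)
  have r: "row1 l (relabel 2 (\<lambda>_. l) (\<lambda>_. \<sigma>) z) = permute l \<sigma> (row1 l z)"
    "row2 l (relabel 2 (\<lambda>_. l) (\<lambda>_. \<sigma>) z) = permute l \<sigma> (row2 l z)" for z
    by (rule row_relabel[where n="\<lambda>_. l" and \<sigma>="\<lambda>_. \<sigma>"], rule \<sigma>, simp)+
  let ?g = "\<lambda>z. ennreal \<bar>f (row1 l z)\<bar> * ennreal \<bar>f (row2 l z)\<bar>"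
  have gm: "?g \<in> borel_measurable (config (vertices 2 (\<lambda>_. l)))"
    using rows_straight_compose[OF abs_measurable[OF f]] unfolding measurable_noise by (intro borel_measurable_times_ennreal)
  have rm: "relabel 2 (\<lambda>_. l) (\<lambda>_. \<sigma>) \<in> straight l \<rightarrow>\<^sub>M config (vertices 2 (\<lambda>_. l))"
    unfolding measurable_noise by (rule relabel_measurable[OF \<sigma>'])
  have "sqn l (\<lambda>z. f (permute l \<sigma> z)) = (\<integral>\<^sup>+z. ?g (relabel 2 (\<lambda>_. l) (\<lambda>_. \<sigma>) z) \<partial>straight l)"
    unfolding sqn_def sq_norm_def r ..
  also have "\<dots> = (\<integral>\<^sup>+z. ?g z \<partial>distr (straight l) (config (vertices 2 (\<lambda>_. l))) (relabel 2 (\<lambda>_. l) (\<lambda>_. \<sigma>)))"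
    by (rule nn_integral_distr[OF rm, symmetric]) (simp only: measurable_distr_eq1 gm)
  also have "distr (straight l) (config (vertices 2 (\<lambda>_. l))) (relabel 2 (\<lambda>_. l) (\<lambda>_. \<sigma>)) = straight l"
  proof -
    have "distr (\<nu> (vertices 2 (\<lambda>_. l)) (shuffle_edges (\<lambda>_. \<sigma>) (straight_diagram l))) (config (vertices 2 (\<lambda>_. l))) (relabel 2 (\<lambda>_. l) (\<lambda>_. \<sigma>)) = straight l"
      by (rule relabel_noise[OF \<sigma> straight_diagram_in])
    then show ?thesis by (simp only: shuffle_straight[OF \<sigma>])
  qed
  finally show ?thesis unfolding sqn_def sq_norm_def .
qed

lemma finite_norm_permute:
  assumes "\<sigma> permutes {1..l}" "f \<in> finite_norm l"
  shows "(\<lambda>z. f (permute l \<sigma> z)) \<in> finite_norm l"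
  using assms sqn_permute[OF assms(1) finite_norm_measurable[OF assms(2)]]
    measurable_compose[OF permute_measurable[OF assms(1)] finite_norm_measurable[OF assms(2)]] by (simp add: finite_norm_def)

lemma norm_conv_permute:
  assumes \<sigma>: "\<sigma> permutes {1..l}" and p: "norm_conv l p f"
  shows "norm_conv l (\<lambda>j z. p j (permute l \<sigma> z)) (\<lambda>z. f (permute l \<sigma> z))"
proof (rule norm_convI)
  show "(\<lambda>j. sqn l (\<lambda>z. p j (permute l \<sigma> z) - f (permute l \<sigma> z))) \<longlonglongrightarrow> 0"
    using norm_convD(3)[OF p] sqn_permute[OF \<sigma> norm_convD(4)[OF p]] by simp
qed (rule finite_norm_permute[OF \<sigma>], rule norm_convD[OF p])+

lemma norm_conv_sum:
  assumes "finite S" "\<And>i. i \<in> S \<Longrightarrow> norm_conv l (p i) (f i)"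
  shows "norm_conv l (\<lambda>j z. \<Sum>i\<in>S. p i j z) (\<lambda>z. \<Sum>i\<in>S. f i z)"
  using assms
proof (induction S rule: finite_induct)
  case empty
  show ?case using norm_conv_const[OF finite_norm_zero] by simp
next
  case (insert i S)
  have 1: "norm_conv l (p i) (f i)" by (rule insert.prems) simp
  have 2: "norm_conv l (\<lambda>j z. \<Sum>i\<in>S. p i j z) (\<lambda>z. \<Sum>i\<in>S. f i z)" by (rule insert.IH, rule insert.prems) simp
  from norm_conv_add[OF 1 2] show ?case using insert(1,2) by simp
qed

lemma norm_conv_average:
  assumes "norm_conv l p f"
  shows "norm_conv l (\<lambda>j. average l (p j)) (average l f)"
  unfolding average_def[abs_def]
  by (intro norm_conv_cmult norm_conv_sum norm_conv_permute assms) (auto simp: finite_permutations)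

text \<open>Symmetrizing the approximants turns them into combinations of tensor powers. It is
  continuous for the norm and reproduces \<open>f\<close> on the space of the measure.\<close>

lemma dense_tensor_powers:
  assumes f: "f \<in> finite_norm l"
    and sym: "\<And>\<sigma> z. \<sigma> permutes {1..l} \<Longrightarrow> z \<in> \<Omega> l \<Longrightarrow> f (permute l \<sigma> z) = f z"
  shows "\<exists>p. (\<forall>j. p j \<in> tensor_powers l) \<and> norm_conv l p f"
proof -
  obtain p where p: "range p \<subseteq> tensors l" "norm_conv l p f" using dense_tensors[OF f] unfolding dense_in_def by blast
  have avg: "average l f z = f z" if "z \<in> \<Omega> l" for z
    using sym[OF _ that] by (simp add: average_def card_permutations del: One_nat_def)
  have conv: "norm_conv l (\<lambda>j. average l (p j)) (average l f)" by (rule norm_conv_average[OF p(2)])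
  have "norm_conv l (\<lambda>j. average l (p j)) f"
  proof (rule norm_convI[OF norm_convD(1)[OF conv] f])
    have "sqn l (\<lambda>z. average l (p j) z - f z) = sqn l (\<lambda>z. average l (p j) z - average l f z)" for j
      by (rule sqn_cong) (simp add: avg)
    then show "(\<lambda>j. sqn l (\<lambda>z. average l (p j) z - f z)) \<longlonglongrightarrow> 0" using norm_convD(3)[OF conv] by simp
  qed
  moreover have "average l (p j) \<in> tensor_powers l" for j using p(1) by (intro average_tensors) blast
  ultimately show ?thesis by (intro exI[of _ "\<lambda>j. average l (p j)"]) simp
qed

text \<open>A change of variables moves the permutations from the functions to the diagram. A single
  diagram may change, the set of all diagrams does not.\<close>

lemma sum_diagram_integrals_permute:
  assumes \<sigma>: "\<And>k. k \<in> {1..m} \<Longrightarrow> \<sigma> k permutes {1..n k}"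
    and f: "\<And>k. k \<in> {1..m} \<Longrightarrow> f k \<in> \<F> (n k)"
  shows "(\<Sum>D\<in>diagrams m n. \<integral>z. (\<Prod>k\<in>{1..m}. f k (permute (n k) (\<sigma> k) (row n k z))) \<partial>\<nu> (vertices m n) D) =
    (\<Sum>D\<in>diagrams m n. \<integral>z. (\<Prod>k\<in>{1..m}. f k (row n k z) :: real) \<partial>\<nu> (vertices m n) D)"
proof -
  let ?I = "\<lambda>D. \<integral>z. (\<Prod>k\<in>{1..m}. f k (permute (n k) (\<sigma> k) (row n k z))) \<partial>\<nu> (vertices m n) D"
  let ?g = "\<lambda>z. \<Prod>k\<in>{1..m}. f k (row n k z)"
  have gm: "?g \<in> borel_measurable (config (vertices m n))"
  proof (rule borel_measurable_prod)
    fix k assume k: "k \<in> {1..m}"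
    show "(\<lambda>z. f k (row n k z)) \<in> borel_measurable (config (vertices m n))"
      by (rule measurable_compose[OF row_measurable[OF k, of n] f[OF k]])
  qed
  have row: "row n k (relabel m n \<sigma> z) = permute (n k) (\<sigma> k) (row n k z)" if "k \<in> {1..m}" for k z
    by (rule row_relabel[OF \<sigma> that])
  have "?I (shuffle_edges \<sigma> D) = (\<integral>z. ?g z \<partial>\<nu> (vertices m n) D)" if D: "D \<in> diagrams m n" for D
  proof -
    let ?N = "\<nu> (vertices m n) (shuffle_edges \<sigma> D)"
    have rm: "relabel m n \<sigma> \<in> ?N \<rightarrow>\<^sub>M config (vertices m n)"
      unfolding measurable_noise by (rule relabel_measurable[OF \<sigma>])
    have "?I (shuffle_edges \<sigma> D) = (\<integral>z. ?g (relabel m n \<sigma> z) \<partial>?N)"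
      by (intro Bochner_Integration.integral_cong prod.cong refl) (simp only: row)
    also have "\<dots> = (\<integral>z. ?g z \<partial>distr ?N (config (vertices m n)) (relabel m n \<sigma>))"
      by (rule integral_distr[OF rm gm, symmetric])
    finally show ?thesis by (simp only: relabel_noise[OF \<sigma> D])
  qed
  moreover have "(\<Sum>D\<in>diagrams m n. ?I (shuffle_edges \<sigma> D)) = (\<Sum>D\<in>diagrams m n. ?I D)"
    by (rule sum_diagrams_shuffle[OF \<sigma>])
  ultimately show ?thesis by simp
qed

text \<open>A product of averages is an average over tuples of permutations, one for each row, and
  every tuple yields the same sum over diagrams. The argument concerns the sum, not a single
  diagram.\<close>

lemma sum_diagram_integrals_average:
  assumes f: "\<And>k. k \<in> {1..m} \<Longrightarrow> f k \<in> finite_norm (n k)"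
  shows "(\<Sum>D\<in>diagrams m n. \<integral>z. (\<Prod>k\<in>{1..m}. average (n k) (f k) (row n k z)) \<partial>\<nu> (vertices m n) D) =
    (\<Sum>D\<in>diagrams m n. \<integral>z. (\<Prod>k\<in>{1..m}. f k (row n k z)) \<partial>\<nu> (vertices m n) D)"
proof -
  let ?N = "\<lambda>D. \<nu> (vertices m n) D"
  let ?S = "PiE {1..m} (\<lambda>k. {\<sigma>. \<sigma> permutes {1..n k}})"
  let ?c = "\<Prod>k\<in>{1..m}. 1 / fact (n k) :: real"
  let ?R = "\<Sum>D\<in>diagrams m n. \<integral>z. (\<Prod>k\<in>{1..m}. f k (row n k z)) \<partial>?N D"
  have fin: "finite ?S" by (intro finite_PiE) (simp_all add: finite_permutations)
  have expand: "(\<Prod>k\<in>{1..m}. average (n k) (f k) (row n k z)) = ?c * (\<Sum>s\<in>?S. \<Prod>k\<in>{1..m}. f k (permute (n k) (s k) (row n k z)))" for z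
    unfolding average_def prod.distrib by (subst prod_sum_PiE) (simp_all add: finite_permutations)
  have int: "integrable (?N D) (\<lambda>z. \<Prod>k\<in>{1..m}. f k (permute (n k) (s k) (row n k z)))" if "D \<in> diagrams m n" "s \<in> ?S" for D s
    using that(2) by (intro diagram_integrable_finite_norm[OF that(1)] finite_norm_permute f) auto
  have "(\<Sum>D\<in>diagrams m n. \<integral>z. (\<Prod>k\<in>{1..m}. average (n k) (f k) (row n k z)) \<partial>?N D) =
    (\<Sum>D\<in>diagrams m n. ?c * (\<Sum>s\<in>?S. \<integral>z. (\<Prod>k\<in>{1..m}. f k (permute (n k) (s k) (row n k z))) \<partial>?N D))"
    unfolding expand using int by (intro sum.cong refl) (simp only: integral_mult_right_zero Bochner_Integration.integral_sum)
  also have "\<dots> = ?c * (\<Sum>s\<in>?S. \<Sum>D\<in>diagrams m n. \<integral>z. (\<Prod>k\<in>{1..m}. f k (permute (n k) (s k) (row n k z))) \<partial>?N D)"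
    by (subst sum.swap) (simp only: sum_distrib_left)
  also have "\<dots> = ?c * (\<Sum>s\<in>?S. ?R)"
  proof (rule arg_cong2[where f="(*)", OF refl sum.cong[OF refl]])
    fix s assume s: "s \<in> ?S"
    then have s': "s k permutes {1..n k}" if "k \<in> {1..m}" for k using that by (auto simp: PiE_iff)
    show "(\<Sum>D\<in>diagrams m n. \<integral>z. (\<Prod>k\<in>{1..m}. f k (permute (n k) (s k) (row n k z))) \<partial>?N D) = ?R"
      by (rule sum_diagram_integrals_permute[OF s' finite_norm_measurable[OF f]])
  qed
  also have "\<dots> = ?c * real (card ?S) * ?R" by simp
  also have "real (card ?S) = (\<Prod>k\<in>{1..m}. fact (n k))" by (simp add: card_PiE card_permutations)
  also have "?c * \<dots> = 1" by (simp add: prod.distrib[symmetric])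
  finally show ?thesis by simp
qed

end

section \<open>Gaussian moments\<close>

text \<open>Diagrams on an arbitrary set of vertices: the set that remains after removing a vertex
  and its partner has rows with gaps.\<close>

definition row_diagrams :: "(nat \<times> nat) set \<Rightarrow> ((nat \<times> nat) \<times> (nat \<times> nat)) set set" where
  "row_diagrams V = {D. pairing V D \<and> (\<forall>(a, b)\<in>D. fst a < fst b)}"

lemma diagrams_eq_row_diagrams: "diagrams m n = row_diagrams (vertices m n)"
proof (rule set_eqI)
  fix D
  show "D \<in> diagrams m n \<longleftrightarrow> D \<in> row_diagrams (vertices m n)"
  proof
    assume D: "D \<in> diagrams m n"
    then have "\<forall>(a, b)\<in>D. fst a < fst b" unfolding diagrams_def by fast
    then show "D \<in> row_diagrams (vertices m n)" using pairing_diagram[OF D] by (simp add: row_diagrams_def)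
  next
    assume D: "D \<in> row_diagrams (vertices m n)"
    then have P: "pairing (vertices m n) D" and lt: "\<forall>(a, b)\<in>D. fst a < fst b" by (simp_all add: row_diagrams_def)
    have "\<forall>(a, b)\<in>D. a \<in> vertices m n \<and> b \<in> vertices m n \<and> fst a < fst b" using lt pairing_edge[OF P] by blast
    moreover have "\<forall>v\<in>vertices m n. \<exists>!e. e \<in> D \<and> (v = fst e \<or> v = snd e)" by (intro ballI pairing_ex1[OF P])
    ultimately show "D \<in> diagrams m n" unfolding diagrams_def by (intro CollectI conjI)
  qed
qed

definition orient :: "nat \<times> nat \<Rightarrow> nat \<times> nat \<Rightarrow> (nat \<times> nat) \<times> (nat \<times> nat)" where
  "orient v u = (if fst u < fst v then (u, v) else (v, u))"

definition other :: "nat \<times> nat \<Rightarrow> (nat \<times> nat) \<times> (nat \<times> nat) \<Rightarrow> nat \<times> nat" where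
  "other v e = (if fst e = v then snd e else fst e)"

lemma row_diagram_insert:
  assumes u: "u \<in> V" and v: "v \<in> V" and uv: "fst u \<noteq> fst v" and D: "D \<in> row_diagrams (V - {v, u})"
  shows "insert (orient v u) D \<in> row_diagrams V" "edge_at (insert (orient v u) D) v = orient v u"
    "orient v u \<notin> D" "other v (orient v u) = u"
proof -
  obtain a b where ab: "orient v u = (a, b)" by (cases "orient v u")
  have abuv: "{a, b} = {v, u}" "a \<noteq> b" "fst a < fst b" "v = a \<or> v = b"
    using ab uv by (auto simp: orient_def split: if_splits)
  have P: "pairing (V - {v, u}) D" using D by (simp add: row_diagrams_def)
  have notin: "a \<notin> V - {v, u}" "b \<notin> V - {v, u}" using abuv(1) by blast+
  have "insert a (insert b (V - {v, u})) = {a, b} \<union> (V - {v, u})" by simp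
  also have "\<dots> = V" unfolding abuv(1) using u v by auto
  finally have "insert a (insert b (V - {v, u})) = V" .
  with pairing_insert[OF P notin abuv(2)] have P': "pairing V (insert (a, b) D)" by simp
  show "insert (orient v u) D \<in> row_diagrams V"
    using P' D abuv(3) unfolding ab row_diagrams_def by auto
  show "edge_at (insert (orient v u) D) v = orient v u"
    using abuv(4) unfolding ab by (intro edge_at_eq[OF P']) auto
  show "orient v u \<notin> D" unfolding ab by (rule pairing_new_edge[OF P notin(1)])
  show "other v (orient v u) = u" using uv by (auto simp: orient_def other_def)
qed

lemma row_diagram_remove:
  assumes v: "v \<in> V" and D: "D \<in> row_diagrams V"
  defines "e \<equiv> edge_at D v"
  shows "e \<in> D" "other v e \<in> V" "fst (other v e) \<noteq> fst v" "orient v (other v e) = e"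
    "D - {e} \<in> row_diagrams (V - {v, other v e})"
proof -
  have P: "pairing V D" and lt: "\<And>a b. (a, b) \<in> D \<Longrightarrow> fst a < fst b" using D by (auto simp: row_diagrams_def)
  obtain a b where ab: "e = (a, b)" by (cases e)
  have e: "(a, b) \<in> D" "v = a \<or> v = b" using edge_at_in[OF P v] ab unfolding e_def by simp_all
  then show "e \<in> D" by (simp add: ab)
  have l: "fst a < fst b" by (rule lt[OF e(1)])
  have V: "a \<in> V" "b \<in> V" using pairing_edge[OF P e(1)] by simp_all
  have o: "other v e = (if v = a then b else a)" by (auto simp: other_def ab)
  show "other v e \<in> V" using V by (simp add: o)
  show "fst (other v e) \<noteq> fst v" using e(2) l by (auto simp: o)
  show "orient v (other v e) = e" using e(2) l by (auto simp: other_def orient_def ab)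
  have "{v, other v e} = {a, b}" using e(2) by (auto simp: o)
  then show "D - {e} \<in> row_diagrams (V - {v, other v e})"
    using pairing_remove[OF P e(1)] lt by (auto simp: row_diagrams_def ab)
qed

text \<open>The diagrams are sorted by the partner of \<open>v\<close>. Inserting and removing the
  edge of \<open>v\<close> are inverse to each other, and by symmetry of \<open>w\<close> the weight
  of that edge does not depend on its orientation.\<close>

lemma sum_row_diagrams:
  fixes w :: "nat \<times> nat \<Rightarrow> nat \<times> nat \<Rightarrow> real"
  assumes fin: "finite V" and v: "v \<in> V" and sym: "\<And>a b. w a b = w b a"
  shows "(\<Sum>D\<in>row_diagrams V. \<Prod>(a, b)\<in>D. w a b) =
    (\<Sum>u | u \<in> V \<and> fst u \<noteq> fst v. w v u * (\<Sum>D\<in>row_diagrams (V - {v, u}). \<Prod>(a, b)\<in>D. w a b))"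
proof -
  let ?U = "{u. u \<in> V \<and> fst u \<noteq> fst v}"
  have finD: "finite (row_diagrams V')" if "finite V'" for V'
  proof (rule finite_subset)
    show "row_diagrams V' \<subseteq> Pow (V' \<times> V')" using pairing_subset unfolding row_diagrams_def by blast
  qed (use that in simp)
  have "(\<Sum>u\<in>?U. w v u * (\<Sum>D\<in>row_diagrams (V - {v, u}). \<Prod>(a, b)\<in>D. w a b)) =
    (\<Sum>(u, D)\<in>(SIGMA u:?U. row_diagrams (V - {v, u})). w v u * (\<Prod>(a, b)\<in>D. w a b))"
    using fin finD by (subst sum.Sigma[symmetric]) (auto simp: sum_distrib_left)
  also have "\<dots> = (\<Sum>D\<in>row_diagrams V. \<Prod>(a, b)\<in>D. w a b)"
  proof (rule sum.reindex_bij_witness[of _ "\<lambda>D. (other v (edge_at D v), D - {edge_at D v})" "\<lambda>(u, D). insert (orient v u) D"])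
    fix q assume "q \<in> (SIGMA u:?U. row_diagrams (V - {v, u}))"
    then obtain u D where q: "q = (u, D)" "u \<in> V" "fst u \<noteq> fst v" "D \<in> row_diagrams (V - {v, u})" by auto
    note I = row_diagram_insert[OF q(2) v q(3,4)]
    show "(other v (edge_at (case q of (u, D) \<Rightarrow> insert (orient v u) D) v), (case q of (u, D) \<Rightarrow> insert (orient v u) D) - {edge_at (case q of (u, D) \<Rightarrow> insert (orient v u) D) v}) = q"
      using I(2,3,4) by (simp add: q(1))
    show "(case q of (u, D) \<Rightarrow> insert (orient v u) D) \<in> row_diagrams V" using I(1) by (simp add: q(1))
    have "finite D" using q(4) pairing_finite unfolding row_diagrams_def by blast
    moreover have "(case orient v u of (a, b) \<Rightarrow> w a b) = w v u" using sym by (simp add: orient_def)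
    ultimately show "(\<Prod>(a, b)\<in>(case q of (u, D) \<Rightarrow> insert (orient v u) D). w a b) = (case q of (u, D) \<Rightarrow> w v u * (\<Prod>(a, b)\<in>D. w a b))"
      using I(3) by (simp add: q(1) case_prod_beta' fun_eq_iff)
  next
    fix D assume D: "D \<in> row_diagrams V"
    note R = row_diagram_remove[OF v D]
    show "(case (other v (edge_at D v), D - {edge_at D v}) of (u, D) \<Rightarrow> insert (orient v u) D) = D"
      using R(1,4) by (simp add: insert_absorb)
    show "(other v (edge_at D v), D - {edge_at D v}) \<in> (SIGMA u:?U. row_diagrams (V - {v, u}))"
      using R(2,3,5) by simp
  qed
  finally show ?thesis by simp
qed

lemma row_diagrams_empty: "row_diagrams {} = {{}}"
proof -
  have "D = {}" if "pairing {} D" for D :: "((nat \<times> nat) \<times> (nat \<times> nat)) set" using pairing_subset[OF that] by simp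
  then show ?thesis by (auto simp: row_diagrams_def)
qed

text \<open>Ryser's formula for a matrix with equal columns, whose permanent is n! times a
  product.\<close>

lemma polarization:
  fixes b :: "'i \<Rightarrow> real"
  assumes fin: "finite I"
  shows "fact (card I) * (\<Prod>i\<in>I. b i) = (\<Sum>T\<in>Pow I. (- 1) ^ card (I - T) * (\<Sum>i\<in>T. b i) ^ card I)"
proof -
  have "(\<Prod>r\<in>I. b (\<sigma> r)) = (\<Prod>i\<in>I. b i)" if "\<sigma> permutes I" for \<sigma>
    using prod.permute[OF that, of b] by (simp add: comp_def)
  then have "(\<Sum>\<sigma> | \<sigma> permutes I. \<Prod>r\<in>I. b (\<sigma> r)) = fact (card I) * (\<Prod>i\<in>I. b i)"
    using fin by (simp add: card_permutations)
  then show ?thesis using permanent_Ryser[OF fin, of "\<lambda>i r. b i"] by simp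
qed

text \<open>The derivative of the polarization formula in the direction \<open>a\<close>: Ryser's
  formula for a matrix with one column \<open>a\<close> and all others \<open>b\<close>, summed over
  the position of that column.\<close>

lemma polarization_derivative:
  fixes a b :: "'i \<Rightarrow> real"
  assumes fin: "finite I"
  shows "(\<Sum>T\<in>Pow I. (- 1) ^ card (I - T) * (real (card I) * (\<Sum>i\<in>T. a i) * (\<Sum>i\<in>T. b i) ^ (card I - 1))) =
    fact (card I) * (\<Sum>j\<in>I. a j * (\<Prod>i\<in>I - {j}. b i))"
proof -
  let ?F = "\<lambda>j. a j * (\<Prod>i\<in>I - {j}. b i)"
  have row: "(\<Sum>T\<in>Pow I. (- 1) ^ card (I - T) * ((\<Sum>i\<in>T. a i) * (\<Sum>i\<in>T. b i) ^ (card I - 1))) =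
    (\<Sum>\<sigma> | \<sigma> permutes I. ?F (\<sigma> r))" if r: "r \<in> I" for r
  proof -
    let ?A = "\<lambda>i r'. if r' = r then a i else b i"
    have 1: "(\<Prod>r'\<in>I. ?A (\<sigma> r') r') = ?F (\<sigma> r)" if \<sigma>: "\<sigma> permutes I" for \<sigma>
    proof -
      have "(\<Prod>r'\<in>I. ?A (\<sigma> r') r') = a (\<sigma> r) * (\<Prod>r'\<in>I - {r}. b (\<sigma> r'))"
        using fin r by (simp add: prod.remove)
      also have "(\<Prod>r'\<in>I - {r}. b (\<sigma> r')) = (\<Prod>i\<in>\<sigma> ` (I - {r}). b i)"
        using permutes_inj_on[OF \<sigma>] by (subst prod.reindex) (auto simp: inj_on_def)
      also have "\<sigma> ` (I - {r}) = I - {\<sigma> r}"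
        using permutes_image[OF \<sigma>] permutes_inj[OF \<sigma>] by (simp add: image_set_diff)
      finally show ?thesis .
    qed
    have 2: "(\<Prod>r'\<in>I. \<Sum>i\<in>T. ?A i r') = (\<Sum>i\<in>T. a i) * (\<Sum>i\<in>T. b i) ^ (card I - 1)" for T
    proof -
      have "(\<Prod>r'\<in>I. \<Sum>i\<in>T. ?A i r') = (\<Sum>i\<in>T. a i) * (\<Prod>r'\<in>I - {r}. \<Sum>i\<in>T. b i)"
        using fin r by (simp add: prod.remove)
      then show ?thesis using r by simp
    qed
    have "(\<Sum>\<sigma> | \<sigma> permutes I. ?F (\<sigma> r)) = (\<Sum>\<sigma> | \<sigma> permutes I. \<Prod>r'\<in>I. ?A (\<sigma> r') r')"
      by (rule sum.cong[OF refl], rule 1[symmetric]) simp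
    also have "\<dots> = (\<Sum>T\<in>Pow I. (- 1) ^ card (I - T) * (\<Prod>r'\<in>I. \<Sum>i\<in>T. ?A i r'))"
      by (rule permanent_Ryser[OF fin, of ?A])
    finally show ?thesis by (simp only: 2)
  qed
  have "(\<Sum>T\<in>Pow I. (- 1) ^ card (I - T) * (real (card I) * (\<Sum>i\<in>T. a i) * (\<Sum>i\<in>T. b i) ^ (card I - 1))) =
    real (card I) * (\<Sum>T\<in>Pow I. (- 1) ^ card (I - T) * ((\<Sum>i\<in>T. a i) * (\<Sum>i\<in>T. b i) ^ (card I - 1)))"
    by (simp add: sum_distrib_left mult_ac)
  also have "\<dots> = (\<Sum>r\<in>I. \<Sum>\<sigma> | \<sigma> permutes I. ?F (\<sigma> r))"
    by (simp only: row sum_constant[symmetric] cong: sum.cong)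
  also have "\<dots> = (\<Sum>\<sigma> | \<sigma> permutes I. \<Sum>r\<in>I. ?F (\<sigma> r))" by (rule sum.swap)
  also have "\<dots> = (\<Sum>\<sigma> | \<sigma> permutes I. \<Sum>j\<in>I. ?F j)"
  proof (rule sum.cong)
    fix \<sigma> assume "\<sigma> \<in> {\<sigma>. \<sigma> permutes I}"
    then show "(\<Sum>r\<in>I. ?F (\<sigma> r)) = (\<Sum>j\<in>I. ?F j)" using sum.permute[of \<sigma> I ?F] by (simp add: comp_def)
  qed simp
  finally show ?thesis using fin by (simp add: card_permutations)
qed

text \<open>The moments of a standard normal variable, that is, (n - 1)!! for even n.\<close>

definition normal_moment :: "nat \<Rightarrow> real" where
  "normal_moment n = (if even n then fact n / (2 ^ (n div 2) * fact (n div 2)) else 0)"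

lemma normal_moment_Suc: "normal_moment (Suc (Suc n)) = real (Suc n) * normal_moment n"
proof (cases "even n")
  case True
  then obtain k where "n = 2 * k" by blast
  then show ?thesis by (simp add: normal_moment_def divide_simps)
qed (simp add: normal_moment_def)

section \<open>Random variables with all moments\<close>

context prob_space
begin

text \<open>These variables form an algebra; membership supplies the integrability needed for
  exchanging expectations with finite sums.\<close>

definition moments :: "('a \<Rightarrow> real) set" where
  "moments = {X. X \<in> borel_measurable M \<and> (\<forall>p. integrable M (\<lambda>\<omega>. \<bar>X \<omega>\<bar> ^ p))}"

lemma moments_measurable: "X \<in> moments \<Longrightarrow> X \<in> borel_measurable M"
  by (simp add: moments_def)

lemma moments_integrable: "X \<in> moments \<Longrightarrow> integrable M X"
  unfolding moments_def by (auto dest: spec[of _ 1] simp: integrable_abs_iff)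

lemma momentsI:
  assumes "X \<in> borel_measurable M" "\<And>p. integrable M (Z p)" "\<And>p \<omega>. \<bar>X \<omega>\<bar> ^ p \<le> Z p \<omega>"
  shows "X \<in> moments"
proof -
  have "integrable M (\<lambda>\<omega>. \<bar>X \<omega>\<bar> ^ p)" for p
  proof (rule Bochner_Integration.integrable_bound[OF assms(2)[of p]])
    show "(\<lambda>\<omega>. \<bar>X \<omega>\<bar> ^ p) \<in> borel_measurable M" using assms(1) by simp
    show "AE \<omega> in M. norm (\<bar>X \<omega>\<bar> ^ p) \<le> norm (Z p \<omega>)" using assms(3)[of _ p] by (intro AE_I2) (simp add: abs_of_nonneg order_trans[OF _ abs_ge_self])
  qed
  then show ?thesis using assms(1) by (simp add: moments_def)
qed

lemma moments_const: "(\<lambda>\<omega>. c) \<in> moments"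
  by (simp add: moments_def)

lemma moments_add:
  assumes X: "X \<in> moments" and Y: "Y \<in> moments"
  shows "(\<lambda>\<omega>. X \<omega> + Y \<omega>) \<in> moments"
proof (rule momentsI)
  show "(\<lambda>\<omega>. X \<omega> + Y \<omega>) \<in> borel_measurable M" by (intro borel_measurable_add moments_measurable X Y)
  show "integrable M (\<lambda>\<omega>. 2 ^ p * (\<bar>X \<omega>\<bar> ^ p + \<bar>Y \<omega>\<bar> ^ p))" for p using X Y by (simp add: moments_def)
  show "\<bar>X \<omega> + Y \<omega>\<bar> ^ p \<le> 2 ^ p * (\<bar>X \<omega>\<bar> ^ p + \<bar>Y \<omega>\<bar> ^ p)" for p \<omega>
  proof -
    have "\<bar>X \<omega> + Y \<omega>\<bar> ^ p \<le> (2 * max \<bar>X \<omega>\<bar> \<bar>Y \<omega>\<bar>) ^ p" by (intro power_mono) auto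
    also have "\<dots> = 2 ^ p * (max \<bar>X \<omega>\<bar> \<bar>Y \<omega>\<bar>) ^ p" by (rule power_mult_distrib)
    also have "\<dots> \<le> 2 ^ p * (\<bar>X \<omega>\<bar> ^ p + \<bar>Y \<omega>\<bar> ^ p)" by (intro mult_left_mono) (auto simp: max_def)
    finally show ?thesis .
  qed
qed

lemma moments_mult:
  assumes X: "X \<in> moments" and Y: "Y \<in> moments"
  shows "(\<lambda>\<omega>. X \<omega> * Y \<omega>) \<in> moments"
proof (rule momentsI)
  show "(\<lambda>\<omega>. X \<omega> * Y \<omega>) \<in> borel_measurable M" by (intro borel_measurable_times moments_measurable X Y)
  show "integrable M (\<lambda>\<omega>. \<bar>X \<omega>\<bar> ^ (p * 2) + \<bar>Y \<omega>\<bar> ^ (p * 2))" for p using X Y by (simp add: moments_def)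
  show "\<bar>X \<omega> * Y \<omega>\<bar> ^ p \<le> \<bar>X \<omega>\<bar> ^ (p * 2) + \<bar>Y \<omega>\<bar> ^ (p * 2)" for p \<omega>
  proof -
    let ?a = "\<bar>X \<omega>\<bar> ^ p" and ?b = "\<bar>Y \<omega>\<bar> ^ p"
    have "2 * ?a * ?b \<le> ?a\<^sup>2 + ?b\<^sup>2" by (rule sum_squares_bound)
    moreover have "0 \<le> ?a * ?b" by simp
    ultimately have "?a * ?b \<le> ?a\<^sup>2 + ?b\<^sup>2" by linarith
    then show ?thesis by (simp only: power_mult abs_mult power_mult_distrib)
  qed
qed

lemma moments_cmult: "X \<in> moments \<Longrightarrow> (\<lambda>\<omega>. c * X \<omega>) \<in> moments"
  by (rule moments_mult[OF moments_const])

lemma moments_power: "X \<in> moments \<Longrightarrow> (\<lambda>\<omega>. X \<omega> ^ n) \<in> moments"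
  by (induction n) (simp_all add: moments_const moments_mult)

lemma moments_prod: "(\<And>i. i \<in> I \<Longrightarrow> X i \<in> moments) \<Longrightarrow> (\<lambda>\<omega>. \<Prod>i\<in>I. X i \<omega>) \<in> moments"
  by (induction I rule: infinite_finite_induct) (simp_all add: moments_const moments_mult)

lemma moments_sum: "(\<And>i. i \<in> I \<Longrightarrow> X i \<in> moments) \<Longrightarrow> (\<lambda>\<omega>. \<Sum>i\<in>I. X i \<omega>) \<in> moments"
  by (induction I rule: infinite_finite_induct) (simp_all add: moments_const moments_add)

lemma moments_poly: "X \<in> moments \<Longrightarrow> (\<lambda>\<omega>. poly p (X \<omega>)) \<in> moments"
  by (induction p) (simp_all add: moments_const moments_mult moments_add)

lemma moments_AE:
  assumes "X \<in> moments" "Y \<in> borel_measurable M" "AE \<omega> in M. Y \<omega> = X \<omega>"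
  shows "Y \<in> moments"
proof -
  have "integrable M (\<lambda>\<omega>. \<bar>Y \<omega>\<bar> ^ p) = integrable M (\<lambda>\<omega>. \<bar>X \<omega>\<bar> ^ p)" for p
    using assms by (intro integrable_cong_AE) (auto simp: moments_def)
  then show ?thesis using assms by (simp add: moments_def)
qed

end

section \<open>Gaussian integration by parts\<close>

locale isonormal = prob_space M for M :: "'w measure" +
  fixes W :: "'h::real_inner \<Rightarrow> 'w \<Rightarrow> real"
  assumes isonormal: "isonormal_process M W"
begin

lemma gaussian: "centered_gaussian M (W h)"
  using isonormal[unfolded isonormal_process_def, THEN conjunct2, THEN conjunct1, rule_format, of "{h}" "\<lambda>_. 1"] by simp

lemma covariance: "(\<integral>\<omega>. W g \<omega> * W h \<omega> \<partial>M) = g \<bullet> h"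
  using isonormal by (simp add: isonormal_process_def)

text \<open>The hypothesis leaves the scale of the Gaussian law open. The second moment, known from
  the covariance, identifies it as the norm of \<open>h\<close>; the degenerate law belongs to norm
  0.\<close>

lemma W_moments_and_expectation: "W h \<in> moments \<and> (\<integral>\<omega>. W h \<omega> ^ n \<partial>M) = normal_moment n * norm h ^ n"
proof -
  have meas: "W h \<in> borel_measurable M" using gaussian[of h] by (simp add: centered_gaussian_def)
  have sq: "(\<integral>\<omega>. W h \<omega> ^ 2 \<partial>M) = (norm h)\<^sup>2" using covariance[of h h] by (simp add: power2_eq_square power2_norm_eq_inner[symmetric])
  from gaussian[of h] consider "AE \<omega> in M. W h \<omega> = 0" | \<sigma> where "0 < \<sigma>" "distributed M lborel (W h) (normal_density 0 \<sigma>)"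
    by (auto simp: centered_gaussian_def)
  then show ?thesis
  proof cases
    case 1
    have m: "W h \<in> moments" by (rule moments_AE[OF moments_const meas 1])
    have int: "(\<integral>\<omega>. W h \<omega> ^ n \<partial>M) = 0 ^ n" for n
    proof -
      have "(\<integral>\<omega>. W h \<omega> ^ n \<partial>M) = (\<integral>\<omega>. 0 ^ n \<partial>M)"
        using 1 meas by (intro integral_cong_AE) auto
      then show ?thesis by (simp add: prob_space)
    qed
    have "norm h = 0" using sq int[of 2] by simp
    then show ?thesis using m int[of n] by (cases "n = 0") (simp_all add: normal_moment_def)
  next
    case 2
    have nn: "0 \<le> normal_density 0 \<sigma> x" for x by simp
    have "integrable M (\<lambda>\<omega>. \<bar>W h \<omega>\<bar> ^ p)" for p
    proof -
      have "integrable lborel (\<lambda>x. normal_density 0 \<sigma> x * \<bar>x\<bar> ^ p)" using integrable_normal_moment_abs[OF 2(1), of 0 p] by simp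
      then show ?thesis by (subst (asm) distributed_integrable[OF 2(2)]) simp_all
    qed
    then have m: "W h \<in> moments" using meas by (simp add: moments_def)
    have E: "(\<integral>\<omega>. W h \<omega> ^ n \<partial>M) = (\<integral>x. normal_density 0 \<sigma> x * x ^ n \<partial>lborel)" for n
      by (rule distributed_integral[OF 2(2), symmetric]) simp_all
    have ex: "(\<integral>\<omega>. W h \<omega> ^ n \<partial>M) = normal_moment n * \<sigma> ^ n" for n
    proof (cases "even n")
      case True
      then obtain k where k: "n = 2 * k" by blast
      show ?thesis using integral_normal_moment_even[OF 2(1), of 0 k] 2(1)
        by (simp add: E k normal_moment_def power_divide power_mult[symmetric])
    next
      case False
      then obtain k where k: "n = 2 * k + 1" by (rule oddE)
      show ?thesis unfolding E unfolding k using integral_normal_moment_odd[OF 2(1), of 0 k] by (simp add: normal_moment_def)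
    qed
    have "\<sigma>\<^sup>2 = (norm h)\<^sup>2" using sq ex[of 2] by (simp add: normal_moment_def)
    then have "\<sigma> = norm h" using 2(1) by (simp add: power2_eq_iff_nonneg)
    then show ?thesis using m ex[of n] by simp
  qed
qed

lemma W_moments: "W h \<in> moments" and W_power_expectation: "(\<integral>\<omega>. W h \<omega> ^ n \<partial>M) = normal_moment n * norm h ^ n"
  using W_moments_and_expectation by blast+

text \<open>The expectation of the squared difference is an expression in covariances, and it
  vanishes by bilinearity of the inner product.\<close>

lemma W_linear: "AE \<omega> in M. W (a *\<^sub>R g + b *\<^sub>R h) \<omega> = a * W g \<omega> + b * W h \<omega>"
proof -
  let ?y = "a *\<^sub>R g + b *\<^sub>R h"
  let ?f = "\<lambda>\<omega>. (W ?y \<omega> - (a * W g \<omega> + b * W h \<omega>))\<^sup>2"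
  have hb: "has_bochner_integral M (\<lambda>\<omega>. W u \<omega> * W v \<omega>) (u \<bullet> v)" for u v
    using moments_integrable[OF moments_mult[OF W_moments W_moments], of u v] covariance[of u v]
    by (simp add: has_bochner_integral_iff)
  have "has_bochner_integral M (\<lambda>\<omega>. W ?y \<omega> * W ?y \<omega> + (a\<^sup>2 * (W g \<omega> * W g \<omega>) + (b\<^sup>2 * (W h \<omega> * W h \<omega>) +
      ((- 2 * a) * (W ?y \<omega> * W g \<omega>) + ((- 2 * b) * (W ?y \<omega> * W h \<omega>) + (2 * a * b) * (W g \<omega> * W h \<omega>))))))
    (?y \<bullet> ?y + (a\<^sup>2 * (g \<bullet> g) + (b\<^sup>2 * (h \<bullet> h) + ((- 2 * a) * (?y \<bullet> g) + ((- 2 * b) * (?y \<bullet> h) + (2 * a * b) * (g \<bullet> h))))))"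
    by (intro has_bochner_integral_add has_bochner_integral_mult_right hb)
  also have "(\<lambda>\<omega>. W ?y \<omega> * W ?y \<omega> + (a\<^sup>2 * (W g \<omega> * W g \<omega>) + (b\<^sup>2 * (W h \<omega> * W h \<omega>) +
      ((- 2 * a) * (W ?y \<omega> * W g \<omega>) + ((- 2 * b) * (W ?y \<omega> * W h \<omega>) + (2 * a * b) * (W g \<omega> * W h \<omega>)))))) = ?f"
    by (simp add: fun_eq_iff power2_eq_square algebra_simps)
  also have "?y \<bullet> ?y + (a\<^sup>2 * (g \<bullet> g) + (b\<^sup>2 * (h \<bullet> h) + ((- 2 * a) * (?y \<bullet> g) + ((- 2 * b) * (?y \<bullet> h) + (2 * a * b) * (g \<bullet> h))))) = 0"
    by (simp add: inner_add_left inner_add_right inner_commute[of h g] power2_eq_square algebra_simps)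
  finally have "integrable M ?f" "integral\<^sup>L M ?f = 0" by (simp_all add: has_bochner_integral_iff)
  then have "AE \<omega> in M. ?f \<omega> = 0" by (subst (asm) integral_nonneg_eq_0_iff_AE) auto
  then show ?thesis by eventually_elim simp
qed

lemma W_zero: "AE \<omega> in M. W 0 \<omega> = 0"
  using W_linear[of 0 0 0 0] by simp

lemma W_sum: "finite I \<Longrightarrow> AE \<omega> in M. W (\<Sum>i\<in>I. h i) \<omega> = (\<Sum>i\<in>I. W (h i) \<omega>)"
proof (induction I rule: finite_induct)
  case (insert i I)
  have "AE \<omega> in M. W (1 *\<^sub>R h i + 1 *\<^sub>R (\<Sum>i\<in>I. h i)) \<omega> = 1 * W (h i) \<omega> + 1 * W (\<Sum>i\<in>I. h i) \<omega>" by (rule W_linear)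
  with insert.IH show ?case using insert(1,2) by (auto elim!: eventually_elim2)
qed (simp add: W_zero)

text \<open>The moment of order n + 1 of W (h + s g) is a polynomial in s by the binomial formula,
  and on the other hand a constant times a power of the norm of h + s g. The derivative at s = 0,
  computed in both ways, gives the identity.\<close>

lemma integration_by_parts_power:
  "(\<integral>\<omega>. W g \<omega> * W h \<omega> ^ n \<partial>M) = real n * (h \<bullet> g) * (\<integral>\<omega>. W h \<omega> ^ (n - 1) \<partial>M)"
proof -
  let ?N = "Suc n"
  define a where "a k = real (?N choose k) * (\<integral>\<omega>. W g \<omega> ^ k * W h \<omega> ^ (?N - k) \<partial>M)" for k
  have poly: "(\<Sum>k\<le>?N. a k * s ^ k) = normal_moment ?N * norm (h + s *\<^sub>R g) ^ ?N" for s
  proof -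
    have "(\<integral>\<omega>. W (1 *\<^sub>R h + s *\<^sub>R g) \<omega> ^ ?N \<partial>M) = (\<integral>\<omega>. (\<Sum>k\<le>?N. (real (?N choose k) * s ^ k) * (W g \<omega> ^ k * W h \<omega> ^ (?N - k))) \<partial>M)"
    proof (rule integral_cong_AE)
      show "(\<lambda>\<omega>. W (1 *\<^sub>R h + s *\<^sub>R g) \<omega> ^ ?N) \<in> borel_measurable M"
        by (rule moments_measurable[OF moments_power[OF W_moments]])
      show "(\<lambda>\<omega>. \<Sum>k\<le>?N. (real (?N choose k) * s ^ k) * (W g \<omega> ^ k * W h \<omega> ^ (?N - k))) \<in> borel_measurable M"
        by (intro moments_measurable moments_sum moments_cmult moments_mult moments_power W_moments)
      show "AE \<omega> in M. W (1 *\<^sub>R h + s *\<^sub>R g) \<omega> ^ ?N = (\<Sum>k\<le>?N. (real (?N choose k) * s ^ k) * (W g \<omega> ^ k * W h \<omega> ^ (?N - k)))"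
        using W_linear[of 1 h s g]
      proof eventually_elim
        case (elim \<omega>)
        have "(s * W g \<omega> + W h \<omega>) ^ ?N = (\<Sum>k\<le>?N. real (?N choose k) * (s * W g \<omega>) ^ k * W h \<omega> ^ (?N - k))"
          by (rule binomial_ring)
        then show ?case by (simp only: elim mult_1 add.commute[of "W h \<omega>"] power_mult_distrib mult.assoc)
      qed
    qed
    also have "\<dots> = (\<Sum>k\<le>?N. (real (?N choose k) * s ^ k) * (\<integral>\<omega>. W g \<omega> ^ k * W h \<omega> ^ (?N - k) \<partial>M))"
      by (subst Bochner_Integration.integral_sum)
        (intro moments_integrable moments_cmult moments_mult moments_power W_moments, simp)
    also have "\<dots> = (\<Sum>k\<le>?N. a k * s ^ k)" unfolding a_def by (intro sum.cong) (simp_all add: mult_ac)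
    finally show ?thesis using W_power_expectation[of "1 *\<^sub>R h + s *\<^sub>R g" ?N] by simp
  qed
  have "((\<lambda>s. \<Sum>k\<le>?N. a k * s ^ k) has_real_derivative (\<Sum>k\<le>?N. a k * (real k * 0 ^ (k - 1)))) (at 0)"
  proof (rule DERIV_sum)
    show "((\<lambda>s. a k * s ^ k) has_real_derivative a k * (real k * 0 ^ (k - 1))) (at 0)" for k
      using DERIV_cmult[OF DERIV_pow[of k 0 UNIV], of "a k"] by simp
  qed
  also have "(\<Sum>k\<le>?N. a k * (real k * 0 ^ (k - 1))) = (\<Sum>k\<le>?N. if k = 1 then a 1 else 0)"
    by (intro sum.cong) (auto simp: power_0_left)
  also have "\<dots> = a 1" by simp
  finally have d1: "((\<lambda>s. normal_moment ?N * norm (h + s *\<^sub>R g) ^ ?N) has_real_derivative a 1) (at 0)" by (simp only: poly)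
  have "a 1 = real ?N * (real n * (h \<bullet> g) * (\<integral>\<omega>. W h \<omega> ^ (n - 1) \<partial>M))"
  \<comment> \<open>For even n both sides vanish. For odd n the exponent n + 1 is even, so the power
    of the norm is a polynomial in s and can be differentiated even where the norm vanishes.\<close>
  proof (cases "even n")
    case True
    then have "a 1 = 0" using DERIV_unique[OF d1, of 0] by (simp add: normal_moment_def)
    moreover have "real n * normal_moment (n - 1) = 0" using True by (cases n) (simp_all add: normal_moment_def)
    ultimately show ?thesis by (auto simp: W_power_expectation)
  next
    case False
    then obtain j where j: "n = 2 * j + 1" by (rule oddE)
    have eq: "norm (h + s *\<^sub>R g) ^ ?N = (h \<bullet> h + 2 * s * (h \<bullet> g) + s\<^sup>2 * (g \<bullet> g)) ^ Suc j" for s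
    proof -
      have "norm (h + s *\<^sub>R g) ^ ?N = ((norm (h + s *\<^sub>R g))\<^sup>2) ^ Suc j"
      proof -
        have "?N = 2 * Suc j" by (simp add: j)
        then show ?thesis by (simp only: power_mult)
      qed
      also have "(norm (h + s *\<^sub>R g))\<^sup>2 = h \<bullet> h + 2 * s * (h \<bullet> g) + s\<^sup>2 * (g \<bullet> g)"
        unfolding power2_norm_eq_inner by (simp add: inner_add_left inner_add_right inner_commute[of g h] power2_eq_square algebra_simps)
      finally show ?thesis .
    qed
    have "((\<lambda>s. normal_moment ?N * (h \<bullet> h + 2 * s * (h \<bullet> g) + s\<^sup>2 * (g \<bullet> g)) ^ Suc j) has_real_derivative
      normal_moment ?N * (real (Suc j) * (h \<bullet> h) ^ j * (2 * (h \<bullet> g)))) (at 0)"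
      by (rule derivative_eq_intros refl | simp)+
    from DERIV_unique[OF d1[unfolded eq] this]
    have "a 1 = normal_moment (Suc (Suc (2 * j))) * (real (Suc j) * (norm h ^ (2 * j)) * (2 * (h \<bullet> g)))"
      by (simp add: j power_mult power2_norm_eq_inner)
    then show ?thesis unfolding normal_moment_Suc W_power_expectation by (simp add: j algebra_simps)
  qed
  moreover have "a 1 = real ?N * (\<integral>\<omega>. W g \<omega> * W h \<omega> ^ n \<partial>M)" by (simp add: a_def)
  ultimately show ?thesis by simp
qed

text \<open>Polarization writes the product as a signed sum of powers of partial sums of the
  vectors. The formula for powers applies to each, and the derivative of the polarization formula
  reassembles the result.\<close>

lemma integration_by_parts_prod:
  assumes fin: "finite I"
  shows "(\<integral>\<omega>. W g \<omega> * (\<Prod>i\<in>I. W (h i) \<omega>) \<partial>M) = (\<Sum>j\<in>I. (h j \<bullet> g) * (\<integral>\<omega>. (\<Prod>i\<in>I - {j}. W (h i) \<omega>) \<partial>M))"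
proof -
  let ?N = "card I" and ?y = "\<lambda>T. \<Sum>i\<in>T. h i" and ?S = "\<lambda>T \<omega>. \<Sum>i\<in>T. W (h i) \<omega>"
  let ?\<epsilon> = "\<lambda>T. (- 1) ^ card (I - T) :: real"
  have T: "finite T" if "T \<in> Pow I" for T using that fin by (auto intro: finite_subset)
  note mom = moments_mult moments_power moments_sum moments_prod moments_cmult W_moments
  have E: "(\<integral>\<omega>. Z \<omega> * ?S T \<omega> ^ k \<partial>M) = (\<integral>\<omega>. Z \<omega> * W (?y T) \<omega> ^ k \<partial>M)" if "Z \<in> moments" "T \<in> Pow I" for Z T k
  proof (rule integral_cong_AE)
    show "(\<lambda>\<omega>. Z \<omega> * ?S T \<omega> ^ k) \<in> borel_measurable M" by (intro moments_measurable mom that(1))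
    show "(\<lambda>\<omega>. Z \<omega> * W (?y T) \<omega> ^ k) \<in> borel_measurable M" by (intro moments_measurable mom that(1))
    show "AE \<omega> in M. Z \<omega> * ?S T \<omega> ^ k = Z \<omega> * W (?y T) \<omega> ^ k" using W_sum[OF T[OF that(2)], of h] by eventually_elim simp
  qed
  have "fact ?N * (\<integral>\<omega>. W g \<omega> * (\<Prod>i\<in>I. W (h i) \<omega>) \<partial>M) = (\<integral>\<omega>. W g \<omega> * (fact ?N * (\<Prod>i\<in>I. W (h i) \<omega>)) \<partial>M)"
    by (simp add: mult.left_commute)
  also have "\<dots> = (\<integral>\<omega>. (\<Sum>T\<in>Pow I. ?\<epsilon> T * (W g \<omega> * ?S T \<omega> ^ ?N)) \<partial>M)"
    unfolding polarization[OF fin] by (simp add: sum_distrib_left mult.left_commute)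
  also have "\<dots> = (\<Sum>T\<in>Pow I. ?\<epsilon> T * (\<integral>\<omega>. W g \<omega> * ?S T \<omega> ^ ?N \<partial>M))"
    by (subst Bochner_Integration.integral_sum) (intro moments_integrable mom, simp)
  also have "\<dots> = (\<Sum>T\<in>Pow I. ?\<epsilon> T * (real ?N * (?y T \<bullet> g) * (\<integral>\<omega>. 1 * W (?y T) \<omega> ^ (?N - 1) \<partial>M)))"
    using E[OF W_moments] by (intro sum.cong refl) (simp add: integration_by_parts_power)
  also have "\<dots> = (\<Sum>T\<in>Pow I. ?\<epsilon> T * (real ?N * (\<Sum>i\<in>T. h i \<bullet> g) * (\<integral>\<omega>. 1 * ?S T \<omega> ^ (?N - 1) \<partial>M)))"
    using E[OF moments_const] by (intro sum.cong refl) (simp only: inner_sum_left)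
  also have "\<dots> = (\<Sum>T\<in>Pow I. (\<integral>\<omega>. ?\<epsilon> T * (real ?N * (\<Sum>i\<in>T. h i \<bullet> g) * ?S T \<omega> ^ (?N - 1)) \<partial>M))"
    by simp
  also have "\<dots> = (\<integral>\<omega>. (\<Sum>T\<in>Pow I. ?\<epsilon> T * (real ?N * (\<Sum>i\<in>T. h i \<bullet> g) * ?S T \<omega> ^ (?N - 1))) \<partial>M)"
    by (rule Bochner_Integration.integral_sum[symmetric]) (intro moments_integrable mom)
  also have "\<dots> = (\<integral>\<omega>. fact ?N * (\<Sum>j\<in>I. (h j \<bullet> g) * (\<Prod>i\<in>I - {j}. W (h i) \<omega>)) \<partial>M)"
    by (simp only: polarization_derivative[OF fin])
  also have "\<dots> = fact ?N * (\<Sum>j\<in>I. (h j \<bullet> g) * (\<integral>\<omega>. (\<Prod>i\<in>I - {j}. W (h i) \<omega>) \<partial>M))"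
    by (subst integral_mult_right_zero, subst Bochner_Integration.integral_sum) (intro moments_integrable mom, simp)
  finally show ?thesis by simp
qed

text \<open>A monomial is a product with repeated factors: the index set contains each
  \<open>k\<close> exactly \<open>e k\<close> times, and removing one copy lowers the exponent by
  one.\<close>

lemma integration_by_parts_monomial:
  assumes fin: "finite K"
  shows "(\<integral>\<omega>. W g \<omega> * (\<Prod>k\<in>K. W (h k) \<omega> ^ e k) \<partial>M) =
    (\<Sum>k\<in>K. (h k \<bullet> g) * (\<integral>\<omega>. real (e k) * (\<Prod>l\<in>K. W (h l) \<omega> ^ (if l = k then e l - 1 else e l)) \<partial>M))"
proof -
  let ?I = "SIGMA k:K. {..<e k}"
  have finI: "finite ?I" using fin by simp
  have P: "(\<Prod>i\<in>(SIGMA k:K. B k). f (fst i)) = (\<Prod>k\<in>K. f k ^ card (B k))" if "\<And>k. finite (B k)" for B :: "_ \<Rightarrow> nat set" and f :: "_ \<Rightarrow> real"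
    using prod.Sigma[of K B "\<lambda>k _. f k"] that fin by (simp add: split_def)
  have "(\<Prod>i\<in>?I. W (h (fst i)) \<omega>) = (\<Prod>k\<in>K. W (h k) \<omega> ^ e k)" for \<omega>
    using P[of "\<lambda>k. {..<e k}" "\<lambda>k. W (h k) \<omega>"] by simp
  then have "(\<integral>\<omega>. W g \<omega> * (\<Prod>k\<in>K. W (h k) \<omega> ^ e k) \<partial>M) = (\<integral>\<omega>. W g \<omega> * (\<Prod>i\<in>?I. W (h (fst i)) \<omega>) \<partial>M)"
    by (simp only:)
  also have "\<dots> = (\<Sum>j\<in>?I. (h (fst j) \<bullet> g) * (\<integral>\<omega>. (\<Prod>i\<in>?I - {j}. W (h (fst i)) \<omega>) \<partial>M))"
    by (rule integration_by_parts_prod[OF finI])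
  also have "\<dots> = (\<Sum>j\<in>?I. (h (fst j) \<bullet> g) * (\<integral>\<omega>. (\<Prod>l\<in>K. W (h l) \<omega> ^ (if l = fst j then e l - 1 else e l)) \<partial>M))"
  proof (rule sum.cong)
    fix j assume j: "j \<in> ?I"
    have "?I - {j} = (SIGMA l:K. if l = fst j then {..<e l} - {snd j} else {..<e l})" by (auto split: if_splits)
    moreover have "card (if l = fst j then {..<e l} - {snd j} else {..<e l}) = (if l = fst j then e l - 1 else e l)" for l
      using j by auto
    ultimately have "(\<Prod>i\<in>?I - {j}. W (h (fst i)) \<omega>) = (\<Prod>l\<in>K. W (h l) \<omega> ^ (if l = fst j then e l - 1 else e l))" for \<omega>
      using P[of "\<lambda>l. if l = fst j then {..<e l} - {snd j} else {..<e l}" "\<lambda>l. W (h l) \<omega>"] by (simp only:) simp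
    then show "(h (fst j) \<bullet> g) * (\<integral>\<omega>. (\<Prod>i\<in>?I - {j}. W (h (fst i)) \<omega>) \<partial>M) =
      (h (fst j) \<bullet> g) * (\<integral>\<omega>. (\<Prod>l\<in>K. W (h l) \<omega> ^ (if l = fst j then e l - 1 else e l)) \<partial>M)" by simp
  qed simp
  also have "\<dots> = (\<Sum>k\<in>K. \<Sum>j<e k. (h k \<bullet> g) * (\<integral>\<omega>. (\<Prod>l\<in>K. W (h l) \<omega> ^ (if l = k then e l - 1 else e l)) \<partial>M))"
    using fin by (subst sum.Sigma) (auto intro!: sum.cong)
  finally show ?thesis by (simp add: mult.left_commute)
qed

text \<open>Multilinear expansion into monomials. One degree bound \<open>d\<close> for all
  polynomials makes the sums range over the same exponents before and after differentiation.\<close>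

lemma integration_by_parts:
  fixes p :: "nat \<Rightarrow> real poly"
  assumes fin: "finite K"
  shows "(\<integral>\<omega>. W g \<omega> * (\<Prod>k\<in>K. poly (p k) (W (h k) \<omega>)) \<partial>M) =
    (\<Sum>k\<in>K. (h k \<bullet> g) * (\<integral>\<omega>. (\<Prod>l\<in>K. poly (if l = k then pderiv (p l) else p l) (W (h l) \<omega>)) \<partial>M))"
proof -
  define d where "d = (\<Sum>k\<in>K. degree (p k))"
  let ?c = "\<lambda>k i. coeff (p k) i" and ?E = "K \<rightarrow>\<^sub>E {..d}"
  have finE: "finite ?E" using fin by (intro finite_PiE) simp_all
  have deg: "degree (p k) \<le> d" if "k \<in> K" for k unfolding d_def using fin that by (intro member_le_sum) auto
  have p: "poly (p k) x = (\<Sum>i\<le>d. ?c k i * x ^ i)" if "k \<in> K" for k x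
    unfolding poly_altdef using deg[OF that] by (intro sum.mono_neutral_left) (auto simp: coeff_eq_0)
  have p': "poly (pderiv (p k)) x = (\<Sum>i\<le>d. ?c k i * (real i * x ^ (i - 1)))" if "k \<in> K" for k x
  proof -
    have "((\<lambda>x. \<Sum>i\<le>d. ?c k i * x ^ i) has_real_derivative (\<Sum>i\<le>d. ?c k i * (real i * x ^ (i - 1)))) (at x)"
    proof (rule DERIV_sum)
      show "((\<lambda>x. ?c k i * x ^ i) has_real_derivative ?c k i * (real i * x ^ (i - 1))) (at x)" for i
        using DERIV_cmult[OF DERIV_pow[of i x UNIV], of "?c k i"] by simp
    qed
    moreover have "((\<lambda>x. \<Sum>i\<le>d. ?c k i * x ^ i) has_real_derivative poly (pderiv (p k)) x) (at x)"
      using poly_DERIV[of "p k" x] by (simp only: p[OF that])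
    ultimately show ?thesis by (rule DERIV_unique[symmetric])
  qed
  note mom = moments_mult moments_power moments_sum moments_prod moments_cmult W_moments
  let ?X = "\<lambda>e k. \<integral>\<omega>. real (e k) * (\<Prod>l\<in>K. W (h l) \<omega> ^ (if l = k then e l - 1 else e l)) \<partial>M"
  let ?Y = "\<lambda>k. \<integral>\<omega>. (\<Prod>l\<in>K. poly (if l = k then pderiv (p l) else p l) (W (h l) \<omega>)) \<partial>M"
  have 1: "(\<Prod>k\<in>K. poly (p k) (x k)) = (\<Sum>e\<in>?E. (\<Prod>k\<in>K. ?c k (e k)) * (\<Prod>k\<in>K. x k ^ e k))" for x
  proof -
    have "(\<Prod>k\<in>K. poly (p k) (x k)) = (\<Prod>k\<in>K. \<Sum>i\<in>{..d}. ?c k i * x k ^ i)" by (intro prod.cong refl) (rule p)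
    also have "\<dots> = (\<Sum>e\<in>?E. \<Prod>k\<in>K. ?c k (e k) * x k ^ e k)" using fin by (intro prod_sum_PiE) simp_all
    finally show ?thesis by (simp only: prod.distrib)
  qed
  have 2: "(\<Prod>l\<in>K. poly (if l = k then pderiv (p l) else p l) (x l)) =
      (\<Sum>e\<in>?E. (\<Prod>k\<in>K. ?c k (e k)) * (real (e k) * (\<Prod>l\<in>K. x l ^ (if l = k then e l - 1 else e l))))" if k: "k \<in> K" for x k
  proof -
    have "(\<Prod>l\<in>K. poly (if l = k then pderiv (p l) else p l) (x l)) =
      (\<Prod>l\<in>K. \<Sum>i\<in>{..d}. ?c l i * ((if l = k then real i else 1) * x l ^ (if l = k then i - 1 else i)))"
      by (intro prod.cong refl) (simp add: p p' k)
    also have "\<dots> = (\<Sum>e\<in>?E. \<Prod>l\<in>K. ?c l (e l) * ((if l = k then real (e l) else 1) * x l ^ (if l = k then e l - 1 else e l)))"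
      using fin by (intro prod_sum_PiE) simp_all
    also have "\<dots> = (\<Sum>e\<in>?E. (\<Prod>k\<in>K. ?c k (e k)) * ((\<Prod>l\<in>K. if l = k then real (e l) else 1) * (\<Prod>l\<in>K. x l ^ (if l = k then e l - 1 else e l))))"
      by (simp only: prod.distrib)
    also have "(\<lambda>e. \<Prod>l\<in>K. if l = k then real (e l) else 1) = (\<lambda>e. real (e k))" using fin k by (simp add: fun_eq_iff prod.delta)
    finally show ?thesis using fin k by simp
  qed
  have "(\<integral>\<omega>. W g \<omega> * (\<Prod>k\<in>K. poly (p k) (W (h k) \<omega>)) \<partial>M) =
    (\<integral>\<omega>. (\<Sum>e\<in>?E. (\<Prod>k\<in>K. ?c k (e k)) * (W g \<omega> * (\<Prod>k\<in>K. W (h k) \<omega> ^ e k))) \<partial>M)"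
    unfolding 1 by (simp add: sum_distrib_left mult.left_commute)
  also have "\<dots> = (\<Sum>e\<in>?E. (\<Prod>k\<in>K. ?c k (e k)) * (\<integral>\<omega>. W g \<omega> * (\<Prod>k\<in>K. W (h k) \<omega> ^ e k) \<partial>M))"
    by (subst Bochner_Integration.integral_sum) (intro moments_integrable mom, simp)
  also have "\<dots> = (\<Sum>e\<in>?E. \<Sum>k\<in>K. (h k \<bullet> g) * ((\<Prod>k\<in>K. ?c k (e k)) * ?X e k))"
    unfolding integration_by_parts_monomial[OF fin] by (simp only: sum_distrib_left mult.left_commute)
  also have "\<dots> = (\<Sum>k\<in>K. (h k \<bullet> g) * (\<Sum>e\<in>?E. (\<Prod>k\<in>K. ?c k (e k)) * ?X e k))"
    by (subst sum.swap) (simp only: sum_distrib_left)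
  also have "\<dots> = (\<Sum>k\<in>K. (h k \<bullet> g) * ?Y k)"
  proof (rule sum.cong)
    fix k assume k: "k \<in> K"
    have "?Y k =
      (\<Sum>e\<in>?E. \<integral>\<omega>. (\<Prod>k\<in>K. ?c k (e k)) * (real (e k) * (\<Prod>l\<in>K. W (h l) \<omega> ^ (if l = k then e l - 1 else e l))) \<partial>M)"
      unfolding 2[OF k] by (rule Bochner_Integration.integral_sum) (intro moments_integrable mom)
    then show "(h k \<bullet> g) * (\<Sum>e\<in>?E. (\<Prod>k\<in>K. ?c k (e k)) * ?X e k) =
      (h k \<bullet> g) * ?Y k"
      by (simp only: integral_mult_right_zero)
  qed simp
  finally show ?thesis .
qed

end

text \<open>Hermite polynomials for a Gaussian variable of variance \<open>s\<close>. With the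
  variance as a parameter there is no division by the norm of a vector, so the zero vector is
  included.\<close>

fun hermite_poly :: "real \<Rightarrow> nat \<Rightarrow> real poly" where
  "hermite_poly s 0 = 1"
| "hermite_poly s (Suc 0) = [:0, 1:]"
| "hermite_poly s (Suc (Suc n)) = [:0, 1:] * hermite_poly s (Suc n) - smult (real (Suc n) * s) (hermite_poly s n)"

lemma hermite_poly_Suc: "hermite_poly s (Suc n) = [:0, 1:] * hermite_poly s n - smult (real n * s) (hermite_poly s (n - 1))"
  by (cases n) simp_all

text \<open>The Appell property, obtained from the recursion. By it, integration by parts lowers the
  degree of a row by one without leaving the family.\<close>

lemma pderiv_hermite_poly: "pderiv (hermite_poly s n) = smult (real n) (hermite_poly s (n - 1))"
proof (induction s n rule: hermite_poly.induct)
  case (3 s n)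
  have "pderiv (hermite_poly s (Suc (Suc n))) =
    hermite_poly s (Suc n) + [:0, 1:] * smult (real (Suc n)) (hermite_poly s n) - smult (real (Suc n) * s) (smult (real n) (hermite_poly s (n - 1)))"
    using 3 by (simp add: pderiv_diff pderiv_mult pderiv_smult pderiv_pCons del: hermite_poly.simps(2))
  also have "\<dots> = hermite_poly s (Suc n) + smult (real (Suc n)) ([:0, 1:] * hermite_poly s n - smult (real n * s) (hermite_poly s (n - 1)))"
    by (simp add: smult_diff_right mult_ac)
  also have "\<dots> = hermite_poly s (Suc n) + smult (real (Suc n)) (hermite_poly s (Suc n))"
    by (simp only: hermite_poly_Suc[of s n, symmetric])
  also have "\<dots> = smult (real (Suc (Suc n))) (hermite_poly s (Suc n))"
    by (rule poly_eqI) (simp add: algebra_simps)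
  finally show ?case by simp
qed (simp_all add: pderiv_pCons)

lemma hermite_poly_scale:
  assumes "\<sigma> \<noteq> 0"
  shows "poly (hermite_poly (\<sigma>\<^sup>2) n) x = \<sigma> ^ n * hermite n (x / \<sigma>)"
  using assms by (induction n rule: induct_nat_012) (simp_all add: power2_eq_square field_simps)

lemma hermite_poly_zero: "poly (hermite_poly 0 n) x = x ^ n"
  by (induction n rule: induct_nat_012) simp_all

context isonormal
begin

text \<open>Induction on the number of vertices. For a vertex in row k the Hermite recursion splits
  off a factor W (h k), and integration by parts yields a sum over all rows. The term of row k
  itself cancels against the second term of the recursion, which is why no edge joins vertices of
  one row; the other terms range over the possible partners. \<open>K\<close> stays fixed, and a row
  that has become empty contributes the constant polynomial.\<close>

lemma expectation_hermite:
  assumes fin: "finite V" and finK: "finite K" and V: "fst ` V \<subseteq> K"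
  shows "(\<integral>\<omega>. (\<Prod>k\<in>K. poly (hermite_poly ((norm (h k))\<^sup>2) (card {v\<in>V. fst v = k})) (W (h k) \<omega>)) \<partial>M) =
    (\<Sum>D\<in>row_diagrams V. \<Prod>(a, b)\<in>D. h (fst a) \<bullet> h (fst b))"
  using fin V
proof (induction V rule: measure_induct_rule[where f=card])
  case (less V)
  define c where "c V k = card {v\<in>V. fst v = k}" for V :: "(nat \<times> nat) set" and k
  let ?H = "\<lambda>k n. hermite_poly ((norm (h k))\<^sup>2) n"
  let ?\<Phi> = "\<lambda>V. \<integral>\<omega>. (\<Prod>k\<in>K. poly (?H k (c V k)) (W (h k) \<omega>)) \<partial>M"
  show ?case
  proof (cases "V = {}")
    case True
    then show ?thesis by (simp add: row_diagrams_empty prob_space)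
  next
    case False
    then obtain v where v: "v \<in> V" by blast
    define k where "k = fst v"
    have kK: "k \<in> K" using v less.prems unfolding k_def by blast
    define V' where "V' = V - {v}"
    have V': "finite V'" using less.prems by (simp add: V'_def)
    have ck: "c V k = Suc (c V' k)"
    proof -
      have "{w\<in>V. fst w = k} = insert v {w\<in>V'. fst w = k}" using v by (auto simp: V'_def k_def)
      then show ?thesis using V' by (simp add: c_def V'_def)
    qed
    have cl: "c V l = c V' l" if "l \<noteq> k" for l
    proof -
      have "{w\<in>V. fst w = l} = {w\<in>V'. fst w = l}" using that by (auto simp: V'_def k_def)
      then show ?thesis by (simp add: c_def)
    qed
    have cu: "c (V - {v, u}) l = (if l = fst u then c V' l - 1 else c V' l)" if u: "u \<in> V'" for u l
    proof -
      have "{w\<in>V - {v, u}. fst w = l} = (if l = fst u then {w\<in>V'. fst w = l} - {u} else {w\<in>V'. fst w = l})" by (auto simp: V'_def)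
      then show ?thesis using u by (simp add: c_def)
    qed
    define X where "X l = (\<integral>\<omega>. (\<Prod>i\<in>K. poly (?H i (if i = l then c V' i - 1 else c V' i)) (W (h i) \<omega>)) \<partial>M)" for l
    note mom = moments_mult moments_prod moments_cmult moments_poly W_moments
    let ?Q = "\<lambda>\<omega>. \<Prod>i\<in>K - {k}. poly (?H i (c V' i)) (W (h i) \<omega>)"
    let ?A = "\<lambda>\<omega>. \<Prod>i\<in>K. poly (?H i (c V' i)) (W (h i) \<omega>)"
    let ?B = "\<lambda>\<omega>. \<Prod>i\<in>K. poly (?H i (if i = k then c V' i - 1 else c V' i)) (W (h i) \<omega>)"
    let ?D = "\<lambda>u. \<Sum>D\<in>row_diagrams (V - {v, u}). \<Prod>(a, b)\<in>D. h (fst a) \<bullet> h (fst b)"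
    have "?\<Phi> V = (\<integral>\<omega>. W (h k) \<omega> * ?A \<omega> -
      real (c V' k) * (norm (h k))\<^sup>2 * ?B \<omega> \<partial>M)"
    proof (rule Bochner_Integration.integral_cong[OF refl])
      fix \<omega>
      have "(\<Prod>i\<in>K. poly (?H i (c V i)) (W (h i) \<omega>)) = poly (?H k (Suc (c V' k))) (W (h k) \<omega>) * ?Q \<omega>"
        using finK kK by (simp add: prod.remove ck cl)
      also have "\<dots> = W (h k) \<omega> * (poly (?H k (c V' k)) (W (h k) \<omega>) * ?Q \<omega>) -
        real (c V' k) * (norm (h k))\<^sup>2 * (poly (?H k (c V' k - 1)) (W (h k) \<omega>) * ?Q \<omega>)"
        unfolding hermite_poly_Suc by (simp add: algebra_simps)
      also have "poly (?H k (c V' k)) (W (h k) \<omega>) * ?Q \<omega> = ?A \<omega>"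
        using finK kK by (simp add: prod.remove)
      also have "poly (?H k (c V' k - 1)) (W (h k) \<omega>) * ?Q \<omega> =
        ?B \<omega>"
        using finK kK by (simp add: prod.remove)
      finally show "(\<Prod>i\<in>K. poly (?H i (c V i)) (W (h i) \<omega>)) = W (h k) \<omega> * ?A \<omega> -
        real (c V' k) * (norm (h k))\<^sup>2 * ?B \<omega>" .
    qed
    also have "\<dots> = (\<integral>\<omega>. W (h k) \<omega> * ?A \<omega> \<partial>M) - real (c V' k) * (norm (h k))\<^sup>2 * X k"
      unfolding X_def by (subst Bochner_Integration.integral_diff) ((intro moments_integrable mom)+, simp)
    also have "(\<integral>\<omega>. W (h k) \<omega> * ?A \<omega> \<partial>M) = (\<Sum>l\<in>K. (h l \<bullet> h k) * (real (c V' l) * X l))"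
      unfolding integration_by_parts[OF finK]
    proof (rule sum.cong)
      fix l assume l: "l \<in> K"
      have "(\<Prod>i\<in>K. poly (if i = l then pderiv (?H i (c V' i)) else ?H i (c V' i)) (W (h i) \<omega>)) =
        real (c V' l) * (\<Prod>i\<in>K. poly (?H i (if i = l then c V' i - 1 else c V' i)) (W (h i) \<omega>))" for \<omega>
        using finK l by (simp add: prod.remove pderiv_hermite_poly)
      then show "(h l \<bullet> h k) * (\<integral>\<omega>. (\<Prod>i\<in>K. poly (if i = l then pderiv (?H i (c V' i)) else ?H i (c V' i)) (W (h i) \<omega>)) \<partial>M) =
        (h l \<bullet> h k) * (real (c V' l) * X l)" by (simp add: X_def)
    qed simp
    \<comment> \<open>The contribution of the row of \<open>v\<close> itself cancels here.\<close>
    also have "\<dots> - real (c V' k) * (norm (h k))\<^sup>2 * X k = (\<Sum>l\<in>K - {k}. real (c V' l) * ((h l \<bullet> h k) * X l))"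
      using finK kK by (simp add: sum.remove power2_norm_eq_inner mult_ac)
    \<comment> \<open>The factor \<open>c V' l\<close> counts the vertices of row \<open>l\<close>,
      each of which is a possible partner of \<open>v\<close>.\<close>
    also have "\<dots> = (\<Sum>l\<in>K - {k}. \<Sum>u\<in>{u\<in>V'. fst u = l}. (h (fst u) \<bullet> h k) * X (fst u))"
      by (intro sum.cong refl) (simp add: c_def)
    also have "\<dots> = (\<Sum>u\<in>{u\<in>V. fst u \<noteq> k}. (h (fst u) \<bullet> h k) * X (fst u))"
    proof -
      have "(\<Sum>l\<in>K - {k}. \<Sum>u\<in>{u\<in>V'. fst u = l}. (h (fst u) \<bullet> h k) * X (fst u)) =
        (\<Sum>l\<in>K - {k}. \<Sum>u\<in>{u \<in> {u\<in>V. fst u \<noteq> k}. fst u = l}. (h (fst u) \<bullet> h k) * X (fst u))"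
        by (intro sum.cong) (auto simp: V'_def k_def)
      also have "\<dots> = (\<Sum>u\<in>{u\<in>V. fst u \<noteq> k}. (h (fst u) \<bullet> h k) * X (fst u))"
        by (rule sum.group) (use finK less.prems in auto)
      finally show ?thesis .
    qed
    also have "\<dots> = (\<Sum>u | u \<in> V \<and> fst u \<noteq> fst v. (h (fst v) \<bullet> h (fst u)) * ?D u)"
    proof (rule sum.cong)
      fix u assume "u \<in> {u. u \<in> V \<and> fst u \<noteq> fst v}"
      then have u: "u \<in> V" "fst u \<noteq> k" "u \<in> V'" by (auto simp: k_def V'_def)
      have "card (V - {v, u}) < card V" using v less.prems by (intro psubset_card_mono) auto
      moreover have "finite (V - {v, u})" "fst ` (V - {v, u}) \<subseteq> K" using less.prems by auto
      ultimately have IH: "?\<Phi> (V - {v, u}) = ?D u"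
        unfolding c_def by (rule less.IH)
      have "X (fst u) = ?\<Phi> (V - {v, u})" unfolding X_def cu[OF u(3)] ..
      then show "(h (fst u) \<bullet> h k) * X (fst u) = (h (fst v) \<bullet> h (fst u)) * ?D u"
        by (simp only: IH k_def inner_commute)
    qed (simp add: k_def)
    also have "\<dots> = (\<Sum>D\<in>row_diagrams V. \<Prod>(a, b)\<in>D. h (fst a) \<bullet> h (fst b))"
      by (rule sum_row_diagrams[OF _ v, symmetric]) (use less.prems in \<open>simp_all add: inner_commute\<close>)
    finally show ?thesis by (simp only: c_def)
  qed
qed

end

section \<open>Multiple integrals\<close>

text \<open>Vitali's convergence theorem for a sequence bounded in L2. By Fatou's lemma the limit
  obeys the same bound. The difference is truncated at height A, where dominated convergence
  applies, and beyond A it is at most its square over A.\<close>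

lemma (in prob_space) integral_tendsto_bounded_square:
  fixes Z :: "nat \<Rightarrow> 'a \<Rightarrow> real"
  assumes Z: "\<And>j. Z j \<in> borel_measurable M" "\<And>j. integrable M (\<lambda>\<omega>. (Z j \<omega>)\<^sup>2)" "\<And>j. (\<integral>\<omega>. (Z j \<omega>)\<^sup>2 \<partial>M) \<le> B"
    and X: "X \<in> borel_measurable M" and lim: "AE \<omega> in M. (\<lambda>j. Z j \<omega>) \<longlonglongrightarrow> X \<omega>"
  shows "integrable M X" "(\<lambda>j. \<integral>\<omega>. Z j \<omega> \<partial>M) \<longlonglongrightarrow> (\<integral>\<omega>. X \<omega> \<partial>M)"
proof -
  have "0 \<le> (\<integral>\<omega>. (Z 0 \<omega>)\<^sup>2 \<partial>M)" by simp
  then have B: "0 \<le> B" using Z(3)[of 0] by linarith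
  have le1: "\<bar>x\<bar> \<le> 1 + x\<^sup>2" for x :: real
    using sum_squares_bound[of "\<bar>x\<bar>" 1] by simp
  have int1: "integrable M Y" if "Y \<in> borel_measurable M" "integrable M (\<lambda>\<omega>. (Y \<omega>)\<^sup>2)" for Y :: "'a \<Rightarrow> real"
  proof (rule Bochner_Integration.integrable_bound[of M "\<lambda>\<omega>. 1 + (Y \<omega>)\<^sup>2"])
    show "AE \<omega> in M. norm (Y \<omega>) \<le> norm (1 + (Y \<omega>)\<^sup>2)" using le1 by (intro AE_I2) (simp add: abs_of_nonneg)
  qed (use that in simp_all)
  have "(\<integral>\<^sup>+\<omega>. ennreal ((X \<omega>)\<^sup>2) \<partial>M) = (\<integral>\<^sup>+\<omega>. liminf (\<lambda>j. ennreal ((Z j \<omega>)\<^sup>2)) \<partial>M)"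
  proof (rule nn_integral_cong_AE)
    show "AE \<omega> in M. ennreal ((X \<omega>)\<^sup>2) = liminf (\<lambda>j. ennreal ((Z j \<omega>)\<^sup>2))"
      using lim
    proof eventually_elim
      case (elim \<omega>)
      then have "(\<lambda>j. ennreal ((Z j \<omega>)\<^sup>2)) \<longlonglongrightarrow> ennreal ((X \<omega>)\<^sup>2)" by (intro tendsto_ennrealI tendsto_power)
      then show ?case by (intro lim_imp_Liminf[symmetric]) simp_all
    qed
  qed
  also have "\<dots> \<le> liminf (\<lambda>j. \<integral>\<^sup>+\<omega>. ennreal ((Z j \<omega>)\<^sup>2) \<partial>M)"
    using Z(1) by (intro nn_integral_liminf) simp
  also have "\<dots> \<le> limsup (\<lambda>j. \<integral>\<^sup>+\<omega>. ennreal ((Z j \<omega>)\<^sup>2) \<partial>M)" by (rule Liminf_le_Limsup) simp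
  also have "\<dots> \<le> ennreal B"
  proof (rule Limsup_bounded, rule always_eventually, rule allI)
    fix j
    have "(\<integral>\<^sup>+\<omega>. ennreal ((Z j \<omega>)\<^sup>2) \<partial>M) = ennreal (\<integral>\<omega>. (Z j \<omega>)\<^sup>2 \<partial>M)"
      by (rule nn_integral_eq_integral[OF Z(2)]) simp
    then show "(\<integral>\<^sup>+\<omega>. ennreal ((Z j \<omega>)\<^sup>2) \<partial>M) \<le> ennreal B" using Z(3)[of j] by (simp add: ennreal_leI)
  qed
  finally have nn: "(\<integral>\<^sup>+\<omega>. ennreal ((X \<omega>)\<^sup>2) \<partial>M) \<le> ennreal B" .
  have X2: "integrable M (\<lambda>\<omega>. (X \<omega>)\<^sup>2)"
    using X le_less_trans[OF nn ennreal_less_top] by (intro integrableI_bounded) simp_all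
  have X2B: "(\<integral>\<omega>. (X \<omega>)\<^sup>2 \<partial>M) \<le> B"
    using nn B unfolding nn_integral_eq_integral[OF X2 AE_I2[OF zero_le_power2]] by simp
  show X1: "integrable M X" by (rule int1[OF X X2])
  have Z1: "integrable M (Z j)" for j by (rule int1[OF Z(1,2)])
  show "(\<lambda>j. \<integral>\<omega>. Z j \<omega> \<partial>M) \<longlonglongrightarrow> (\<integral>\<omega>. X \<omega> \<partial>M)"
  proof (rule LIMSEQ_I)
    fix e :: real assume e: "0 < e"
    \<comment> \<open>Chosen so that the bound \<open>4 * B / A\<close> on the part beyond A is
      below \<open>e / 2\<close>; the summand 1 keeps \<open>A\<close> positive when
      \<open>B\<close> is 0.\<close>
    define A where "A = 8 * B / e + 1"
    have A: "0 < A" using B e by (simp add: A_def add_nonneg_pos)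
    have AB: "4 * B / A < e / 2"
    proof -
      have "8 * B < e * A" using e by (simp add: A_def algebra_simps)
      then show ?thesis using A by (simp add: divide_simps mult_ac)
    qed
    let ?m = "\<lambda>j \<omega>. min \<bar>Z j \<omega> - X \<omega>\<bar> A"
    have mm: "?m j \<in> borel_measurable M" for j using Z(1)[of j] X by simp
    have mi: "integrable M (?m j)" for j
      by (rule Bochner_Integration.integrable_bound[OF integrable_const[of A] mm]) (use A in auto)
    have "(\<lambda>j. \<integral>\<omega>. ?m j \<omega> \<partial>M) \<longlonglongrightarrow> (\<integral>\<omega>. 0 \<partial>M)"
    proof (rule integral_dominated_convergence[where w="\<lambda>_. A"])
      show "AE \<omega> in M. (\<lambda>j. ?m j \<omega>) \<longlonglongrightarrow> 0"
        using lim
      proof eventually_elim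
        case (elim \<omega>)
        then have "(\<lambda>j. ?m j \<omega>) \<longlonglongrightarrow> min \<bar>X \<omega> - X \<omega>\<bar> A" by (intro tendsto_intros)
        then show ?case using A by simp
      qed
      show "AE \<omega> in M. norm (?m j \<omega>) \<le> A" for j using A by auto
    qed (use mm in simp_all)
    then have "(\<lambda>j. \<integral>\<omega>. ?m j \<omega> \<partial>M) \<longlonglongrightarrow> 0" by simp
    then obtain N where N: "\<And>j. N \<le> j \<Longrightarrow> norm ((\<integral>\<omega>. ?m j \<omega> \<partial>M) - 0) < e / 2"
      using LIMSEQ_D[of "\<lambda>j. \<integral>\<omega>. ?m j \<omega> \<partial>M" 0 "e / 2"] e by auto
    have "norm ((\<integral>\<omega>. Z j \<omega> \<partial>M) - (\<integral>\<omega>. X \<omega> \<partial>M)) < e" if j: "N \<le> j" for j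
    proof -
      have bound: "\<bar>Z j \<omega> - X \<omega>\<bar> \<le> ?m j \<omega> + (2 * (Z j \<omega>)\<^sup>2 + 2 * (X \<omega>)\<^sup>2) / A" for \<omega>
      proof (cases "\<bar>Z j \<omega> - X \<omega>\<bar> \<le> A")
        case True
        then show ?thesis using A by simp
      next
        case False
        have "A * \<bar>Z j \<omega> - X \<omega>\<bar> \<le> \<bar>Z j \<omega> - X \<omega>\<bar> * \<bar>Z j \<omega> - X \<omega>\<bar>" using False by (intro mult_right_mono) auto
        also have "\<dots> = (Z j \<omega> - X \<omega>)\<^sup>2" by (simp add: power2_eq_square)
        also have "\<dots> \<le> 2 * (Z j \<omega>)\<^sup>2 + 2 * (X \<omega>)\<^sup>2"
          using zero_le_power2[of "Z j \<omega> + X \<omega>"] by (simp add: power2_eq_square algebra_simps)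
        finally have "\<bar>Z j \<omega> - X \<omega>\<bar> \<le> (2 * (Z j \<omega>)\<^sup>2 + 2 * (X \<omega>)\<^sup>2) / A" using A by (simp add: pos_le_divide_eq mult_ac)
        then show ?thesis using A by simp
      qed
      have "norm ((\<integral>\<omega>. Z j \<omega> \<partial>M) - (\<integral>\<omega>. X \<omega> \<partial>M)) = \<bar>\<integral>\<omega>. Z j \<omega> - X \<omega> \<partial>M\<bar>"
        using Z1[of j] X1 by simp
      also have "\<dots> \<le> (\<integral>\<omega>. \<bar>Z j \<omega> - X \<omega>\<bar> \<partial>M)" by (rule integral_abs_bound)
      also have "\<dots> \<le> (\<integral>\<omega>. ?m j \<omega> + (2 * (Z j \<omega>)\<^sup>2 + 2 * (X \<omega>)\<^sup>2) / A \<partial>M)"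
        using Z1[of j] X1 mi[of j] Z(2)[of j] X2 bound by (intro integral_mono) auto
      also have "\<dots> = (\<integral>\<omega>. ?m j \<omega> \<partial>M) + (2 * (\<integral>\<omega>. (Z j \<omega>)\<^sup>2 \<partial>M) + 2 * (\<integral>\<omega>. (X \<omega>)\<^sup>2 \<partial>M)) / A"
        using mi[of j] Z(2)[of j] X2 by simp
      also have "\<dots> \<le> (\<integral>\<omega>. ?m j \<omega> \<partial>M) + 4 * B / A"
        using Z(3)[of j] X2B A by (intro add_left_mono divide_right_mono) auto
      also have "\<dots> < e" using N[OF j] AB by simp
      finally show ?thesis .
    qed
    then show "\<exists>no. \<forall>j\<ge>no. norm ((\<integral>\<omega>. Z j \<omega> \<partial>M) - (\<integral>\<omega>. X \<omega> \<partial>M)) < e" by blast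
  qed
qed

lemma sum_lessThan_add:
  fixes g :: "nat \<Rightarrow> 'x::comm_monoid_add"
  shows "(\<Sum>j<N + K. g j) = (\<Sum>j<N. g j) + (\<Sum>j<K. g (N + j))"
  by (induction K) (simp_all add: add.assoc)

lemma prod_two: "(\<Prod>k\<in>{1..2::nat}. h k) = (h 1 * h 2 :: 'x::comm_monoid_mult)"
proof -
  have "{1..2::nat} = {1, 2}" by auto
  then show ?thesis by simp
qed

lemma subspace_closure:
  fixes S :: "'x::real_normed_vector set"
  assumes S: "subspace S"
  shows "subspace (closure S)"
proof (rule subspaceI)
  show "0 \<in> closure S" using subspace_0[OF S] closure_subset by blast
next
  fix x y assume "x \<in> closure S" "y \<in> closure S"
  then obtain f g where "\<forall>n. f n \<in> S" "f \<longlonglongrightarrow> x" "\<forall>n. g n \<in> S" "g \<longlonglongrightarrow> y" unfolding closure_sequential by blast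
  then have "\<forall>n. f n + g n \<in> S" "(\<lambda>n. f n + g n) \<longlonglongrightarrow> x + y" using subspace_add[OF S] by (auto intro: tendsto_add)
  then show "x + y \<in> closure S" unfolding closure_sequential by (intro exI[of _ "\<lambda>n. f n + g n"] conjI)
next
  fix x c assume "x \<in> closure S"
  then obtain f where "\<forall>n. f n \<in> S" "f \<longlonglongrightarrow> x" unfolding closure_sequential by blast
  then have "\<forall>n. c *\<^sub>R f n \<in> S" "(\<lambda>n. c *\<^sub>R f n) \<longlonglongrightarrow> c *\<^sub>R x" using subspace_scale[OF S] by (auto intro: tendsto_scaleR)
  then show "c *\<^sub>R x \<in> closure S" unfolding closure_sequential by (intro exI[of _ "\<lambda>n. c *\<^sub>R f n"] conjI)
qed

section \<open>Multiple integrals of tensor powers\<close>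

locale wiener_chaos = isonormal M W for M :: "'w measure" and W :: "'h::{real_inner,banach} \<Rightarrow> 'w \<Rightarrow> real" +
  fixes T :: "nat \<Rightarrow> (nat \<Rightarrow> 'h) \<Rightarrow> 'k::{real_inner,banach}" and J :: "nat \<Rightarrow> 'k \<Rightarrow> 'w \<Rightarrow> real"
  assumes tensor: "is_tensor_power T" and multiple_integral: "is_multiple_integral M W T J"
begin

lemma T_inner: "T n u \<bullet> T n v = (\<Prod>i\<in>{1..n}. u i \<bullet> v i)"
  using tensor by (simp add: is_tensor_power_def)

text \<open>Tensors are given by their inner products alone, so an identity between them is proved
  by computing the squared norm of the difference.\<close>

lemma T_power_scale: "T n (\<lambda>_. c *\<^sub>R h) = c ^ n *\<^sub>R T n (\<lambda>_. h)"
proof -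
  let ?D = "T n (\<lambda>_. c *\<^sub>R h) - c ^ n *\<^sub>R T n (\<lambda>_. h)"
  have "?D \<bullet> ?D = 0" by (simp add: inner_diff_left inner_diff_right T_inner power_mult_distrib)
  then show ?thesis by simp
qed

lemma T_in_tensor_space: "T n u \<in> tensor_space T n"
  unfolding tensor_space_def by (intro subsetD[OF closure_subset] span_base) simp

lemma tensor_space_subspace: "subspace (tensor_space T n)"
  unfolding tensor_space_def by (intro subspace_closure subspace_span)

lemma symmetric_tensors_add: "F \<in> symmetric_tensors T n \<Longrightarrow> G \<in> symmetric_tensors T n \<Longrightarrow> F + G \<in> symmetric_tensors T n"
  using subspace_add[OF tensor_space_subspace] by (auto simp: symmetric_tensors_def inner_add_left)

lemma symmetric_tensors_scaleR: "F \<in> symmetric_tensors T n \<Longrightarrow> c *\<^sub>R F \<in> symmetric_tensors T n"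
  using subspace_scale[OF tensor_space_subspace] by (auto simp: symmetric_tensors_def)

lemma symmetric_tensors_zero: "0 \<in> symmetric_tensors T n"
  using subspace_0[OF tensor_space_subspace] by (auto simp: symmetric_tensors_def)

lemma symmetric_tensors_sum: "(\<And>i. i \<in> I \<Longrightarrow> F i \<in> symmetric_tensors T n) \<Longrightarrow> (\<Sum>i\<in>I. F i) \<in> symmetric_tensors T n"
  by (induction I rule: infinite_finite_induct) (simp_all add: symmetric_tensors_zero symmetric_tensors_add)

lemma T_power_symmetric: "T n (\<lambda>_. h) \<in> symmetric_tensors T n"
proof -
  have "(\<Prod>i\<in>{1..n}. h \<bullet> u (\<sigma> i)) = (\<Prod>i\<in>{1..n}. h \<bullet> u i)" if "\<sigma> permutes {1..n}" for \<sigma> u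
    using prod.permute[OF that, of "\<lambda>i. h \<bullet> u i"] by (simp add: comp_def)
  then show ?thesis by (simp add: symmetric_tensors_def T_in_tensor_space T_inner del: One_nat_def)
qed

lemma symmetric_tensors_closed:
  assumes "\<And>j. P j \<in> symmetric_tensors T n" "P \<longlonglongrightarrow> F"
  shows "F \<in> symmetric_tensors T n"
proof -
  have "F \<in> tensor_space T n"
    using assms unfolding tensor_space_def by (intro closed_sequentially[OF closed_closure _ assms(2)]) (auto simp: symmetric_tensors_def tensor_space_def)
  moreover have "F \<bullet> T n (u \<circ> \<sigma>) = F \<bullet> T n u" if "\<sigma> permutes {1..n}" for \<sigma> u
  proof (rule LIMSEQ_unique)
    show "(\<lambda>j. P j \<bullet> T n u) \<longlonglongrightarrow> F \<bullet> T n u" by (intro tendsto_inner assms(2) tendsto_const)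
    have "(\<lambda>j. P j \<bullet> T n (u \<circ> \<sigma>)) \<longlonglongrightarrow> F \<bullet> T n (u \<circ> \<sigma>)" by (intro tendsto_inner assms(2) tendsto_const)
    moreover have "P j \<bullet> T n (u \<circ> \<sigma>) = P j \<bullet> T n u" for j using assms(1)[of j] that by (simp add: symmetric_tensors_def)
    ultimately show "(\<lambda>j. P j \<bullet> T n u) \<longlonglongrightarrow> F \<bullet> T n (u \<circ> \<sigma>)" by simp
  qed
  ultimately show ?thesis by (simp add: symmetric_tensors_def)
qed

lemma J_measurable: "1 \<le> n \<Longrightarrow> F \<in> symmetric_tensors T n \<Longrightarrow> J n F \<in> borel_measurable M"
  and J_square_integrable: "1 \<le> n \<Longrightarrow> F \<in> symmetric_tensors T n \<Longrightarrow> integrable M (\<lambda>\<omega>. (J n F \<omega>)\<^sup>2)"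
  and J_isometry: "1 \<le> n \<Longrightarrow> F \<in> symmetric_tensors T n \<Longrightarrow> (\<integral>\<omega>. (J n F \<omega>)\<^sup>2 \<partial>M) = fact n * (norm F)\<^sup>2"
  and J_linear: "1 \<le> n \<Longrightarrow> F \<in> symmetric_tensors T n \<Longrightarrow> G \<in> symmetric_tensors T n \<Longrightarrow>
    AE \<omega> in M. J n (a *\<^sub>R F + b *\<^sub>R G) \<omega> = a * J n F \<omega> + b * J n G \<omega>"
  and J_unit: "1 \<le> n \<Longrightarrow> norm h = 1 \<Longrightarrow> AE \<omega> in M. J n (T n (\<lambda>_. h)) \<omega> = hermite n (W h \<omega>)"
  using multiple_integral unfolding is_multiple_integral_def by simp_all

lemma J_zero: "1 \<le> n \<Longrightarrow> AE \<omega> in M. J n 0 \<omega> = 0"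
  using J_linear[OF _ symmetric_tensors_zero symmetric_tensors_zero, of n 0 0] by simp

lemma J_scale:
  assumes "1 \<le> n" "F \<in> symmetric_tensors T n"
  shows "AE \<omega> in M. J n (a *\<^sub>R F) \<omega> = a * J n F \<omega>"
  using J_linear[OF assms(1,2) symmetric_tensors_zero, of a 0] by simp

lemma J_sum:
  assumes n: "1 \<le> n" and I: "finite I" "\<And>i. i \<in> I \<Longrightarrow> F i \<in> symmetric_tensors T n"
  shows "AE \<omega> in M. J n (\<Sum>i\<in>I. c i *\<^sub>R F i) \<omega> = (\<Sum>i\<in>I. c i * J n (F i) \<omega>)"
  using I
proof (induction I rule: finite_induct)
  case (insert i I)
  have 1: "AE \<omega> in M. J n (\<Sum>i\<in>I. c i *\<^sub>R F i) \<omega> = (\<Sum>i\<in>I. c i * J n (F i) \<omega>)"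
    by (rule insert.IH, rule insert.prems) simp
  have "(\<Sum>i\<in>I. c i *\<^sub>R F i) \<in> symmetric_tensors T n"
    by (intro symmetric_tensors_sum symmetric_tensors_scaleR insert.prems) simp
  with J_linear[OF n insert.prems, of i "\<Sum>i\<in>I. c i *\<^sub>R F i" "c i" 1]
  have "AE \<omega> in M. J n (c i *\<^sub>R F i + (\<Sum>i\<in>I. c i *\<^sub>R F i)) \<omega> = c i * J n (F i) \<omega> + J n (\<Sum>i\<in>I. c i *\<^sub>R F i) \<omega>" by simp
  with 1 show ?case using insert(1,2) by (auto elim!: eventually_elim2)
qed (simp add: J_zero[OF n])

text \<open>Rescaling carries the Hermite formula over from unit vectors. For the zero vector both
  sides vanish almost surely, since n \<ge> 1.\<close>

lemma J_power:
  assumes n: "1 \<le> n"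
  shows "AE \<omega> in M. J n (T n (\<lambda>_. h)) \<omega> = poly (hermite_poly ((norm h)\<^sup>2) n) (W h \<omega>)"
proof (cases "h = 0")
  case True
  have "T n (\<lambda>_. 0) = 0" using T_power_scale[of n 0 h] n by simp
  then show ?thesis using J_zero[OF n] W_zero n unfolding True by (auto simp: hermite_poly_zero elim!: eventually_elim2)
next
  case False
  let ?u = "(1 / norm h) *\<^sub>R h"
  have h: "h = norm h *\<^sub>R ?u" using False by simp
  have "AE \<omega> in M. J n (T n (\<lambda>_. h)) \<omega> = norm h ^ n * J n (T n (\<lambda>_. ?u)) \<omega>"
    using J_scale[OF n T_power_symmetric[of n ?u], of "norm h ^ n"] by (subst h) (simp only: T_power_scale)
  moreover have "AE \<omega> in M. J n (T n (\<lambda>_. ?u)) \<omega> = hermite n (W ?u \<omega>)" using False by (intro J_unit[OF n]) simp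
  moreover have "AE \<omega> in M. W ?u \<omega> = W h \<omega> / norm h" using W_linear[of "1 / norm h" h 0 0] by simp
  ultimately show ?thesis
  proof eventually_elim
    case (elim \<omega>)
    then show ?case using hermite_poly_scale[of "norm h" n "W h \<omega>"] False by simp
  qed
qed

text \<open>By multilinearity the product expands over choices \<open>s\<close> of one summand in
  every row. For a fixed choice each row carries a single vector, and the Hermite formula
  applies.\<close>

lemma expectation_combinations:
  fixes N :: "nat \<Rightarrow> nat" and c :: "nat \<Rightarrow> nat \<Rightarrow> real" and h :: "nat \<Rightarrow> nat \<Rightarrow> 'h"
  assumes n: "\<And>k. k \<in> {1..m} \<Longrightarrow> 1 \<le> n k"
    and P: "\<And>k. k \<in> {1..m} \<Longrightarrow> P k = (\<Sum>j<N k. c k j *\<^sub>R T (n k) (\<lambda>_. h k j))"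
  shows "(\<lambda>\<omega>. \<Prod>k\<in>{1..m}. J (n k) (P k) \<omega>) \<in> moments"
    and "(\<integral>\<omega>. (\<Prod>k\<in>{1..m}. J (n k) (P k) \<omega>) \<partial>M) = (\<Sum>s\<in>PiE {1..m} (\<lambda>k. {..<N k}). (\<Prod>k\<in>{1..m}. c k (s k)) *
      (\<Sum>D\<in>diagrams m n. \<Prod>(a, b)\<in>D. h (fst a) (s (fst a)) \<bullet> h (fst b) (s (fst b))))"
proof -
  let ?K = "{1..m}" and ?S = "PiE {1..m} (\<lambda>k. {..<N k})"
  define X where "X k j \<omega> = poly (hermite_poly ((norm (h k j))\<^sup>2) (n k)) (W (h k j) \<omega>)" for k j \<omega>
  have Xm: "X k j \<in> moments" for k j unfolding X_def[abs_def] by (rule moments_poly[OF W_moments])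
  have Psym: "P k \<in> symmetric_tensors T (n k)" if "k \<in> ?K" for k
    unfolding P[OF that] by (intro symmetric_tensors_sum symmetric_tensors_scaleR T_power_symmetric)
  have J1: "AE \<omega> in M. J (n k) (P k) \<omega> = (\<Sum>j<N k. c k j * X k j \<omega>)" if k: "k \<in> ?K" for k
  proof -
    have 1: "AE \<omega> in M. J (n k) (P k) \<omega> = (\<Sum>j<N k. c k j * J (n k) (T (n k) (\<lambda>_. h k j)) \<omega>)"
      unfolding P[OF k] by (intro J_sum[OF n[OF k]] T_power_symmetric) simp
    have 2: "AE \<omega> in M. \<forall>j\<in>{..<N k}. J (n k) (T (n k) (\<lambda>_. h k j)) \<omega> = X k j \<omega>"
      unfolding X_def using J_power[OF n[OF k]] by (intro AE_finite_allI) simp_all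
    from 1 2 show ?thesis by eventually_elim simp
  qed
  have J2: "AE \<omega> in M. \<forall>k\<in>?K. J (n k) (P k) \<omega> = (\<Sum>j<N k. c k j * X k j \<omega>)"
    by (intro AE_finite_allI J1) simp_all
  have J3: "AE \<omega> in M. (\<Prod>k\<in>?K. J (n k) (P k) \<omega>) = (\<Prod>k\<in>?K. \<Sum>j<N k. c k j * X k j \<omega>)"
    using J2 by eventually_elim (intro prod.cong, auto)
  have Ym: "(\<lambda>\<omega>. \<Prod>k\<in>?K. \<Sum>j<N k. c k j * X k j \<omega>) \<in> moments"
    by (intro moments_prod moments_sum moments_cmult Xm)
  have Jm: "(\<lambda>\<omega>. \<Prod>k\<in>?K. J (n k) (P k) \<omega>) \<in> borel_measurable M"
    by (intro borel_measurable_prod J_measurable n Psym)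
  show "(\<lambda>\<omega>. \<Prod>k\<in>?K. J (n k) (P k) \<omega>) \<in> moments" by (rule moments_AE[OF Ym Jm J3])
  have "(\<integral>\<omega>. (\<Prod>k\<in>?K. J (n k) (P k) \<omega>) \<partial>M) = (\<integral>\<omega>. (\<Prod>k\<in>?K. \<Sum>j<N k. c k j * X k j \<omega>) \<partial>M)"
    by (rule integral_cong_AE[OF Jm moments_measurable[OF Ym] J3])
  also have "\<dots> = (\<integral>\<omega>. (\<Sum>s\<in>?S. (\<Prod>k\<in>?K. c k (s k)) * (\<Prod>k\<in>?K. X k (s k) \<omega>)) \<partial>M)"
    by (subst prod_sum_PiE) (simp_all add: prod.distrib)
  also have "\<dots> = (\<Sum>s\<in>?S. (\<Prod>k\<in>?K. c k (s k)) * (\<integral>\<omega>. (\<Prod>k\<in>?K. X k (s k) \<omega>) \<partial>M))"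
    by (subst Bochner_Integration.integral_sum) (intro moments_integrable moments_cmult moments_prod Xm, simp)
  also have "\<dots> = (\<Sum>s\<in>?S. (\<Prod>k\<in>?K. c k (s k)) * (\<Sum>D\<in>diagrams m n. \<Prod>(a, b)\<in>D. h (fst a) (s (fst a)) \<bullet> h (fst b) (s (fst b))))"
  proof (rule sum.cong[OF refl])
    fix s
    have "card {v \<in> vertices m n. fst v = k} = n k" if "k \<in> ?K" for k
    proof -
      have "{v \<in> vertices m n. fst v = k} = Pair k ` {1..n k}" using that by (auto simp: vertices_def)
      then show ?thesis by (simp add: card_image inj_on_def)
    qed
    then have "(\<integral>\<omega>. (\<Prod>k\<in>?K. X k (s k) \<omega>) \<partial>M) =
      (\<integral>\<omega>. (\<Prod>k\<in>?K. poly (hermite_poly ((norm (h k (s k)))\<^sup>2) (card {v \<in> vertices m n. fst v = k})) (W (h k (s k)) \<omega>)) \<partial>M)"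
      unfolding X_def by (intro Bochner_Integration.integral_cong prod.cong) simp_all
    also have "\<dots> = (\<Sum>D\<in>row_diagrams (vertices m n). \<Prod>(a, b)\<in>D. h (fst a) (s (fst a)) \<bullet> h (fst b) (s (fst b)))"
      by (rule expectation_hermite) (auto simp: vertices_def)
    finally show "(\<Prod>k\<in>?K. c k (s k)) * (\<integral>\<omega>. (\<Prod>k\<in>?K. X k (s k) \<omega>) \<partial>M) =
      (\<Prod>k\<in>?K. c k (s k)) * (\<Sum>D\<in>diagrams m n. \<Prod>(a, b)\<in>D. h (fst a) (s (fst a)) \<bullet> h (fst b) (s (fst b)))"
      by (simp only: diagrams_eq_row_diagrams)
  qed
  finally show "(\<integral>\<omega>. (\<Prod>k\<in>?K. J (n k) (P k) \<omega>) \<partial>M) = (\<Sum>s\<in>?S. (\<Prod>k\<in>?K. c k (s k)) *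
      (\<Sum>D\<in>diagrams m n. \<Prod>(a, b)\<in>D. h (fst a) (s (fst a)) \<bullet> h (fst b) (s (fst b))))" .
qed

end

section \<open>The correspondence between kernels and tensors\<close>

locale chaos_setting = tame_noise \<gamma> \<Lambda> + wiener_chaos M W T J
  for \<gamma> :: "real correlation" and \<Lambda> :: "(real ^ 'd) correlation"
    and M :: "'w measure" and W :: "'h::{real_inner,banach} \<Rightarrow> 'w \<Rightarrow> real"
    and T :: "nat \<Rightarrow> (nat \<Rightarrow> 'h) \<Rightarrow> 'k::{real_inner,banach}" and J :: "nat \<Rightarrow> 'k \<Rightarrow> 'w \<Rightarrow> real" +
  fixes \<iota> :: "(real \<times> (real ^ 'd) \<Rightarrow> real) \<Rightarrow> 'h"
  assumes noise_space: "is_noise_space \<gamma> \<Lambda> \<iota>"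
begin

lemma embedding_inner:
  assumes "\<phi> \<in> test_functions" "\<psi> \<in> test_functions"
  shows "\<iota> \<phi> \<bullet> \<iota> \<psi> = (\<integral>w. \<phi> (fst w 1, snd w 1) * \<psi> (fst w 2, snd w 2) \<partial>noise12)"
  using noise_space assms by (simp add: is_noise_space_def noise_inner_def split_def)

lemma integral_test_product:
  assumes P: "pairing V E" and \<phi>: "\<And>v. v \<in> V \<Longrightarrow> \<phi> v \<in> test_functions"
  shows "integrable (\<nu> V E) (\<lambda>z. \<Prod>v\<in>V. \<phi> v (point z v))"
    and "(\<integral>z. (\<Prod>v\<in>V. \<phi> v (point z v)) \<partial>\<nu> V E) = (\<Prod>(a, b)\<in>E. \<iota> (\<phi> a) \<bullet> \<iota> (\<phi> b))"
proof -
  \<comment> \<open>Off \<open>V\<close> the zero function is inserted, because the factorization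
    over edges is stated for families indexed by all vertices.\<close>
  define \<psi> where "\<psi> v = (if v \<in> V then \<phi> v else (\<lambda>_. 0))" for v
  have \<psi>: "\<psi> v \<in> test_functions" for v by (simp add: \<psi>_def \<phi> test_functions_zero)
  have eq: "(\<Prod>v\<in>V. \<phi> v (point z v)) = (\<Prod>v\<in>V. \<psi> v (fst z v, snd z v))" for z
    by (intro prod.cong) (simp_all add: \<psi>_def point_def)
  note I = integral_noise_prod[OF P, of "\<lambda>v s y. \<psi> v (s, y)", OF pair_borel_measurable[OF test_function_borel[OF \<psi>]] compactly_bounded_pair[OF compactly_bounded_test[OF \<psi>] compactly_bounded_test[OF \<psi>]]]
  show "integrable (\<nu> V E) (\<lambda>z. \<Prod>v\<in>V. \<phi> v (point z v))" unfolding eq using I by (rule conjunct1)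
  have "(\<integral>z. (\<Prod>v\<in>V. \<phi> v (point z v)) \<partial>\<nu> V E) =
    (\<Prod>(a, b)\<in>E. \<integral>w. \<psi> a (fst w 1, snd w 1) * \<psi> b (fst w 2, snd w 2) \<partial>noise12)" unfolding eq using I by (rule conjunct2)
  also have "\<dots> = (\<Prod>(a, b)\<in>E. \<iota> (\<psi> a) \<bullet> \<iota> (\<psi> b))" by (simp only: embedding_inner[OF \<psi> \<psi>])
  also have "\<dots> = (\<Prod>(a, b)\<in>E. \<iota> (\<phi> a) \<bullet> \<iota> (\<phi> b))"
  proof (rule prod.cong[OF refl])
    fix e assume "e \<in> E"
    then have "fst e \<in> V" "snd e \<in> V" using pairing_edge[OF P, of "fst e" "snd e"] by simp_all
    then show "(case e of (a, b) \<Rightarrow> \<iota> (\<psi> a) \<bullet> \<iota> (\<psi> b)) = (case e of (a, b) \<Rightarrow> \<iota> (\<phi> a) \<bullet> \<iota> (\<phi> b))"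
      by (simp add: split_def \<psi>_def)
  qed
  finally show "(\<integral>z. (\<Prod>v\<in>V. \<phi> v (point z v)) \<partial>\<nu> V E) = (\<Prod>(a, b)\<in>E. \<iota> (\<phi> a) \<bullet> \<iota> (\<phi> b))" .
qed

text \<open>A relation, so that a function and its tensor are built in parallel. That the function
  determines the tensor is a consequence of \<open>realizes_norm\<close>, not a
  prerequisite.\<close>

inductive realizes :: "nat \<Rightarrow> ((nat, 'd) configuration \<Rightarrow> real) \<Rightarrow> 'k \<Rightarrow> bool" for l where
  realizes_base: "\<phi> \<in> test_functions \<Longrightarrow> realizes l (\<lambda>z. \<Prod>r\<in>{1..l}. \<phi> (point z r)) (T l (\<lambda>_. \<iota> \<phi>))"
| realizes_zero: "realizes l (\<lambda>z. 0) 0"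
| realizes_add: "realizes l p P \<Longrightarrow> realizes l q Q \<Longrightarrow> realizes l (\<lambda>z. p z + q z) (P + Q)"
| realizes_cmult: "realizes l p P \<Longrightarrow> realizes l (\<lambda>z. c * p z) (c *\<^sub>R P)"

lemma tensor_powers_realized: "p \<in> tensor_powers l \<Longrightarrow> \<exists>P. realizes l p P"
proof (induction rule: tensor_powers.induct)
  case (powers_base \<phi>)
  then show ?case by (intro exI) (rule realizes_base)
next
  case powers_zero
  then show ?case by (intro exI) (rule realizes_zero)
next
  case (powers_add p q)
  then obtain P Q where "realizes l p P" "realizes l q Q" by blast
  then show ?case by (intro exI) (rule realizes_add)
next
  case (powers_cmult p c)
  then obtain P where "realizes l p P" by blast
  then show ?case by (intro exI) (rule realizes_cmult)
qed

lemma realizes_finite_norm: "realizes l p P \<Longrightarrow> p \<in> finite_norm l"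
proof (induction rule: realizes.induct)
  case (realizes_base \<phi>)
  then show ?case by (rule tensor_finite_norm)
qed (simp_all only: finite_norm_zero finite_norm_add finite_norm_cmult)

lemma realizes_symmetric: "realizes l p P \<Longrightarrow> P \<in> symmetric_tensors T l"
  by (induction rule: realizes.induct)
    (simp_all only: T_power_symmetric symmetric_tensors_zero symmetric_tensors_add symmetric_tensors_scaleR)

lemma realizes_diff:
  assumes "realizes l p P" "realizes l q Q"
  shows "realizes l (\<lambda>z. p z - q z) (P - Q)"
  using realizes_add[OF assms(1) realizes_cmult[OF assms(2), of "- 1"]] by simp

text \<open>A normal form with numbered summands, from which one summand can be chosen in every
  row.\<close>

lemma realizes_sum:
  "realizes l p P \<Longrightarrow> \<exists>(N :: nat) (c :: nat \<Rightarrow> real) \<phi>. (\<forall>j. \<phi> j \<in> test_functions) \<and>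
     p = (\<lambda>z. \<Sum>j<N. c j * (\<Prod>r\<in>{1..l}. \<phi> j (point z r))) \<and> P = (\<Sum>j<N. c j *\<^sub>R T l (\<lambda>_. \<iota> (\<phi> j)))"
proof (induction rule: realizes.induct)
  case (realizes_base \<phi>)
  then show ?case by (intro exI[of _ 1] exI[of _ "\<lambda>_. 1"] exI[of _ "\<lambda>_. \<phi>"]) simp
next
  case realizes_zero
  then show ?case by (intro exI[of _ 0] exI[of _ "\<lambda>_. 1"] exI[of _ "\<lambda>_ _. 0"]) (simp add: test_functions_zero)
next
  case (realizes_add p P q Q)
  from realizes_add.IH(1) obtain N :: nat and c \<phi> where p: "\<forall>j. \<phi> j \<in> test_functions"
    "p = (\<lambda>z. \<Sum>j<N. c j * (\<Prod>r\<in>{1..l}. \<phi> j (point z r)))" "P = (\<Sum>j<N. c j *\<^sub>R T l (\<lambda>_. \<iota> (\<phi> j)))" by blast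
  from realizes_add.IH(2) obtain N' :: nat and c' \<phi>' where q: "\<forall>j. \<phi>' j \<in> test_functions"
    "q = (\<lambda>z. \<Sum>j<N'. c' j * (\<Prod>r\<in>{1..l}. \<phi>' j (point z r)))" "Q = (\<Sum>j<N'. c' j *\<^sub>R T l (\<lambda>_. \<iota> (\<phi>' j)))" by blast
  show ?case
    by (intro exI[of _ "N + N'"] exI[of _ "\<lambda>j. if j < N then c j else c' (j - N)"] exI[of _ "\<lambda>j. if j < N then \<phi> j else \<phi>' (j - N)"])
      (simp add: p q sum_lessThan_add)
next
  case (realizes_cmult p P c)
  then obtain N :: nat and d \<phi> where p: "\<forall>j. \<phi> j \<in> test_functions"
    "p = (\<lambda>z. \<Sum>j<N. d j * (\<Prod>r\<in>{1..l}. \<phi> j (point z r)))" "P = (\<Sum>j<N. d j *\<^sub>R T l (\<lambda>_. \<iota> (\<phi> j)))" by blast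
  show ?case
    by (intro exI[of _ N] exI[of _ "\<lambda>j. c * d j"] exI[of _ \<phi>]) (simp add: p sum_distrib_left scaleR_sum_right mult.assoc)
qed

lemma two_rows_integrable:
  assumes "f \<in> finite_norm l" "g \<in> finite_norm l"
  shows "integrable (straight l) (\<lambda>z. f (row1 l z) * g (row2 l z))"
proof -
  have "integrable (straight l) (\<lambda>z. \<Prod>k\<in>{1..2}. (if k = 1 then f else g) (row (\<lambda>_. l) k z))"
    using assms by (intro diagram_integrable_finite_norm[OF straight_diagram_in]) simp
  then show ?thesis unfolding prod_two by simp
qed

lemma tensors_inner:
  assumes \<phi>: "\<And>i. \<phi> i \<in> test_functions" and \<psi>: "\<And>i. \<psi> i \<in> test_functions"
  shows "T l (\<lambda>i. \<iota> (\<phi> i)) \<bullet> T l (\<lambda>i. \<iota> (\<psi> i)) =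
    (\<integral>z. (\<Prod>r\<in>{1..l}. \<phi> r (point (row1 l z) r)) * (\<Prod>r\<in>{1..l}. \<psi> r (point (row2 l z) r)) \<partial>straight l)"
proof -
  let ?\<theta> = "\<lambda>v. if fst v = 1 then \<phi> (snd v) else \<psi> (snd v)"
  have row: "point (row (\<lambda>_. l) k z) r = point z (k, r)" if "r \<in> {1..l}" for k r z using that by (simp add: point_def row_def)
  have "(\<integral>z. (\<Prod>v\<in>vertices 2 (\<lambda>_. l). ?\<theta> v (point z v)) \<partial>straight l) = (\<Prod>(a, b)\<in>straight_diagram l. \<iota> (?\<theta> a) \<bullet> \<iota> (?\<theta> b))"
    using \<phi> \<psi> by (intro integral_test_product(2) pairing_diagram straight_diagram_in) simp
  also have "\<dots> = (\<Prod>i\<in>{1..l}. \<iota> (\<phi> i) \<bullet> \<iota> (\<psi> i))"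
    unfolding straight_diagram_def by (subst prod.reindex) (simp_all add: inj_on_def)
  also have "(\<lambda>z. \<Prod>v\<in>vertices 2 (\<lambda>_. l). ?\<theta> v (point z v)) =
    (\<lambda>z. (\<Prod>r\<in>{1..l}. \<phi> r (point (row1 l z) r)) * (\<Prod>r\<in>{1..l}. \<psi> r (point (row2 l z) r)))"
    unfolding prod_vertices_two by (simp add: row fun_eq_iff cong: prod.cong_simp)
  finally show ?thesis by (simp add: T_inner)
qed

lemma realizes_inner_tensor:
  assumes "realizes l p P" and \<psi>: "\<And>i. \<psi> i \<in> test_functions"
  shows "P \<bullet> T l (\<lambda>i. \<iota> (\<psi> i)) = (\<integral>z. p (row1 l z) * (\<Prod>r\<in>{1..l}. \<psi> r (point (row2 l z) r)) \<partial>straight l)"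
  using assms(1)
proof (induction rule: realizes.induct)
  case (realizes_base \<phi>)
  then show ?case by (intro tensors_inner[of "\<lambda>_. \<phi>"] \<psi>)
next
  case (realizes_add p P q Q)
  note int = two_rows_integrable[OF realizes_finite_norm tensor_finite_norm[OF \<psi>]]
  show ?case using int[OF realizes_add.hyps(1)] int[OF realizes_add.hyps(2)] realizes_add.IH
    by (simp add: inner_add_left distrib_right del: One_nat_def)
next
  case (realizes_cmult p P c)
  then show ?case by (simp add: mult.assoc del: One_nat_def)
qed simp

lemma realizes_inner:
  assumes P: "realizes l p P" and "realizes l q Q"
  shows "P \<bullet> Q = (\<integral>z. p (row1 l z) * q (row2 l z) \<partial>straight l)"
  using assms(2)
proof (induction rule: realizes.induct)
  case (realizes_base \<phi>)
  then show ?case by (intro realizes_inner_tensor[OF P, of "\<lambda>_. \<phi>"])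
next
  case (realizes_add q Q q' Q')
  note int = two_rows_integrable[OF realizes_finite_norm[OF P] realizes_finite_norm]
  show ?case using int[OF realizes_add.hyps(1)] int[OF realizes_add.hyps(2)] realizes_add.IH
    by (simp add: inner_add_right distrib_left del: One_nat_def)
next
  case (realizes_cmult q Q c)
  then show ?case by (simp add: mult.left_commute del: One_nat_def)
qed simp

text \<open>The squared Hilbert norm is an integral along the straight diagram, and taking absolute
  values inside can only increase it. Convergence of functions thus passes to their tensors.\<close>

lemma realizes_norm:
  assumes P: "realizes l p P"
  shows "ennreal ((norm P)\<^sup>2) \<le> sqn l p"
proof -
  let ?g = "\<lambda>z. p (row1 l z) * p (row2 l z)"
  have "(norm P)\<^sup>2 = (\<integral>z. ?g z \<partial>straight l)" by (simp only: power2_norm_eq_inner realizes_inner[OF P P])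
  also have "\<dots> \<le> norm (\<integral>z. ?g z \<partial>straight l)" by simp
  finally have "ennreal ((norm P)\<^sup>2) \<le> ennreal (norm (\<integral>z. ?g z \<partial>straight l))" by (rule ennreal_leI)
  also have "\<dots> \<le> (\<integral>\<^sup>+z. ennreal (norm (?g z)) \<partial>straight l)"
    by (intro integral_norm_bound_ennreal two_rows_integrable realizes_finite_norm[OF P])
  also have "\<dots> = sqn l p" unfolding sqn_def sq_norm_def by (simp add: abs_mult ennreal_mult)
  finally show ?thesis .
qed

text \<open>The expectation and the diagram integrals are both multilinear. For every choice of one
  tensor power in each row they reduce to the same sum of products of inner products over
  edges.\<close>

lemma expectation_powers:
  assumes n: "\<And>k. k \<in> {1..m} \<Longrightarrow> 1 \<le> n k" and P: "\<And>k. k \<in> {1..m} \<Longrightarrow> realizes (n k) (p k) (P k)"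
  shows "(\<lambda>\<omega>. \<Prod>k\<in>{1..m}. J (n k) (P k) \<omega>) \<in> moments"
    and "(\<integral>\<omega>. (\<Prod>k\<in>{1..m}. J (n k) (P k) \<omega>) \<partial>M) =
      (\<Sum>D\<in>diagrams m n. \<integral>z. (\<Prod>k\<in>{1..m}. p k (row n k z)) \<partial>\<nu> (vertices m n) D)"
proof -
  let ?K = "{1..m}"
  have "\<forall>k\<in>?K. \<exists>(N :: nat) (c :: nat \<Rightarrow> real) \<phi>. (\<forall>j. \<phi> j \<in> test_functions) \<and>
     p k = (\<lambda>z. \<Sum>j<N. c j * (\<Prod>r\<in>{1..n k}. \<phi> j (point z r))) \<and> P k = (\<Sum>j<N. c j *\<^sub>R T (n k) (\<lambda>_. \<iota> (\<phi> j)))"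
    by (intro ballI realizes_sum P)
  from bchoice[OF this] obtain N :: "nat \<Rightarrow> nat" where "\<forall>k\<in>?K. \<exists>(c :: nat \<Rightarrow> real) \<phi>. (\<forall>j. \<phi> j \<in> test_functions) \<and>
     p k = (\<lambda>z. \<Sum>j<N k. c j * (\<Prod>r\<in>{1..n k}. \<phi> j (point z r))) \<and> P k = (\<Sum>j<N k. c j *\<^sub>R T (n k) (\<lambda>_. \<iota> (\<phi> j)))" ..
  from bchoice[OF this] obtain c :: "nat \<Rightarrow> nat \<Rightarrow> real" where "\<forall>k\<in>?K. \<exists>\<phi>. (\<forall>j. \<phi> j \<in> test_functions) \<and>
     p k = (\<lambda>z. \<Sum>j<N k. c k j * (\<Prod>r\<in>{1..n k}. \<phi> j (point z r))) \<and> P k = (\<Sum>j<N k. c k j *\<^sub>R T (n k) (\<lambda>_. \<iota> (\<phi> j)))" ..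
  from bchoice[OF this] obtain \<phi> where \<phi>: "\<forall>k\<in>?K. (\<forall>j. \<phi> k j \<in> test_functions) \<and>
     p k = (\<lambda>z. \<Sum>j<N k. c k j * (\<Prod>r\<in>{1..n k}. \<phi> k j (point z r))) \<and> P k = (\<Sum>j<N k. c k j *\<^sub>R T (n k) (\<lambda>_. \<iota> (\<phi> k j)))" ..
  have test: "\<phi> k j \<in> test_functions" if "k \<in> ?K" for k j using bspec[OF \<phi> that] by (elim conjE) (erule spec)
  have pk: "p k = (\<lambda>z. \<Sum>j<N k. c k j * (\<Prod>r\<in>{1..n k}. \<phi> k j (point z r)))" if "k \<in> ?K" for k
    using bspec[OF \<phi> that] by (elim conjE)
  have Pk: "P k = (\<Sum>j<N k. c k j *\<^sub>R T (n k) (\<lambda>_. \<iota> (\<phi> k j)))" if "k \<in> ?K" for k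
    using bspec[OF \<phi> that] by (elim conjE)
  note E = expectation_combinations[where N=N and c=c and h="\<lambda>k j. \<iota> (\<phi> k j)", OF n Pk]
  show "(\<lambda>\<omega>. \<Prod>k\<in>?K. J (n k) (P k) \<omega>) \<in> moments" by (rule E(1))
  let ?S = "PiE ?K (\<lambda>k. {..<N k})" and ?V = "vertices m n"
  have "(\<integral>z. (\<Prod>k\<in>?K. p k (row n k z)) \<partial>\<nu> ?V D) =
    (\<Sum>s\<in>?S. (\<Prod>k\<in>?K. c k (s k)) * (\<Prod>(a, b)\<in>D. \<iota> (\<phi> (fst a) (s (fst a))) \<bullet> \<iota> (\<phi> (fst b) (s (fst b)))))"
    if D: "D \<in> diagrams m n" for D
  proof -
    have expand: "(\<Prod>k\<in>?K. p k (row n k z)) = (\<Sum>s\<in>?S. (\<Prod>k\<in>?K. c k (s k)) * (\<Prod>v\<in>?V. \<phi> (fst v) (s (fst v)) (point z v)))" for z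
    proof -
      have "(\<Prod>k\<in>?K. p k (row n k z)) = (\<Prod>k\<in>?K. \<Sum>j<N k. c k j * (\<Prod>r\<in>{1..n k}. \<phi> k j (point z (k, r))))"
        by (intro prod.cong refl) (simp add: pk point_def row_def)
      also have "\<dots> = (\<Sum>s\<in>?S. \<Prod>k\<in>?K. c k (s k) * (\<Prod>r\<in>{1..n k}. \<phi> k (s k) (point z (k, r))))"
        by (intro prod_sum_PiE) simp_all
      also have "\<dots> = (\<Sum>s\<in>?S. (\<Prod>k\<in>?K. c k (s k)) * (\<Prod>v\<in>?V. \<phi> (fst v) (s (fst v)) (point z v)))"
        unfolding vertices_def prod.distrib by (subst prod.Sigma) (simp_all add: split_def)
      finally show ?thesis .
    qed
    have tv: "\<phi> (fst v) (s (fst v)) \<in> test_functions" if "v \<in> ?V" for v and s :: "nat \<Rightarrow> nat"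
      using that by (intro test) (auto simp: vertices_def)
    have I1: "integrable (\<nu> ?V D) (\<lambda>z. \<Prod>v\<in>?V. \<phi> (fst v) (s (fst v)) (point z v))" for s :: "nat \<Rightarrow> nat"
      by (rule integral_test_product(1)[OF pairing_diagram[OF D] tv])
    have I2: "(\<integral>z. (\<Prod>v\<in>?V. \<phi> (fst v) (s (fst v)) (point z v)) \<partial>\<nu> ?V D) =
      (\<Prod>(a, b)\<in>D. \<iota> (\<phi> (fst a) (s (fst a))) \<bullet> \<iota> (\<phi> (fst b) (s (fst b))))" for s :: "nat \<Rightarrow> nat"
      by (rule integral_test_product(2)[OF pairing_diagram[OF D] tv])
    have "(\<integral>z. (\<Prod>k\<in>?K. p k (row n k z)) \<partial>\<nu> ?V D) =
      (\<Sum>s\<in>?S. \<integral>z. (\<Prod>k\<in>?K. c k (s k)) * (\<Prod>v\<in>?V. \<phi> (fst v) (s (fst v)) (point z v)) \<partial>\<nu> ?V D)"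
      unfolding expand by (intro Bochner_Integration.integral_sum integrable_mult_right I1)
    then show ?thesis by (simp only: integral_mult_right_zero I2)
  qed
  then have "(\<Sum>D\<in>diagrams m n. \<integral>z. (\<Prod>k\<in>?K. p k (row n k z)) \<partial>\<nu> ?V D) =
    (\<Sum>D\<in>diagrams m n. \<Sum>s\<in>?S. (\<Prod>k\<in>?K. c k (s k)) * (\<Prod>(a, b)\<in>D. \<iota> (\<phi> (fst a) (s (fst a))) \<bullet> \<iota> (\<phi> (fst b) (s (fst b)))))"
    by (rule sum.cong[OF refl])
  also have "\<dots> = (\<Sum>s\<in>?S. (\<Prod>k\<in>?K. c k (s k)) * (\<Sum>D\<in>diagrams m n. \<Prod>(a, b)\<in>D. \<iota> (\<phi> (fst a) (s (fst a))) \<bullet> \<iota> (\<phi> (fst b) (s (fst b)))))"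
    by (subst sum.swap) (simp only: sum_distrib_left)
  finally show "(\<integral>\<omega>. (\<Prod>k\<in>?K. J (n k) (P k) \<omega>) \<partial>M) =
      (\<Sum>D\<in>diagrams m n. \<integral>z. (\<Prod>k\<in>?K. p k (row n k z)) \<partial>\<nu> ?V D)"
    by (simp only: E(2))
qed

text \<open>The squared norm of the difference expands into three products of inner products, each
  tending to the squared norm of the limit.\<close>

lemma T_tendsto_inner:
  assumes "\<And>i. (\<lambda>j. u j i) \<longlonglongrightarrow> u' i"
  shows "(\<lambda>j. T l (u j)) \<longlonglongrightarrow> T l u'"
proof -
  let ?U = "(\<Prod>i\<in>{1..l}. u' i \<bullet> u' i)"
  have "(\<lambda>j. (\<Prod>i\<in>{1..l}. u j i \<bullet> u j i) - 2 * (\<Prod>i\<in>{1..l}. u j i \<bullet> u' i) + ?U) \<longlonglongrightarrow>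
    ?U - 2 * ?U + ?U"
    by (intro tendsto_intros assms)
  moreover have "(\<Prod>i\<in>{1..l}. u j i \<bullet> u j i) - 2 * (\<Prod>i\<in>{1..l}. u j i \<bullet> u' i) + ?U = (norm (T l (u j) - T l u'))\<^sup>2" for j
    unfolding power2_norm_eq_inner inner_diff_left inner_diff_right inner_commute[of "T l u'" "T l (u j)"] by (simp add: T_inner)
  ultimately have "(\<lambda>j. (norm (T l (u j) - T l u'))\<^sup>2) \<longlonglongrightarrow> 0" by simp
  then have "(\<lambda>j. sqrt ((norm (T l (u j) - T l u'))\<^sup>2)) \<longlonglongrightarrow> sqrt 0" by (rule tendsto_real_sqrt)
  then show ?thesis by (simp add: tendsto_norm_zero_iff LIM_zero_cancel)
qed

text \<open>Test functions are dense in the Hilbert space, elementary tensors depend continuously on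
  their factors, and their span is dense. So an element is determined by its inner products with
  products of test functions.\<close>

lemma tensor_space_orthogonal:
  assumes F: "F \<in> tensor_space T l" and orth: "\<And>\<phi>. (\<And>i. \<phi> i \<in> test_functions) \<Longrightarrow> F \<bullet> T l (\<lambda>i. \<iota> (\<phi> i)) = 0"
  shows "F = 0"
proof -
  have 1: "F \<bullet> T l u = 0" for u
  proof -
    have "\<forall>i. \<exists>x. (\<forall>j. x j \<in> \<iota> ` test_functions) \<and> x \<longlonglongrightarrow> u i"
      using noise_space closure_sequential[of _ "\<iota> ` test_functions"] unfolding is_noise_space_def by blast
    from choice[OF this] obtain x where x: "\<forall>i. (\<forall>j. x i j \<in> \<iota> ` test_functions) \<and> x i \<longlonglongrightarrow> u i" ..
    have "F \<bullet> T l (\<lambda>i. x i j) = 0" for j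
    proof -
      have "\<forall>i. \<exists>\<phi>. \<phi> \<in> test_functions \<and> x i j = \<iota> \<phi>" using x by blast
      from choice[OF this] obtain \<phi> where "\<forall>i. \<phi> i \<in> test_functions \<and> x i j = \<iota> (\<phi> i)" ..
      then show ?thesis using orth[of \<phi>] by simp
    qed
    moreover have "(\<lambda>j. F \<bullet> T l (\<lambda>i. x i j)) \<longlonglongrightarrow> F \<bullet> T l u"
      using x by (intro tendsto_inner tendsto_const T_tendsto_inner) blast
    ultimately show ?thesis using LIMSEQ_unique[OF _ tendsto_const] by fastforce
  qed
  have "subspace {G. F \<bullet> G = 0}" by (rule subspaceI) (simp_all add: inner_add_right)
  then have "span (range (T l)) \<subseteq> {G. F \<bullet> G = 0}" using 1 by (intro span_minimal) auto
  moreover have "closed {G. F \<bullet> G = 0}" by (rule closed_Collect_eq) (intro continuous_intros)+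
  ultimately have "tensor_space T l \<subseteq> {G. F \<bullet> G = 0}" unfolding tensor_space_def by (rule closure_minimal)
  then have "F \<bullet> F = 0" using F by blast
  then show ?thesis by simp
qed

end

section \<open>Passage to the limit\<close>

context chaos_setting
begin

text \<open>Density provides the functions, and their tensors form a Cauchy sequence because the
  Hilbert norm is bounded by the norm of the absolute value. The limit has the same inner products
  as \<open>F\<close> with products of test functions, hence equals \<open>F\<close>.\<close>

lemma approximation:
  assumes f: "f \<in> finite_norm l"
    and sym: "\<And>\<sigma> z. \<sigma> permutes {1..l} \<Longrightarrow> z \<in> \<Omega> l \<Longrightarrow> f (permute l \<sigma> z) = f z"
    and F: "F \<in> tensor_space T l"
    and Ff: "\<And>\<phi>. (\<And>i. \<phi> i \<in> test_functions) \<Longrightarrow>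
      F \<bullet> T l (\<lambda>i. \<iota> (\<phi> i)) = (\<integral>z. f (row1 l z) * (\<Prod>r\<in>{1..l}. \<phi> r (point (row2 l z) r)) \<partial>straight l)"
  shows "\<exists>p P. (\<forall>j. realizes l (p j) (P j)) \<and> norm_conv l p f \<and> P \<longlonglongrightarrow> F"
proof -
  from dense_tensor_powers[OF f sym] obtain p where p: "\<forall>j. p j \<in> tensor_powers l" and conv: "norm_conv l p f" by blast
  have "\<forall>j. \<exists>P. realizes l (p j) P" using p tensor_powers_realized by blast
  from choice[OF this] obtain P where P: "\<forall>j. realizes l (p j) (P j)" ..
  obtain c where c: "c < \<top>" "\<And>g h. g \<in> \<F> l \<Longrightarrow> h \<in> \<F> l \<Longrightarrow>
    sqn l (\<lambda>z. g z + h z) \<le> c * (sqn l g + sqn l h)" using sqn_add_bound[of l] by blast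
  define a where "a j = sqn l (\<lambda>z. p j z - f z)" for j
  have "(\<lambda>j. c * a j) \<longlonglongrightarrow> 0"
    by (rule ennreal_tendsto_zero_bound[of _ c a]) (use c(1) norm_convD(3)[OF conv] in \<open>simp_all add: a_def[abs_def]\<close>)
  then have small: "eventually (\<lambda>j. c * a j < ennreal e) sequentially" if "0 < e" for e
    using that by (intro order_tendstoD(2)[of _ 0]) simp_all
  have le: "ennreal ((norm (P i - P j))\<^sup>2) \<le> c * a i + c * a j" for i j
  proof -
    have "ennreal ((norm (P i - P j))\<^sup>2) \<le> sqn l (\<lambda>z. p i z - p j z)"
      using P by (intro realizes_norm realizes_diff) blast+
    also have "\<dots> = sqn l (\<lambda>z. (p i z - f z) + (f z - p j z))" by simp
    also have "\<dots> \<le> c * (sqn l (\<lambda>z. p i z - f z) + sqn l (\<lambda>z. f z - p j z))"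
      by (rule c(2)) (intro borel_measurable_diff finite_norm_measurable f norm_convD(1)[OF conv])+
    also have "sqn l (\<lambda>z. f z - p j z) = a j" unfolding sqn_def a_def by (simp only: abs_minus_commute)
    finally show ?thesis by (simp add: a_def distrib_left)
  qed
  have "Cauchy P"
  proof (rule metric_CauchyI)
    fix e :: real assume e: "0 < e"
    then have "0 < e\<^sup>2 / 2" by simp
    from small[OF this] obtain N where N: "\<And>j. N \<le> j \<Longrightarrow> c * a j < ennreal (e\<^sup>2 / 2)" unfolding eventually_sequentially by blast
    have "dist (P i) (P j) < e" if "N \<le> i" "N \<le> j" for i j
    proof -
      have "c * a i + c * a j < ennreal (e\<^sup>2 / 2) + ennreal (e\<^sup>2 / 2)" by (intro add_strict_mono N that)
      also have "\<dots> = ennreal (e\<^sup>2)" by (simp add: ennreal_plus[symmetric] del: ennreal_plus)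
      finally have "ennreal ((norm (P i - P j))\<^sup>2) < ennreal (e\<^sup>2)" using le[of i j] by (rule order.strict_trans1[rotated])
      then have "(norm (P i - P j))\<^sup>2 < e\<^sup>2" by (simp add: ennreal_less_iff)
      then show ?thesis using e by (simp add: dist_norm power2_less_imp_less)
    qed
    then show "\<exists>N. \<forall>i\<ge>N. \<forall>j\<ge>N. dist (P i) (P j) < e" by blast
  qed
  then obtain G where G: "P \<longlonglongrightarrow> G" using Cauchy_convergent_iff unfolding convergent_def by blast
  have Gs: "G \<in> symmetric_tensors T l" using P by (intro symmetric_tensors_closed[OF _ G] realizes_symmetric) blast
  have "F - G = 0"
  proof (rule tensor_space_orthogonal)
    show "F - G \<in> tensor_space T l" using F Gs by (intro subspace_diff[OF tensor_space_subspace]) (simp_all add: symmetric_tensors_def)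
    fix \<phi> :: "nat \<Rightarrow> real \<times> (real ^ 'd) \<Rightarrow> real" assume \<phi>: "\<And>i. \<phi> i \<in> test_functions"
    let ?t = "\<lambda>z. \<Prod>r\<in>{1..l}. \<phi> r (point z r)"
    have "(\<lambda>j. \<integral>z. (\<Prod>k\<in>{1..2}. (if k = 1 then p j else ?t) (row (\<lambda>_. l) k z)) \<partial>straight l) \<longlonglongrightarrow>
      (\<integral>z. (\<Prod>k\<in>{1..2}. (if k = 1 then f else ?t) (row (\<lambda>_. l) k z)) \<partial>straight l)"
      using diagram_integral_tendsto[OF straight_diagram_in, of l "\<lambda>k j. if k = 1 then p j else ?t" "\<lambda>k. if k = 1 then f else ?t"]
        conv norm_conv_const[OF tensor_finite_norm[where \<phi>=\<phi>, OF \<phi>]] by simp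
    then have "(\<lambda>j. P j \<bullet> T l (\<lambda>i. \<iota> (\<phi> i))) \<longlonglongrightarrow> F \<bullet> T l (\<lambda>i. \<iota> (\<phi> i))"
      unfolding prod_two Ff[of \<phi>, OF \<phi>] realizes_inner_tensor[OF P[rule_format], of \<phi>, OF \<phi>] by simp
    moreover have "(\<lambda>j. P j \<bullet> T l (\<lambda>i. \<iota> (\<phi> i))) \<longlonglongrightarrow> G \<bullet> T l (\<lambda>i. \<iota> (\<phi> i))" by (intro tendsto_inner G tendsto_const)
    ultimately have "F \<bullet> T l (\<lambda>i. \<iota> (\<phi> i)) = G \<bullet> T l (\<lambda>i. \<iota> (\<phi> i))" by (rule LIMSEQ_unique)
    then show "(F - G) \<bullet> T l (\<lambda>i. \<iota> (\<phi> i)) = 0" by (simp add: inner_diff_left)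
  qed
  then show ?thesis using P conv G by (intro exI[of _ p] exI[of _ P]) simp
qed

text \<open>Linearity of the multiple integral holds almost surely, so the isometry for
  \<open>P j - F\<close> is transferred along an almost sure equality.\<close>

lemma J_tendsto:
  assumes l: "1 \<le> l" and P: "\<And>j. P j \<in> symmetric_tensors T l" and F: "F \<in> symmetric_tensors T l" and lim: "P \<longlonglongrightarrow> F"
  shows "integrable M (\<lambda>\<omega>. (J l (P j) \<omega> - J l F \<omega>)\<^sup>2)" "(\<lambda>j. \<integral>\<omega>. (J l (P j) \<omega> - J l F \<omega>)\<^sup>2 \<partial>M) \<longlonglongrightarrow> 0"
proof -
  have D: "P j - F \<in> symmetric_tensors T l" for j
    using symmetric_tensors_add[OF P symmetric_tensors_scaleR[OF F, of "- 1"]] by simp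
  have ae: "AE \<omega> in M. (J l (P j - F) \<omega>)\<^sup>2 = (J l (P j) \<omega> - J l F \<omega>)\<^sup>2" for j
    using J_linear[OF l P F, of 1 j "- 1"] by eventually_elim simp
  have m: "(\<lambda>\<omega>. (J l (P j) \<omega> - J l F \<omega>)\<^sup>2) \<in> borel_measurable M" "(\<lambda>\<omega>. (J l (P j - F) \<omega>)\<^sup>2) \<in> borel_measurable M" for j
    by (intro borel_measurable_power borel_measurable_diff J_measurable l P F D)+
  show "integrable M (\<lambda>\<omega>. (J l (P j) \<omega> - J l F \<omega>)\<^sup>2)"
    using J_square_integrable[OF l D] integrable_cong_AE[OF m(2) m(1) ae] by blast
  have "(\<integral>\<omega>. (J l (P j) \<omega> - J l F \<omega>)\<^sup>2 \<partial>M) = fact l * (norm (P j - F))\<^sup>2" for j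
    using integral_cong_AE[OF m(2) m(1) ae] J_isometry[OF l D] by simp
  moreover have "(\<lambda>j. fact l * (norm (P j - F))\<^sup>2) \<longlonglongrightarrow> fact l * (norm (F - F))\<^sup>2"
    by (intro tendsto_intros lim)
  ultimately show "(\<lambda>j. \<integral>\<omega>. (J l (P j) \<omega> - J l F \<omega>)\<^sup>2 \<partial>M) \<longlonglongrightarrow> 0" by simp
qed

text \<open>Each factor converges in L2, which does not suffice for a product of several factors.
  Along a subsequence all factors converge almost surely, and the bound on the second moments of the
  products gives convergence of their expectations.\<close>

theorem expectation_multiple_integrals:
  assumes n: "\<And>k. k \<in> {1..m} \<Longrightarrow> 1 \<le> n k"
    and f: "\<And>k. k \<in> {1..m} \<Longrightarrow> f k \<in> finite_norm (n k)"
    and sym: "\<And>k \<sigma> z. k \<in> {1..m} \<Longrightarrow> \<sigma> permutes {1..n k} \<Longrightarrow> z \<in> \<Omega> (n k) \<Longrightarrow> f k (permute (n k) \<sigma> z) = f k z"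
    and F: "\<And>k. k \<in> {1..m} \<Longrightarrow> F k \<in> tensor_space T (n k)"
    and Ff: "\<And>k \<phi>. k \<in> {1..m} \<Longrightarrow> (\<And>i. \<phi> i \<in> test_functions) \<Longrightarrow>
      F k \<bullet> T (n k) (\<lambda>i. \<iota> (\<phi> i)) = (\<integral>z. f k (row1 (n k) z) * (\<Prod>r\<in>{1..n k}. \<phi> r (point (row2 (n k) z) r)) \<partial>straight (n k))"
  shows "integrable M (\<lambda>\<omega>. \<Prod>k\<in>{1..m}. J (n k) (F k) \<omega>)"
    and "(\<integral>\<omega>. (\<Prod>k\<in>{1..m}. J (n k) (F k) \<omega>) \<partial>M) =
      (\<Sum>D\<in>diagrams m n. \<integral>z. (\<Prod>k\<in>{1..m}. f k (row n k z)) \<partial>\<nu> (vertices m n) D)"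
proof -
  let ?K = "{1..m}"
  let ?R = "(\<Sum>D\<in>diagrams m n. \<integral>z. (\<Prod>k\<in>?K. f k (row n k z)) \<partial>\<nu> (vertices m n) D)"
  have "\<forall>k\<in>?K. \<exists>p P. (\<forall>j. realizes (n k) (p j) (P j)) \<and> norm_conv (n k) p (f k) \<and> P \<longlonglongrightarrow> F k"
    by (intro ballI approximation f sym F Ff)
  from bchoice[OF this] obtain p where "\<forall>k\<in>?K. \<exists>P. (\<forall>j. realizes (n k) (p k j) (P j)) \<and> norm_conv (n k) (p k) (f k) \<and> P \<longlonglongrightarrow> F k" ..
  from bchoice[OF this] obtain P where pP: "\<forall>k\<in>?K. (\<forall>j. realizes (n k) (p k j) (P k j)) \<and> norm_conv (n k) (p k) (f k) \<and> P k \<longlonglongrightarrow> F k" ..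
  have P: "realizes (n k) (p k j) (P k j)" and conv: "norm_conv (n k) (p k) (f k)" and lim: "P k \<longlonglongrightarrow> F k" if "k \<in> ?K" for k j
    using bspec[OF pP that] by blast+
  have Ps: "P k j \<in> symmetric_tensors T (n k)" if "k \<in> ?K" for k j by (rule realizes_symmetric[OF P[OF that]])
  have Fs: "F k \<in> symmetric_tensors T (n k)" if "k \<in> ?K" for k by (rule symmetric_tensors_closed[OF Ps lim]) (rule that)+
  define Z where "Z j \<omega> = (\<Prod>k\<in>?K. J (n k) (P k j) \<omega>)" for j \<omega>
  let ?X = "\<lambda>\<omega>. \<Prod>k\<in>?K. J (n k) (F k) \<omega>"
  have Zm: "Z j \<in> moments" for j unfolding Z_def[abs_def] by (rule expectation_powers(1)[OF n P])
  have EZ: "(\<integral>\<omega>. Z j \<omega> \<partial>M) = (\<Sum>D\<in>diagrams m n. \<integral>z. (\<Prod>k\<in>?K. p k j (row n k z)) \<partial>\<nu> (vertices m n) D)" for j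
    unfolding Z_def by (rule expectation_powers(2)[OF n P])
  have EZlim: "(\<lambda>j. \<integral>\<omega>. Z j \<omega> \<partial>M) \<longlonglongrightarrow> ?R"
    unfolding EZ by (intro tendsto_sum diagram_integral_tendsto conv)
  have Xm: "?X \<in> borel_measurable M" by (intro borel_measurable_prod J_measurable n Fs)
  \<comment> \<open>The second moment of a product is a sum over diagrams with every row doubled, so it converges too.\<close>
  define \<kappa> where "\<kappa> k = (if k \<le> m then k else k - m)" for k
  have double: "(\<Prod>k\<in>{1..m + m}. g (\<kappa> k)) = (\<Prod>k\<in>?K. g k)\<^sup>2" for g :: "nat \<Rightarrow> real"
  proof -
    have "(\<Prod>k\<in>{1..m + m}. g (\<kappa> k)) = (\<Prod>k\<in>{1..m}. g (\<kappa> k)) * (\<Prod>k\<in>{m + 1..m + m}. g (\<kappa> k))"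
      by (rule prod.ub_add_nat) simp
    also have "(\<Prod>k\<in>{m + 1..m + m}. g (\<kappa> k)) = (\<Prod>k\<in>{1..m}. g (\<kappa> (k + m)))"
      using prod.shift_bounds_cl_nat_ivl[of "\<lambda>k. g (\<kappa> k)" 1 m m] by (simp add: add.commute)
    also have "\<dots> = (\<Prod>k\<in>?K. g k)" by (intro prod.cong) (simp_all add: \<kappa>_def)
    also have "(\<Prod>k\<in>{1..m}. g (\<kappa> k)) = (\<Prod>k\<in>?K. g k)" by (intro prod.cong) (simp_all add: \<kappa>_def)
    finally show ?thesis by (simp add: power2_eq_square)
  qed
  have \<kappa>: "\<kappa> k \<in> ?K" if "k \<in> {1..m + m}" for k using that by (auto simp: \<kappa>_def)
  have Z2: "(Z j \<omega>)\<^sup>2 = (\<Prod>k\<in>{1..m + m}. J (n (\<kappa> k)) (P (\<kappa> k) j) \<omega>)" for j \<omega>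
    unfolding Z_def by (rule double[symmetric])
  have "(\<lambda>j. \<integral>\<omega>. (Z j \<omega>)\<^sup>2 \<partial>M) \<longlonglongrightarrow> (\<Sum>D\<in>diagrams (m + m) (\<lambda>k. n (\<kappa> k)). \<integral>z. (\<Prod>k\<in>{1..m + m}. f (\<kappa> k) (row (\<lambda>k. n (\<kappa> k)) k z)) \<partial>\<nu> (vertices (m + m) (\<lambda>k. n (\<kappa> k))) D)"
  proof -
    have "(\<integral>\<omega>. (Z j \<omega>)\<^sup>2 \<partial>M) = (\<Sum>D\<in>diagrams (m + m) (\<lambda>k. n (\<kappa> k)). \<integral>z. (\<Prod>k\<in>{1..m + m}. p (\<kappa> k) j (row (\<lambda>k. n (\<kappa> k)) k z)) \<partial>\<nu> (vertices (m + m) (\<lambda>k. n (\<kappa> k))) D)" for j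
      unfolding Z2 by (rule expectation_powers(2)[where n="\<lambda>k. n (\<kappa> k)"]) (intro n P \<kappa>; assumption)+
    then show ?thesis by (simp only:) (intro tendsto_sum diagram_integral_tendsto conv \<kappa>)
  qed
  \<comment> \<open>Of the convergence of the second moments, the boundedness is what is used
    below.\<close>
  then have "Bseq (\<lambda>j. \<integral>\<omega>. (Z j \<omega>)\<^sup>2 \<partial>M)" by (intro convergent_imp_Bseq convergentI)
  then obtain B where B: "\<And>j. norm (\<integral>\<omega>. (Z j \<omega>)\<^sup>2 \<partial>M) \<le> B" unfolding Bseq_def by blast
  have Z2B: "(\<integral>\<omega>. (Z j \<omega>)\<^sup>2 \<partial>M) \<le> B" for j using B[of j] by simp
  let ?d = "\<lambda>k j \<omega>. (J (n k) (P k j) \<omega> - J (n k) (F k) \<omega>)\<^sup>2"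
  \<comment> \<open>The sum over the factors, so that one subsequence serves all of them.\<close>
  let ?U = "\<lambda>j \<omega>. \<Sum>k\<in>?K. ?d k j \<omega>"
  have dint: "integrable M (?d k j)" and dlim: "(\<lambda>j. \<integral>\<omega>. ?d k j \<omega> \<partial>M) \<longlonglongrightarrow> 0" if "k \<in> ?K" for k j
    using J_tendsto[OF n[OF that] Ps[OF that] Fs[OF that] lim[OF that]] by blast+
  have Uint: "integrable M (?U j)" for j by (intro Bochner_Integration.integrable_sum dint)
  have "(\<lambda>j. \<Sum>k\<in>?K. \<integral>\<omega>. ?d k j \<omega> \<partial>M) \<longlonglongrightarrow> (\<Sum>k\<in>?K. 0)" by (intro tendsto_sum dlim)
  moreover have "(\<integral>\<omega>. norm (?U j \<omega>) \<partial>M) = (\<Sum>k\<in>?K. \<integral>\<omega>. ?d k j \<omega> \<partial>M)" for j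
  proof -
    have "norm (?U j \<omega>) = ?U j \<omega>" for \<omega> by (simp add: sum_nonneg)
    then show ?thesis by (simp only:) (intro Bochner_Integration.integral_sum dint)
  qed
  ultimately have "(\<lambda>j. \<integral>\<omega>. norm (?U j \<omega>) \<partial>M) \<longlonglongrightarrow> 0" by simp
  from tendsto_L1_AE_subseq[OF Uint this] obtain r where r: "strict_mono r" "AE \<omega> in M. (\<lambda>j. ?U (r j) \<omega>) \<longlonglongrightarrow> 0" by blast
  have Zlim: "AE \<omega> in M. (\<lambda>j. Z (r j) \<omega>) \<longlonglongrightarrow> ?X \<omega>"
    using r(2)
  proof eventually_elim
    case (elim \<omega>)
    show ?case unfolding Z_def
    proof (rule tendsto_prod)
      fix k assume k: "k \<in> ?K"
      have "(\<lambda>j. ?d k (r j) \<omega>) \<longlonglongrightarrow> 0"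
      proof (rule tendsto_sandwich[OF _ _ tendsto_const elim])
        show "eventually (\<lambda>j. ?d k (r j) \<omega> \<le> ?U (r j) \<omega>) sequentially"
          using k by (intro always_eventually allI member_le_sum[of k ?K "\<lambda>k. ?d k _ \<omega>"]) simp_all
      qed simp
      then have "(\<lambda>j. sqrt (?d k (r j) \<omega>)) \<longlonglongrightarrow> sqrt 0" by (rule tendsto_real_sqrt)
      then have "(\<lambda>j. J (n k) (P k (r j)) \<omega> - J (n k) (F k) \<omega>) \<longlonglongrightarrow> 0" by (simp add: tendsto_rabs_zero_iff)
      then show "(\<lambda>j. J (n k) (P k (r j)) \<omega>) \<longlonglongrightarrow> J (n k) (F k) \<omega>" by (rule LIM_zero_cancel)
    qed
  qed
  have Zsq: "integrable M (\<lambda>\<omega>. (Z j \<omega>)\<^sup>2)" for j by (intro moments_integrable moments_power Zm)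
  note lims = integral_tendsto_bounded_square[of "\<lambda>j. Z (r j)", OF moments_measurable[OF Zm] Zsq Z2B Xm Zlim]
  show "integrable M ?X" by (rule lims(1))
  have "(\<lambda>j. \<integral>\<omega>. Z (r j) \<omega> \<partial>M) \<longlonglongrightarrow> ?R"
    using LIMSEQ_subseq_LIMSEQ[OF EZlim r(1)] by (simp add: comp_def)
  from LIMSEQ_unique[OF lims(2) this]
  show "(\<integral>\<omega>. ?X \<omega> \<partial>M) = ?R" .
qed

end

section \<open>Chaos kernels\<close>

lemma ordered_kernel_cong:
  assumes n: "1 \<le> n" and eq: "\<And>r. r \<in> {1..n} \<Longrightarrow> \<tau> r = \<tau>' r" "\<And>r. r \<in> {1..n} \<Longrightarrow> \<xi> r = \<xi>' r"
  shows "ordered_kernel G I0 t x n \<tau> \<xi> = ordered_kernel G I0 t x n \<tau>' \<xi>'"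
proof -
  let ?s = "\<tau>(Suc n := t)" and ?s' = "\<tau>'(Suc n := t)" and ?y = "\<xi>(Suc n := x)" and ?y' = "\<xi>'(Suc n := x)"
  have s: "?s r = ?s' r" "?y r = ?y' r" if "r \<in> {1..Suc n}" for r
    using that eq[of r] by (auto simp: le_Suc_eq)
  have 1: "?s 1 = ?s' 1" "?y 1 = ?y' 1" using n by (intro s; simp)+
  have 2: "?s r = ?s' r" "?y r = ?y' r" "?s (Suc r) = ?s' (Suc r)" "?y (Suc r) = ?y' (Suc r)" if "r \<in> {1..n}" for r
    using that by (intro s; simp)+
  have "(\<Prod>r\<in>{1..n}. G (?s (Suc r) - ?s r) (?y (Suc r)) (?y r)) = (\<Prod>r\<in>{1..n}. G (?s' (Suc r) - ?s' r) (?y' (Suc r)) (?y' r))"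
    by (rule prod.cong[OF refl]) (simp only: 2)
  moreover have "(\<forall>r\<in>{1..n}. ?s r < ?s (Suc r)) = (\<forall>r\<in>{1..n}. ?s' r < ?s' (Suc r))"
    by (rule ball_cong[OF refl]) (simp only: 2)
  ultimately show ?thesis unfolding ordered_kernel_def Let_def by (simp only: 1)
qed

lemma ordered_kernel_not_increasing:
  assumes "r \<in> {1..<n}" "\<tau> (Suc r) \<le> \<tau> r"
  shows "ordered_kernel G I0 t x n \<tau> \<xi> = 0"
proof -
  have "\<not> (\<forall>r\<in>{1..n}. (\<tau>(Suc n := t)) r < (\<tau>(Suc n := t)) (Suc r))"
    using assms by (intro notI) (drule bspec[of _ _ r], auto)
  then show ?thesis unfolding ordered_kernel_def Let_def by (simp only: simp_thms if_False mult_zero_left mult_zero_right)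
qed

text \<open>Composing with \<sigma> merely permutes the summands of the symmetrization.\<close>

lemma chaos_kernel_compose:
  assumes "\<sigma> permutes {1..n}"
  shows "chaos_kernel G I0 t x n (\<tau> \<circ> \<sigma>) (\<xi> \<circ> \<sigma>) = chaos_kernel G I0 t x n \<tau> \<xi>"
  unfolding chaos_kernel_def
  by (subst setum_permutations_compose_left[OF assms, of "\<lambda>\<rho>. ordered_kernel G I0 t x n (\<tau> \<circ> \<rho>) (\<xi> \<circ> \<rho>)"]) (simp only: comp_assoc)

text \<open>Since \<tau> is increasing before and after composing with \<sigma>, the permutation
  itself is increasing, hence r \<le> \<sigma> r for all r; this forces the identity.\<close>

lemma increasing_permutation_id:
  fixes \<tau> :: "nat \<Rightarrow> real"
  assumes \<sigma>: "\<sigma> permutes {1..n}"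
    and inc: "\<And>r. r \<in> {1..<n} \<Longrightarrow> \<tau> r < \<tau> (Suc r)" "\<And>r. r \<in> {1..<n} \<Longrightarrow> \<tau> (\<sigma> r) < \<tau> (\<sigma> (Suc r))"
  shows "\<sigma> = id"
proof (rule permutes_natset_ge[OF \<sigma>], rule ballI)
  have mono: "1 \<le> r \<Longrightarrow> r \<le> s \<Longrightarrow> s \<le> n \<Longrightarrow> \<tau> r \<le> \<tau> s" for r s
  proof (induction s)
    case (Suc s)
    show ?case
    proof (cases "r = Suc s")
      case False
      then have "r \<le> s" "s \<le> n" using Suc.prems by linarith+
      with Suc.IH[OF Suc.prems(1)] have "\<tau> r \<le> \<tau> s" by blast
      also have "\<tau> s < \<tau> (Suc s)" using Suc.prems \<open>r \<le> s\<close> by (intro inc(1)) auto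
      finally show ?thesis by (rule less_imp_le)
    qed simp
  qed simp
  fix r assume "r \<in> {1..n}"
  then have "1 \<le> r" "r \<le> n" by auto
  then show "r \<le> \<sigma> r"
  proof (induction r rule: dec_induct)
    case base
    then show ?case using permutes_in_image[OF \<sigma>, of 1] by simp
  next
    case (step r)
    have lt: "\<tau> (\<sigma> r) < \<tau> (\<sigma> (Suc r))" using step by (intro inc(2)) simp
    have "r \<in> {1..n}" "Suc r \<in> {1..n}" using step.hyps step.prems by simp_all
    then have "\<sigma> r \<in> {1..n}" "\<sigma> (Suc r) \<in> {1..n}" unfolding permutes_in_image[OF \<sigma>] .
    then have "\<not> \<sigma> (Suc r) \<le> \<sigma> r" using mono[of "\<sigma> (Suc r)" "\<sigma> r"] lt by (auto simp del: One_nat_def)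
    then show ?case using step by simp
  qed
qed

text \<open>For increasing times, every summand other than that of the identity has two consecutive
  times in the wrong order and vanishes. The conditions that the first time is positive and the last
  one below t remain inside the kernel.\<close>

lemma chaos_kernel_increasing:
  assumes inc: "\<And>r. r \<in> {1..<n} \<Longrightarrow> \<tau> r < \<tau> (Suc r)"
  shows "ordered_kernel G I0 t x n \<tau> \<xi> = fact n * chaos_kernel G I0 t x n \<tau> \<xi>"
proof -
  have "(\<Sum>\<sigma> | \<sigma> permutes {1..n}. ordered_kernel G I0 t x n (\<tau> \<circ> \<sigma>) (\<xi> \<circ> \<sigma>)) =
    (\<Sum>\<sigma> | \<sigma> permutes {1..n}. if \<sigma> = id then ordered_kernel G I0 t x n \<tau> \<xi> else 0)"
  proof (rule sum.cong[OF refl])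
    fix \<sigma> assume "\<sigma> \<in> {\<sigma>. \<sigma> permutes {1..n}}"
    then have \<sigma>: "\<sigma> permutes {1..n}" by simp
    show "ordered_kernel G I0 t x n (\<tau> \<circ> \<sigma>) (\<xi> \<circ> \<sigma>) = (if \<sigma> = id then ordered_kernel G I0 t x n \<tau> \<xi> else 0)"
    proof (cases "\<sigma> = id")
      case False
      have "\<exists>r\<in>{1..<n}. \<tau> (\<sigma> (Suc r)) \<le> \<tau> (\<sigma> r)"
      proof (rule ccontr)
        assume "\<not> ?thesis"
        then have "\<tau> (\<sigma> r) < \<tau> (\<sigma> (Suc r))" if "r \<in> {1..<n}" for r using that by (auto simp: not_le)
        then have "\<sigma> = id" by (intro increasing_permutation_id[where \<tau>=\<tau>, OF \<sigma> inc])
        then show False using False by simp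
      qed
      then obtain r where "r \<in> {1..<n}" "\<tau> (\<sigma> (Suc r)) \<le> \<tau> (\<sigma> r)" by blast
      then have "ordered_kernel G I0 t x n (\<tau> \<circ> \<sigma>) (\<xi> \<circ> \<sigma>) = 0" by (intro ordered_kernel_not_increasing[of r]) simp_all
      then show ?thesis using False by simp
    qed simp
  qed
  also have "\<dots> = ordered_kernel G I0 t x n \<tau> \<xi>"
    by (subst sum.delta) (simp_all add: finite_permutations permutes_id)
  finally show ?thesis by (simp add: chaos_kernel_def)
qed

section \<open>The chaos kernels as functions of finite norm\<close>

context tame_noise
begin

text \<open>The absolute convergence demanded of a represented function amounts to finiteness of the
  norm of its absolute value.\<close>

lemma represents_finite_norm:
  assumes "represents \<gamma> \<Lambda> \<iota> T n f F"
  shows "(\<lambda>z. f (fst z) (snd z)) \<in> finite_norm n"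
proof -
  have m: "(\<lambda>z. f (fst z) (snd z)) \<in> \<F> n"
    using assms by (simp add: represents_def split_def)
  have "integrable (straight n) (\<lambda>z. f (fst (row1 n z)) (snd (row1 n z)) * f (fst (row2 n z)) (snd (row2 n z)))"
    using assms unfolding represents_def diagram_integrable_def diagram_integrand_def prod_two by (simp add: split_def row_def)
  then have "sqn n (\<lambda>z. f (fst z) (snd z)) < \<top>" unfolding integrable_iff_bounded sqn_def sq_norm_def by (simp add: abs_mult ennreal_mult)
  then show ?thesis using m by (simp add: finite_norm_def)
qed

lemma average_ordered_kernel:
  assumes "1 \<le> n"
  shows "average n (\<lambda>z. ordered_kernel G I0 t x n (fst z) (snd z)) z = chaos_kernel G I0 t x n (fst z) (snd z)"
  unfolding average_def chaos_kernel_def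
  by (intro arg_cong2[where f="(*)"] sum.cong refl ordered_kernel_cong[OF assms]) (simp_all add: permute_def)

text \<open>\<open>permute\<close> leaves configurations undefined outside the index range, so the
  two sides have arguments that agree only on the coordinates on which the kernel depends.\<close>

lemma chaos_kernel_permute:
  assumes n: "1 \<le> n" and \<sigma>: "\<sigma> permutes {1..n}"
  shows "chaos_kernel G I0 t x n (fst (permute n \<sigma> z)) (snd (permute n \<sigma> z)) = chaos_kernel G I0 t x n (fst z) (snd z)"
proof -
  have "chaos_kernel G I0 t x n (fst (permute n \<sigma> z)) (snd (permute n \<sigma> z)) = chaos_kernel G I0 t x n (fst z \<circ> \<sigma>) (snd z \<circ> \<sigma>)"
    unfolding chaos_kernel_def
  proof (intro arg_cong2[where f="(*)"] sum.cong refl ordered_kernel_cong[OF n])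
    fix \<rho> r assume "\<rho> \<in> {\<rho>. \<rho> permutes {1..n}}" "r \<in> {1..n}"
    then have "\<rho> r \<in> {1..n}" using permutes_in_image[of \<rho> "{1..n}" r] by simp
    then show "(fst (permute n \<sigma> z) \<circ> \<rho>) r = (fst z \<circ> \<sigma> \<circ> \<rho>) r" "(snd (permute n \<sigma> z) \<circ> \<rho>) r = (snd z \<circ> \<sigma> \<circ> \<rho>) r"
      by (simp_all add: permute_def)
  qed
  then show ?thesis by (simp only: chaos_kernel_compose[OF \<sigma>])
qed

text \<open>Measurability and finiteness are given for the symmetrized kernel. The ordered kernel is
  n! times its restriction to the measurable set of configurations with increasing times.\<close>

lemma ordered_kernel_finite_norm:
  assumes f: "(\<lambda>z. chaos_kernel G I0 t x n (fst z) (snd z)) \<in> finite_norm n"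
  shows "(\<lambda>z. ordered_kernel G I0 t x n (fst z) (snd z)) \<in> finite_norm n"
proof -
  let ?f = "\<lambda>z. chaos_kernel G I0 t x n (fst z) (snd z)" and ?g = "\<lambda>z. ordered_kernel G I0 t x n (fst z) (snd z)"
  let ?A = "{z \<in> \<Omega> n. \<forall>r\<in>{1..<n}. fst z r < fst z (Suc r)}"
  have c: "(\<lambda>z. fst z r) \<in> \<F> n" if "r \<in> {1..n}" for r
    by (rule measurable_compose[OF measurable_fst T.component_borel[OF that]])
  have "{z \<in> \<Omega> n. fst z r < fst z (Suc r)} \<in> sets (config {1..n})" if "r \<in> {1..<n}" for r
    using that by (intro borel_measurable_less c) simp_all
  then have A: "?A \<in> sets (config {1..n})" by (intro sets.sets_Collect_finite_All) simp_all
  have eq: "?g z = fact n * ?f z * indicator ?A z" if z: "z \<in> \<Omega> n" for z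
  proof (cases "z \<in> ?A")
    case True
    then show ?thesis using chaos_kernel_increasing[of n "fst z" G I0 t x "snd z"] by simp
  next
    case False
    then obtain r where "r \<in> {1..<n}" "fst z (Suc r) \<le> fst z r" using z by (auto simp: not_less)
    then show ?thesis using False ordered_kernel_not_increasing[of r n "fst z"] by simp
  qed
  have m: "?g \<in> \<F> n"
    using measurable_cong[of "config {1..n}" ?g "\<lambda>z. fact n * ?f z * indicator ?A z", OF eq] finite_norm_measurable[OF f] A by simp
  show ?thesis
  proof (rule finite_norm_dominated[OF m finite_norm_cmult[OF finite_norm_abs[OF f], of "fact n"]])
    fix z :: "(nat, 'd) configuration" assume z: "z \<in> \<Omega> n"
    show "\<bar>?g z\<bar> \<le> fact n * \<bar>?f z\<bar>" unfolding eq[OF z] by (simp add: abs_mult indicator_def)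
  qed
qed

lemma diagram_integrand_row:
  "diagram_integrand m n g = (\<lambda>z. \<Prod>k\<in>{1..m}. g k (fst (row n k z)) (snd (row n k z)))"
  by (simp add: diagram_integrand_def row_def split_def)

end

theorem theorem5p4:
  fixes \<gamma> :: "real correlation" and \<Lambda> :: "(real ^ 'd) correlation"
    and \<iota> :: "(real \<times> (real ^ 'd) \<Rightarrow> real) \<Rightarrow> 'h::{real_inner, banach}"
    and M :: "'w measure" and W :: "'h \<Rightarrow> 'w \<Rightarrow> real"
    and T :: "nat \<Rightarrow> (nat \<Rightarrow> 'h) \<Rightarrow> 'k::{real_inner, banach}"
    and J :: "nat \<Rightarrow> 'k \<Rightarrow> 'w \<Rightarrow> real"
    and G :: "real \<Rightarrow> real ^ 'd \<Rightarrow> real ^ 'd \<Rightarrow> real" and I0 :: "real \<Rightarrow> real ^ 'd \<Rightarrow> real"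
    and t :: real and x :: "real ^ 'd"
    and m :: nat and n :: "nat \<Rightarrow> nat" and F :: "nat \<Rightarrow> 'k"
  assumes "admissible_noise \<gamma> \<Lambda>"
    and "is_noise_space \<gamma> \<Lambda> \<iota>"
    and "isonormal_process M W"
    and "is_tensor_power T"
    and "is_multiple_integral M W T J"
    and "t > 0"
    and "m \<ge> 1" and "\<forall>k\<in>{1..m}. n k \<ge> 1"
    and "\<forall>k\<in>{1..m}. represents \<gamma> \<Lambda> \<iota> T (n k) (chaos_kernel G I0 t x (n k)) (F k)"
  shows "integrable M (\<lambda>\<omega>. \<Prod>k\<in>{1..m}. J (n k) (F k) \<omega>) \<and>
    (\<forall>D\<in>diagrams m n.
       diagram_integrable \<gamma> \<Lambda> m n D (\<lambda>k. chaos_kernel G I0 t x (n k)) \<and>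
       diagram_integrable \<gamma> \<Lambda> m n D (\<lambda>k. ordered_kernel G I0 t x (n k))) \<and>
    (\<integral>\<omega>. (\<Prod>k\<in>{1..m}. J (n k) (F k) \<omega>) \<partial>M) =
      (\<Sum>D\<in>diagrams m n. diagram_integral \<gamma> \<Lambda> m n D (\<lambda>k. chaos_kernel G I0 t x (n k))) \<and>
    (\<Sum>D\<in>diagrams m n. diagram_integral \<gamma> \<Lambda> m n D (\<lambda>k. chaos_kernel G I0 t x (n k))) =
      (\<Sum>D\<in>diagrams m n. diagram_integral \<gamma> \<Lambda> m n D (\<lambda>j. ordered_kernel G I0 t x (n j)))"
proof -
  interpret prob_space M using assms(3) by (simp add: isonormal_process_def)
  interpret I: isonormal M W by unfold_locales (rule assms(3))
  interpret C: wiener_chaos M W T J by unfold_locales (rule assms(4,5))+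
  interpret N: tame_noise \<gamma> \<Lambda> by (rule admissible_tame_noise[OF assms(1)])
  interpret S: chaos_setting \<gamma> \<Lambda> M W T J \<iota> by unfold_locales (rule assms(2))
  let ?f = "\<lambda>k z. chaos_kernel G I0 t x (n k) (fst z) (snd z)" and ?g = "\<lambda>k z. ordered_kernel G I0 t x (n k) (fst z) (snd z)"
  have n: "1 \<le> n k" if "k \<in> {1..m}" for k using assms(8) that by blast
  have rep: "represents \<gamma> \<Lambda> \<iota> T (n k) (chaos_kernel G I0 t x (n k)) (F k)" if "k \<in> {1..m}" for k using assms(9) that by blast
  have f: "?f k \<in> N.finite_norm (n k)" if "k \<in> {1..m}" for k by (rule N.represents_finite_norm[OF rep[OF that]])
  have g: "?g k \<in> N.finite_norm (n k)" if "k \<in> {1..m}" for k by (rule N.ordered_kernel_finite_norm[OF f[OF that]])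
  have F: "F k \<in> tensor_space T (n k)" if "k \<in> {1..m}" for k using rep[OF that] by (simp add: represents_def)
  have Ff: "F k \<bullet> T (n k) (\<lambda>i. \<iota> (\<phi> i)) = (\<integral>z. ?f k (N.row1 (n k) z) * (\<Prod>r\<in>{1..n k}. \<phi> r (point (N.row2 (n k) z) r)) \<partial>N.straight (n k))"
    if k: "k \<in> {1..m}" and \<phi>: "\<And>i. \<phi> i \<in> test_functions" for k \<phi>
  proof -
    have "F k \<bullet> T (n k) (\<lambda>i. \<iota> (\<phi> i)) = diagram_integral \<gamma> \<Lambda> 2 (\<lambda>_. n k) (straight_diagram (n k))
      (\<lambda>i. if i = 1 then chaos_kernel G I0 t x (n k) else (\<lambda>\<tau> \<xi>. \<Prod>r\<in>{1..n k}. \<phi> r (\<tau> r, \<xi> r)))"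
      using rep[OF k] \<phi> by (simp only: represents_def simp_thms)
    then show ?thesis unfolding diagram_integral_def N.diagram_integrand_row prod_two by (simp add: point_def)
  qed
  note E = S.expectation_multiple_integrals[where f="?f", OF n f N.chaos_kernel_permute[OF n] F Ff]
  have int: "diagram_integrable \<gamma> \<Lambda> m n D (\<lambda>k. chaos_kernel G I0 t x (n k)) \<and>
       diagram_integrable \<gamma> \<Lambda> m n D (\<lambda>k. ordered_kernel G I0 t x (n k))" if "D \<in> diagrams m n" for D
    unfolding diagram_integrable_def N.diagram_integrand_row
    using N.diagram_integrable_finite_norm[OF that, of ?f] N.diagram_integrable_finite_norm[OF that, of ?g] f g by blast
  have 2: "(\<integral>\<omega>. (\<Prod>k\<in>{1..m}. J (n k) (F k) \<omega>) \<partial>M) =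
      (\<Sum>D\<in>diagrams m n. diagram_integral \<gamma> \<Lambda> m n D (\<lambda>k. chaos_kernel G I0 t x (n k)))"
    unfolding diagram_integral_def N.diagram_integrand_row by (rule E(2))
  \<comment> \<open>In every row the chaos kernel is the average of the ordered one, and averaging
    does not change the sum over diagrams.\<close>
  have "(\<Prod>k\<in>{1..m}. average (n k) (?g k) (N.row n k z)) = (\<Prod>k\<in>{1..m}. ?f k (N.row n k z))" for z
    by (intro prod.cong refl N.average_ordered_kernel n)
  then have 3: "(\<Sum>D\<in>diagrams m n. diagram_integral \<gamma> \<Lambda> m n D (\<lambda>k. chaos_kernel G I0 t x (n k))) =
      (\<Sum>D\<in>diagrams m n. diagram_integral \<gamma> \<Lambda> m n D (\<lambda>j. ordered_kernel G I0 t x (n j)))"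
    using N.sum_diagram_integrals_average[of m ?g n, OF g] unfolding diagram_integral_def N.diagram_integrand_row by (simp only:)
  show ?thesis using E(1) int 2 3 by blast
qed

end
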